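(* Let $U\subset\mathbb{C}^n$ be a domain, let $\Omega\subset U\times\mathbb{C}^m$ be a strictly pseudoconvex family of bounded domains over $U$, and let $\varphi$ be a $C^2$ plurisubharmonic function defined on some neighborhood of $\overline\Omega$ in $U\times\mathbb{C}^m$. Assume that all fibers $\Omega_t$ ($t\in U$) are (connected) Reinhardt domains in $\mathbb{C}^m$ and that $\varphi(t,z)$ is $T^m$-invariant with respect to $z$. Then for any nonnegative integers $k_1,\dots,k_m$, the function $\psi(t)$ defined by $$e^{-\psi(t)}=\int_{\Omega_t}|z_1^{k_1}\cdots z_m^{k_m}|^2e^{-\varphi_t}\,d\lambda_z,\qquad \varphi_t(z)=\varphi(t,z),$$ is a strictly plurisubharmonic function on $U$.
   Context: Notation: $p:\mathbb{C}^n\times\mathbb{C}^m\to\mathbb{C}^n$ is the natural projection; for $A\subset\mathbb{C}^n\times\mathbb{C}^m$, $A_t=p^{-1}(t)\cap A$ is the fiber over $t$, regarded as a subset of $\mathbb{C}^m$. $d\lambda_z$ is Lebesgue measure on $\mathbb{C}^m$. Closures $\overline\Omega$ are taken in $U\times\mathbb{C}^m$. A family of domains of dimension $m$ over a domain $U\subset\mathbb{C}^n$ is a domain $\Omega\subset U\times\mathbb{C}^m$ with $p(\Omega)=U$; it is a family of bounded domains if every fiber $\Omega_t$ ($t\in U$) is bounded. It has $C^k$ boundary ($k\ge1$) if there is a $C^k$ real function $\rho(t,z)$ on some neighborhood of $\overline\Omega$ in $U\times\mathbb{C}^m$ such that $\Omega=\{\rho<0\}$ and, for every $t\in U$, the differential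 of $z\mapsto\rho(t,z)$ is nonzero at every point of $\partial\Omega_t$; such $\rho$ is called a defining function. A family with $C^2$ boundary is strictly pseudoconvex if it admits a ($C^2$) defining function that is strictly plurisubharmonic on some neighborhood of $\overline\Omega$ in $U\times\mathbb{C}^m$. A $C^2$ function is strictly plurisubharmonic if its complex Hessian is positive definite everywhere. A domain $D\subset\mathbb{C}^m$ is Reinhardt if it is invariant under the action of the torus $T^m$ given by $(e^{i\theta_1},\dots,e^{i\theta_m})\cdot(z_1,\dots,z_m)=(e^{i\theta_1}z_1,\dots,e^{i\theta_m}z_m)$, $\theta_i\in\mathbb{R}$. *)

theory Defs
  imports "HOL-Analysis.Analysis"
begin

definition is_domain :: "'a::topological_space set \<Rightarrow> bool" where
  "is_domain D \<longleftrightarrow> open D \<and> connected D \<and> D \<noteq> {}"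


(* Meant for open S. In finite dimension, continuity of all directional derivatives
   is the same as continuity of the Frechet derivative, so this is the usual class C^k. *)
primrec Ck_on :: "nat \<Rightarrow> ('a::euclidean_space \<Rightarrow> 'b::real_normed_vector) \<Rightarrow> 'a set \<Rightarrow> bool" where
  "Ck_on 0 f S \<longleftrightarrow> continuous_on S f"
| "Ck_on (Suc k) f S \<longleftrightarrow> (\<forall>x\<in>S. f differentiable (at x)) \<and>
     (\<forall>v. Ck_on k (\<lambda>x. frechet_derivative f (at x) v) S)"


(* The Wirtinger operators d/dz_j = (d/dx_j - i d/dy_j)/2 and d/dzbar_j = (d/dx_j + i d/dy_j)/2;
   the directions x_j and y_j are the vectors axis j 1 and axis j \<i>. *)
definition wirtinger :: "'N::finite \<Rightarrow> (complex^'N \<Rightarrow> complex) \<Rightarrow> complex^'N \<Rightarrow> complex" where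
  "wirtinger j f x = (frechet_derivative f (at x) (axis j 1)
                      - \<i> * frechet_derivative f (at x) (axis j \<i>)) / 2"

definition wirtinger_bar :: "'N::finite \<Rightarrow> (complex^'N \<Rightarrow> complex) \<Rightarrow> complex^'N \<Rightarrow> complex" where
  "wirtinger_bar j f x = (frechet_derivative f (at x) (axis j 1)
                          + \<i> * frechet_derivative f (at x) (axis j \<i>)) / 2"

definition complex_hessian :: "(complex^'N::finite \<Rightarrow> real) \<Rightarrow> complex^'N \<Rightarrow> complex^'N^'N" where
  "complex_hessian f x =
     (\<chi> j k. wirtinger j (wirtinger_bar k (\<lambda>y. complex_of_real (f y))) x)"

definition positive_definite :: "complex^'N^'N::finite \<Rightarrow> bool" where
  "positive_definite H \<longleftrightarrow> (\<forall>w. w \<noteq> 0 \<longrightarrow>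
     (let q = (\<Sum>j\<in>UNIV. \<Sum>k\<in>UNIV. H $ j $ k * w $ j * cnj (w $ k)) in q \<in> \<real> \<and> 0 < Re q))"

definition strictly_psh_on :: "(complex^'N::finite \<Rightarrow> real) \<Rightarrow> (complex^'N) set \<Rightarrow> bool" where
  "strictly_psh_on f S \<longleftrightarrow>
     open S \<and> Ck_on 2 f S \<and> (\<forall>x\<in>S. positive_definite (complex_hessian f x))"

(* Real-valued plurisubharmonic functions: upper semicontinuous, with the sub-mean value
   inequality on every closed disc {a + zeta b : |zeta| <= 1} contained in S (b = 0 is harmless).
   A finite value at the centre forces integrability on the circle; this is stated explicitly
   because the HOL integral of a non-integrable function is 0. *)
definition psh_on :: "(complex^'N::finite \<Rightarrow> real) \<Rightarrow> (complex^'N) set \<Rightarrow> bool" where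
  "psh_on f S \<longleftrightarrow> open S \<and>
     (\<forall>x\<in>S. \<forall>c. f x < c \<longrightarrow> (\<forall>\<^sub>F y in at x. f y < c)) \<and>
     (\<forall>a b. (\<forall>\<zeta>. cmod \<zeta> \<le> 1 \<longrightarrow> a + \<zeta> *s b \<in> S) \<longrightarrow>
        (\<lambda>\<theta>. f (a + cis \<theta> *s b)) integrable_on {0..2*pi} \<and>
        f a \<le> integral {0..2*pi} (\<lambda>\<theta>. f (a + cis \<theta> *s b)) / (2*pi))"


(* The identification of C^(n+m) with C^n x C^m. Plurisubharmonicity of a function on (part of)
   the product is expressed by pulling it back along this map. *)
definition split_coords :: "complex^('n::finite + 'm::finite) \<Rightarrow> (complex^'n) \<times> (complex^'m)" where
  "split_coords w = ((\<chi> i. w $ Inl i), (\<chi> j. w $ Inr j))"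

definition strictly_psh_prod_on ::
  "((complex^'n::finite) \<times> (complex^'m::finite) \<Rightarrow> real) \<Rightarrow> ((complex^'n) \<times> (complex^'m)) set \<Rightarrow> bool" where
  "strictly_psh_prod_on f S \<longleftrightarrow> strictly_psh_on (f \<circ> split_coords) (split_coords -` S)"

definition psh_prod_on ::
  "((complex^'n::finite) \<times> (complex^'m::finite) \<Rightarrow> real) \<Rightarrow> ((complex^'n) \<times> (complex^'m)) set \<Rightarrow> bool" where
  "psh_prod_on f S \<longleftrightarrow> psh_on (f \<circ> split_coords) (split_coords -` S)"


definition fiber :: "('a \<times> 'b) set \<Rightarrow> 'a \<Rightarrow> 'b set" where
  "fiber A t = {z. (t, z) \<in> A}"

definition bounded_domain_family ::
  "(complex^'n::finite) set \<Rightarrow> ((complex^'n) \<times> (complex^'m::finite)) set \<Rightarrow> bool" where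
  "bounded_domain_family U \<Omega> \<longleftrightarrow> is_domain U \<and> is_domain \<Omega> \<and> \<Omega> \<subseteq> U \<times> UNIV \<and> fst ` \<Omega> = U \<and>
     (\<forall>t\<in>U. bounded (fiber \<Omega> t))"

(* closure \<Omega> \<inter> (U \<times> UNIV) is the closure of \<Omega> relative to U x C^m. *)
definition closure_nbhd ::
  "(complex^'n::finite) set \<Rightarrow> ((complex^'n) \<times> (complex^'m::finite)) set
    \<Rightarrow> ((complex^'n) \<times> (complex^'m)) set \<Rightarrow> bool" where
  "closure_nbhd U \<Omega> N \<longleftrightarrow> open N \<and> closure \<Omega> \<inter> (U \<times> UNIV) \<subseteq> N \<and> N \<subseteq> U \<times> UNIV"

definition defining_function ::
  "nat \<Rightarrow> (complex^'n::finite) set \<Rightarrow> ((complex^'n) \<times> (complex^'m::finite)) set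
    \<Rightarrow> ((complex^'n) \<times> (complex^'m)) set \<Rightarrow> ((complex^'n) \<times> (complex^'m) \<Rightarrow> real) \<Rightarrow> bool" where
  "defining_function k U \<Omega> N \<rho> \<longleftrightarrow> closure_nbhd U \<Omega> N \<and> Ck_on k \<rho> N \<and>
     \<Omega> = {x \<in> N. \<rho> x < 0} \<and>
     (\<forall>t\<in>U. \<forall>z\<in>frontier (fiber \<Omega> t).
        frechet_derivative (\<lambda>w. \<rho> (t, w)) (at z) \<noteq> (\<lambda>_. 0))"

definition strictly_pseudoconvex_bounded_family ::
  "(complex^'n::finite) set \<Rightarrow> ((complex^'n) \<times> (complex^'m::finite)) set \<Rightarrow> bool" where
  "strictly_pseudoconvex_bounded_family U \<Omega> \<longleftrightarrow> bounded_domain_family U \<Omega> \<and>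
     (\<exists>N \<rho> W. defining_function 2 U \<Omega> N \<rho> \<and>
        closure_nbhd U \<Omega> W \<and> W \<subseteq> N \<and> strictly_psh_prod_on \<rho> W)"


definition torus_act :: "('m::finite \<Rightarrow> real) \<Rightarrow> complex^'m \<Rightarrow> complex^'m" where
  "torus_act \<theta> z = (\<chi> j. cis (\<theta> j) * z $ j)"

definition reinhardt_domain :: "(complex^'m::finite) set \<Rightarrow> bool" where
  "reinhardt_domain D \<longleftrightarrow> is_domain D \<and> (\<forall>\<theta>. \<forall>z\<in>D. torus_act \<theta> z \<in> D)"

(* N itself need not be invariant, so the values are compared whenever both points lie in N. *)
definition torus_invariant_on ::
  "('a \<times> (complex^'m::finite) \<Rightarrow> real) \<Rightarrow> ('a \<times> (complex^'m)) set \<Rightarrow> bool" where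
  "torus_invariant_on f N \<longleftrightarrow> (\<forall>t z \<theta>. (t, z) \<in> N \<longrightarrow> (t, torus_act \<theta> z) \<in> N \<longrightarrow>
     f (t, torus_act \<theta> z) = f (t, z))"

definition monomial_integral ::
  "('a \<times> (complex^'m::finite)) set \<Rightarrow> ('a \<times> (complex^'m) \<Rightarrow> real) \<Rightarrow> ('m \<Rightarrow> nat) \<Rightarrow> 'a \<Rightarrow> real" where
  "monomial_integral \<Omega> \<phi> k t =
     (LINT z:fiber \<Omega> t|lborel. (cmod (\<Prod>j\<in>UNIV. z $ j ^ k j))\<^sup>2 * exp (- \<phi> (t, z)))"

end

(* Berndtsson's subharmonicity theorem is replaced here by a Prekopa-Leindler argument on circles.

   In logarithmic coordinates x_j = ln |z_j| the fibers become convex domains D_t, and the integral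
   G(t) becomes the integral over D_t of exp (l(x) - phi(t, x)) with l affine and phi convex in x.
   Given a small circle t0 + r e^(i theta) w and points x(theta) of D at its boundary values, the
   harmonic extension of x is the real part of a holomorphic map h, so tau |-> (t0 + tau w, exp h(tau))
   is a holomorphic disc. The maximum principle for the plurisubharmonic rho keeps it inside Omega,
   the mean value inequality for phi bounds phi at the mean a of x by the mean of phi along x, and the
   strict positivity of the Levi form of rho yields rho <= - kappa r^2 / 4 at a. Iterating a
   one-dimensional Prekopa-Leindler inequality for the geometric mean over the circle, one coordinate
   at a time, exp (mean of ln G over the circle) is at most the integral over the smaller
   set {rho <= - kappa r^2 / 4} of the fiber at t0. The omitted shell carries at least c r^2 of the
   mass, so -ln G exceeds its sub-mean-value inequality by a multiple of r^2, which bounds the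
   Laplacian along every complex line from below.

   G is of class C^2 because the boundary of Omega is locally a C^2 graph and averaging over
   translates transverse to it turns the integral into one of C^2 functions of the parameter. *)

theory Submission
  imports Defs "HOL-Probability.Probability" "HOL-Real_Asymp.Real_Asymp"
begin

section \<open>Calculus of \<open>C\<^sup>k\<close> functions\<close>

text \<open>The selections x(theta) in the Prekopa-Leindler step are merely measurable, while discs
  need holomorphic data. Real parts of polynomials therefore serve as approximate boundary values:
  their extensions are entire, and no boundary regularity of conjugate functions enters. A limit of
  such discs only places the mean in the closure of \<open>\<Omega>\<close>; the strict bound -kappa
  r^2 / 4 on \<open>\<rho>\<close> puts it back inside, so strict pseudoconvexity serves twice. A
  disc is kept inside \<open>\<Omega>\<close> by deforming it to a constant one at a point c common
  to all the D_t above it; convexity of D_t keeps the boundary values inside meanwhile. The D_t are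
  unbounded where coordinates tend to 0, and limits of loops need a compact set, so the inequality
  is first proved on compact sets \<open>K n\<close> exhausting the domains. \<open>\<rho>\<close>
  is not assumed torus invariant, hence the bounds over all rotations throughout. The shell is
  measured by comparing a fiber with its dilate by 1 + delta: the loss then comes from the
  homogeneity of the monomial and of Lebesgue measure, without any surface measure.\<close>

lemma Ck_on_subset: "Ck_on k f S \<Longrightarrow> T \<subseteq> S \<Longrightarrow> Ck_on k f T"
  by (induction k arbitrary: f) (auto intro: continuous_on_subset)

lemma has_derivative_cong_open:
  assumes "open S" "x \<in> S" "\<And>y. y \<in> S \<Longrightarrow> f y = g y"
  shows "(f has_derivative D) (at x) \<longleftrightarrow> (g has_derivative D) (at x)"
  using assms by (metis has_derivative_transform_within_open)

lemma frechet_derivative_cong_open: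
  assumes "open S" "x \<in> S" "\<And>y. y \<in> S \<Longrightarrow> f y = g y"
  shows "frechet_derivative f (at x) = frechet_derivative g (at x)"
  unfolding frechet_derivative_def using has_derivative_cong_open[OF assms] by simp

lemma Ck_on_cong:
  assumes "open S" "\<And>x. x \<in> S \<Longrightarrow> f x = g x"
  shows "Ck_on k f S \<longleftrightarrow> Ck_on k g S"
  using assms(2)
proof (induction k arbitrary: f g)
  case 0
  then show ?case by (auto intro: continuous_on_cong)
next
  case (Suc k)
  have "frechet_derivative f (at x) = frechet_derivative g (at x)" if "x \<in> S" for x
    using frechet_derivative_cong_open[OF assms(1) that Suc.prems] by auto
  then have "Ck_on k (\<lambda>x. frechet_derivative f (at x) v) S = Ck_on k (\<lambda>x. frechet_derivative g (at x) v) S" for v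
    by (intro Suc.IH) auto
  moreover have "f differentiable at x \<longleftrightarrow> g differentiable at x" if "x \<in> S" for x
    using has_derivative_cong_open[OF assms(1) that Suc.prems] by (auto simp: differentiable_def)
  ultimately show ?case by auto
qed

text \<open>Regularity is local, so a function may be pieced together from formulas on overlapping
  open sets. The smoothed fiber integrals and the products with cutoffs are handled this
  way.\<close>

lemma Ck_on_local:
  assumes "\<And>x. x \<in> S \<Longrightarrow> \<exists>T. open T \<and> x \<in> T \<and> Ck_on k f T"
  shows "Ck_on k f S"
  using assms
proof (induction k arbitrary: f)
  case 0
  have "isCont f x" if "x \<in> S" for x
    using 0[OF that] by (auto simp: continuous_on_eq_continuous_at)
  then show ?case by (simp add: continuous_at_imp_continuous_on)
next
  case (Suc k)
  have "Ck_on k (\<lambda>x. frechet_derivative f (at x) v) S" for v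
    by (rule Suc.IH) (use Suc.prems in fastforce)
  moreover have "f differentiable at x" if "x \<in> S" for x
    using Suc.prems[OF that] by auto
  ultimately show ?case by auto
qed

lemma Ck_on_has_derivative:
  "Ck_on (Suc k) f S \<Longrightarrow> x \<in> S \<Longrightarrow> (f has_derivative frechet_derivative f (at x)) (at x)"
  by (simp add: frechet_derivative_works)

lemma Ck_on_deriv: "Ck_on (Suc k) f S \<Longrightarrow> Ck_on k (\<lambda>x. frechet_derivative f (at x) v) S"
  by simp

lemma Ck_on_imp_continuous_on: "Ck_on k f S \<Longrightarrow> continuous_on S f"
  by (cases k) (auto intro!: continuous_at_imp_continuous_on differentiable_imp_continuous_within)

lemma Ck_on_SucD: "Ck_on (Suc k) f S \<Longrightarrow> Ck_on k f S"
proof (induction k arbitrary: f)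
  case 0
  then show ?case using Ck_on_imp_continuous_on[OF 0] by simp
qed auto

text \<open>By uniqueness of the derivative any explicit \<open>f'\<close> may replace the chosen
  \<open>frechet_derivative\<close>. This is the introduction rule behind the closure properties
  below.\<close>

lemma Ck_on_SucI:
  assumes "open S" "\<And>x. x \<in> S \<Longrightarrow> (f has_derivative f' x) (at x)" "\<And>v. Ck_on k (\<lambda>x. f' x v) S"
  shows "Ck_on (Suc k) f S"
proof -
  have "frechet_derivative f (at x) = f' x" if "x \<in> S" for x
    using assms(2)[OF that] frechet_derivative_at by metis
  then have "Ck_on k (\<lambda>x. frechet_derivative f (at x) v) S" for v
    using Ck_on_cong[OF assms(1), of "\<lambda>x. frechet_derivative f (at x) v" "\<lambda>x. f' x v"] assms(3) by auto
  then show ?thesis using assms(2) by (auto simp: differentiable_def)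
qed

lemma Ck_on_const: "open S \<Longrightarrow> Ck_on k (\<lambda>x. c) S"
proof (induction k arbitrary: c)
  case (Suc k)
  show ?case by (rule Ck_on_SucI[where f'="\<lambda>x v. 0"]) (use Suc in \<open>auto intro!: derivative_eq_intros\<close>)
qed simp

lemma Ck_on_bounded_linear:
  assumes "open S" "bounded_linear L" "Ck_on k f S"
  shows "Ck_on k (\<lambda>x. L (f x)) S"
  using assms(3)
proof (induction k arbitrary: f)
  case 0
  then show ?case using assms bounded_linear.continuous_on by auto
next
  case (Suc k)
  show ?case
  proof (rule Ck_on_SucI[OF assms(1)])
    show "((\<lambda>x. L (f x)) has_derivative (\<lambda>v. L (frechet_derivative f (at x) v))) (at x)" if "x \<in> S" for x
      using bounded_linear.has_derivative[OF assms(2) Ck_on_has_derivative[OF Suc.prems that]] .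
  qed (use Suc in auto)
qed

lemma Ck_on_id: "open S \<Longrightarrow> Ck_on k (\<lambda>x. x) S"
proof (cases k)
  case (Suc l)
  assume "open S"
  then show ?thesis unfolding Suc
    by (intro Ck_on_SucI[where f'="\<lambda>x v. v"]) (auto intro: Ck_on_const)
qed auto

lemma Ck_on_linear: "open S \<Longrightarrow> bounded_linear L \<Longrightarrow> Ck_on k L S"
  using Ck_on_bounded_linear[OF _ _ Ck_on_id] by auto

lemma Ck_on_add:
  assumes "open S" "Ck_on k f S" "Ck_on k g S"
  shows "Ck_on k (\<lambda>x. f x + g x) S"
  using assms(2,3)
proof (induction k arbitrary: f g)
  case (Suc k)
  show ?case
  proof (rule Ck_on_SucI[OF assms(1)])
    show "((\<lambda>x. f x + g x) has_derivative (\<lambda>v. frechet_derivative f (at x) v + frechet_derivative g (at x) v)) (at x)"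
      if "x \<in> S" for x
      by (intro has_derivative_add Ck_on_has_derivative[OF Suc.prems(1) that] Ck_on_has_derivative[OF Suc.prems(2) that])
  qed (use Suc in auto)
qed (auto intro: continuous_intros)

lemma Ck_on_sum:
  assumes "open S" "\<And>i. i \<in> I \<Longrightarrow> Ck_on k (f i) S"
  shows "Ck_on k (\<lambda>x. \<Sum>i\<in>I. f i x) S"
  using assms(2) by (induction I rule: infinite_finite_induct) (auto intro: Ck_on_const Ck_on_add assms(1))

lemma Ck_on_bilinear:
  assumes "open S" "bounded_bilinear h" "Ck_on k f S" "Ck_on k g S"
  shows "Ck_on k (\<lambda>x. h (f x) (g x)) S"
  using assms(3,4)
proof (induction k arbitrary: f g)
  case 0
  then show ?case using assms(2) by (auto intro: bounded_bilinear.continuous_on)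
next
  case (Suc k)
  show ?case
  proof (rule Ck_on_SucI[OF assms(1)])
    show "((\<lambda>x. h (f x) (g x)) has_derivative
        (\<lambda>v. h (f x) (frechet_derivative g (at x) v) + h (frechet_derivative f (at x) v) (g x))) (at x)"
      if "x \<in> S" for x
      by (intro bounded_bilinear.FDERIV[OF assms(2)] Ck_on_has_derivative[OF Suc.prems(1) that]
         Ck_on_has_derivative[OF Suc.prems(2) that])
    show "Ck_on k (\<lambda>x. h (f x) (frechet_derivative g (at x) v) + h (frechet_derivative f (at x) v) (g x)) S" for v
      by (intro Ck_on_add Suc.IH assms(1) Ck_on_SucD[OF Suc.prems(1)] Ck_on_SucD[OF Suc.prems(2)]
          Ck_on_deriv[OF Suc.prems(1)] Ck_on_deriv[OF Suc.prems(2)])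
  qed
qed

lemmas Ck_on_mult = Ck_on_bilinear[OF _ bounded_bilinear_mult]
lemmas Ck_on_scaleR = Ck_on_bilinear[OF _ bounded_bilinear_scaleR]

lemma Ck_on_minus: "open S \<Longrightarrow> Ck_on k f S \<Longrightarrow> Ck_on k (\<lambda>x. - f x) S"
  by (rule Ck_on_bounded_linear[OF _ bounded_linear_minus[OF bounded_linear_ident]])

lemma Ck_on_diff: "open S \<Longrightarrow> Ck_on k f S \<Longrightarrow> Ck_on k g S \<Longrightarrow> Ck_on k (\<lambda>x. f x - g x) S"
  using Ck_on_add[of S k f "\<lambda>x. - g x"] Ck_on_minus by auto

lemma Ck_on_Pair:
  assumes "open S" "Ck_on k f S" "Ck_on k g S"
  shows "Ck_on k (\<lambda>x. (f x, g x)) S"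
proof -
  have "Ck_on k (\<lambda>x. (f x, 0) + (0, g x)) S"
    by (intro Ck_on_add assms Ck_on_bounded_linear[OF assms(1) _ assms(2), of "\<lambda>y. (y, 0)"]
        Ck_on_bounded_linear[OF assms(1) _ assms(3), of "\<lambda>y. (0, y)"])
      (auto intro!: bounded_linear_Pair bounded_linear_ident bounded_linear_zero)
  then show ?thesis by simp
qed

text \<open>\<open>Ck_on\<close> only knows derivatives in fixed directions, but the chain rule
  evaluates the derivative of \<open>f\<close> in the direction Dg(x) v, which moves with x.
  Expanding that direction in the basis leaves fixed directions with C^k coefficients.\<close>

lemma Ck_on_compose:
  fixes g :: "'a::euclidean_space \<Rightarrow> 'b::euclidean_space" and f :: "'b \<Rightarrow> 'c::real_normed_vector"
  assumes "open S" "open T" "Ck_on k f T" "Ck_on k g S" "\<And>x. x \<in> S \<Longrightarrow> g x \<in> T"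
  shows "Ck_on k (\<lambda>x. f (g x)) S"
  using assms(3,4)
proof (induction k arbitrary: f)
  case 0
  then show ?case using assms by (auto intro!: continuous_on_compose2[of T f])
next
  case (Suc k)
  note d = Ck_on_has_derivative[OF Suc.prems(1) assms(5)] Ck_on_has_derivative[OF Suc.prems(2)]
  show ?case
  proof (rule Ck_on_SucI[OF assms(1)])
    fix x assume x: "x \<in> S"
    show "((\<lambda>x. f (g x)) has_derivative
       (\<lambda>v. \<Sum>b\<in>Basis. (frechet_derivative g (at x) v \<bullet> b) *\<^sub>R frechet_derivative f (at (g x)) b)) (at x)"
    proof (rule has_derivative_eq_rhs[OF has_derivative_compose[OF d(2)[OF x] d(1)[OF x]]], rule ext)
      fix v
      interpret l: linear "frechet_derivative f (at (g x))"
        using d(1)[OF x] has_derivative_linear by blast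
      show "frechet_derivative f (at (g x)) (frechet_derivative g (at x) v) =
         (\<Sum>b\<in>Basis. (frechet_derivative g (at x) v \<bullet> b) *\<^sub>R frechet_derivative f (at (g x)) b)"
        by (subst euclidean_representation[of "frechet_derivative g (at x) v", symmetric])
           (simp only: l.sum l.scale)
    qed
  next
    fix v
    show "Ck_on k (\<lambda>x. \<Sum>b\<in>Basis. (frechet_derivative g (at x) v \<bullet> b) *\<^sub>R frechet_derivative f (at (g x)) b) S"
      by (intro Ck_on_sum Ck_on_scaleR Suc.IH assms(1) Ck_on_deriv[OF Suc.prems(1)] Ck_on_SucD[OF Suc.prems(2)]
         Ck_on_bounded_linear[OF assms(1) bounded_linear_inner_left Ck_on_deriv[OF Suc.prems(2)]])
  qed
qed

lemma Ck_on_inverse: "Ck_on k (inverse :: real \<Rightarrow> real) (- {0})"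
proof (induction k)
  case (Suc k)
  have o: "open (- {0::real})" by auto
  show ?case
  proof (rule Ck_on_SucI[OF o])
    show "((inverse :: real \<Rightarrow> real) has_derivative (\<lambda>v. - (inverse x * inverse x) * v)) (at x)" if "x \<in> -{0}" for x
      using that by (auto intro!: derivative_eq_intros)
    show "Ck_on k (\<lambda>x. - (inverse x * inverse x) * v) (- {0})" for v :: real
      by (intro Ck_on_mult Ck_on_minus o Suc Ck_on_const)
  qed
qed (auto intro!: continuous_intros)

lemma Ck_on_exp: "Ck_on k (exp :: real \<Rightarrow> real) UNIV"
proof (induction k)
  case (Suc k)
  show ?case
    by (rule Ck_on_SucI[where f'="\<lambda>x v. exp x * v"])
      (auto intro!: derivative_eq_intros Ck_on_mult Suc Ck_on_const)
qed (auto intro!: continuous_intros)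

lemma Ck_on_ln: "Ck_on k (ln :: real \<Rightarrow> real) {0<..}"
proof (cases k)
  case (Suc l)
  show ?thesis unfolding Suc
    by (rule Ck_on_SucI[where f'="\<lambda>x v. inverse x * v"])
     (auto intro!: derivative_eq_intros Ck_on_mult Ck_on_const Ck_on_subset[OF Ck_on_inverse])
qed (auto intro!: continuous_intros)

lemma Ck_on_power: "open S \<Longrightarrow> Ck_on k (f::_ \<Rightarrow> real) S \<Longrightarrow> Ck_on k (\<lambda>x. f x ^ n) S"
  by (induction n) (auto intro: Ck_on_const Ck_on_mult)

lemma Ck_on_prod:
  assumes "open S" "\<And>i. i \<in> I \<Longrightarrow> Ck_on k (f i :: _ \<Rightarrow> real) S"
  shows "Ck_on k (\<lambda>x. \<Prod>i\<in>I. f i x) S"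
  using assms(2) by (induction I rule: infinite_finite_induct) (auto intro: Ck_on_const Ck_on_mult assms(1))

text \<open>The cube is the lowest power of the positive part that is C^2 at 0. All kernels and
  cutoffs of this development are built from it.\<close>

lemma Ck_on_max_cube: "Ck_on 2 (\<lambda>x::real. max 0 x ^ 3) UNIV"
proof -
  \<comment> \<open>Stated for every exponent n + 2 to cover the cube and also its derivative, a
    multiple of the square. At 0 the difference quotient has absolute value
    \<open>max 0 h ^ (n+1)\<close>.\<close>
  have 1: "((\<lambda>x::real. max 0 x ^ (n+2)) has_derivative (\<lambda>v. of_nat (n+2) * max 0 x ^ (n+1) * v)) (at x)" for x and n
  proof (cases x "0::real" rule: linorder_cases)
    case less
    then show ?thesis
      by (subst has_derivative_cong_open[of "{..<0}" x _ "\<lambda>_. 0"]) (auto intro!: derivative_eq_intros)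
  next
    case greater
    then show ?thesis
      by (subst has_derivative_cong_open[of "{0<..}" x _ "\<lambda>x. x^(n+2)"])
        (use DERIV_pow[of "n+2" x UNIV] in \<open>auto simp: has_field_derivative_def algebra_simps elim!: has_derivative_eq_rhs\<close>)
  next
    case equal
    have "((\<lambda>x::real. max 0 x ^ (n+2)) has_real_derivative 0) (at 0)"
      unfolding has_field_derivative_def has_derivative_at
    proof (safe)
      have "((\<lambda>h. max 0 h ^ (n+1) :: real) \<longlongrightarrow> max 0 0 ^ (n+1)) (at 0)"
        by (intro tendsto_intros)
      then have "((\<lambda>h. max 0 h ^ (n+1) :: real) \<longlongrightarrow> 0) (at 0)" by simp
      moreover have "max 0 h ^ (n+1) = norm (max 0 (0+h) ^ (n+2) - max 0 0 ^ (n+2) - 0 * h) / norm h"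
        if "h \<noteq> 0" for h :: real
        using that by (cases "h > 0") (auto simp: max_def)
      then have "\<forall>\<^sub>F h in at (0::real). max 0 h ^ (n+1) = norm (max 0 (0+h) ^ (n+2) - max 0 0 ^ (n+2) - 0 * h) / norm h"
        by (auto simp only: eventually_at intro!: exI[of _ 1] zero_less_one)
      ultimately show "(\<lambda>h::real. norm (max 0 (0+h) ^ (n+2) - max 0 0 ^ (n+2) - 0 * h) / norm h) \<midarrow>0\<rightarrow> (0::real)"
        by (rule Lim_transform_eventually)
    qed (rule bounded_linear_mult_right)
    then show ?thesis using equal by (auto simp: has_field_derivative_def lambda_zero)
  qed
  have "Ck_on (Suc (Suc 0)) (\<lambda>x::real. max 0 x ^ (1+2)) UNIV"
  proof (rule Ck_on_SucI[OF _ 1])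
    have "Ck_on (Suc 0) (\<lambda>x::real. max 0 x ^ (0+2)) UNIV"
      by (rule Ck_on_SucI[OF _ 1]) (auto intro!: continuous_intros)
    then show "Ck_on (Suc 0) (\<lambda>x. real (1 + 2) * max 0 x ^ (1 + 1) * v) UNIV" for v
      by (intro Ck_on_mult Ck_on_const) (auto simp: numeral_2_eq_2)
  qed auto
  then show ?thesis by (simp add: numeral_2_eq_2 eval_nat_numeral)
qed

text \<open>Differentiation under the integral sign, by induction on k. The partial derivative in t
  is packaged as a bounded linear map \<open>G\<close>, because the Leibniz rule asks for an
  operator-valued integrand that is jointly continuous; this is checked on basis vectors.\<close>

lemma Ck_on_integral_cbox:
  fixes f :: "'a::euclidean_space \<times> 'b::euclidean_space \<Rightarrow> 'c::banach"
  assumes "open V" "open W" "cbox a b \<subseteq> W" "Ck_on k f (V \<times> W)"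
  shows "Ck_on k (\<lambda>t. integral (cbox a b) (\<lambda>z. f (t, z))) V"
  using assms(4)
proof (induction k arbitrary: f)
  case 0
  then have "continuous_on (V \<times> cbox a b) (\<lambda>(t,z). f (t,z))"
    using assms(3) by (auto intro: continuous_on_subset)
  then show ?case
    using integral_continuous_on_param by (simp add: integral_continuous_on_param)
next
  case (Suc k)
  define G where "G x = Blinfun (\<lambda>v. frechet_derivative f (at x) (v, 0))" for x
  have d: "(f has_derivative frechet_derivative f (at x)) (at x)" if "x \<in> V \<times> W" for x
    using Ck_on_has_derivative[OF Suc.prems that] .
  have bl: "bounded_linear (\<lambda>v. frechet_derivative f (at x) (v, 0))" if "x \<in> V \<times> W" for x
    by (intro bounded_linear_compose[OF has_derivative_bounded_linear[OF d[OF that]]]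
        bounded_linear_Pair bounded_linear_ident bounded_linear_zero)
  have G: "blinfun_apply (G x) v = frechet_derivative f (at x) (v, 0)" if "x \<in> V \<times> W" for x v
    unfolding G_def using bounded_linear_Blinfun_apply[OF bl[OF that]] by simp
  have cG: "continuous_on (V \<times> W) G"
  proof (rule continuous_on_blinfun_componentwise)
    fix i :: 'a assume "i \<in> Basis"
    have "continuous_on (V \<times> W) (\<lambda>x. frechet_derivative f (at x) (i, 0))"
      using Ck_on_imp_continuous_on[OF Ck_on_deriv[OF Suc.prems]] .
    then show "continuous_on (V \<times> W) (\<lambda>x. blinfun_apply (G x) i)"
      by (rule continuous_on_eq) (simp add: G)
  qed
  have cf: "continuous_on (V \<times> W) f" using Suc.prems by (rule Ck_on_imp_continuous_on)
  show ?case
  proof (rule Ck_on_SucI[OF assms(1)])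
    fix t assume t: "t \<in> V"
    obtain e where e: "e > 0" "ball t e \<subseteq> V" using assms(1) t open_contains_ball by blast
    have "((\<lambda>t. integral (cbox a b) (\<lambda>z. f (t, z))) has_derivative 
        integral (cbox a b) (\<lambda>z. G (t, z))) (at t within ball t e)"
    proof (rule leibniz_rule)
      show "((\<lambda>x. f (x, z)) has_derivative blinfun_apply (G (x, z))) (at x within ball t e)"
        if "x \<in> ball t e" "z \<in> cbox a b" for x z
      proof -
        have xz: "(x, z) \<in> V \<times> W" using that e assms(3) by auto
        have "((\<lambda>x. (x, z)) has_derivative (\<lambda>v. (v, 0))) (at x)"
          by (auto intro!: derivative_eq_intros)
        from has_derivative_compose[OF this d[OF xz]]
        have "((\<lambda>x. f (x, z)) has_derivative blinfun_apply (G (x, z))) (at x)"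
          using G[OF xz] by (metis (no_types, lifting) ext)
        then show ?thesis by (rule has_derivative_at_withinI)
      qed
      show "(\<lambda>z. f (x, z)) integrable_on cbox a b" if "x \<in> ball t e" for x
        by (intro integrable_continuous continuous_on_compose2[OF cf])
          (use that e assms(3) in \<open>auto intro!: continuous_intros\<close>)
      show "continuous_on (ball t e \<times> cbox a b) (\<lambda>(x, t). G (x, t))"
        using continuous_on_subset[OF cG] e assms(3) by (simp add: Sigma_mono)
    qed (use e in auto)
    moreover have "blinfun_apply (integral (cbox a b) (\<lambda>z. G (t, z))) v
        = integral (cbox a b) (\<lambda>z. frechet_derivative f (at (t, z)) (v, 0))" for v
    proof -
      have "(\<lambda>z. G (t, z)) integrable_on cbox a b"
        by (intro integrable_continuous continuous_on_compose2[OF cG])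
          (use t assms(3) in \<open>auto intro!: continuous_intros\<close>)
      from blinfun_apply_integral[OF this]
      have "blinfun_apply (integral (cbox a b) (\<lambda>z. G (t, z))) v = integral (cbox a b) (\<lambda>z. G (t, z) v)" .
      also have "\<dots> = integral (cbox a b) (\<lambda>z. frechet_derivative f (at (t, z)) (v, 0))"
        by (intro integral_cong) (use G t assms(3) in auto)
      finally show ?thesis .
    qed
    ultimately have "((\<lambda>t. integral (cbox a b) (\<lambda>z. f (t, z))) has_derivative 
        (\<lambda>v. integral (cbox a b) (\<lambda>z. frechet_derivative f (at (t, z)) (v, 0)))) (at t within ball t e)"
      by (metis (no_types, lifting) ext)
    then show "((\<lambda>t. integral (cbox a b) (\<lambda>z. f (t, z))) has_derivative 
        (\<lambda>v. integral (cbox a b) (\<lambda>z. frechet_derivative f (at (t, z)) (v, 0)))) (at t)"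
      using e by (subst (asm) at_within_open) auto
  next
    fix v
    show "Ck_on k (\<lambda>x. integral (cbox a b) (\<lambda>z. frechet_derivative f (at (x, z)) (v, 0))) V"
      by (rule Suc.IH[OF Ck_on_deriv[OF Suc.prems]])
  qed
qed

section \<open>An implicit function theorem and integrals over moving domains\<close>

text \<open>A product rule in which the second factor need only converge at x, not be
  differentiable, because the first factor vanishes there. It differentiates an implicit function
  whose increment is such a product.\<close>

lemma has_derivative_vanishing_mult:
  fixes n e :: "'a::real_normed_vector \<Rightarrow> real"
  assumes n: "(n has_derivative n') (at x)" "n x = 0" and e: "(e \<longlongrightarrow> e0) (at x)"
  shows "((\<lambda>y. n y * e y) has_derivative (\<lambda>h. n' h * e0)) (at x)"
proof -
  interpret n: bounded_linear n' using n(1) by (rule has_derivative_bounded_linear)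
  have "((\<lambda>y. ((n y - n x) - n' (y - x)) /\<^sub>R norm (y - x)) \<longlongrightarrow> 0) (at x)"
    using n(1) unfolding has_derivative_within by (simp add: divide_inverse algebra_simps)
  then have 1: "((\<lambda>y. (((n y - n x) - n' (y - x)) /\<^sub>R norm (y - x)) * e y) \<longlongrightarrow> 0) (at x)"
    using tendsto_mult[OF _ e, of _ 0] by auto
  obtain K where K0: "0 \<le> K" and K: "\<And>h. norm (n' h) \<le> norm h * K" using n.nonneg_bounded by blast
  have "((\<lambda>y. (n' (y - x) /\<^sub>R norm (y - x)) * (e y - e0)) \<longlongrightarrow> 0) (at x)"
  proof (rule Lim_null_comparison[where g="\<lambda>y. K * \<bar>e y - e0\<bar>"])
    show "\<forall>\<^sub>F y in at x. norm ((n' (y - x) /\<^sub>R norm (y - x)) * (e y - e0)) \<le> K * \<bar>e y - e0\<bar>"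
    proof (rule always_eventually, rule allI)
      fix y
      have "\<bar>n' (y - x)\<bar> / norm (y - x) \<le> K" if "y \<noteq> x"
        using K[of "y - x"] that by (simp add: field_simps)
      moreover have "norm ((n' (y - x) /\<^sub>R norm (y - x)) * (e y - e0)) = (\<bar>n' (y - x)\<bar> / norm (y - x)) * \<bar>e y - e0\<bar>"
        by (simp add: abs_mult divide_inverse mult.commute)
      ultimately show "norm ((n' (y - x) /\<^sub>R norm (y - x)) * (e y - e0)) \<le> K * \<bar>e y - e0\<bar>"
        using K0 mult_right_mono[of "\<bar>n' (y - x)\<bar> / norm (y - x)" K "\<bar>e y - e0\<bar>"] by (cases "y = x") (auto simp: n.zero)
    qed
    have "((\<lambda>y. K * \<bar>e y - e0\<bar>) \<longlongrightarrow> K * \<bar>e0 - e0\<bar>) (at x)" by (intro tendsto_intros e)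
    then show "((\<lambda>y. K * \<bar>e y - e0\<bar>) \<longlongrightarrow> 0) (at x)" by simp
  qed
  note 2 = this
  have eq: "(((n y - n x) - n' (y - x)) /\<^sub>R norm (y - x)) * e y + (n' (y - x) /\<^sub>R norm (y - x)) * (e y - e0)
     = ((n y * e y - n x * e x) - n' (y - x) * e0) /\<^sub>R norm (y - x)" for y
    by (simp add: n(2) algebra_simps)
  have "((\<lambda>y. ((n y * e y - n x * e x) - n' (y - x) * e0) /\<^sub>R norm (y - x)) \<longlongrightarrow> 0) (at x)"
    using tendsto_add[OF 1 2] unfolding eq by simp
  moreover have "bounded_linear (\<lambda>h. n' h * e0)" by (rule n.bounded_linear_axioms[THEN bounded_linear_mult_const])
  ultimately show ?thesis unfolding has_derivative_within by (simp add: divide_inverse algebra_simps)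
qed

text \<open>Bootstrapping: the derivative of \<open>\<alpha>\<close> is an expression in first
  derivatives of \<open>\<Psi>\<close> at \<open>(y, \<alpha> y)\<close>, hence as regular as
  \<open>\<alpha>\<close> itself, and \<open>\<alpha>\<close> gains one order. Two applications lead
  from continuity to C^2.\<close>

lemma implicit_Ck_step:
  fixes \<Psi> :: "'y::euclidean_space \<times> real \<Rightarrow> real"
  assumes Q: "open Q" and Z: "open Z" and \<Psi>: "Ck_on (Suc k) \<Psi> Z"
    and a: "\<And>y. y \<in> Q \<Longrightarrow> (y, \<alpha> y) \<in> Z \<and> frechet_derivative \<Psi> (at (y, \<alpha> y)) (0, 1) > 0"
    and d: "\<And>y. y \<in> Q \<Longrightarrow> (\<alpha> has_derivative (\<lambda>h. - frechet_derivative \<Psi> (at (y, \<alpha> y)) (h, 0) * inverse (frechet_derivative \<Psi> (at (y, \<alpha> y)) (0, 1)))) (at y)"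
    and k: "Ck_on k \<alpha> Q"
  shows "Ck_on (Suc k) \<alpha> Q"
proof (rule Ck_on_SucI[OF Q d])
  fix v
  have p: "Ck_on k (\<lambda>y. (y, \<alpha> y)) Q" by (intro Ck_on_Pair Q Ck_on_id k)
  have c: "Ck_on k (\<lambda>y. frechet_derivative \<Psi> (at (y, \<alpha> y)) w) Q" for w
    by (rule Ck_on_compose[OF Q Z Ck_on_deriv[OF \<Psi>] p]) (use a in auto)
  have "Ck_on k (\<lambda>y. inverse (frechet_derivative \<Psi> (at (y, \<alpha> y)) (0, 1))) Q"
    by (rule Ck_on_compose[OF Q _ Ck_on_inverse c]) (use a in force)+
  then show "Ck_on k (\<lambda>x. - frechet_derivative \<Psi> (at (x, \<alpha> x)) (v, 0) * inverse (frechet_derivative \<Psi> (at (x, \<alpha> x)) (0, 1))) Q"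
    by (intro Ck_on_mult Ck_on_minus Q c)
qed

text \<open>The sign change across the bracket [-b, b] and monotonicity in s give exactly one zero
  \<open>\<alpha> y\<close> for each y in the prescribed set \<open>Q\<close>. The last conclusion
  is the one that matters later: the sublevel set lies below the graph of
  \<open>\<alpha>\<close>.\<close>

lemma implicit_function_C2:
  fixes \<Psi> :: "'y::euclidean_space \<times> real \<Rightarrow> real"
  assumes Q: "open Q" and Z: "open Z" and sub: "\<And>y s. y \<in> Q \<Longrightarrow> \<bar>s\<bar> \<le> b \<Longrightarrow> (y, s) \<in> Z" and \<Psi>: "Ck_on 2 \<Psi> Z" and b: "0 < b"
    and pos: "\<And>y s. y \<in> Q \<Longrightarrow> \<bar>s\<bar> \<le> b \<Longrightarrow> frechet_derivative \<Psi> (at (y, s)) (0, 1) > 0"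
    and ends: "\<And>y. y \<in> Q \<Longrightarrow> \<Psi> (y, -b) < 0 \<and> 0 < \<Psi> (y, b)"
  obtains \<alpha> where "Ck_on 2 \<alpha> Q" "\<And>y. y \<in> Q \<Longrightarrow> -b < \<alpha> y \<and> \<alpha> y < b"
    "\<And>y s. y \<in> Q \<Longrightarrow> \<bar>s\<bar> \<le> b \<Longrightarrow> \<Psi> (y, s) < 0 \<longleftrightarrow> s < \<alpha> y"
proof -
  have Psi': "(\<Psi> has_derivative frechet_derivative \<Psi> (at p)) (at p)" if "p \<in> Z" for p
    using Ck_on_has_derivative[of "Suc 0" \<Psi> Z] \<Psi> that by (simp add: numeral_2_eq_2 del: Ck_on.simps)
  have cD: "continuous_on Z (\<lambda>p. frechet_derivative \<Psi> (at p) w)" for w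
    using Ck_on_imp_continuous_on[OF Ck_on_deriv[of "Suc 0" \<Psi> Z]] \<Psi> by (simp add: numeral_2_eq_2 del: Ck_on.simps)
  have c\<Psi>: "continuous_on Z \<Psi>" using \<Psi> by (rule Ck_on_imp_continuous_on)
  have ds: "((\<lambda>s. \<Psi> (y, s)) has_real_derivative frechet_derivative \<Psi> (at (y, s)) (0, 1)) (at s)" if "y \<in> Q" "\<bar>s\<bar> \<le> b" for y s
  proof -
    have "((\<lambda>s. (y, s)) has_derivative (\<lambda>h. (0, h))) (at s)" by (auto intro!: derivative_eq_intros)
    from has_derivative_compose[OF this Psi'[OF sub[OF that]]]
    have 1: "((\<lambda>s. \<Psi> (y, s)) has_derivative (\<lambda>h. frechet_derivative \<Psi> (at (y, s)) (0, h))) (at s)" .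
    have 2: "frechet_derivative \<Psi> (at (y, s)) (0, h) = frechet_derivative \<Psi> (at (y, s)) (0, 1) * h" for h
    proof -
      have "frechet_derivative \<Psi> (at (y, s)) (0, h) = frechet_derivative \<Psi> (at (y, s)) (h *\<^sub>R (0, 1))" by simp
      also have "\<dots> = h *\<^sub>R frechet_derivative \<Psi> (at (y, s)) (0, 1)"
        by (rule linear_scale[OF has_derivative_linear[OF Psi'[OF sub[OF that]]]])
      also have "\<dots> = frechet_derivative \<Psi> (at (y, s)) (0, 1) * h" by (simp only: real_scaleR_def mult.commute)
      finally show ?thesis .
    qed
    show ?thesis unfolding has_field_derivative_def
      by (rule has_derivative_eq_rhs[OF 1]) (rule ext, rule 2)
  qed
  have mono: "\<Psi> (y, s) < \<Psi> (y, s')" if "y \<in> Q" "s < s'" "\<bar>s\<bar> \<le> b" "\<bar>s'\<bar> \<le> b" for y s s'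
  proof (rule DERIV_pos_imp_increasing[OF that(2)])
    fix x assume "s \<le> x" "x \<le> s'"
    then have "\<bar>x\<bar> \<le> b" using that by auto
    then show "\<exists>z. ((\<lambda>s. \<Psi> (y, s)) has_real_derivative z) (at x) \<and> 0 < z" using ds pos that(1) by blast
  qed
  have "\<exists>s. \<bar>s\<bar> \<le> b \<and> \<Psi> (y, s) = 0" if y: "y \<in> Q" for y
  proof -
    have "\<exists>s\<ge>-b. s \<le> b \<and> \<Psi> (y, s) = 0"
    proof (rule IVT)
      show "\<forall>s. - b \<le> s \<and> s \<le> b \<longrightarrow> isCont (\<lambda>x. \<Psi> (y, x)) s"
        by (intro allI impI DERIV_isCont[OF ds[OF y]]) auto
    qed (use ends[OF y] b in \<open>auto intro!: less_imp_le\<close>)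
    then show ?thesis by (auto simp: abs_le_iff)
  qed
  then obtain \<alpha> where \<alpha>0: "\<And>y. y \<in> Q \<Longrightarrow> \<bar>\<alpha> y\<bar> \<le> b \<and> \<Psi> (y, \<alpha> y) = 0" by metis
  have \<alpha>b: "-b < \<alpha> y \<and> \<alpha> y < b" if "y \<in> Q" for y
  proof -
    have "\<alpha> y \<noteq> b" "\<alpha> y \<noteq> -b" using \<alpha>0[OF that] ends[OF that] by auto
    then show ?thesis using \<alpha>0[OF that] by auto
  qed
  have iff: "\<Psi> (y, s) < 0 \<longleftrightarrow> s < \<alpha> y" if "y \<in> Q" "\<bar>s\<bar> \<le> b" for y s
    using mono[of y s "\<alpha> y"] mono[of y "\<alpha> y" s] \<alpha>0[OF that(1)] that by (cases s "\<alpha> y" rule: linorder_cases) auto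
  have iff': "0 < \<Psi> (y, s) \<longleftrightarrow> \<alpha> y < s" if "y \<in> Q" "\<bar>s\<bar> \<le> b" for y s
    using mono[of y s "\<alpha> y"] mono[of y "\<alpha> y" s] \<alpha>0[OF that(1)] that by (cases s "\<alpha> y" rule: linorder_cases) auto
  have cy: "isCont (\<lambda>y. \<Psi> (y, s)) y" if "y \<in> Q" "\<bar>s\<bar> \<le> b" for y s
  proof -
    have "isCont \<Psi> (y, s)" using c\<Psi> Z sub[OF that] by (simp add: continuous_on_eq_continuous_at)
    moreover have "isCont (\<lambda>y. (y, s)) y" by (intro continuous_intros)
    ultimately show ?thesis using isCont_o2[of y "\<lambda>y. (y, s)" \<Psi>] by simp
  qed
  have c\<alpha>: "isCont \<alpha> y0" if y0: "y0 \<in> Q" for y0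
    unfolding continuous_at tendsto_iff
  proof (intro allI impI)
    fix e :: real assume "0 < e"
    \<comment> \<open>Half the distances to b and -b keep both test heights inside the bracket,
      where the sign of \<open>\<Psi>\<close> tells on which side of \<open>\<alpha> y\<close> they
      lie.\<close>
    define e' where "e' = min (e/2) (min ((b - \<alpha> y0)/2) ((b + \<alpha> y0)/2))"
    have e': "0 < e'" "e' < e" "\<bar>\<alpha> y0 - e'\<bar> \<le> b" "\<bar>\<alpha> y0 + e'\<bar> \<le> b"
      using \<open>0 < e\<close> \<alpha>b[OF y0] by (auto simp: e'_def abs_le_iff min_def field_simps)
    have "\<Psi> (y0, \<alpha> y0 - e') < 0" using iff[OF y0 e'(3)] e' by simp
    then have 1: "\<forall>\<^sub>F y in at y0. \<Psi> (y, \<alpha> y0 - e') < 0"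
      using cy[OF y0 e'(3)] by (auto simp: continuous_at intro: order_tendstoD)
    have "0 < \<Psi> (y0, \<alpha> y0 + e')" using iff'[OF y0 e'(4)] e' by simp
    then have 2: "\<forall>\<^sub>F y in at y0. 0 < \<Psi> (y, \<alpha> y0 + e')"
      using cy[OF y0 e'(4)] by (auto simp: continuous_at intro: order_tendstoD)
    have 3: "\<forall>\<^sub>F y in at y0. y \<in> Q" using Q y0 eventually_at_in_open' by blast
    show "\<forall>\<^sub>F y in at y0. dist (\<alpha> y) (\<alpha> y0) < e"
      using 1 2 3
    proof eventually_elim
      case (elim y)
      then show ?case using iff[OF elim(3) e'(3)] iff'[OF elim(3) e'(4)] e' by (simp add: dist_real_def abs_less_iff)
    qed
  qed
  have d\<alpha>: "(\<alpha> has_derivative (\<lambda>h. - frechet_derivative \<Psi> (at (y, \<alpha> y)) (h, 0) * inverse (frechet_derivative \<Psi> (at (y, \<alpha> y)) (0, 1)))) (at y)"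
    if y: "y \<in> Q" for y
  proof -
    let ?a = "\<alpha> y"
    have ab: "\<bar>?a\<bar> \<le> b" using \<alpha>0[OF y] by simp
    \<comment> \<open>Mean value theorem in s at the fixed point x, between the height
      \<open>\<alpha> x\<close>, where \<open>\<Psi>\<close> vanishes, and \<open>?a\<close>. It
      writes \<open>\<alpha> x - ?a\<close> as a quotient whose numerator is differentiable and
      vanishes at y while the denominator merely converges, which is the case of
      \<open>has_derivative_vanishing_mult\<close>.\<close>
    have "\<exists>\<xi>. (\<bar>\<xi> - ?a\<bar> \<le> \<bar>\<alpha> x - ?a\<bar>) \<and> \<bar>\<xi>\<bar> \<le> b \<and> - \<Psi> (x, ?a) = (\<alpha> x - ?a) * frechet_derivative \<Psi> (at (x, \<xi>)) (0, 1)"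
      if x: "x \<in> Q" for x
    proof (cases "\<alpha> x" ?a rule: linorder_cases)
      case less
      have "\<exists>\<xi>>\<alpha> x. \<xi> < ?a \<and> \<Psi> (x, ?a) - \<Psi> (x, \<alpha> x) = (?a - \<alpha> x) * frechet_derivative \<Psi> (at (x, \<xi>)) (0, 1)"
        by (rule MVT2[OF less]) (use \<alpha>0[OF x] ab in \<open>auto intro!: ds[OF x]\<close>)
      then obtain \<xi> where "\<alpha> x < \<xi>" "\<xi> < ?a" "\<Psi> (x, ?a) - \<Psi> (x, \<alpha> x) = (?a - \<alpha> x) * frechet_derivative \<Psi> (at (x, \<xi>)) (0, 1)" by blast
      then show ?thesis using \<alpha>0[OF x] ab by (intro exI[of _ \<xi>]) (auto simp: algebra_simps)
    next
      case equal
      then show ?thesis using \<alpha>0[OF x] ab by (intro exI[of _ ?a]) auto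
    next
      case greater
      have "\<exists>\<xi>>?a. \<xi> < \<alpha> x \<and> \<Psi> (x, \<alpha> x) - \<Psi> (x, ?a) = (\<alpha> x - ?a) * frechet_derivative \<Psi> (at (x, \<xi>)) (0, 1)"
        by (rule MVT2[OF greater]) (use \<alpha>0[OF x] ab in \<open>auto intro!: ds[OF x]\<close>)
      then obtain \<xi> where "?a < \<xi>" "\<xi> < \<alpha> x" "\<Psi> (x, \<alpha> x) - \<Psi> (x, ?a) = (\<alpha> x - ?a) * frechet_derivative \<Psi> (at (x, \<xi>)) (0, 1)" by blast
      then show ?thesis using \<alpha>0[OF x] ab by (intro exI[of _ \<xi>]) (auto simp: algebra_simps)
    qed
    then obtain \<xi> where \<xi>: "\<And>x. x \<in> Q \<Longrightarrow> \<bar>\<xi> x - ?a\<bar> \<le> \<bar>\<alpha> x - ?a\<bar>" "\<And>x. x \<in> Q \<Longrightarrow> \<bar>\<xi> x\<bar> \<le> b"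
      "\<And>x. x \<in> Q \<Longrightarrow> - \<Psi> (x, ?a) = (\<alpha> x - ?a) * frechet_derivative \<Psi> (at (x, \<xi> x)) (0, 1)" by metis
    have evQ: "\<forall>\<^sub>F x in at y. x \<in> Q" using Q y eventually_at_in_open' by blast
    have "((\<lambda>x. \<alpha> x - ?a) \<longlongrightarrow> ?a - ?a) (at y)" using c\<alpha>[OF y] by (intro tendsto_intros) (simp add: continuous_at)
    then have "((\<lambda>x. \<bar>\<alpha> x - ?a\<bar>) \<longlongrightarrow> 0) (at y)" using tendsto_rabs_zero by auto
    then have "((\<lambda>x. \<xi> x - ?a) \<longlongrightarrow> 0) (at y)"
      by (rule Lim_null_comparison[rotated]) (use evQ \<xi>(1) in \<open>auto elim!: eventually_mono\<close>)
    then have "(\<xi> \<longlongrightarrow> ?a) (at y)" by (simp add: LIM_zero_iff)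
    then have "((\<lambda>x. (x, \<xi> x)) \<longlongrightarrow> (y, ?a)) (at y)" by (intro tendsto_intros)
    moreover have "isCont (\<lambda>p. frechet_derivative \<Psi> (at p) (0,1)) (y, ?a)"
      using cD Z sub[OF y ab] by (simp add: continuous_on_eq_continuous_at)
    ultimately have "((\<lambda>x. frechet_derivative \<Psi> (at (x, \<xi> x)) (0,1)) \<longlongrightarrow> frechet_derivative \<Psi> (at (y, ?a)) (0,1)) (at y)"
      by (rule isCont_tendsto_compose[rotated])
    then have e: "((\<lambda>x. inverse (frechet_derivative \<Psi> (at (x, \<xi> x)) (0,1))) \<longlongrightarrow> inverse (frechet_derivative \<Psi> (at (y, ?a)) (0,1))) (at y)"
      using pos[OF y ab] by (intro tendsto_inverse) auto
    have "((\<lambda>x. (x, ?a)) has_derivative (\<lambda>h. (h, 0))) (at y)" by (auto intro!: derivative_eq_intros)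
    from has_derivative_minus[OF has_derivative_compose[OF this Psi'[OF sub[OF y ab]]]]
    have "((\<lambda>x. - \<Psi> (x, ?a)) has_derivative (\<lambda>h. - frechet_derivative \<Psi> (at (y, ?a)) (h, 0))) (at y)" .
    from has_derivative_vanishing_mult[OF this _ e] \<alpha>0[OF y]
    have "((\<lambda>x. - \<Psi> (x, ?a) * inverse (frechet_derivative \<Psi> (at (x, \<xi> x)) (0,1))) has_derivative
      (\<lambda>h. - frechet_derivative \<Psi> (at (y, ?a)) (h, 0) * inverse (frechet_derivative \<Psi> (at (y, ?a)) (0,1)))) (at y)" by simp
    from has_derivative_add[OF has_derivative_const[of ?a] this]
    have 1: "((\<lambda>x. ?a + - \<Psi> (x, ?a) * inverse (frechet_derivative \<Psi> (at (x, \<xi> x)) (0,1))) has_derivative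
      (\<lambda>h. - frechet_derivative \<Psi> (at (y, ?a)) (h, 0) * inverse (frechet_derivative \<Psi> (at (y, ?a)) (0,1)))) (at y)" by simp
    show ?thesis
    proof (rule has_derivative_cong_open[THEN iffD1, OF Q y _ 1])
      fix x assume x: "x \<in> Q"
      have "frechet_derivative \<Psi> (at (x, \<xi> x)) (0,1) > 0" using pos[OF x \<xi>(2)[OF x]] .
      then show "?a + - \<Psi> (x, ?a) * inverse (frechet_derivative \<Psi> (at (x, \<xi> x)) (0,1)) = \<alpha> x"
        using \<xi>(3)[OF x] by (simp add: field_simps)
    qed
  qed
  have ok: "(y, \<alpha> y) \<in> Z \<and> frechet_derivative \<Psi> (at (y, \<alpha> y)) (0, 1) > 0" if "y \<in> Q" for y
    using sub[OF that] pos[OF that] \<alpha>0[OF that] by blast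
  have P2: "Ck_on (Suc (Suc 0)) \<Psi> Z" using \<Psi> by (simp only: numeral_2_eq_2)
  have "Ck_on 0 \<alpha> Q" using c\<alpha> by (simp add: continuous_at_imp_continuous_on)
  from implicit_Ck_step[OF Q Z Ck_on_SucD[OF P2] ok d\<alpha> this]
  have "Ck_on (Suc 0) \<alpha> Q" .
  from implicit_Ck_step[OF Q Z P2 ok d\<alpha> this]
  have "Ck_on 2 \<alpha> Q" by (simp only: numeral_2_eq_2)
  from that[OF this \<alpha>b iff] show thesis by blast
qed

section \<open>Integrals with a parameter, smoothing kernels and cutoffs\<close>

lemma LINT_compact_support:
  fixes f :: "'b::euclidean_space \<Rightarrow> real"
  assumes "continuous_on (cbox a b) f" "\<And>z. z \<notin> cbox a b \<Longrightarrow> f z = 0"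
  shows "integrable lborel f" "(LINT z|lborel. f z) = integral (cbox a b) f"
proof -
  have *: "(\<lambda>x. indicator (cbox a b) x *\<^sub>R f x) = f"
    using assms(2) by (auto simp: fun_eq_iff indicator_def)
  have "integrable lborel (\<lambda>x. indicator (cbox a b) x *\<^sub>R f x)"
    by (rule borel_integrable_compact[OF compact_cbox assms(1)])
  then show "integrable lborel f" by (simp only: *)
  have "set_integrable lborel (cbox a b) f" unfolding set_integrable_def using \<open>integrable lborel f\<close> by (simp only: *)
  from set_borel_integral_eq_integral(2)[OF this]
  show "(LINT z|lborel. f z) = integral (cbox a b) f" unfolding set_lebesgue_integral_def by (simp only: *)
qed

lemma Ck_on_LINT_compact_support:
  fixes f :: "'a::euclidean_space \<times> 'b::euclidean_space \<Rightarrow> real"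
  assumes V: "open V" and f: "Ck_on k f (V \<times> UNIV)" and z: "\<And>t z. t \<in> V \<Longrightarrow> z \<notin> cbox a b \<Longrightarrow> f (t, z) = 0"
  shows "Ck_on k (\<lambda>t. LINT z|lborel. f (t, z)) V"
proof -
  have "Ck_on k (\<lambda>t. integral (cbox a b) (\<lambda>z. f (t, z))) V"
    by (rule Ck_on_integral_cbox[OF V open_UNIV _ f]) simp
  moreover have "(LINT z|lborel. f (t, z)) = integral (cbox a b) (\<lambda>z. f (t, z))" if "t \<in> V" for t
  proof (rule LINT_compact_support(2))
    show "continuous_on (cbox a b) (\<lambda>z. f (t, z))"
      by (rule continuous_on_compose2[OF Ck_on_imp_continuous_on[OF f]]) (use that in \<open>auto intro!: continuous_intros\<close>)
  qed (use z that in auto)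
  ultimately show ?thesis by (subst Ck_on_cong[OF V]) auto
qed

lemma LINT_translate:
  fixes H :: "'b::euclidean_space \<Rightarrow> real"
  assumes "H \<in> borel_measurable borel"
  shows "(LINT z|lborel. H (z + c)) = (LINT z|lborel. H z)"
proof -
  have "(LINT z|lborel. H z) = (LINT z|distr lborel borel ((+) c). H z)" by (simp add: lborel_distr_plus)
  also have "\<dots> = (LINT z|lborel. H (c + z))" by (rule integral_distr) (use assms in auto)
  finally show ?thesis by (simp add: add.commute)
qed

text \<open>Fubini, translation invariance and total mass 1 of the kernel. The gain is that a
  discontinuity of \<open>H\<close> transverse to \<open>v\<close> is averaged out by the inner
  integral.\<close>

lemma LINT_smoothing:
  fixes H :: "'b::euclidean_space \<Rightarrow> real"
  assumes H[measurable]: "H \<in> borel_measurable borel" and HB: "\<And>z. \<bar>H z\<bar> \<le> B" and Hs: "\<And>z. z \<notin> cball z0 d \<Longrightarrow> H z = 0"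
    and \<eta>: "continuous_on UNIV (\<eta> :: real \<Rightarrow> real)" "\<And>s. b < \<bar>s\<bar> \<Longrightarrow> \<eta> s = 0" "(LINT s|lborel. \<eta> s) = 1"
  shows "(LINT z|lborel. H z) = (LINT z|lborel. LINT s|lborel. \<eta> s * H (z + s *\<^sub>R v))"
proof -
  have [measurable]: "\<eta> \<in> borel_measurable borel" using \<eta>(1) by (rule borel_measurable_continuous_onI)
  have "bounded (\<eta> ` {-b..b})" by (intro compact_imp_bounded compact_continuous_image continuous_on_subset[OF \<eta>(1)]) auto
  then obtain E where "\<forall>x\<in>\<eta> ` {-b..b}. norm x \<le> E" unfolding bounded_iff by blast
  then have E: "\<And>s. s \<in> {-b..b} \<Longrightarrow> \<bar>\<eta> s\<bar> \<le> E" by simp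
  have E': "\<bar>\<eta> s\<bar> \<le> max E 0" for s using E[of s] \<eta>(2)[of s] by (cases "\<bar>s\<bar> \<le> b") (auto simp: abs_le_iff)
  \<comment> \<open>For |s| at most b, translation by s v moves a point by at most b |v|, so all
    translated supports lie in the ball of this radius.\<close>
  define D where "D = d + b * norm v"
  have "integrable (lborel \<Otimes>\<^sub>M lborel) (\<lambda>(z, s). \<eta> s * H (z + s *\<^sub>R v))"
  proof (rule integrableI_bounded_set[where A="cball z0 D \<times> {-b..b}" and B="max E 0 * B"])
    show "emeasure (lborel \<Otimes>\<^sub>M lborel) (cball z0 D \<times> {- b..b}) < \<infinity>"
      by (subst lborel.emeasure_pair_measure_Times)
        (use emeasure_lborel_cball_finite[of z0 D] in \<open>auto simp: ennreal_mult_less_top emeasure_lborel_Icc_eq\<close>)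
    show "(\<lambda>(z, s). \<eta> s * H (z + s *\<^sub>R v)) \<in> borel_measurable (lborel \<Otimes>\<^sub>M lborel)" by measurable
    show "AE x in lborel \<Otimes>\<^sub>M lborel. x \<in> cball z0 D \<times> {- b..b} \<longrightarrow> norm (case x of (z, s) \<Rightarrow> \<eta> s * H (z + s *\<^sub>R v)) \<le> max E 0 * B"
      by (intro AE_I2) (auto simp: abs_mult intro!: mult_mono E' HB)
    show "AE x in lborel \<Otimes>\<^sub>M lborel. x \<notin> cball z0 D \<times> {- b..b} \<longrightarrow> (case x of (z, s) \<Rightarrow> \<eta> s * H (z + s *\<^sub>R v)) = 0"
    proof (intro AE_I2 impI)
      fix x assume x: "x \<notin> cball z0 D \<times> {- b..b}"
      obtain z s where zs: "x = (z, s)" by (cases x)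
      then have *: "(z, s) \<notin> cball z0 D \<times> {- b..b}" using x by simp
      have "\<eta> s * H (z + s *\<^sub>R v) = 0"
      proof (cases "\<bar>s\<bar> \<le> b")
        case True
        then have z: "D < dist z0 z" using * by (auto simp: abs_le_iff)
        have "\<bar>s\<bar> * norm v \<le> b * norm v" using True by (intro mult_right_mono) auto
        moreover have "dist z0 z \<le> dist z0 (z + s *\<^sub>R v) + \<bar>s\<bar> * norm v"
          using dist_triangle[of z0 z "z + s *\<^sub>R v"] by (simp add: dist_norm)
        ultimately have "z + s *\<^sub>R v \<notin> cball z0 d" using z by (auto simp: D_def)
        then show ?thesis using Hs by simp
      qed (use \<eta>(2) in auto)
      then show "(case x of (z, s) \<Rightarrow> \<eta> s * H (z + s *\<^sub>R v)) = 0" by (simp add: zs)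
    qed
  qed auto
  from lborel_pair.Fubini_integral[OF this]
  have "(LINT z|lborel. LINT s|lborel. \<eta> s * H (z + s *\<^sub>R v)) = (LINT s|lborel. LINT z|lborel. \<eta> s * H (z + s *\<^sub>R v))" by simp
  also have "\<dots> = (LINT s|lborel. \<eta> s * (LINT z|lborel. H z))" by (simp add: LINT_translate)
  also have "\<dots> = (LINT z|lborel. H z)" using \<eta>(3) by simp
  finally show ?thesis by simp
qed

lemma exists_C2_kernel:
  assumes "0 < (b::real)"
  obtains \<eta> :: "real \<Rightarrow> real" where "Ck_on 2 \<eta> UNIV" "\<And>s. b \<le> \<bar>s\<bar> \<Longrightarrow> \<eta> s = 0" "(LINT s|lborel. \<eta> s) = 1"
proof -
  define f where "f s = max 0 (b^2 - s^2) ^ 3" for s :: real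
  have f2: "Ck_on 2 f UNIV" unfolding f_def
    by (rule Ck_on_compose[OF _ _ Ck_on_max_cube]) (auto intro!: Ck_on_diff Ck_on_const Ck_on_power Ck_on_id)
  have f0: "f s = 0" if "b \<le> \<bar>s\<bar>" for s
    using power_mono[OF that, of 2] assms by (simp add: f_def)
  have fn: "0 \<le> f s" for s by (simp add: f_def)
  have int: "integrable lborel f"
    by (rule LINT_compact_support(1)[of "-b" b]) (auto intro!: f0 continuous_on_subset[OF Ck_on_imp_continuous_on[OF f2]] simp: abs_if)
  \<comment> \<open>On the middle half of [-b, b], an interval of length b, the difference b^2 - s^2
    is at least 3/4 b^2. This positive lower bound for the mass allows the normalization.\<close>
  have "0 < (3/4 * b^2)^3 * b" using assms by simp
  also have "\<dots> = (LINT s|lborel. (3/4 * b^2)^3 * indicator {-b/2..b/2} s)" using assms by simp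
  also have "\<dots> \<le> (LINT s|lborel. f s)"
  proof (rule integral_mono[OF _ int])
    show "integrable lborel (\<lambda>s. (3 / 4 * b\<^sup>2) ^ 3 * indicat_real {- b / 2..b / 2} s)"
      by (intro integrable_mult_right integrable_real_indicator) (auto simp: emeasure_lborel_Icc_eq)
    fix s
    show "(3 / 4 * b\<^sup>2) ^ 3 * indicat_real {- b / 2..b / 2} s \<le> f s"
    proof (cases "s \<in> {-b/2..b/2}")
      case True
      then have "\<bar>s\<bar> \<le> b/2" by auto
      from power_mono[OF this, of 2] have "3/4 * b^2 \<le> b^2 - s^2" by (simp add: power_divide)
      then have "(3/4 * b^2)^3 \<le> f s" unfolding f_def by (intro power_mono order_trans[OF _ max.cobounded2]) auto
      then show ?thesis using True by simp
    qed (use fn in simp)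
  qed
  finally have c: "0 < (LINT s|lborel. f s)" .
  show thesis
  proof (rule that[of "\<lambda>s. f s * (1 / (LINT s|lborel. f s))"])
    show "Ck_on 2 (\<lambda>s. f s * (1 / (LINT s|lborel. f s))) UNIV" by (intro Ck_on_mult Ck_on_const f2) auto
  qed (use f0 c int in auto)
qed

lemma exists_C2_cutoff:
  assumes "0 < r"
  obtains \<kappa> :: "'b::euclidean_space \<Rightarrow> real" where "Ck_on 2 \<kappa> UNIV" "\<And>z. z \<in> ball a (r/2) \<Longrightarrow> \<kappa> z = 1" "\<And>z. z \<notin> cball a r \<Longrightarrow> \<kappa> z = 0"
proof -
  \<comment> \<open>Normalizes the bump so that \<open>A * f z\<close> is at least 1 on the half
    ball; the positive part in \<open>\<kappa>\<close> is then 0 there and \<open>\<kappa>\<close>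
    is exactly 1.\<close>
  define A where "A = 1 / (3/4 * r^2)^3"
  define f where "f z = max 0 (r^2 - (z - a) \<bullet> (z - a)) ^ 3" for z :: 'b
  have f2: "Ck_on 2 f UNIV" unfolding f_def
    by (rule Ck_on_compose[OF _ _ Ck_on_max_cube])
      (auto intro!: Ck_on_diff Ck_on_const Ck_on_id Ck_on_bilinear[OF _ bounded_bilinear_inner])
  define \<kappa> where "\<kappa> z = 1 - max 0 (1 - A * f z) ^ 3" for z
  show thesis
  proof (rule that[of \<kappa>])
    show "Ck_on 2 \<kappa> UNIV" unfolding \<kappa>_def
      by (intro Ck_on_diff Ck_on_const Ck_on_compose[OF _ _ Ck_on_max_cube] Ck_on_mult f2) auto
    fix z :: 'b
    show "\<kappa> z = 1" if "z \<in> ball a (r/2)"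
    proof -
      have "norm (z - a) \<le> r/2" using that by (simp add: dist_norm norm_minus_commute)
      from power_mono[OF this, of 2] have "(z - a) \<bullet> (z - a) \<le> r^2/4" by (simp add: power2_norm_eq_inner power_divide)
      then have "(3/4 * r^2)^3 \<le> f z" unfolding f_def by (intro power_mono order_trans[OF _ max.cobounded2]) auto
      moreover have "0 < (3/4 * r^2)^3" using assms by simp
      ultimately have "1 \<le> A * f z" unfolding A_def by (simp add: field_simps)
      then show ?thesis by (simp add: \<kappa>_def)
    qed
    show "\<kappa> z = 0" if "z \<notin> cball a r"
    proof -
      have "r \<le> norm (z - a)" using that by (simp add: dist_norm norm_minus_commute)
      from power_mono[OF this, of 2] have "r^2 \<le> (z - a) \<bullet> (z - a)" using assms by (simp add: power2_norm_eq_inner)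
      then have "f z = 0" by (simp add: f_def)
      then show ?thesis by (simp add: \<kappa>_def)
    qed
  qed
qed

section \<open>Localization of the regularity of integrals over moving domains\<close>

definition smooth_integral :: "'a::euclidean_space set \<Rightarrow> ('a \<times> 'b::euclidean_space \<Rightarrow> real) \<Rightarrow> bool" where
  "smooth_integral V h \<longleftrightarrow> (\<forall>t\<in>V. integrable lborel (\<lambda>z. h (t, z))) \<and> Ck_on 2 (\<lambda>t. LINT z|lborel. h (t, z)) V"

lemma smooth_integral_cong:
  assumes "open V" "\<And>t z. t \<in> V \<Longrightarrow> h (t, z) = h' (t, z)" "smooth_integral V h"
  shows "smooth_integral V h'"
proof -
  have e: "(\<lambda>z. h (t, z)) = (\<lambda>z. h' (t, z))" if "t \<in> V" for t using assms(2)[OF that] by auto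
  have "Ck_on 2 (\<lambda>t. LINT z|lborel. h (t, z)) V \<longleftrightarrow> Ck_on 2 (\<lambda>t. LINT z|lborel. h' (t, z)) V"
    by (rule Ck_on_cong[OF assms(1)]) (simp only: e)
  then show ?thesis using assms(3) e unfolding smooth_integral_def by metis
qed

lemma smooth_integral_add:
  assumes "open V" "smooth_integral V h" "smooth_integral V h'"
  shows "smooth_integral V (\<lambda>x. h x + h' x)"
proof -
  have "Ck_on 2 (\<lambda>t. (LINT z|lborel. h (t, z)) + (LINT z|lborel. h' (t, z))) V"
    using assms by (intro Ck_on_add) (auto simp: smooth_integral_def)
  then have "Ck_on 2 (\<lambda>t. (LINT z|lborel. h (t, z) + h' (t, z))) V"
    by (rule Ck_on_cong[OF assms(1), THEN iffD1, rotated]) (use assms in \<open>auto simp: smooth_integral_def\<close>)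
  then show ?thesis using assms by (auto simp: smooth_integral_def)
qed

lemma smooth_integral_compact:
  fixes g :: "'a::euclidean_space \<times> 'b::euclidean_space \<Rightarrow> real"
  assumes V: "open V" and g: "Ck_on 2 g (V \<times> UNIV)" and s: "\<And>t z. t \<in> V \<Longrightarrow> z \<notin> cball z0 d \<Longrightarrow> g (t, z) = 0"
  shows "smooth_integral V g"
proof -
  obtain a b where ab: "cball z0 d \<subseteq> cbox a b" using bounded_subset_cbox_symmetric[OF bounded_cball] by blast
  have z: "g (t, z) = 0" if "t \<in> V" "z \<notin> cbox a b" for t z using s that ab by blast
  show ?thesis unfolding smooth_integral_def
  proof (intro conjI ballI Ck_on_LINT_compact_support[OF V g z])
    fix t assume t: "t \<in> V"
    show "integrable lborel (\<lambda>z. g (t, z))"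
    proof (rule LINT_compact_support(1))
      show "continuous_on (cbox a b) (\<lambda>z. g (t, z))"
        by (rule continuous_on_compose2[OF Ck_on_imp_continuous_on[OF g]]) (use t in \<open>auto intro!: continuous_intros\<close>)
    qed (use z t in auto)
  qed
qed

text \<open>Integrals over \<open>D\<close> of functions supported near \<open>z0\<close> are \<open>C\<^sup>2\<close>; a partition of unity reduces to this case.\<close>
definition integral_chart :: "('a::euclidean_space \<times> 'b::euclidean_space) set \<Rightarrow> 'a \<Rightarrow> 'b \<Rightarrow> 'a set \<Rightarrow> real \<Rightarrow> bool" where
  "integral_chart D t0 z0 V d \<longleftrightarrow> open V \<and> t0 \<in> V \<and> 0 < d \<and>
     (\<forall>V' g. open V' \<longrightarrow> V' \<subseteq> V \<longrightarrow> Ck_on 2 g (V' \<times> UNIV) \<longrightarrow> (\<forall>t\<in>V'. \<forall>z. z \<notin> cball z0 d \<longrightarrow> g (t, z) = 0) \<longrightarrow>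
       smooth_integral V' (\<lambda>x. indicator D x * g x))"

text \<open>On a small product neighbourhood inside \<open>D\<close> the indicator is 1 wherever
  \<open>g\<close> can be nonzero, so the domain drops out of the integral.\<close>

lemma integral_chart_interior:
  assumes D: "open D" and x: "(t0, z0) \<in> D"
  shows "\<exists>V d. integral_chart D t0 z0 V d"
proof -
  obtain V B where VB: "open V" "open B" "(t0, z0) \<in> V \<times> B" "V \<times> B \<subseteq> D" using open_prod_elim[OF D x] .
  obtain d where d: "0 < d" "cball z0 d \<subseteq> B" using VB open_contains_cball by blast
  have key: "smooth_integral V' (\<lambda>x. indicator D x * g x)"
    if V': "open V'" "V' \<subseteq> V" and g: "Ck_on 2 g (V' \<times> UNIV)" and s: "\<forall>t\<in>V'. \<forall>z. z \<notin> cball z0 d \<longrightarrow> g (t, z) = 0" for V' g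
  proof (rule smooth_integral_cong[OF V'(1)])
    show "smooth_integral V' g" by (rule smooth_integral_compact[OF V'(1) g]) (use s in auto)
    fix t z assume t: "t \<in> V'"
    show "g (t, z) = indicator D (t, z) * g (t, z)"
    proof (cases "z \<in> cball z0 d")
      case True
      then have "(t, z) \<in> D" using t d VB V' by blast
      then show ?thesis by simp
    qed (use s t in auto)
  qed
  have "open V" "t0 \<in> V" using VB by auto
  then have "integral_chart D t0 z0 V d" unfolding integral_chart_def
    by (intro conjI allI impI key d(1))
  then show ?thesis by blast
qed

lemma integral_chart_exterior:
  assumes W: "open W" and x: "(t0, z0) \<in> W" and D: "W \<inter> D = {}"
  shows "\<exists>V d. integral_chart D t0 z0 V d"
proof -
  obtain V B where VB: "open V" "open B" "(t0, z0) \<in> V \<times> B" "V \<times> B \<subseteq> W" using open_prod_elim[OF W x] .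
  obtain d where d: "0 < d" "cball z0 d \<subseteq> B" using VB open_contains_cball by blast
  have key: "smooth_integral V' (\<lambda>x. indicator D x * g x)"
    if V': "open V'" "V' \<subseteq> V" and g: "Ck_on 2 g (V' \<times> UNIV)" and s: "\<forall>t\<in>V'. \<forall>z. z \<notin> cball z0 d \<longrightarrow> g (t, z) = 0" for V' g
  proof (rule smooth_integral_cong[OF V'(1)])
    show "smooth_integral V' (\<lambda>_. 0)" by (simp add: smooth_integral_def Ck_on_const[OF V'(1)])
    fix t z assume t: "t \<in> V'"
    show "0 = indicator D (t, z) * g (t, z)"
    proof (cases "z \<in> cball z0 d")
      case True
      then have "(t, z) \<in> W" using t d VB V' by blast
      then have "(t, z) \<notin> D" using D by auto
      then show ?thesis by simp
    qed (use s t in auto)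
  qed
  have "open V" "t0 \<in> V" using VB by auto
  then have "integral_chart D t0 z0 V d" unfolding integral_chart_def
    by (intro conjI allI impI key d(1))
  then show ?thesis by blast
qed

text \<open>Near a boundary point with \<open>D\<^sub>v \<rho> > 0\<close> the domain lies below a graph in the direction \<open>v\<close>.
  Averaging the integral over translates along \<open>v\<close> replaces it by an integral, over all of space,
  of one-dimensional integrals whose upper limit is the implicit function.\<close>
lemma integral_chart_boundary:
  fixes \<rho> :: "'a::euclidean_space \<times> 'b::euclidean_space \<Rightarrow> real"
  assumes N: "open N" and \<rho>: "Ck_on 2 \<rho> N" and x0: "(t0, z0) \<in> N" "\<rho> (t0, z0) = 0"
    and v: "frechet_derivative \<rho> (at (t0, z0)) (0, v) > 0"
    and D: "open D" "\<And>x. x \<in> N \<Longrightarrow> x \<in> D \<longleftrightarrow> \<rho> x < 0"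
  shows "\<exists>V d. integral_chart D t0 z0 V d"
proof -
  \<comment> \<open>Coordinates along the lines in direction \<open>v\<close>: \<open>\<Psi>\<close>
    is \<open>\<rho>\<close> read as a function of the displacement s from the point (t, z).\<close>
  define \<Phi> where "\<Phi> p = (fst (fst p), snd (fst p) + snd p *\<^sub>R v)" for p :: "('a \<times> 'b) \<times> real"
  have bl\<Phi>: "bounded_linear \<Phi>" unfolding \<Phi>_def
    by (intro bounded_linear_Pair bounded_linear_add bounded_linear_scaleR_const bounded_linear_fst bounded_linear_snd
       bounded_linear_fst[THEN bounded_linear_compose] bounded_linear_snd[THEN bounded_linear_compose])
  have c\<Phi>: "continuous_on UNIV \<Phi>" using bl\<Phi> by (simp add: linear_continuous_on)
  define Z where "Z = \<Phi> -` N"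
  have Z: "open Z" unfolding Z_def using N c\<Phi> by (simp add: open_vimage)
  define \<Psi> where "\<Psi> p = \<rho> (\<Phi> p)" for p
  have \<Psi>: "Ck_on 2 \<Psi> Z" unfolding \<Psi>_def
    by (rule Ck_on_compose[OF Z N \<rho> Ck_on_linear[OF Z bl\<Phi>]]) (simp add: Z_def)
  have \<rho>': "(\<rho> has_derivative frechet_derivative \<rho> (at p)) (at p)" if "p \<in> N" for p
    using Ck_on_has_derivative[of "Suc 0" \<rho> N] \<rho> that by (simp add: numeral_2_eq_2 del: Ck_on.simps)
  have c\<rho>': "continuous_on N (\<lambda>p. frechet_derivative \<rho> (at p) w)" for w
    using Ck_on_imp_continuous_on[OF Ck_on_deriv[of "Suc 0" \<rho> N]] \<rho> by (simp add: numeral_2_eq_2 del: Ck_on.simps)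
  have d\<Psi>: "frechet_derivative \<Psi> (at p) (0, 1) = frechet_derivative \<rho> (at (\<Phi> p)) (0, v)" if "p \<in> Z" for p
  proof -
    have "(\<Psi> has_derivative (\<lambda>h. frechet_derivative \<rho> (at (\<Phi> p)) (\<Phi> h))) (at p)" unfolding \<Psi>_def
      by (rule has_derivative_compose[OF bounded_linear_imp_has_derivative[OF bl\<Phi>] \<rho>']) (use that in \<open>simp add: Z_def\<close>)
    from fun_cong[OF frechet_derivative_at[OF this], of "(0,1)"] show ?thesis by (simp add: \<Phi>_def zero_prod_def)
  qed
  define P where "P = Z \<inter> (\<lambda>p. frechet_derivative \<rho> (at (\<Phi> p)) (0, v)) -` {0<..}"
  have "continuous_on Z (\<lambda>p. frechet_derivative \<rho> (at (\<Phi> p)) (0, v))"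
    by (rule continuous_on_compose2[OF c\<rho>' continuous_on_subset[OF c\<Phi>]]) (auto simp: Z_def)
  then have P: "open P" unfolding P_def using Z by (simp add: continuous_open_preimage)
  have "((t0, z0), 0) \<in> P" using x0 v by (simp add: P_def Z_def \<Phi>_def)
  from open_prod_elim[OF P this] obtain Q1 A where QA: "open Q1" "open A" "((t0, z0), 0) \<in> Q1 \<times> A" "Q1 \<times> A \<subseteq> P" .
  obtain b where b: "0 < b" "cball 0 b \<subseteq> A" using QA open_contains_cball by blast
  have inP: "(y, s) \<in> P" if "y \<in> Q1" "\<bar>s\<bar> \<le> b" for y s
  proof -
    have "s \<in> cball 0 b" using that by simp
    then show ?thesis using QA(4) b that by blast
  qed
  have inZ: "(y, s) \<in> Z" if "y \<in> Q1" "\<bar>s\<bar> \<le> b" for y s using inP[OF that] by (simp add: P_def)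
  have pos: "frechet_derivative \<Psi> (at (y, s)) (0, 1) > 0" if "y \<in> Q1" "\<bar>s\<bar> \<le> b" for y s
    using inP[OF that] d\<Psi>[OF inZ[OF that]] by (simp add: P_def)
  have \<Psi>': "(\<Psi> has_derivative frechet_derivative \<Psi> (at p)) (at p)" if "p \<in> Z" for p
    using Ck_on_has_derivative[of "Suc 0" \<Psi> Z] \<Psi> that by (simp add: numeral_2_eq_2 del: Ck_on.simps)
  have y0: "(t0, z0) \<in> Q1" using QA by simp
  have ds: "\<exists>y. ((\<lambda>s. \<Psi> ((t0, z0), s)) has_real_derivative y) (at s) \<and> 0 < y" if s: "\<bar>s\<bar> \<le> b" for s
  proof -
    have "((\<lambda>s. ((t0, z0), s)) has_derivative (\<lambda>h. (0, h))) (at s)" by (auto intro!: derivative_eq_intros)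
    from has_derivative_compose[OF this \<Psi>'[OF inZ[OF y0 s]]]
    have 1: "((\<lambda>s. \<Psi> ((t0, z0), s)) has_derivative (\<lambda>h. frechet_derivative \<Psi> (at ((t0, z0), s)) (0, h))) (at s)" .
    have 2: "frechet_derivative \<Psi> (at ((t0, z0), s)) (0, h) = frechet_derivative \<Psi> (at ((t0, z0), s)) (0, 1) * h" for h
    proof -
      have "frechet_derivative \<Psi> (at ((t0, z0), s)) (0, h) = frechet_derivative \<Psi> (at ((t0, z0), s)) (h *\<^sub>R (0, 1))" by simp
      also have "\<dots> = h *\<^sub>R frechet_derivative \<Psi> (at ((t0, z0), s)) (0, 1)"
        by (rule linear_scale[OF has_derivative_linear[OF \<Psi>'[OF inZ[OF y0 s]]]])
      also have "\<dots> = frechet_derivative \<Psi> (at ((t0, z0), s)) (0, 1) * h" by (simp only: real_scaleR_def mult.commute)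
      finally show ?thesis .
    qed
    have "((\<lambda>s. \<Psi> ((t0, z0), s)) has_real_derivative frechet_derivative \<Psi> (at ((t0, z0), s)) (0, 1)) (at s)"
      unfolding has_field_derivative_def by (rule has_derivative_eq_rhs[OF 1]) (rule ext, rule 2)
    then show ?thesis using pos[OF y0 s] by blast
  qed
  have \<Psi>0: "\<Psi> ((t0, z0), 0) = 0" using x0 by (simp add: \<Psi>_def \<Phi>_def)
  have ep: "\<Psi> ((t0, z0), 0) < \<Psi> ((t0, z0), b)" by (rule DERIV_pos_imp_increasing[OF b(1)]) (use ds in auto)
  have "\<Psi> ((t0, z0), -b) < \<Psi> ((t0, z0), 0)" by (rule DERIV_pos_imp_increasing[where f="\<lambda>s. \<Psi> ((t0, z0), s)"]) (use ds b in auto)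
  note ends0 = this[unfolded \<Psi>0] ep[unfolded \<Psi>0]
  \<comment> \<open>Strict monotonicity along \<open>v\<close> at (t0, z0) fixes the signs of
    \<open>\<Psi>\<close> at -b and b. Both are open conditions, so the bracket required by
    \<open>implicit_function_C2\<close> persists on a neighbourhood.\<close>
  define Q2 where "Q2 = Q1 \<inter> (\<lambda>y. \<Psi> (y, -b)) -` {..<0} \<inter> (Q1 \<inter> (\<lambda>y. \<Psi> (y, b)) -` {0<..})"
  have cQ: "continuous_on Q1 (\<lambda>y. \<Psi> (y, s))" if "\<bar>s\<bar> \<le> b" for s
    by (rule continuous_on_compose2[OF Ck_on_imp_continuous_on[OF \<Psi>]]) (use inZ that in \<open>auto intro!: continuous_intros\<close>)
  have Q2: "open Q2" unfolding Q2_def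
    by (intro open_Int[of "Q1 \<inter> (\<lambda>y. \<Psi> (y, -b)) -` {..<0}"] continuous_open_preimage[OF cQ QA(1)])
      (use b in auto)
  have "(t0, z0) \<in> Q2" using ends0 y0 by (simp add: Q2_def)
  from open_prod_elim[OF Q2 this] obtain V B where VB: "open V" "open B" "(t0, z0) \<in> V \<times> B" "V \<times> B \<subseteq> Q2" .
  obtain e where e: "0 < e" "ball z0 e \<subseteq> B" using VB open_contains_ball by blast
  have VQ: "(t, z) \<in> Q2" if "t \<in> V" "z \<in> ball z0 e" for t z using VB(4) e that by blast
  have oQ: "open (V \<times> ball z0 e)" using VB by (simp add: open_Times)
  have Q2Q1: "y \<in> Q1" if "y \<in> V \<times> ball z0 e" for y using that VQ by (auto simp: Q2_def)
  obtain \<alpha> where \<alpha>: "Ck_on 2 \<alpha> (V \<times> ball z0 e)" "\<And>y. y \<in> V \<times> ball z0 e \<Longrightarrow> -b < \<alpha> y \<and> \<alpha> y < b"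
    "\<And>y s. y \<in> V \<times> ball z0 e \<Longrightarrow> \<bar>s\<bar> \<le> b \<Longrightarrow> \<Psi> (y, s) < 0 \<longleftrightarrow> s < \<alpha> y"
  proof (rule implicit_function_C2[OF oQ Z _ \<Psi> b(1)])
    show "(y, s) \<in> Z" if "y \<in> V \<times> ball z0 e" "\<bar>s\<bar> \<le> b" for y s using inZ Q2Q1 that by blast
    show "0 < frechet_derivative \<Psi> (at (y, s)) (0, 1)" if "y \<in> V \<times> ball z0 e" "\<bar>s\<bar> \<le> b" for y s using pos Q2Q1 that by blast
    show "\<Psi> (y, - b) < 0 \<and> 0 < \<Psi> (y, b)" if "y \<in> V \<times> ball z0 e" for y using VQ that by (auto simp: Q2_def)
  qed blast
  \<comment> \<open>Translations by s v with |s| at most b' move points by at most e/4, so a support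
    of radius e/4 spreads to radius e/2 and stays in the ball where \<open>\<alpha>\<close> is
    defined. The 1 added to \<open>norm v\<close> keeps the denominator positive.\<close>
  define b' where "b' = min b (e / (4 * (norm v + 1)))"
  have "0 < norm v + 1" by (simp add: add_nonneg_pos)
  then have b': "0 < b'" "b' \<le> b" using b e by (auto simp: b'_def)
  have b'v: "b' * norm v \<le> e / 4"
  proof -
    have "b' * norm v \<le> e / (4 * (norm v + 1)) * (norm v + 1)"
      using b' e \<open>0 < norm v + 1\<close> by (intro mult_mono) (auto simp: b'_def)
    moreover have "e / (4 * q) * q = e / 4" if "0 < q" for q using that by simp
    ultimately show ?thesis using \<open>0 < norm v + 1\<close> by metis
  qed
  obtain \<eta> :: "real \<Rightarrow> real" where \<eta>: "Ck_on 2 \<eta> UNIV" "\<And>s. b' \<le> \<bar>s\<bar> \<Longrightarrow> \<eta> s = 0" "(LINT s|lborel. \<eta> s) = 1"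
    using exists_C2_kernel[OF b'(1)] by blast
  have c\<eta>: "continuous_on UNIV \<eta>" by (rule Ck_on_imp_continuous_on[OF \<eta>(1)])
  have "integral_chart D t0 z0 V (e/4)"
    unfolding integral_chart_def
  proof (intro conjI allI impI)
    fix V' and g :: "'a \<times> 'b \<Rightarrow> real"
    assume V': "open V'" "V' \<subseteq> V" and g: "Ck_on 2 g (V' \<times> UNIV)" and s: "\<forall>t\<in>V'. \<forall>z. z \<notin> cball z0 (e/4) \<longrightarrow> g (t, z) = 0"
    define H where "H t z = indicator D (t, z) * g (t, z)" for t z
    have Hs: "H t z = 0" if "t \<in> V'" "z \<notin> cball z0 (e/4)" for t z using s that by (simp add: H_def)
    have cg: "continuous_on S (\<lambda>z. g (t, z))" if "t \<in> V'" for t S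
      by (rule continuous_on_compose2[OF Ck_on_imp_continuous_on[OF g]]) (use that in \<open>auto intro!: continuous_intros\<close>)
    have Hm: "H t \<in> borel_measurable borel" if t: "t \<in> V'" for t
    proof -
      have "continuous_on UNIV (\<lambda>z::'b. (t, z))" by (intro continuous_intros)
      then have "open ((\<lambda>z. (t, z)) -` D)" using D(1) by (simp add: open_vimage)
      then have [measurable]: "(\<lambda>z. (t, z)) -` D \<in> sets borel" by simp
      have [measurable]: "(\<lambda>z. g (t, z)) \<in> borel_measurable borel" using cg[OF t] by (rule borel_measurable_continuous_onI)
      have "H t = (\<lambda>z. indicator ((\<lambda>z. (t, z)) -` D) z * g (t, z))" by (auto simp: H_def indicator_def fun_eq_iff)
      then show ?thesis by simp
    qed
    have "\<exists>B. \<forall>z. \<bar>H t z\<bar> \<le> B" if t: "t \<in> V'" for t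
    proof -
      have "bounded ((\<lambda>z. g (t, z)) ` cball z0 (e/4))"
        by (intro compact_imp_bounded compact_continuous_image cg[OF t]) auto
      then obtain B where "\<forall>x\<in>(\<lambda>z. g (t, z)) ` cball z0 (e/4). norm x \<le> B" unfolding bounded_iff by blast
      then have B: "\<And>z. z \<in> cball z0 (e/4) \<Longrightarrow> \<bar>g (t, z)\<bar> \<le> B" by simp
      have "\<bar>H t z\<bar> \<le> max B 0" for z
        using B[of z] Hs[OF t, of z] by (cases "z \<in> cball z0 (e/4)") (auto simp: H_def indicator_def)
      then show ?thesis by blast
    qed
    then obtain Bd where Bd: "\<And>t z. t \<in> V' \<Longrightarrow> \<bar>H t z\<bar> \<le> Bd t" by metis
    have intH: "integrable lborel (H t)" if t: "t \<in> V'" for t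
      by (rule integrableI_bounded_set[where A="cball z0 (e/4)" and B="Bd t"])
        (use Hm[OF t] Bd[OF t] Hs[OF t] emeasure_lborel_cball_finite[of z0 "e/4"] in \<open>auto intro!: AE_I2\<close>)
    define I where "I p = (LINT s|lborel. \<eta> s * H (fst p) (snd p + s *\<^sub>R v))" for p
    have LI: "(LINT z|lborel. H t z) = (LINT z|lborel. I (t, z))" if t: "t \<in> V'" for t
      unfolding I_def fst_conv snd_conv
    proof (rule LINT_smoothing[OF Hm[OF t] Bd[OF t] _ c\<eta> _ \<eta>(3)])
      show "H t z = 0" if "z \<notin> cball z0 (e/4)" for z by (rule Hs[OF t that])
      show "\<eta> s = 0" if "b' < \<bar>s\<bar>" for s using \<eta>(2) that by simp
    qed
    have I0: "I (t, z) = 0" if t: "t \<in> V'" and z: "z \<notin> cball z0 (e/2)" for t z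
    proof -
      have "\<eta> s * H t (z + s *\<^sub>R v) = 0" for s
      proof (cases "\<bar>s\<bar> \<le> b'")
        case True
        have "\<bar>s\<bar> * norm v \<le> b' * norm v" using True by (intro mult_right_mono) auto
        moreover have "dist z0 z \<le> dist z0 (z + s *\<^sub>R v) + \<bar>s\<bar> * norm v"
          using dist_triangle[of z0 z "z + s *\<^sub>R v"] by (simp add: dist_norm)
        ultimately have "z + s *\<^sub>R v \<notin> cball z0 (e/4)" using z b'v by auto
        then show ?thesis using Hs t by simp
      qed (use \<eta>(2) in auto)
      then show ?thesis by (simp only: I_def fst_conv snd_conv Bochner_Integration.integral_zero)
    qed
    \<comment> \<open>The substitution s = -b + (alpha + b) sigma carries [0, 1] onto [-b, alpha].
      The moving upper limit thereby enters the integrand, which is C^2 because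
      \<open>\<alpha>\<close>, \<open>\<eta>\<close> and \<open>g\<close> are.\<close>
    define f where "f p = (\<alpha> (fst p) + b) * (\<eta> (-b + (\<alpha> (fst p) + b) * snd p) * g (fst (fst p), snd (fst p) + (-b + (\<alpha> (fst p) + b) * snd p) *\<^sub>R v))"
      for p :: "('a \<times> 'b) \<times> real"
    have oV': "open (V' \<times> ball z0 e)" using V' by (simp add: open_Times)
    have oVU: "open ((V' \<times> ball z0 e) \<times> (UNIV::real set))" using oV' by (simp add: open_Times)
    have f2: "Ck_on 2 f ((V' \<times> ball z0 e) \<times> UNIV)"
    proof -
      have 1: "Ck_on 2 (\<lambda>p. \<alpha> (fst p) + b) ((V' \<times> ball z0 e) \<times> (UNIV::real set))"
        by (intro Ck_on_add oVU Ck_on_const Ck_on_compose[OF oVU oQ \<alpha>(1) Ck_on_linear[OF oVU bounded_linear_fst]])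
          (use V' in auto)
      have 2: "Ck_on 2 (\<lambda>p. -b + (\<alpha> (fst p) + b) * snd p) ((V' \<times> ball z0 e) \<times> (UNIV::real set))"
        by (intro Ck_on_add Ck_on_mult oVU Ck_on_const 1 Ck_on_linear[OF oVU bounded_linear_snd])
      have 3: "Ck_on 2 (\<lambda>p. (fst (fst p), snd (fst p) + (-b + (\<alpha> (fst p) + b) * snd p) *\<^sub>R v)) ((V' \<times> ball z0 e) \<times> (UNIV::real set))"
        by (intro Ck_on_Pair Ck_on_add Ck_on_scaleR oVU 2 Ck_on_const Ck_on_linear[OF oVU]
            bounded_linear_fst[THEN bounded_linear_compose] bounded_linear_snd[THEN bounded_linear_compose] bounded_linear_fst)
      have "open (V' \<times> (UNIV::'b set))" using V' by (simp add: open_Times)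
      from Ck_on_compose[OF oVU this g 3]
      have 4: "Ck_on 2 (\<lambda>p. g (fst (fst p), snd (fst p) + (-b + (\<alpha> (fst p) + b) * snd p) *\<^sub>R v)) ((V' \<times> ball z0 e) \<times> (UNIV::real set))" by auto
      have 5: "Ck_on 2 (\<lambda>p. \<eta> (-b + (\<alpha> (fst p) + b) * snd p)) ((V' \<times> ball z0 e) \<times> (UNIV::real set))"
        by (rule Ck_on_compose[OF oVU open_UNIV \<eta>(1) 2]) auto
      show ?thesis unfolding f_def by (intro Ck_on_mult oVU 1 4 5)
    qed
    have I1: "I (t, z) = integral (cbox 0 1) (\<lambda>\<sigma>. f ((t, z), \<sigma>))" if t: "t \<in> V'" and z: "z \<in> ball z0 e" for t z
    proof -
      have tz: "(t, z) \<in> V \<times> ball z0 e" using t z V' by auto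
      define a where "a = \<alpha> (t, z) + b"
      have a: "0 < a" using \<alpha>(2)[OF tz] by (simp add: a_def)
      define h where "h s = \<eta> s * g (t, z + s *\<^sub>R v)" for s
      have ch: "continuous_on UNIV h" unfolding h_def
        by (intro continuous_on_mult c\<eta> continuous_on_compose2[OF cg[OF t, of UNIV]] continuous_intros) auto
      have "I (t, z) = (LINT s|lborel. indicator {-b<..<\<alpha> (t, z)} s * h s)"
        unfolding I_def
      proof (rule Bochner_Integration.integral_cong[OF refl])
        fix s :: real
        show "\<eta> s * H (fst (t, z)) (snd (t, z) + s *\<^sub>R v) = indicator {- b<..<\<alpha> (t, z)} s * h s"
        proof (cases "b' \<le> \<bar>s\<bar>")
          case False
          then have s: "\<bar>s\<bar> < b" using b' by auto
          have "(t, z + s *\<^sub>R v) \<in> N" using inZ[OF Q2Q1[OF tz], of s] s by (auto simp: Z_def \<Phi>_def)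
          then have "(t, z + s *\<^sub>R v) \<in> D \<longleftrightarrow> \<Psi> ((t, z), s) < 0" using D(2) by (simp add: \<Psi>_def \<Phi>_def)
          also have "\<dots> \<longleftrightarrow> s < \<alpha> (t, z)" using \<alpha>(3)[OF tz] s by auto
          finally show ?thesis using s by (auto simp: H_def h_def indicator_def abs_less_iff)
        qed (simp add: \<eta>(2) h_def)
      qed
      also have "\<dots> = \<bar>a\<bar> *\<^sub>R (LINT \<sigma>|lborel. indicator {-b<..<\<alpha> (t, z)} (-b + a * \<sigma>) * h (-b + a * \<sigma>))"
        by (rule lborel_integral_real_affine) (use a in auto)
      also have "\<dots> = (LINT \<sigma>|lborel. a * (indicator {-b<..<\<alpha> (t, z)} (-b + a * \<sigma>) * h (-b + a * \<sigma>)))"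
        using a by simp
      also have "\<dots> = (LINT \<sigma>|lborel. indicator {0..1} \<sigma> *\<^sub>R f ((t, z), \<sigma>))"
      proof (rule integral_cong_AE)
        have [measurable]: "h \<in> borel_measurable borel" using ch by (rule borel_measurable_continuous_onI)
        show "(\<lambda>\<sigma>. a * (indicator {-b<..<\<alpha> (t, z)} (-b + a * \<sigma>) * h (-b + a * \<sigma>))) \<in> borel_measurable lborel" by measurable
        have feq: "f ((t, z), \<sigma>) = a * h (-b + a * \<sigma>)" for \<sigma> by (simp add: f_def h_def a_def)
        then show "(\<lambda>\<sigma>. indicator {0..1} \<sigma> *\<^sub>R f ((t, z), \<sigma>)) \<in> borel_measurable lborel" by simp
        have "AE \<sigma> in lborel. \<sigma> \<noteq> (0::real)" "AE \<sigma> in lborel. \<sigma> \<noteq> (1::real)" by (rule AE_lborel_singleton)+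
        then show "AE \<sigma> in lborel. a * (indicator {-b<..<\<alpha> (t, z)} (-b + a * \<sigma>) * h (-b + a * \<sigma>)) = indicator {0..1} \<sigma> *\<^sub>R f ((t, z), \<sigma>)"
        proof eventually_elim
          case (elim \<sigma>)
          have "-b + a * \<sigma> \<in> {-b<..<\<alpha> (t, z)} \<longleftrightarrow> 0 < a * \<sigma> \<and> a * \<sigma> < a"
            unfolding a_def greaterThanLessThan_iff by linarith
          also have "\<dots> \<longleftrightarrow> 0 < \<sigma> \<and> \<sigma> < 1" using a by (auto simp: zero_less_mult_iff)
          also have "\<dots> \<longleftrightarrow> \<sigma> \<in> {0..1}" using elim by auto
          finally show ?case by (simp add: feq indicator_def)
        qed
      qed
      also have "\<dots> = integral {0..1} (\<lambda>\<sigma>. f ((t, z), \<sigma>))"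
      proof -
        have "continuous_on {0..1} (\<lambda>\<sigma>. f ((t, z), \<sigma>))"
          by (rule continuous_on_compose2[OF Ck_on_imp_continuous_on[OF f2]]) (use t z in \<open>auto intro!: continuous_intros\<close>)
        then have "set_integrable lborel {0..1} (\<lambda>\<sigma>. f ((t, z), \<sigma>))"
          unfolding set_integrable_def by (intro borel_integrable_compact) auto
        from set_borel_integral_eq_integral(2)[OF this] show ?thesis unfolding set_lebesgue_integral_def .
      qed
      finally show ?thesis by simp
    qed
    \<comment> \<open>Over the open ball of radius e the formula \<open>I1\<close> applies; off the
      closed ball of radius e/2 the function vanishes. These two open regions cover
      everything.\<close>
    have I2: "Ck_on 2 I (V' \<times> UNIV)"
    proof (rule Ck_on_local)
      fix x :: "'a \<times> 'b" assume x: "x \<in> V' \<times> UNIV"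
      show "\<exists>T. open T \<and> x \<in> T \<and> Ck_on 2 I T"
      proof (cases "snd x \<in> ball z0 e")
        case True
        have "Ck_on 2 (\<lambda>y. integral (cbox 0 1) (\<lambda>\<sigma>. f (y, \<sigma>))) (V' \<times> ball z0 e)"
          by (rule Ck_on_integral_cbox[OF oV' open_UNIV _ f2]) simp
        then have "Ck_on 2 I (V' \<times> ball z0 e)"
          by (rule Ck_on_cong[OF oV', THEN iffD2, rotated]) (use I1 in auto)
        then show ?thesis using True x oV' by (intro exI[of _ "V' \<times> ball z0 e"]) (auto simp: mem_Times_iff)
      next
        case False
        have o: "open (V' \<times> (- cball z0 (e/2)))" using V' by (simp add: open_Times open_Compl)
        have "Ck_on 2 (\<lambda>_. 0::real) (V' \<times> (- cball z0 (e/2)))" by (rule Ck_on_const[OF o])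
        then have "Ck_on 2 I (V' \<times> (- cball z0 (e/2)))"
          by (rule Ck_on_cong[OF o, THEN iffD2, rotated]) (use I0 in auto)
        moreover have "snd x \<notin> cball z0 (e/2)" using False e by auto
        ultimately show ?thesis using x o by (intro exI[of _ "V' \<times> (- cball z0 (e/2))"]) (auto simp: mem_Times_iff)
      qed
    qed
    have "smooth_integral V' I" by (rule smooth_integral_compact[OF V'(1) I2 I0])
    then have "Ck_on 2 (\<lambda>t. LINT z|lborel. H t z) V'"
      unfolding smooth_integral_def using Ck_on_cong[OF V'(1), of "\<lambda>t. LINT z|lborel. H t z" "\<lambda>t. LINT z|lborel. I (t, z)"] LI by auto
    then show "smooth_integral V' (\<lambda>x. indicator D x * g x)"
      using intH unfolding smooth_integral_def H_def by auto
  qed (use VB e in auto)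
  then show ?thesis by blast
qed

text \<open>The function 1 - prod (1 - kappa) equals 1 on the compact set \<open>K\<close>, because
  some cutoff is 1 at each of its points, and over \<open>V0\<close> the domain lies in
  \<open>K\<close>. Multiplying \<open>g\<close> by it changes nothing under the integral and splits
  the integrand into pieces that fit the charts.\<close>

lemma smooth_integral_cover:
  fixes g :: "'a::euclidean_space \<times> 'b::euclidean_space \<Rightarrow> real"
  assumes K: "compact K" and V0: "open V0" "t0 \<in> V0" and G: "open G" "V0 \<times> K \<subseteq> G" and g: "Ck_on 2 g G"
    and DK: "\<And>t z. t \<in> V0 \<Longrightarrow> (t, z) \<in> D \<Longrightarrow> z \<in> K"
    and charts: "\<And>z. z \<in> K \<Longrightarrow> \<exists>V d. integral_chart D t0 z V d"
  shows "\<exists>V. open V \<and> t0 \<in> V \<and> V \<subseteq> V0 \<and> smooth_integral V (\<lambda>x. indicator D x * g x)"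
proof -
  \<comment> \<open>\<open>g\<close> is C^2 on \<open>G\<close> only. The factor 2 leaves a margin
    between the support of the cutoff, of radius r, and the ball on which \<open>g\<close> is
    regular, so that the product extends by zero to all z.\<close>
  define good where "good z V r \<longleftrightarrow> open V \<and> t0 \<in> V \<and> V \<subseteq> V0 \<and> 0 < r \<and> V \<times> ball z (2 * r) \<subseteq> G \<and>
      (\<forall>V' g. open V' \<longrightarrow> V' \<subseteq> V \<longrightarrow> Ck_on 2 g (V' \<times> UNIV) \<longrightarrow> (\<forall>t\<in>V'. \<forall>w. w \<notin> cball z r \<longrightarrow> g (t, w) = 0) \<longrightarrow>
       smooth_integral V' (\<lambda>x. indicator D x * g x))" for z V r
  have "\<exists>V r. good z V r" if z: "z \<in> K" for z
  proof -
    obtain V d where Vd: "open V" "t0 \<in> V" "0 < d" and ch: "\<And>V' g. open V' \<Longrightarrow> V' \<subseteq> V \<Longrightarrow> Ck_on 2 g (V' \<times> UNIV) \<Longrightarrow> (\<forall>t\<in>V'. \<forall>w. w \<notin> cball z d \<longrightarrow> g (t, w) = 0) \<Longrightarrow>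
       smooth_integral V' (\<lambda>x. indicator D x * g x)" using charts[OF z] unfolding integral_chart_def by blast
    have "(t0, z) \<in> G" using G(2) V0 z by auto
    from open_prod_elim[OF G(1) this] obtain A B where AB: "open A" "open B" "(t0, z) \<in> A \<times> B" "A \<times> B \<subseteq> G" .
    obtain e where e: "0 < e" "ball z e \<subseteq> B" using AB open_contains_ball by blast
    define r where "r = min d (e/2)"
    have r: "0 < r" "r \<le> d" "2 * r \<le> e" using Vd e by (auto simp: r_def)
    show ?thesis
    proof (rule exI[of _ "V \<inter> A \<inter> V0"], rule exI[of _ r], unfold good_def, intro conjI allI impI)
      have "ball z (2*r) \<subseteq> B" using r e by (meson subset_ball subset_trans)
      then show "(V \<inter> A \<inter> V0) \<times> ball z (2*r) \<subseteq> G" using AB(4) by blast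
      fix V' and g :: "'a \<times> 'b \<Rightarrow> real" assume *: "open V'" "V' \<subseteq> V \<inter> A \<inter> V0" "Ck_on 2 g (V' \<times> UNIV)" "\<forall>t\<in>V'. \<forall>w. w \<notin> cball z r \<longrightarrow> g (t, w) = 0"
      show "smooth_integral V' (\<lambda>x. indicator D x * g x)"
        by (rule ch[OF *(1) _ *(3)]) (use * r in auto)
    qed (use Vd AB V0 r in auto)
  qed
  then have "\<forall>z\<in>K. \<exists>V r. good z V r" by blast
  then obtain Vf r where good: "\<And>z. z \<in> K \<Longrightarrow> good z (Vf z) (r z)" by metis
  have Vr: "open (Vf z)" "t0 \<in> Vf z" "Vf z \<subseteq> V0" "0 < r z" "Vf z \<times> ball z (2 * r z) \<subseteq> G" if "z \<in> K" for z
    using good[OF that] unfolding good_def by blast+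
  have ch: "smooth_integral V' (\<lambda>x. indicator D x * g x)"
    if "z \<in> K" "open V'" "V' \<subseteq> Vf z" "Ck_on 2 g (V' \<times> UNIV)" "\<forall>t\<in>V'. \<forall>w. w \<notin> cball z (r z) \<longrightarrow> g (t, w) = 0" for z V' g
    using good[OF that(1)] that unfolding good_def by blast
  have "K \<subseteq> (\<Union>z\<in>K. ball z (r z / 2))" using Vr(4) by force
  from compactE_image[OF K _ this] obtain F where F: "F \<subseteq> K" "finite F" "K \<subseteq> (\<Union>z\<in>F. ball z (r z / 2))" by auto
  define V where "V = V0 \<inter> (\<Inter>z\<in>F. Vf z)"
  have V: "open V" "t0 \<in> V" "V \<subseteq> V0" "\<And>z. z \<in> F \<Longrightarrow> V \<subseteq> Vf z"
    using F Vr V0 unfolding V_def by (auto intro!: open_Int open_INT)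
  have "\<exists>\<kappa>::'b \<Rightarrow> real. Ck_on 2 \<kappa> UNIV \<and> (\<forall>w\<in>ball z (r z / 2). \<kappa> w = 1) \<and> (\<forall>w. w \<notin> cball z (r z) \<longrightarrow> \<kappa> w = 0)" if "z \<in> F" for z
  proof -
    have "0 < r z" using Vr(4) F that by blast
    from exists_C2_cutoff[OF this, of z] obtain \<kappa> :: "'b \<Rightarrow> real" where
      "Ck_on 2 \<kappa> UNIV" "\<And>w. w \<in> ball z (r z / 2) \<Longrightarrow> \<kappa> w = 1" "\<And>w. w \<notin> cball z (r z) \<Longrightarrow> \<kappa> w = 0" by blast
    then show ?thesis by blast
  qed
  then obtain \<kappa> where \<kappa>: "\<And>z. z \<in> F \<Longrightarrow> Ck_on 2 (\<kappa> z :: 'b \<Rightarrow> real) UNIV" "\<And>z w. z \<in> F \<Longrightarrow> w \<in> ball z (r z / 2) \<Longrightarrow> \<kappa> z w = 1"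
     "\<And>z w. z \<in> F \<Longrightarrow> w \<notin> cball z (r z) \<Longrightarrow> \<kappa> z w = 0" by metis
  define GV where "GV = G \<inter> V \<times> UNIV"
  have GV: "open GV" unfolding GV_def using G(1) V(1) by (intro open_Int open_Times) auto
  have \<kappa>s: "Ck_on 2 (\<lambda>x. \<kappa> z (snd x)) S" if "z \<in> F" "open S" for z and S :: "('a \<times> 'b) set"
    by (rule Ck_on_compose[OF that(2) open_UNIV \<kappa>(1)[OF that(1)] Ck_on_linear[OF that(2) bounded_linear_snd]]) auto
  \<comment> \<open>Generalized over \<open>h\<close>: with P the product over F', 1 - (1 - kappa a)
    P equals (1 - P) (1 - kappa a) + kappa a. The induction hypothesis is used for (1 - kappa a) h,
    and only kappa a h needs the chart at \<open>a\<close>.\<close>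
  have key: "smooth_integral V (\<lambda>x. indicator D x * ((1 - (\<Prod>z\<in>F'. 1 - \<kappa> z (snd x))) * h x))"
    if "finite F'" "F' \<subseteq> F" "Ck_on 2 h GV" for F' h
    using that
  proof (induction F' arbitrary: h rule: finite_induct)
    case empty
    then show ?case by (simp add: smooth_integral_def Ck_on_const[OF V(1)])
  next
    case (insert a F')
    have a: "a \<in> F" "a \<in> K" using insert F by auto
    have "smooth_integral V (\<lambda>x. indicator D x * ((1 - (\<Prod>z\<in>F'. 1 - \<kappa> z (snd x))) * ((1 - \<kappa> a (snd x)) * h x)))"
      by (rule insert.IH) (use insert.prems a in \<open>auto intro!: Ck_on_mult Ck_on_diff Ck_on_const GV \<kappa>s\<close>)
    moreover have "smooth_integral V (\<lambda>x. indicator D x * (\<kappa> a (snd x) * h x))"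
    proof (rule ch[OF a(2) V(1) V(4)[OF a(1)]])
      show "Ck_on 2 (\<lambda>x. \<kappa> a (snd x) * h x) (V \<times> UNIV)"
      proof (rule Ck_on_local)
        fix x :: "'a \<times> 'b" assume x: "x \<in> V \<times> UNIV"
        show "\<exists>T. open T \<and> x \<in> T \<and> Ck_on 2 (\<lambda>x. \<kappa> a (snd x) * h x) T"
        proof (cases "snd x \<in> ball a (2 * r a)")
          case True
          have "(fst x, snd x) \<in> Vf a \<times> ball a (2 * r a)" using True x V(4)[OF a(1)] by auto
          then have "x \<in> G" using Vr(5)[OF a(2)] by auto
          then have "x \<in> GV" using x by (auto simp: GV_def mem_Times_iff)
          then show ?thesis using GV insert.prems(2) a(1) \<kappa>s by (intro exI[of _ GV] conjI Ck_on_mult) auto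
        next
          case False
          have o: "open (V \<times> (- cball a (r a)))" using V by (simp add: open_Times open_Compl)
          have "Ck_on 2 (\<lambda>_. 0::real) (V \<times> (- cball a (r a)))" by (rule Ck_on_const[OF o])
          then have "Ck_on 2 (\<lambda>x. \<kappa> a (snd x) * h x) (V \<times> (- cball a (r a)))"
            by (rule Ck_on_cong[OF o, THEN iffD2, rotated]) (use \<kappa>(3)[OF a(1)] in auto)
          moreover have "snd x \<notin> cball a (r a)" using False Vr(4)[OF a(2)] by auto
          ultimately show ?thesis using x o by (intro exI[of _ "V \<times> (- cball a (r a))"]) (auto simp: mem_Times_iff)
        qed
      qed
    qed (use \<kappa>(3)[OF a(1)] in auto)
    ultimately have "smooth_integral V (\<lambda>x. indicator D x * ((1 - (\<Prod>z\<in>F'. 1 - \<kappa> z (snd x))) * ((1 - \<kappa> a (snd x)) * h x)) + indicator D x * (\<kappa> a (snd x) * h x))"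
      by (rule smooth_integral_add[OF V(1)])
    then show ?case
      by (rule smooth_integral_cong[OF V(1), rotated]) (use insert.hyps in \<open>simp add: algebra_simps\<close>)
  qed
  have "smooth_integral V (\<lambda>x. indicator D x * ((1 - (\<Prod>z\<in>F. 1 - \<kappa> z (snd x))) * g x))"
    by (rule key[OF F(2) order_refl]) (rule Ck_on_subset[OF g], simp add: GV_def)
  then have "smooth_integral V (\<lambda>x. indicator D x * g x)"
  proof (rule smooth_integral_cong[OF V(1), rotated])
    fix t z assume t: "t \<in> V"
    show "indicator D (t, z) * ((1 - (\<Prod>a\<in>F. 1 - \<kappa> a (snd (t, z)))) * g (t, z)) = indicator D (t, z) * g (t, z)"
    proof (cases "(t, z) \<in> D")
      case True
      then have "z \<in> K" using DK t V by blast
      then obtain a where a: "a \<in> F" "z \<in> ball a (r a / 2)" using F by blast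
      then have "1 - \<kappa> a z = 0" using \<kappa>(2) by simp
      then have "(\<Prod>a\<in>F. 1 - \<kappa> a z) = 0" using a F(2) by (auto intro!: prod_zero)
      then show ?thesis by simp
    qed simp
  qed
  then show ?thesis using V by blast
qed

section \<open>Second derivatives, Levi form and mean values\<close>

definition D2 :: "('a::euclidean_space \<Rightarrow> real) \<Rightarrow> 'a \<Rightarrow> 'a \<Rightarrow> 'a \<Rightarrow> real" where
  "D2 f x u v = frechet_derivative (\<lambda>y. frechet_derivative f (at y) v) (at x) u"

lemma Ck2_derivative:
  assumes "Ck_on 2 f S" "x \<in> S"
  shows "(f has_derivative frechet_derivative f (at x)) (at x)"
  using assms Ck_on_has_derivative[of "Suc 0" f S x] by (simp add: numeral_2_eq_2 del: Ck_on.simps)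

lemma Ck2_derivative2:
  assumes "Ck_on 2 f S" "x \<in> S"
  shows "((\<lambda>y. frechet_derivative f (at y) v) has_derivative (\<lambda>u. D2 f x u v)) (at x)"
proof -
  have "Ck_on (Suc 0) (\<lambda>y. frechet_derivative f (at y) v) S" using assms by (auto simp: numeral_2_eq_2)
  from Ck_on_has_derivative[OF this assms(2)] show ?thesis by (simp add: D2_def[abs_def])
qed

lemma Ck2_D1_cont: "Ck_on 2 f S \<Longrightarrow> continuous_on S (\<lambda>x. frechet_derivative f (at x) v)"
  using Ck_on_imp_continuous_on[OF Ck_on_deriv[of "Suc 0" f S]] by (simp add: numeral_2_eq_2 del: Ck_on.simps)

lemma Ck2_D2_cont0: "Ck_on 2 f S \<Longrightarrow> continuous_on S (\<lambda>x. D2 f x u v)"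
  unfolding D2_def by (simp add: numeral_2_eq_2)

lemma Ck2_linear: "Ck_on 2 f S \<Longrightarrow> x \<in> S \<Longrightarrow> linear (frechet_derivative f (at x))"
  using Ck2_derivative has_derivative_linear by blast

lemma Ck2_D2_linear1: "Ck_on 2 f S \<Longrightarrow> x \<in> S \<Longrightarrow> linear (\<lambda>u. D2 f x u v)"
  using Ck2_derivative2 has_derivative_linear by blast

text \<open>Linearity in the inner direction is not linearity of a derivative at x. It is obtained
  by differentiating the linearity of the first derivative, which holds on a neighbourhood.\<close>

lemma Ck2_D2_linear2:
  assumes "open S" "Ck_on 2 f S" "x \<in> S" shows "linear (\<lambda>v. D2 f x u v)"
proof (rule linearI)
  fix v w :: 'a and r :: real
  have "((\<lambda>y. frechet_derivative f (at y) v + frechet_derivative f (at y) w) has_derivative (\<lambda>u. D2 f x u v + D2 f x u w)) (at x)"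
    by (intro has_derivative_add Ck2_derivative2[OF assms(2,3)])
  then have "((\<lambda>y. frechet_derivative f (at y) (v + w)) has_derivative (\<lambda>u. D2 f x u v + D2 f x u w)) (at x)"
    by (rule has_derivative_cong_open[THEN iffD1, OF assms(1,3), rotated])
      (simp add: linear_add[OF Ck2_linear[OF assms(2)]])
  from has_derivative_unique[OF this Ck2_derivative2[OF assms(2,3)]]
  show "D2 f x u (v + w) = D2 f x u v + D2 f x u w" by metis
  have "((\<lambda>y. r * frechet_derivative f (at y) v) has_derivative (\<lambda>u. r * D2 f x u v)) (at x)"
    by (intro has_derivative_mult_right Ck2_derivative2[OF assms(2,3)])
  then have "((\<lambda>y. frechet_derivative f (at y) (r *\<^sub>R v)) has_derivative (\<lambda>u. r * D2 f x u v)) (at x)"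
    by (rule has_derivative_cong_open[THEN iffD1, OF assms(1,3), rotated])
      (simp add: linear_scale[OF Ck2_linear[OF assms(2)]])
  from has_derivative_unique[OF this Ck2_derivative2[OF assms(2,3)]]
  show "D2 f x u (r *\<^sub>R v) = r *\<^sub>R D2 f x u v" by (metis real_scaleR_def)
qed

lemma linear_euclidean_sum:
  fixes L :: "'a::euclidean_space \<Rightarrow> real"
  assumes "linear L" shows "L v = (\<Sum>b\<in>Basis. (v \<bullet> b) * L b)"
proof -
  have "L (\<Sum>b\<in>Basis. (v \<bullet> b) *\<^sub>R b) = (\<Sum>b\<in>Basis. (v \<bullet> b) * L b)"
    by (simp add: linear_sum[OF assms] linear_scale[OF assms])
  then show ?thesis by (simp add: euclidean_representation)
qed

lemma continuous_on_D1_joint: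
  fixes f :: "'a::euclidean_space \<Rightarrow> real"
  assumes "Ck_on 2 f S" "continuous_on T g" "continuous_on T h" "\<And>t. t \<in> T \<Longrightarrow> g t \<in> S"
  shows "continuous_on T (\<lambda>t. frechet_derivative f (at (g t)) (h t))"
proof -
  have "continuous_on T (\<lambda>t. \<Sum>b\<in>Basis. (h t \<bullet> b) * frechet_derivative f (at (g t)) b)"
    by (intro continuous_intros assms continuous_on_compose2[OF Ck2_D1_cont[OF assms(1)] assms(2)]) (use assms(4) in auto)
  then show ?thesis
    by (rule continuous_on_eq) (use linear_euclidean_sum[OF Ck2_linear[OF assms(1) assms(4)]] in auto)
qed

lemma continuous_on_D2_joint:
  assumes "open S" "Ck_on 2 f S" "continuous_on T g" "continuous_on T h" "continuous_on T k" "\<And>t. t \<in> T \<Longrightarrow> g t \<in> S"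
  shows "continuous_on T (\<lambda>t. D2 f (g t) (h t) (k t))"
proof -
  have "continuous_on T (\<lambda>t. \<Sum>b\<in>Basis. (h t \<bullet> b) * (\<Sum>c\<in>Basis. (k t \<bullet> c) * D2 f (g t) b c))"
    by (intro continuous_intros assms continuous_on_compose2[OF Ck2_D2_cont0[OF assms(2)] assms(3)]) (use assms(6) in auto)
  moreover have "D2 f (g t) (h t) (k t) = (\<Sum>b\<in>Basis. (h t \<bullet> b) * (\<Sum>c\<in>Basis. (k t \<bullet> c) * D2 f (g t) b c))"
    if "t \<in> T" for t
  proof -
    have l1: "linear (\<lambda>u. D2 f (g t) u (k t))" by (rule Ck2_D2_linear1[OF assms(2) assms(6)[OF that]])
    have l2: "linear (\<lambda>v. D2 f (g t) u v)" for u by (rule Ck2_D2_linear2[OF assms(1,2) assms(6)[OF that]])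
    show ?thesis
      by (subst linear_euclidean_sum[OF l1], rule sum.cong[OF refl], subst linear_euclidean_sum[OF l2]) simp
  qed
  ultimately show ?thesis by (subst continuous_on_cong[OF refl]) auto
qed

text \<open>Base point and direction both move; expanding the direction in the basis reduces the
  claim to products with derivatives in fixed directions.\<close>

lemma has_derivative_D1_along:
  fixes g :: "'b::real_normed_vector \<Rightarrow> 'a::euclidean_space"
  assumes "open S" "Ck_on 2 f S" "g x \<in> S" "(g has_derivative g') (at x)" "(h has_derivative h') (at x)"
  shows "((\<lambda>y. frechet_derivative f (at (g y)) (h y)) has_derivative
     (\<lambda>k. D2 f (g x) (g' k) (h x) + frechet_derivative f (at (g x)) (h' k))) (at x)"
proof -
  have "((\<lambda>y. \<Sum>b\<in>Basis. (h y \<bullet> b) * frechet_derivative f (at (g y)) b) has_derivative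
     (\<lambda>k. \<Sum>b\<in>Basis. (h x \<bullet> b) * D2 f (g x) (g' k) b + (h' k \<bullet> b) * frechet_derivative f (at (g x)) b)) (at x)"
    by (intro has_derivative_sum has_derivative_mult has_derivative_inner_left assms(5)
       has_derivative_compose[OF assms(4) Ck2_derivative2[OF assms(2,3)]])
  moreover have "(\<Sum>b\<in>Basis. (h x \<bullet> b) * D2 f (g x) (g' k) b + (h' k \<bullet> b) * frechet_derivative f (at (g x)) b)
     = D2 f (g x) (g' k) (h x) + frechet_derivative f (at (g x)) (h' k)" for k
    using linear_euclidean_sum[OF Ck2_linear[OF assms(2,3)], of "h' k"]
      linear_euclidean_sum[OF Ck2_D2_linear2[OF assms(1-3)], of "g' k" "h x"] by (simp add: sum.distrib)
  ultimately have 1: "((\<lambda>y. \<Sum>b\<in>Basis. (h y \<bullet> b) * frechet_derivative f (at (g y)) b) has_derivative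
     (\<lambda>k. D2 f (g x) (g' k) (h x) + frechet_derivative f (at (g x)) (h' k))) (at x)" by simp
  have "isCont g x" using assms(4) has_derivative_continuous by blast
  then obtain W where W: "open W" "x \<in> W" "\<And>y. y \<in> W \<Longrightarrow> g y \<in> S"
    using assms(1,3) continuous_at_open[of x g] by metis
  show ?thesis
    by (rule has_derivative_cong_open[THEN iffD1, OF W(1,2) _ 1])
      (use linear_euclidean_sum[OF Ck2_linear[OF assms(2) W(3)]] in auto)
qed

text \<open>Write f(x + s u + t v) as f(x + s u) plus an integral of the v-derivative and
  differentiate in s at 0 under the integral: this gives P(t) = P(0) + int_0^t h with P the
  u-derivative along x + t v. The derivative at t = 0 is h(0) by the fundamental theorem and the
  other mixed derivative by definition.\<close>

lemma D2_sym:
  assumes S: "open S" and f: "Ck_on 2 f S" and x: "x \<in> S"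
  shows "D2 f x u v = D2 f x v u"
proof -
  have "continuous_on UNIV (\<lambda>p::real\<times>real. x + fst p *\<^sub>R u + snd p *\<^sub>R v)" by (intro continuous_intros)
  then have "open ((\<lambda>p::real\<times>real. x + fst p *\<^sub>R u + snd p *\<^sub>R v) -` S)" using S by (auto simp: continuous_on_open_vimage)
  moreover have "(0,0) \<in> ((\<lambda>p::real\<times>real. x + fst p *\<^sub>R u + snd p *\<^sub>R v) -` S)" using x by simp
  ultimately obtain A B where AB0: "open A" "open B" "(0,0) \<in> A \<times> B" "A \<times> B \<subseteq> (\<lambda>p::real\<times>real. x + fst p *\<^sub>R u + snd p *\<^sub>R v) -` S"
    by (rule open_prod_elim)
  then have AB: "open A" "open B" "0 \<in> A" "0 \<in> B" "A \<times> B \<subseteq> (\<lambda>p::real\<times>real. x + fst p *\<^sub>R u + snd p *\<^sub>R v) -` S"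
    by auto
  obtain d1 where d1: "d1 > 0" "ball 0 d1 \<subseteq> A" using AB open_contains_ball by blast
  obtain d2 where d2: "d2 > 0" "ball 0 d2 \<subseteq> B" using AB open_contains_ball by blast
  define d where "d = min d1 d2 / 2"
  have d: "0 < d" using d1 d2 by (simp add: d_def)
  have inS: "x + s *\<^sub>R u + t *\<^sub>R v \<in> S" if "\<bar>s\<bar> \<le> d" "\<bar>t\<bar> \<le> d" for s t
  proof -
    have "s \<in> ball 0 d1" "t \<in> ball 0 d2" using that d1 d2 by (auto simp: d_def)
    then have "(s, t) \<in> A \<times> B" using d1 d2 by blast
    then have "(s, t) \<in> (\<lambda>p::real\<times>real. x + fst p *\<^sub>R u + snd p *\<^sub>R v) -` S" using AB(5) by blast
    then show ?thesis by simp
  qed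
  define P where "P t = frechet_derivative f (at (x + t *\<^sub>R v)) u" for t
  define h where "h t = D2 f (x + t *\<^sub>R v) u v" for t
  have ch: "continuous_on {0..d} h" unfolding h_def
    by (intro continuous_on_D2_joint[OF S f] continuous_intros) (use inS[of 0] in auto)
  have P: "P t = P 0 + integral {0..t} h" if t: "t \<in> {0..d}" for t
  proof -
    have eq: "f (x + s *\<^sub>R u + t *\<^sub>R v) = f (x + s *\<^sub>R u) + integral (cbox 0 t) (\<lambda>\<tau>. frechet_derivative f (at (x + s *\<^sub>R u + \<tau> *\<^sub>R v)) v)"
      if s: "s \<in> {-d<..<d}" for s
    proof -
      have "((\<lambda>\<tau>. frechet_derivative f (at (x + s *\<^sub>R u + \<tau> *\<^sub>R v)) v) has_integral
          (f (x + s *\<^sub>R u + t *\<^sub>R v) - f (x + s *\<^sub>R u + 0 *\<^sub>R v))) {0..t}"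
      proof (rule fundamental_theorem_of_calculus)
        fix \<tau> assume \<tau>: "\<tau> \<in> {0..t}"
        have i: "x + s *\<^sub>R u + \<tau> *\<^sub>R v \<in> S" using s t \<tau> by (intro inS) auto
        have "((\<lambda>\<tau>. x + s *\<^sub>R u + \<tau> *\<^sub>R v) has_derivative (\<lambda>k. k *\<^sub>R v)) (at \<tau>)"
          by (auto intro!: derivative_eq_intros)
        from has_derivative_compose[OF this Ck2_derivative[OF f i]]
        have "((\<lambda>\<tau>. f (x + s *\<^sub>R u + \<tau> *\<^sub>R v)) has_vector_derivative frechet_derivative f (at (x + s *\<^sub>R u + \<tau> *\<^sub>R v)) v) (at \<tau>)"
          by (simp add: has_vector_derivative_def linear_scale[OF Ck2_linear[OF f i]])
        then show "((\<lambda>\<tau>. f (x + s *\<^sub>R u + \<tau> *\<^sub>R v)) has_vector_derivative frechet_derivative f (at (x + s *\<^sub>R u + \<tau> *\<^sub>R v)) v) (at \<tau> within {0..t})"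
          by (rule has_vector_derivative_at_within)
      qed (use t in auto)
      then show ?thesis by (simp add: integral_unique)
    qed
    have L: "((\<lambda>s. f (x + s *\<^sub>R u + t *\<^sub>R v)) has_vector_derivative P t) (at 0)"
    proof -
      have i: "x + 0 *\<^sub>R u + t *\<^sub>R v \<in> S" using t d by (intro inS) auto
      have "((\<lambda>s. x + s *\<^sub>R u + t *\<^sub>R v) has_derivative (\<lambda>k. k *\<^sub>R u)) (at 0)"
        by (auto intro!: derivative_eq_intros)
      from has_derivative_compose[OF this Ck2_derivative[OF f i]] show ?thesis using i
        by (simp add: has_vector_derivative_def P_def linear_scale[OF Ck2_linear[OF f]])
    qed
    have R0: "((\<lambda>s. f (x + s *\<^sub>R u)) has_vector_derivative P 0) (at 0)"
    proof -
      have i: "x + 0 *\<^sub>R u \<in> S" using x by auto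
      have "((\<lambda>s. x + s *\<^sub>R u) has_derivative (\<lambda>k. k *\<^sub>R u)) (at 0)"
        by (auto intro!: derivative_eq_intros)
      from has_derivative_compose[OF this Ck2_derivative[OF f i]] show ?thesis using i
        by (simp add: has_vector_derivative_def P_def linear_scale[OF Ck2_linear[OF f]])
    qed
    have "((\<lambda>s. integral (cbox 0 t) (\<lambda>\<tau>. frechet_derivative f (at (x + s *\<^sub>R u + \<tau> *\<^sub>R v)) v)) has_vector_derivative
        integral (cbox 0 t) (\<lambda>\<tau>. D2 f (x + 0 *\<^sub>R u + \<tau> *\<^sub>R v) u v)) (at 0 within {-d<..<d})"
    proof (rule leibniz_rule_vector_derivative)
      fix s \<tau> assume s: "s \<in> {-d<..<d}" "\<tau> \<in> cbox 0 t"
      have i: "x + s *\<^sub>R u + \<tau> *\<^sub>R v \<in> S" using s t by (intro inS) auto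
      have "((\<lambda>s. x + s *\<^sub>R u + \<tau> *\<^sub>R v) has_derivative (\<lambda>k. k *\<^sub>R u)) (at s)"
        by (auto intro!: derivative_eq_intros)
      from has_derivative_compose[OF this Ck2_derivative2[OF f i, of v]]
      have "((\<lambda>s. frechet_derivative f (at (x + s *\<^sub>R u + \<tau> *\<^sub>R v)) v) has_vector_derivative D2 f (x + s *\<^sub>R u + \<tau> *\<^sub>R v) u v) (at s)"
        unfolding has_vector_derivative_def linear_scale[OF Ck2_D2_linear1[OF f i, of v]] .
      then show "((\<lambda>s. frechet_derivative f (at (x + s *\<^sub>R u + \<tau> *\<^sub>R v)) v) has_vector_derivative D2 f (x + s *\<^sub>R u + \<tau> *\<^sub>R v) u v) (at s within {-d<..<d})"
        by (rule has_vector_derivative_at_within)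
    next
      show "(\<lambda>\<tau>. frechet_derivative f (at (x + s *\<^sub>R u + \<tau> *\<^sub>R v)) v) integrable_on cbox 0 t" if "s \<in> {-d<..<d}" for s
        by (intro integrable_continuous continuous_on_D1_joint[OF f] continuous_intros inS) (use that t in auto)
      show "continuous_on ({-d<..<d} \<times> cbox 0 t) (\<lambda>(s, \<tau>). D2 f (x + s *\<^sub>R u + \<tau> *\<^sub>R v) u v)"
        unfolding split_beta by (intro continuous_on_D2_joint[OF S f] continuous_intros inS) (use t in auto)
    qed (use d in auto)
    then have R1: "((\<lambda>s. integral (cbox 0 t) (\<lambda>\<tau>. frechet_derivative f (at (x + s *\<^sub>R u + \<tau> *\<^sub>R v)) v)) has_vector_derivative
        integral {0..t} h) (at 0)"
      using d by (subst (asm) at_within_open) (auto simp: h_def[abs_def])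
    have "((\<lambda>s. f (x + s *\<^sub>R u + t *\<^sub>R v)) has_vector_derivative P 0 + integral {0..t} h) (at 0)"
      unfolding has_vector_derivative_def
      by (rule has_derivative_cong_open[of "{-d<..<d}", THEN iffD2, OF _ _ eq])
        (use d has_vector_derivative_add[OF R0 R1] in \<open>auto simp: has_vector_derivative_def\<close>)
    from vector_derivative_unique_at[OF L this] show ?thesis .
  qed
  have "((\<lambda>t. P 0 + integral {0..t} h) has_vector_derivative (0 + h 0)) (at 0 within {0..d})"
    by (intro has_vector_derivative_add has_vector_derivative_const integral_has_vector_derivative[OF ch]) (use d in auto)
  then have "(P has_vector_derivative 0 + h 0) (at 0 within {0..d})"
    by (rule has_vector_derivative_transform[rotated 2]) (simp add: d less_imp_le, rule P)
  then have 1: "(P has_vector_derivative h 0) (at 0 within {0..d})" by simp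
  have "((\<lambda>s. x + s *\<^sub>R v) has_derivative (\<lambda>k. k *\<^sub>R v)) (at 0)"
    by (auto intro!: derivative_eq_intros)
  from has_derivative_compose[OF this Ck2_derivative2[OF f, of _ u]] x
  have "(P has_vector_derivative D2 f x v u) (at 0)"
    by (simp add: has_vector_derivative_def P_def[abs_def] linear_scale[OF Ck2_D2_linear1[OF f x]])
  then have 2: "(P has_vector_derivative D2 f x v u) (at 0 within cbox 0 d)" by (rule has_vector_derivative_at_within)
  have "h 0 = D2 f x v u"
    using vector_derivative_unique_within_closed_interval[of 0 d 0 P] 1 2 d by auto
  then show ?thesis by (simp add: h_def)
qed

text \<open>For a complex structure \<open>J\<close> this is four times the complex Hessian form,
  see \<open>complex_hessian_form\<close>; on the complex plane with v = 1 it is the Laplacian.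
  Built from real derivatives, it makes sense on product spaces without choosing complex
  coordinates.\<close>

definition levi :: "('a::euclidean_space \<Rightarrow> 'a) \<Rightarrow> ('a \<Rightarrow> real) \<Rightarrow> 'a \<Rightarrow> 'a \<Rightarrow> real" where
  "levi J f x v = D2 f x v v + D2 f x (J v) (J v)"

abbreviation laplace :: "(complex \<Rightarrow> real) \<Rightarrow> complex \<Rightarrow> real" where
  "laplace v z \<equiv> levi ((*) \<i>) v z 1"

section \<open>Circle means and the Laplacian\<close>

lemma laplace_rotate:
  assumes "open S" "Ck_on 2 v S" "z \<in> S" "cmod c = 1"
  shows "D2 v z c c + D2 v z (\<i> * c) (\<i> * c) = laplace v z"
proof -
  define a b where "a = Re c" "b = Im c"
  have c: "c = a *\<^sub>R 1 + b *\<^sub>R \<i>" "\<i> * c = (- b) *\<^sub>R 1 + a *\<^sub>R \<i>" by (auto simp: complex_eq_iff a_b_def)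
  note l1 = Ck2_D2_linear1[OF assms(2,3)] and l2 = Ck2_D2_linear2[OF assms(1-3)]
  have s: "D2 v z 1 \<i> = D2 v z \<i> 1" by (rule D2_sym[OF assms(1-3)])
  have ab: "a^2 + b^2 = 1" using assms(4) by (simp add: a_b_def cmod_def)
  have *: "D2 v z (p *\<^sub>R 1 + q *\<^sub>R \<i>) (p *\<^sub>R 1 + q *\<^sub>R \<i>) = p^2 * D2 v z 1 1 + 2 * p * q * D2 v z \<i> 1 + q^2 * D2 v z \<i> \<i>" for p q
    unfolding linear_add[OF l1] linear_scale[OF l1] linear_add[OF l2] linear_scale[OF l2] s
    by (simp add: power2_eq_square algebra_simps)
  have "D2 v z c c + D2 v z (\<i> * c) (\<i> * c) = (a^2 + b^2) * (D2 v z 1 1 + D2 v z \<i> \<i>)"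
    using *[of a b] *[of "-b" a] c by (simp only:) (simp add: algebra_simps)
  then show ?thesis using ab by (simp add: levi_def)
qed

text \<open>The Laplacian in polar coordinates: with A(s) the integral over the circle of radius s,
  B = s A' has derivative C = s times the circle integral of the Laplacian, so C is at least 2 pi k
  s. Integrating twice gives B at least pi k s^2 and A(r) at least A(0) + pi k r^2 / 2.\<close>

lemma mean_value_laplace:
  assumes S: "open S" and v: "Ck_on 2 v S" and r: "0 < r" "cball a r \<subseteq> S"
    and k: "\<And>z. z \<in> cball a r \<Longrightarrow> k \<le> laplace v z"
  shows "2 * pi * v a + pi * k * r^2 / 2 \<le> integral {0..2*pi} (\<lambda>\<theta>. v (a + of_real r * cis \<theta>))"
proof -
  \<comment> \<open>A slightly larger disc makes r an interior point of the range of radii, so that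
    two-sided derivatives exist on all of [0, r].\<close>
  have "\<exists>R>r. cball a R \<subseteq> S"
  proof -
    have "compact (cball a r)" by simp
    from compact_subset_open_imp_ball_epsilon_subset[OF this S r(2)]
    obtain e where e: "e > 0" "(\<Union>x\<in>cball a r. ball x e) \<subseteq> S" by blast
    have "cball a (r + e/2) \<subseteq> S"
    proof
      fix z assume z: "z \<in> cball a (r + e/2)"
      show "z \<in> S"
      proof (cases "dist a z \<le> r")
        case False
        have az: "a \<noteq> z" using False r by auto
        define y where "y = a + (r / dist a z) *\<^sub>R (z - a)"
        have "y - z = (r / dist a z - 1) *\<^sub>R (z - a)" by (simp add: y_def algebra_simps)
        then have "dist y z = \<bar>r / dist a z - 1\<bar> * dist a z" by (simp add: dist_norm norm_minus_commute)
        moreover have "\<bar>r / dist a z - 1\<bar> = 1 - r / dist a z" using False r az by (simp add: abs_if field_simps)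
        ultimately have "dist y z = dist a z - r" using az by (simp add: left_diff_distrib)
        moreover have "dist a z - r < e" using e z by auto
        moreover have "dist a y = r" using False r az by (simp add: y_def dist_norm norm_minus_commute)
        ultimately have "y \<in> cball a r" "z \<in> ball y e" by auto
        then show ?thesis using e(2) by blast
      qed (use r in auto)
    qed
    then show ?thesis using e by (intro exI[of _ "r + e/2"]) auto
  qed
  then obtain R where R: "R > r" "cball a R \<subseteq> S" by blast
  let ?U = "{-R<..<R}"
  have inS: "a + of_real s * cis \<theta> \<in> S" if "s \<in> ?U" for s \<theta>
    using that R by (intro subsetD[OF R(2)]) (auto simp: dist_norm norm_mult)
  define p where "p s \<theta> = a + of_real s * cis \<theta>" for s \<theta>
  have dps: "((\<lambda>s. p s \<theta>) has_derivative (\<lambda>h. h *\<^sub>R cis \<theta>)) (at s)" for s \<theta>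
    unfolding p_def by (auto intro!: derivative_eq_intros simp: scaleR_conv_of_real)
  have dpt: "((\<lambda>\<theta>. p s \<theta>) has_derivative (\<lambda>h. h *\<^sub>R (of_real s * (\<i> * cis \<theta>)))) (at \<theta>)" for s \<theta>
    unfolding p_def by (auto intro!: derivative_eq_intros simp: scaleR_conv_of_real algebra_simps)
  have pS: "p s \<theta> \<in> S" if "s \<in> ?U" for s \<theta> using inS[OF that] by (simp add: p_def)
  define A where "A s = integral (cbox 0 (2*pi)) (\<lambda>\<theta>. v (p s \<theta>))" for s
  define A1 where "A1 s = integral (cbox 0 (2*pi)) (\<lambda>\<theta>. frechet_derivative v (at (p s \<theta>)) (cis \<theta>))" for s
  define B where "B s = integral (cbox 0 (2*pi)) (\<lambda>\<theta>. frechet_derivative v (at (p s \<theta>)) (of_real s * cis \<theta>))" for s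
  define C where "C s = integral (cbox 0 (2*pi)) (\<lambda>\<theta>. D2 v (p s \<theta>) (cis \<theta>) (of_real s * cis \<theta>) + frechet_derivative v (at (p s \<theta>)) (cis \<theta>))" for s
  have cv: "continuous_on S v" using v by (rule Ck_on_imp_continuous_on)
  have pcont: "continuous_on T (\<lambda>x. p (f x) (g x))" if "continuous_on T f" "continuous_on T g" for T f g
    unfolding p_def by (intro continuous_intros that)
  have dA: "(A has_real_derivative A1 s) (at s)" if s: "s \<in> ?U" for s
  proof -
    have "(A has_real_derivative A1 s) (at s within ?U)" unfolding A_def A1_def
    proof (rule leibniz_rule_field_derivative)
      fix s \<theta> assume s: "s \<in> ?U"
      have "((\<lambda>s. v (p s \<theta>)) has_derivative (*) (frechet_derivative v (at (p s \<theta>)) (cis \<theta>))) (at s)"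
      proof (rule has_derivative_eq_rhs[OF has_derivative_compose[OF dps Ck2_derivative[OF v pS[OF s]]]], rule ext)
        fix h
        have "frechet_derivative v (at (p s \<theta>)) (h *\<^sub>R cis \<theta>) = h *\<^sub>R frechet_derivative v (at (p s \<theta>)) (cis \<theta>)"
          by (rule linear_scale[OF Ck2_linear[OF v pS[OF s]]])
        then show "frechet_derivative v (at (p s \<theta>)) (h *\<^sub>R cis \<theta>) = frechet_derivative v (at (p s \<theta>)) (cis \<theta>) * h"
          by (simp only: real_scaleR_def mult.commute)
      qed
      then show "((\<lambda>s. v (p s \<theta>)) has_real_derivative frechet_derivative v (at (p s \<theta>)) (cis \<theta>)) (at s within ?U)"
        unfolding has_field_derivative_def by (rule has_derivative_at_withinI)
    next
      show "(\<lambda>\<theta>. v (p s \<theta>)) integrable_on cbox 0 (2*pi)" if "s \<in> ?U" for s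
        by (intro integrable_continuous continuous_on_compose2[OF cv] pcont continuous_intros) (use pS[OF that] in auto)
      show "continuous_on (?U \<times> cbox 0 (2*pi)) (\<lambda>(s, \<theta>). frechet_derivative v (at (p s \<theta>)) (cis \<theta>))"
        unfolding split_beta by (intro continuous_on_D1_joint[OF v] pcont continuous_intros) (use pS in auto)
    qed (use s in auto)
    then show ?thesis using s by (subst (asm) at_within_open) auto
  qed
  have dB: "(B has_real_derivative C s) (at s)" if s: "s \<in> ?U" for s
  proof -
    have "(B has_real_derivative C s) (at s within ?U)" unfolding B_def C_def
    proof (rule leibniz_rule_field_derivative)
      fix s \<theta> assume s: "s \<in> ?U"
      have d: "((\<lambda>s. of_real s * cis \<theta>) has_derivative (\<lambda>h. h *\<^sub>R cis \<theta>)) (at s)"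
        by (auto intro!: derivative_eq_intros simp: scaleR_conv_of_real)
      have "((\<lambda>s. frechet_derivative v (at (p s \<theta>)) (of_real s * cis \<theta>)) has_derivative 
          (*) (D2 v (p s \<theta>) (cis \<theta>) (of_real s * cis \<theta>) + frechet_derivative v (at (p s \<theta>)) (cis \<theta>))) (at s)"
      proof (rule has_derivative_eq_rhs[OF has_derivative_D1_along[OF S v pS[OF s] dps d]], rule ext)
        fix h
        have "D2 v (p s \<theta>) (h *\<^sub>R cis \<theta>) (of_real s * cis \<theta>) = h *\<^sub>R D2 v (p s \<theta>) (cis \<theta>) (of_real s * cis \<theta>)"
          by (rule linear_scale[OF Ck2_D2_linear1[OF v pS[OF s]]])
        moreover have "frechet_derivative v (at (p s \<theta>)) (h *\<^sub>R cis \<theta>) = h *\<^sub>R frechet_derivative v (at (p s \<theta>)) (cis \<theta>)"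
          by (rule linear_scale[OF Ck2_linear[OF v pS[OF s]]])
        ultimately show "D2 v (p s \<theta>) (h *\<^sub>R cis \<theta>) (of_real s * cis \<theta>) + frechet_derivative v (at (p s \<theta>)) (h *\<^sub>R cis \<theta>)
          = (D2 v (p s \<theta>) (cis \<theta>) (of_real s * cis \<theta>) + frechet_derivative v (at (p s \<theta>)) (cis \<theta>)) * h"
          by (simp only: real_scaleR_def distrib_left mult.commute[of _ h])
      qed
      then show "((\<lambda>s. frechet_derivative v (at (p s \<theta>)) (of_real s * cis \<theta>)) has_real_derivative 
          D2 v (p s \<theta>) (cis \<theta>) (of_real s * cis \<theta>) + frechet_derivative v (at (p s \<theta>)) (cis \<theta>)) (at s within ?U)"
        unfolding has_field_derivative_def by (rule has_derivative_at_withinI)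
    next
      show "(\<lambda>\<theta>. frechet_derivative v (at (p s \<theta>)) (of_real s * cis \<theta>)) integrable_on cbox 0 (2*pi)" if "s \<in> ?U" for s
        by (intro integrable_continuous continuous_on_D1_joint[OF v] pcont continuous_intros) (use pS[OF that] in auto)
      show "continuous_on (?U \<times> cbox 0 (2*pi)) (\<lambda>(s, \<theta>). D2 v (p s \<theta>) (cis \<theta>) (of_real s * cis \<theta>) + frechet_derivative v (at (p s \<theta>)) (cis \<theta>))"
        unfolding split_beta by (intro continuous_on_add continuous_on_D2_joint[OF S v] continuous_on_D1_joint[OF v] pcont continuous_intros) (use pS in auto)
    qed (use s in auto)
    then show ?thesis using s by (subst (asm) at_within_open) auto
  qed
  have BA: "B s = s * A1 s" if s: "s \<in> ?U" for s
  proof -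
    have "frechet_derivative v (at (p s \<theta>)) (of_real s * cis \<theta>) = s * frechet_derivative v (at (p s \<theta>)) (cis \<theta>)" for \<theta>
      using linear_scale[OF Ck2_linear[OF v pS[OF s, of \<theta>]], of s "cis \<theta>"] by (simp add: scaleR_conv_of_real)
    then show ?thesis by (simp add: B_def A1_def)
  qed
  have C: "2 * pi * k * s \<le> C s" if s: "0 \<le> s" "s \<le> r" for s
  proof -
    have sU: "s \<in> ?U" using s R r by auto
    \<comment> \<open>The theta-derivative of the periodic function \<open>frechet_derivative v (at
      (p s \<theta>)) (\<i> * cis \<theta>)\<close>, hence of integral 0. Added to the integrand of
      \<open>C\<close> it cancels the first-order term and leaves s times the Laplacian.\<close>
    let ?h = "\<lambda>\<theta>. D2 v (p s \<theta>) (of_real s * (\<i> * cis \<theta>)) (\<i> * cis \<theta>) + frechet_derivative v (at (p s \<theta>)) (- cis \<theta>)"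
    have "(?h has_integral (frechet_derivative v (at (p s (2*pi))) (\<i> * cis (2*pi)) - frechet_derivative v (at (p s 0)) (\<i> * cis 0))) {0..2*pi}"
    proof (rule fundamental_theorem_of_calculus)
      fix \<theta>
      have d: "((\<lambda>\<theta>. \<i> * cis \<theta>) has_derivative (\<lambda>h. h *\<^sub>R (- cis \<theta>))) (at \<theta>)"
        by (auto intro!: derivative_eq_intros simp: scaleR_conv_of_real algebra_simps)
      have "((\<lambda>\<theta>. frechet_derivative v (at (p s \<theta>)) (\<i> * cis \<theta>)) has_derivative (\<lambda>h. h *\<^sub>R ?h \<theta>)) (at \<theta>)"
      proof (rule has_derivative_eq_rhs[OF has_derivative_D1_along[OF S v pS[OF sU] dpt d]], rule ext)
        fix h
        have "D2 v (p s \<theta>) (h *\<^sub>R (of_real s * (\<i> * cis \<theta>))) (\<i> * cis \<theta>) = h *\<^sub>R D2 v (p s \<theta>) (of_real s * (\<i> * cis \<theta>)) (\<i> * cis \<theta>)"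
          by (rule linear_scale[OF Ck2_D2_linear1[OF v pS[OF sU]]])
        moreover have "frechet_derivative v (at (p s \<theta>)) (h *\<^sub>R (- cis \<theta>)) = h *\<^sub>R frechet_derivative v (at (p s \<theta>)) (- cis \<theta>)"
          by (rule linear_scale[OF Ck2_linear[OF v pS[OF sU]]])
        ultimately show "D2 v (p s \<theta>) (h *\<^sub>R (of_real s * (\<i> * cis \<theta>))) (\<i> * cis \<theta>) + frechet_derivative v (at (p s \<theta>)) (h *\<^sub>R (- cis \<theta>)) = h *\<^sub>R ?h \<theta>"
          by (simp only: scaleR_right_distrib)
      qed
      then show "((\<lambda>\<theta>. frechet_derivative v (at (p s \<theta>)) (\<i> * cis \<theta>)) has_vector_derivative ?h \<theta>) (at \<theta> within {0..2*pi})"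
        unfolding has_vector_derivative_def by (rule has_derivative_at_withinI)
    qed auto
    then have h0: "integral (cbox 0 (2*pi)) ?h = 0" by (simp add: p_def integral_unique)
    have "?h integrable_on cbox 0 (2*pi)"
      by (intro integrable_continuous continuous_on_add continuous_on_D2_joint[OF S v] continuous_on_D1_joint[OF v] pcont continuous_intros) (use pS[OF sU] in auto)
    moreover have "(\<lambda>\<theta>. D2 v (p s \<theta>) (cis \<theta>) (of_real s * cis \<theta>) + frechet_derivative v (at (p s \<theta>)) (cis \<theta>)) integrable_on cbox 0 (2*pi)"
      by (intro integrable_continuous continuous_on_add continuous_on_D2_joint[OF S v] continuous_on_D1_joint[OF v] pcont continuous_intros) (use pS[OF sU] in auto)
    ultimately have "C s = integral (cbox 0 (2*pi)) (\<lambda>\<theta>. D2 v (p s \<theta>) (cis \<theta>) (of_real s * cis \<theta>) + frechet_derivative v (at (p s \<theta>)) (cis \<theta>) + ?h \<theta>)"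
      using h0 unfolding C_def by (subst integral_add) auto
    also have "\<dots> = integral (cbox 0 (2*pi)) (\<lambda>\<theta>. s * laplace v (p s \<theta>))"
    proof (rule integral_cong)
      fix \<theta>
      have "D2 v (p s \<theta>) (cis \<theta>) (of_real s * cis \<theta>) = s * D2 v (p s \<theta>) (cis \<theta>) (cis \<theta>)"
        using linear_scale[OF Ck2_D2_linear2[OF S v pS[OF sU, of \<theta>]], of "cis \<theta>" s "cis \<theta>"] by (simp add: scaleR_conv_of_real)
      moreover have "D2 v (p s \<theta>) (of_real s * (\<i> * cis \<theta>)) (\<i> * cis \<theta>) = s * D2 v (p s \<theta>) (\<i> * cis \<theta>) (\<i> * cis \<theta>)"
        using linear_scale[OF Ck2_D2_linear1[OF v pS[OF sU, of \<theta>], of "\<i> * cis \<theta>"], of s "\<i> * cis \<theta>"] by (simp add: scaleR_conv_of_real)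
      moreover have "frechet_derivative v (at (p s \<theta>)) (- cis \<theta>) = - frechet_derivative v (at (p s \<theta>)) (cis \<theta>)"
        by (rule linear_neg[OF Ck2_linear[OF v pS[OF sU]]])
      ultimately show "D2 v (p s \<theta>) (cis \<theta>) (of_real s * cis \<theta>) + frechet_derivative v (at (p s \<theta>)) (cis \<theta>) + ?h \<theta> = s * laplace v (p s \<theta>)"
        using laplace_rotate[OF S v pS[OF sU, of \<theta>], of "cis \<theta>"] by (simp add: distrib_left[symmetric])
    qed
    also have "\<dots> \<ge> integral (cbox 0 (2*pi)) (\<lambda>\<theta>. s * k)"
    proof (rule integral_le)
      show "(\<lambda>\<theta>. s * laplace v (p s \<theta>)) integrable_on cbox 0 (2*pi)" unfolding levi_def
        by (intro integrable_continuous continuous_on_add continuous_on_mult continuous_on_D2_joint[OF S v] pcont continuous_intros) (use pS[OF sU] in auto)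
      fix \<theta>
      have "p s \<theta> \<in> cball a r" using s by (auto simp: p_def dist_norm norm_mult)
      then show "s * k \<le> s * laplace v (p s \<theta>)" using k s by (intro mult_left_mono) auto
    qed auto
    finally show ?thesis by (simp add: algebra_simps)
  qed
  have B: "pi * k * s^2 \<le> B s" if s: "0 \<le> s" "s \<le> r" for s
  proof -
    have "B 0 - pi * k * 0^2 \<le> B s - pi * k * s^2"
    proof (rule DERIV_nonneg_imp_nondecreasing[OF s(1)])
      fix x assume x: "0 \<le> x" "x \<le> s"
      have "((\<lambda>x. B x - pi * k * x^2) has_real_derivative C x - 2 * pi * k * x) (at x)"
        using dB[of x] x s R r by (auto intro!: derivative_eq_intros)
      then show "\<exists>y. ((\<lambda>x. B x - pi * k * x^2) has_real_derivative y) (at x) \<and> 0 \<le> y"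
        using C[of x] x s by (intro exI[of _ "C x - 2 * pi * k * x"]) auto
    qed
    moreover have "B 0 = 0" using BA[of 0] R r by auto
    ultimately show ?thesis by simp
  qed
  have "A 0 - pi * k * 0^2 / 2 \<le> A r - pi * k * r^2 / 2"
  proof (rule DERIV_nonneg_imp_increasing_open[where f="\<lambda>x. A x - pi * k * x^2 / 2"])
    fix x assume x: "0 < x" "x < r"
    have "((\<lambda>x. A x - pi * k * x^2 / 2) has_real_derivative A1 x - pi * k * x) (at x)"
      using dA[of x] x R r by (auto intro!: derivative_eq_intros)
    moreover have "pi * k * x \<le> A1 x" using B[of x] BA[of x] x R r by (auto simp: power2_eq_square)
    ultimately show "\<exists>y. ((\<lambda>x. A x - pi * k * x^2 / 2) has_real_derivative y) (at x) \<and> 0 \<le> y"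
      by (intro exI[of _ "A1 x - pi * k * x"]) auto
  next
    have "continuous_on {0..r} A"
      by (intro continuous_at_imp_continuous_on ballI DERIV_isCont[OF dA]) (use R r in auto)
    then show "continuous_on {0..r} (\<lambda>x. A x - pi * k * x^2 / 2)" by (intro continuous_intros) auto
  qed (use r in auto)
  moreover have "A 0 = 2 * pi * v a" by (simp add: A_def p_def)
  ultimately show ?thesis by (simp add: A_def p_def)
qed

lemma continuous_on_levi:
  assumes "open S" "Ck_on 2 f S" "continuous_on T g" "continuous_on T h" "bounded_linear J" "\<And>t. t \<in> T \<Longrightarrow> g t \<in> S"
  shows "continuous_on T (\<lambda>t. levi J f (g t) (h t))"
  unfolding levi_def using assms
  by (intro continuous_on_add continuous_on_D2_joint bounded_linear.continuous_on[OF assms(5)]) auto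

text \<open>Were the Laplacian at a below 2 c / pi, it would stay below some k < 2 c / pi on a small
  disc, and \<open>mean_value_laplace\<close> for -v would bound the excess of the circle integral
  by pi k r^2 / 2 < c r^2.\<close>

lemma laplace_lower_bound:
  assumes S: "open S" and v: "Ck_on 2 v S" and a: "a \<in> S"
    and m: "r0 > 0" "\<And>r. 0 < r \<Longrightarrow> r < r0 \<Longrightarrow> 2 * pi * v a + c * r^2 \<le> integral {0..2*pi} (\<lambda>\<theta>. v (a + of_real r * cis \<theta>))"
  shows "2 * c / pi \<le> laplace v a"
proof (rule ccontr)
  assume "\<not> ?thesis"
  then obtain k where k: "laplace v a < k" "k < 2 * c / pi" using dense by (meson not_le)
  have "continuous_on S (laplace v)" by (rule continuous_on_levi[OF S v]) (auto intro: continuous_intros bounded_linear_mult_right)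
  then have "open (S \<inter> laplace v -` {..<k})" using S by (simp add: continuous_open_preimage)
  moreover have "a \<in> S \<inter> laplace v -` {..<k}" using a k by simp
  ultimately obtain d where d: "d > 0" "cball a d \<subseteq> S \<inter> laplace v -` {..<k}" unfolding open_contains_cball by blast
  define r where "r = min d (r0/2)"
  have r: "0 < r" "r < r0" "r \<le> d" using d m by (auto simp: r_def)
  have sub: "cball a r \<subseteq> S" "\<And>z. z \<in> cball a r \<Longrightarrow> laplace v z < k" using d r by (auto simp: subset_eq)
  have dv: "frechet_derivative (\<lambda>x. - v x) (at y) u = - frechet_derivative v (at y) u" if "y \<in> S" for y u
    using has_derivative_minus[OF Ck2_derivative[OF v that]] frechet_derivative_at by metis
  have D2: "D2 (\<lambda>x. - v x) y u w = - D2 v y u w" if "y \<in> S" for y u w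
  proof -
    have "((\<lambda>y. frechet_derivative (\<lambda>x. - v x) (at y) w) has_derivative (\<lambda>u. - D2 v y u w)) (at y)"
      using has_derivative_minus[OF Ck2_derivative2[OF v that]] dv
      by (subst has_derivative_cong_open[OF S that, where g="\<lambda>y. - frechet_derivative v (at y) w"]) auto
    then show ?thesis unfolding D2_def by (metis frechet_derivative_at)
  qed
  have "2 * pi * (- v a) + pi * (- k) * r^2 / 2 \<le> integral {0..2*pi} (\<lambda>\<theta>. - v (a + of_real r * cis \<theta>))"
  proof (rule mean_value_laplace[OF S Ck_on_minus[OF S v] r(1) sub(1)])
    fix z assume z: "z \<in> cball a r"
    then have "z \<in> S" "laplace v z < k" using sub by auto
    then show "- k \<le> laplace (\<lambda>x. - v x) z" using D2[of z] by (simp add: levi_def)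
  qed
  then have "integral {0..2*pi} (\<lambda>\<theta>. v (a + of_real r * cis \<theta>)) \<le> 2 * pi * v a + pi * k * r^2 / 2" by simp
  with m(2)[OF r(1,2)] have "c * r^2 \<le> (pi * k / 2) * r^2" by simp
  then have "c \<le> pi * k / 2" using r by (simp add: mult_le_cancel_right)
  then show False using k by (simp add: field_simps)
qed

text \<open>A positive Laplacian at a would make the mean over a small circle exceed the
  maximum.\<close>

lemma laplace_local_max:
  assumes S: "open S" and v: "Ck_on 2 v S" and a: "a \<in> S" and m: "\<And>z. z \<in> S \<Longrightarrow> v z \<le> v a"
  shows "laplace v a \<le> 0"
proof (rule ccontr)
  assume "\<not> ?thesis"
  then obtain k where k: "0 < k" "k < laplace v a" using dense by (meson not_le)
  have "continuous_on S (laplace v)" by (rule continuous_on_levi[OF S v]) (auto intro: continuous_intros bounded_linear_mult_right)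
  then have "open (S \<inter> laplace v -` {k<..})" using S by (simp add: continuous_open_preimage)
  moreover have "a \<in> S \<inter> laplace v -` {k<..}" using a k by simp
  ultimately obtain d where d: "d > 0" "cball a d \<subseteq> S \<inter> laplace v -` {k<..}" unfolding open_contains_cball by blast
  have in_S: "a + of_real d * cis \<theta> \<in> S" for \<theta>
    using d by (intro subsetD[of "cball a d" S]) (auto simp: dist_norm norm_mult)
  have "2 * pi * v a + pi * k * d^2 / 2 \<le> integral {0..2*pi} (\<lambda>\<theta>. v (a + of_real d * cis \<theta>))"
    by (rule mean_value_laplace[OF S v d(1)]) (use d in \<open>auto intro: less_imp_le\<close>)
  also have "\<dots> \<le> integral {0..2*pi} (\<lambda>\<theta>. v a)"
  proof (rule integral_le)
    show "(\<lambda>\<theta>. v (a + of_real d * cis \<theta>)) integrable_on {0..2*pi}"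
      by (intro integrable_continuous_real continuous_on_compose2[OF Ck_on_imp_continuous_on[OF v]] continuous_intros) (use in_S in auto)
  qed (use m in_S in auto)
  finally have "pi * k * d^2 \<le> 0" by simp
  moreover have "0 < pi * k * d^2" using k d by simp
  ultimately show False by linarith
qed

text \<open>Holomorphic maps into a real space with complex structure \<open>J\<close>:
  \<open>p\<close> is the complex velocity and the derivative is complex linear. The second conjunct
  asks the same of \<open>p\<close>, with a continuous velocity \<open>q\<close>, so that the curve
  is C^2 and can be composed with C^2 functions.\<close>

definition holo_curve :: "('a::euclidean_space \<Rightarrow> 'a) \<Rightarrow> complex set \<Rightarrow> (complex \<Rightarrow> 'a) \<Rightarrow> (complex \<Rightarrow> 'a) \<Rightarrow> bool" where
  "holo_curve J S \<gamma> p \<longleftrightarrow> (\<forall>z\<in>S. (\<gamma> has_derivative (\<lambda>h. Re h *\<^sub>R p z + Im h *\<^sub>R J (p z))) (at z)) \<and>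
     (\<exists>q. continuous_on S q \<and> (\<forall>z\<in>S. (p has_derivative (\<lambda>h. Re h *\<^sub>R q z + Im h *\<^sub>R J (q z))) (at z)))"

text \<open>In the Laplacian of the composition the acceleration enters as q + J (J q) = 0, so only
  second derivatives of \<open>u\<close> along \<open>p\<close> and \<open>J p\<close> survive. This
  is how positivity of the Levi form reaches functions of one complex variable.\<close>

lemma levi_compose:
  assumes S: "open S" and T: "open T" and u: "Ck_on 2 u T" and g: "holo_curve J S \<gamma> p"
    and sub: "\<And>z. z \<in> S \<Longrightarrow> \<gamma> z \<in> T" and J: "bounded_linear J" "\<And>x. J (J x) = - x"
  shows "Ck_on 2 (\<lambda>z. u (\<gamma> z)) S" "\<And>z. z \<in> S \<Longrightarrow> laplace (\<lambda>z. u (\<gamma> z)) z = levi J u (\<gamma> z) (p z)"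
proof -
  have dg: "(\<gamma> has_derivative (\<lambda>h. Re h *\<^sub>R p z + Im h *\<^sub>R J (p z))) (at z)" if "z \<in> S" for z
    using g that by (auto simp: holo_curve_def)
  obtain q where q: "continuous_on S q" "\<And>z. z \<in> S \<Longrightarrow> (p has_derivative (\<lambda>h. Re h *\<^sub>R q z + Im h *\<^sub>R J (q z))) (at z)"
    using g by (auto simp: holo_curve_def)
  have lin: "Ck_on k (\<lambda>z. Re h *\<^sub>R w z + Im h *\<^sub>R J (w z)) S" if "Ck_on k w S" for k w and h
    by (intro Ck_on_add Ck_on_bounded_linear[OF S bounded_linear_scaleR_right] that Ck_on_bounded_linear[OF S J(1)] S)
  have "Ck_on (Suc 0) p S" by (rule Ck_on_SucI[OF S q(2) lin]) (use q in auto)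
  then have "Ck_on (Suc (Suc 0)) \<gamma> S" by (intro Ck_on_SucI[OF S dg lin]) 
  then have g2: "Ck_on 2 \<gamma> S" by (simp only: numeral_2_eq_2)
  show "Ck_on 2 (\<lambda>z. u (\<gamma> z)) S" by (rule Ck_on_compose[OF S T u g2 sub])
  fix z assume z: "z \<in> S"
  have D1: "frechet_derivative (\<lambda>z. u (\<gamma> z)) (at y) h = frechet_derivative u (at (\<gamma> y)) (Re h *\<^sub>R p y + Im h *\<^sub>R J (p y))"
    if y: "y \<in> S" for y h
    using frechet_derivative_at[OF has_derivative_compose[OF dg[OF y] Ck2_derivative[OF u sub[OF y]]], symmetric] by (rule fun_cong)
  have D2: "D2 (\<lambda>z. u (\<gamma> z)) z k h = D2 u (\<gamma> z) (Re k *\<^sub>R p z + Im k *\<^sub>R J (p z)) (Re h *\<^sub>R p z + Im h *\<^sub>R J (p z)) +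
     frechet_derivative u (at (\<gamma> z)) (Re h *\<^sub>R (Re k *\<^sub>R q z + Im k *\<^sub>R J (q z)) + Im h *\<^sub>R J (Re k *\<^sub>R q z + Im k *\<^sub>R J (q z)))" for h k
  proof -
    have "((\<lambda>y. Re h *\<^sub>R p y + Im h *\<^sub>R J (p y)) has_derivative (\<lambda>k. Re h *\<^sub>R (Re k *\<^sub>R q z + Im k *\<^sub>R J (q z)) + Im h *\<^sub>R J (Re k *\<^sub>R q z + Im k *\<^sub>R J (q z)))) (at z)"
      by (intro has_derivative_add has_derivative_scaleR_right q(2)[OF z] bounded_linear.has_derivative[OF J(1)])
    from has_derivative_D1_along[OF T u sub[OF z] dg[OF z] this]
    have "((\<lambda>y. frechet_derivative (\<lambda>z. u (\<gamma> z)) (at y) h) has_derivative (\<lambda>k. D2 u (\<gamma> z) (Re k *\<^sub>R p z + Im k *\<^sub>R J (p z)) (Re h *\<^sub>R p z + Im h *\<^sub>R J (p z)) +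
     frechet_derivative u (at (\<gamma> z)) (Re h *\<^sub>R (Re k *\<^sub>R q z + Im k *\<^sub>R J (q z)) + Im h *\<^sub>R J (Re k *\<^sub>R q z + Im k *\<^sub>R J (q z))))) (at z)"
      by (subst has_derivative_cong_open[OF S z D1]) auto
    from fun_cong[OF frechet_derivative_at[OF this, symmetric]] show ?thesis unfolding D2_def .
  qed
  have "frechet_derivative u (at (\<gamma> z)) (- q z) = - frechet_derivative u (at (\<gamma> z)) (q z)"
    using linear_neg[OF Ck2_linear[OF u sub[OF z]]] .
  then show "laplace (\<lambda>z. u (\<gamma> z)) z = levi J u (\<gamma> z) (p z)"
    unfolding levi_def D2 by (simp add: J(2))
qed

section \<open>Complex Hessian and plurisubharmonicity\<close>

abbreviation vecJ :: "complex^'n \<Rightarrow> complex^'n" where "vecJ v \<equiv> \<i> *s v"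

definition cscale :: "complex \<Rightarrow> (complex^'n) \<times> (complex^'m) \<Rightarrow> (complex^'n) \<times> (complex^'m)" where
  "cscale c p = (c *s fst p, c *s snd p)"

lemma bounded_linear_vec_cmult: "bounded_linear (\<lambda>v::complex^'n::finite. c *s v)"
proof -
  have "linear (\<lambda>v::complex^'n. c *s v)"
    by (rule linearI) (simp_all add: vec_eq_iff algebra_simps)
  then show ?thesis by (rule linear_conv_bounded_linear[THEN iffD1])
qed

lemma bounded_linear_cscale: "bounded_linear (cscale c :: (complex^'n::finite) \<times> (complex^'m::finite) \<Rightarrow> _)"
  unfolding cscale_def
  by (intro bounded_linear_Pair bounded_linear_compose[OF bounded_linear_vec_cmult] bounded_linear_fst bounded_linear_snd)

lemma vecJ_vecJ: "vecJ (vecJ v) = - (v::complex^'n::finite)"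
  by (simp add: vec_eq_iff flip: mult.assoc)

lemma cscale_J: "cscale \<i> (cscale \<i> p) = - p"
  by (cases p) (simp add: cscale_def vec_eq_iff flip: mult.assoc)

lemma vec_cmult_Re_Im: "z *s v = Re z *\<^sub>R v + Im z *\<^sub>R vecJ (v::complex^'n::finite)"
  by (simp add: vec_eq_iff complex_eq_iff)

lemma cscale_Re_Im: "cscale z p = Re z *\<^sub>R p + Im z *\<^sub>R cscale \<i> p"
  by (cases p) (simp add: cscale_def vec_eq_iff complex_eq_iff)

lemma holo_curve_affine:
  assumes "bounded_linear J"
  shows "holo_curve J S (\<lambda>z. x + (Re z *\<^sub>R v + Im z *\<^sub>R J v)) (\<lambda>_. v)"
  unfolding holo_curve_def
proof (intro conjI ballI exI[of _ "\<lambda>_. 0"])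
  fix z
  show "((\<lambda>z. x + (Re z *\<^sub>R v + Im z *\<^sub>R J v)) has_derivative (\<lambda>h. Re h *\<^sub>R v + Im h *\<^sub>R J v)) (at z)"
    by (auto intro!: derivative_eq_intros)
  show "((\<lambda>_. v) has_derivative (\<lambda>h. Re h *\<^sub>R 0 + Im h *\<^sub>R J 0)) (at z)"
    using linear_0[OF bounded_linear.linear[OF assms]] by (auto intro!: derivative_eq_intros)
qed simp

lemma Cx_derivative:
  assumes "(g has_derivative g') (at x)" "(h has_derivative h') (at x)"
  shows "frechet_derivative (\<lambda>y. (of_real (g y) + \<i> * of_real (h y)) / 2) (at x) u = (of_real (g' u) + \<i> * of_real (h' u)) / (2::complex)"
proof -
  have "((\<lambda>y. (of_real (g y) + \<i> * of_real (h y)) / (2::complex)) has_derivative (\<lambda>u. (of_real (g' u) + \<i> * of_real (h' u)) / 2)) (at x)"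
    using assms by (auto intro!: derivative_eq_intros)
  from frechet_derivative_at[OF this] show ?thesis by (metis (no_types, lifting))
qed

lemma complex_hessian_entry:
  fixes f :: "complex^'N::finite \<Rightarrow> real"
  assumes S: "open S" and f: "Ck_on 2 f S" and x: "x \<in> S"
  shows "complex_hessian f x $ j $ k =
    (of_real (D2 f x (axis j 1) (axis k 1) + D2 f x (axis j \<i>) (axis k \<i>))
     + \<i> * of_real (D2 f x (axis j 1) (axis k \<i>) - D2 f x (axis j \<i>) (axis k 1))) / 4"
proof -
  have wb: "wirtinger_bar k (\<lambda>y. complex_of_real (f y)) y =
      (of_real (frechet_derivative f (at y) (axis k 1)) + \<i> * of_real (frechet_derivative f (at y) (axis k \<i>))) / 2"
    if y: "y \<in> S" for y
  proof -
    have "((\<lambda>y. complex_of_real (f y)) has_derivative (\<lambda>u. of_real (frechet_derivative f (at y) u))) (at y)"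
      by (rule bounded_linear.has_derivative[OF bounded_linear_of_real Ck2_derivative[OF f y]])
    then show ?thesis unfolding wirtinger_bar_def by (subst (1 2) frechet_derivative_at[symmetric]) auto
  qed
  have fd: "frechet_derivative (wirtinger_bar k (\<lambda>y. complex_of_real (f y))) (at x) u =
     (of_real (D2 f x u (axis k 1)) + \<i> * of_real (D2 f x u (axis k \<i>))) / 2" for u
    by (subst frechet_derivative_cong_open[OF S x wb], assumption)
      (rule Cx_derivative[OF Ck2_derivative2[OF f x] Ck2_derivative2[OF f x]])
  show ?thesis unfolding complex_hessian_def wirtinger_def[of j] vec_lambda_beta fd
    by (simp add: field_simps complex_eq_iff)
qed

text \<open>Expansion in the real basis vectors \<open>axis j 1\<close> and
  \<open>axis j \<i>\<close>. The factor 1/4 comes from the halves in the two Wirtinger operators,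
  and the imaginary parts cancel in pairs (j, k), (k, j) by symmetry of second derivatives.\<close>

lemma complex_hessian_form:
  fixes f :: "complex^'N::finite \<Rightarrow> real"
  assumes S: "open S" and f: "Ck_on 2 f S" and x: "x \<in> S"
  shows "(\<Sum>j\<in>UNIV. \<Sum>k\<in>UNIV. complex_hessian f x $ j $ k * w $ j * cnj (w $ k)) = of_real (levi vecJ f x w / 4)"
proof -
  note l1 = Ck2_D2_linear1[OF f x] and l2 = Ck2_D2_linear2[OF S f x]
  define E F where "E j = axis j (1::complex)" and "F j = axis j \<i>" for j :: 'N
  define a b where "a j = Re (w $ j)" and "b j = Im (w $ j)" for j
  let ?A = "D2 f x"
  have sym: "?A u v = ?A v u" for u v by (rule D2_sym[OF S f x])
  have expand: "v = (\<Sum>j\<in>UNIV. Re (v $ j) *\<^sub>R E j + Im (v $ j) *\<^sub>R F j)" for v :: "complex^'N"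
    by (simp add: vec_eq_iff E_def F_def axis_def complex_eq_iff if_distrib sum.distrib cong: if_cong)
  have bil: "?A (\<Sum>j\<in>UNIV. p j *\<^sub>R E j + q j *\<^sub>R F j) (\<Sum>k\<in>UNIV. p k *\<^sub>R E k + q k *\<^sub>R F k) =
     (\<Sum>j\<in>UNIV. \<Sum>k\<in>UNIV. p j * p k * ?A (E j) (E k) + p j * q k * ?A (E j) (F k) + q j * p k * ?A (F j) (E k) + q j * q k * ?A (F j) (F k))" for p q
  proof -
    let ?X = "\<lambda>j. p j *\<^sub>R E j + q j *\<^sub>R F j"
    have "?A (\<Sum>j\<in>UNIV. ?X j) (\<Sum>k\<in>UNIV. ?X k) = (\<Sum>j\<in>UNIV. ?A (?X j) (\<Sum>k\<in>UNIV. ?X k))"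
      by (rule linear_sum[OF l1])
    also have "\<dots> = (\<Sum>j\<in>UNIV. \<Sum>k\<in>UNIV. ?A (?X j) (?X k))"
      by (intro sum.cong refl linear_sum[OF l2])
    also have "\<dots> = (\<Sum>j\<in>UNIV. \<Sum>k\<in>UNIV. p j * p k * ?A (E j) (E k) + p j * q k * ?A (E j) (F k) + q j * p k * ?A (F j) (E k) + q j * q k * ?A (F j) (F k))"
      unfolding linear_add[OF l1] linear_scale[OF l1] linear_add[OF l2] linear_scale[OF l2]
      by (intro sum.cong refl) (simp add: algebra_simps)
    finally show ?thesis .
  qed
  have L: "levi vecJ f x w = (\<Sum>j\<in>UNIV. \<Sum>k\<in>UNIV. (a j * a k + b j * b k) * (?A (E j) (E k) + ?A (F j) (F k)) + (a j * b k - b j * a k) * (?A (E j) (F k) - ?A (F j) (E k)))"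
  proof -
    have 1: "w = (\<Sum>j\<in>UNIV. a j *\<^sub>R E j + b j *\<^sub>R F j)" using expand[of w] by (simp add: a_def b_def)
    have 2: "vecJ w = (\<Sum>j\<in>UNIV. (- b j) *\<^sub>R E j + a j *\<^sub>R F j)" using expand[of "vecJ w"] by (simp add: a_def b_def)
    have "levi vecJ f x w = ?A (\<Sum>j\<in>UNIV. a j *\<^sub>R E j + b j *\<^sub>R F j) (\<Sum>j\<in>UNIV. a j *\<^sub>R E j + b j *\<^sub>R F j)
       + ?A (\<Sum>j\<in>UNIV. (- b j) *\<^sub>R E j + a j *\<^sub>R F j) (\<Sum>j\<in>UNIV. (- b j) *\<^sub>R E j + a j *\<^sub>R F j)"
      unfolding levi_def using 1 2 by metis
    then show ?thesis unfolding bil by (simp add: sum.distrib[symmetric]) (intro sum.cong refl, simp add: algebra_simps)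
  qed
  have R: "Re (complex_hessian f x $ j $ k * w $ j * cnj (w $ k)) =
     ((a j * a k + b j * b k) * (?A (E j) (E k) + ?A (F j) (F k)) + (a j * b k - b j * a k) * (?A (E j) (F k) - ?A (F j) (E k))) / 4" for j k
    unfolding complex_hessian_entry[OF assms] E_def F_def a_def b_def by (simp add: field_simps)
  have I: "(\<Sum>j\<in>UNIV. \<Sum>k\<in>UNIV. Im (complex_hessian f x $ j $ k * w $ j * cnj (w $ k))) = 0"
  proof -
    define g where "g j k = Im (complex_hessian f x $ j $ k * w $ j * cnj (w $ k))" for j k
    have anti: "g j k = - g k j" for j k
      unfolding g_def complex_hessian_entry[OF assms] using sym by (simp add: field_simps)
    have "(\<Sum>j\<in>UNIV. \<Sum>k\<in>UNIV. g j k) = (\<Sum>j\<in>UNIV. \<Sum>k\<in>UNIV. - g k j)"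
      by (intro sum.cong refl) (rule anti)
    then have "(\<Sum>j\<in>UNIV. \<Sum>k\<in>UNIV. g j k) = - (\<Sum>j\<in>UNIV. \<Sum>k\<in>UNIV. g k j)"
      by (simp only: sum_negf)
    moreover have "(\<Sum>j\<in>UNIV. \<Sum>k\<in>UNIV. g k j) = (\<Sum>j\<in>UNIV. \<Sum>k\<in>UNIV. g j k)" by (rule sum.swap)
    ultimately show ?thesis by (simp add: g_def)
  qed
  show ?thesis
  proof (rule complex_eqI)
    show "Re (\<Sum>j\<in>UNIV. \<Sum>k\<in>UNIV. complex_hessian f x $ j $ k * w $ j * cnj (w $ k)) = Re (of_real (levi vecJ f x w / 4))"
      unfolding Re_sum R L Re_complex_of_real by (simp only: sum_divide_distrib)
    show "Im (\<Sum>j\<in>UNIV. \<Sum>k\<in>UNIV. complex_hessian f x $ j $ k * w $ j * cnj (w $ k)) = Im (of_real (levi vecJ f x w / 4))"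
      unfolding Im_sum I by simp
  qed
qed

lemma positive_definite_iff_levi:
  fixes f :: "complex^'N::finite \<Rightarrow> real"
  assumes "open S" "Ck_on 2 f S" "x \<in> S"
  shows "positive_definite (complex_hessian f x) \<longleftrightarrow> (\<forall>w. w \<noteq> 0 \<longrightarrow> 0 < levi vecJ f x w)"
  unfolding positive_definite_def complex_hessian_form[OF assms] by (simp add: Let_def)

lemma bounded_linear_split_coords: "bounded_linear (split_coords :: complex^('n::finite + 'm::finite) \<Rightarrow> _)"
proof -
  have "linear (split_coords :: complex^('n + 'm) \<Rightarrow> _)"
    by (rule linearI) (simp_all add: vec_eq_iff split_coords_def)
  then show ?thesis by (rule linear_conv_bounded_linear[THEN iffD1])
qed

lemma surj_split_coords: "\<exists>w. split_coords w = p"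
proof (cases p)
  case (Pair a b)
  have "split_coords (\<chi> i. case i of Inl i \<Rightarrow> a $ i | Inr j \<Rightarrow> b $ j) = p"
    by (simp add: split_coords_def Pair vec_eq_iff)
  then show ?thesis ..
qed

lemma split_coords_cmult: "split_coords (c *s w) = cscale c (split_coords w)"
  by (simp add: split_coords_def cscale_def vec_eq_iff)

lemma D2_linear_compose:
  assumes S: "open S" and f: "Ck_on 2 f S" and L: "bounded_linear L" and x: "L x \<in> S"
  shows "D2 (f \<circ> L) x u v = D2 f (L x) (L u) (L v)"
proof -
  have o: "open (L -` S)" using S L by (simp add: continuous_open_vimage linear_continuous_at)
  have "frechet_derivative (f \<circ> L) (at y) v = frechet_derivative f (at (L y)) (L v)" if "y \<in> L -` S" for y
  proof -
    have "((f \<circ> L) has_derivative (\<lambda>v. frechet_derivative f (at (L y)) (L v))) (at y)"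
      unfolding comp_def using that
      by (intro has_derivative_compose[OF bounded_linear_imp_has_derivative[OF L] Ck2_derivative[OF f]]) auto
    from fun_cong[OF frechet_derivative_at[OF this, symmetric]] show ?thesis .
  qed
  then have "D2 (f \<circ> L) x u v = frechet_derivative (\<lambda>y. frechet_derivative f (at (L y)) (L v)) (at x) u"
    unfolding D2_def by (subst frechet_derivative_cong_open[OF o]) (use x in auto)
  also have "((\<lambda>y. frechet_derivative f (at (L y)) (L v)) has_derivative (\<lambda>u. D2 f (L x) (L u) (L v))) (at x)"
    by (rule has_derivative_compose[OF bounded_linear_imp_has_derivative[OF L] Ck2_derivative2[OF f x]])
  from fun_cong[OF frechet_derivative_at[OF this, symmetric]]
  have "frechet_derivative (\<lambda>y. frechet_derivative f (at (L y)) (L v)) (at x) u = D2 f (L x) (L u) (L v)" .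
  finally show ?thesis .
qed

lemma strictly_psh_prod_levi:
  fixes \<rho> :: "(complex^'n::finite) \<times> (complex^'m::finite) \<Rightarrow> real"
  assumes "open N" "Ck_on 2 \<rho> N" "strictly_psh_prod_on \<rho> W" "W \<subseteq> N" "x \<in> W" "v \<noteq> 0"
  shows "0 < levi (cscale \<i>) \<rho> x v"
proof -
  obtain y where y: "split_coords y = x" using surj_split_coords by blast
  obtain w where w: "split_coords w = v" using surj_split_coords by blast
  have w0: "w \<noteq> 0" using w assms(6) linear_0[OF bounded_linear.linear[OF bounded_linear_split_coords]] by metis
  have "positive_definite (complex_hessian (\<rho> \<circ> split_coords) y)" "open (split_coords -` W)" "Ck_on 2 (\<rho> \<circ> split_coords) (split_coords -` W)"
    using assms(3,5) y by (auto simp: strictly_psh_prod_on_def strictly_psh_on_def)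
  then have "0 < levi vecJ (\<rho> \<circ> split_coords) y w"
    using positive_definite_iff_levi[of "split_coords -` W" "\<rho> \<circ> split_coords" y] w0 y assms(5) by auto
  also have "levi vecJ (\<rho> \<circ> split_coords) y w = levi (cscale \<i>) \<rho> x v"
    unfolding levi_def using D2_linear_compose[OF assms(1,2) bounded_linear_split_coords, of y] y w assms(4,5)
    by (auto simp: split_coords_cmult)
  finally show ?thesis .
qed

text \<open>The sub-mean value inequality on small circles in the complex line through x in
  direction v is the case c = 0 of \<open>laplace_lower_bound\<close>; the Laplacian there is the
  Levi form.\<close>

lemma psh_prod_levi:
  fixes \<phi> :: "(complex^'n::finite) \<times> (complex^'m::finite) \<Rightarrow> real"
  assumes N: "open N" and f: "Ck_on 2 \<phi> N" and psh: "psh_prod_on \<phi> N" and x: "x \<in> N"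
  shows "0 \<le> levi (cscale \<i>) \<phi> x v"
proof -
  obtain y where y: "split_coords y = x" using surj_split_coords by blast
  obtain w where w: "split_coords w = v" using surj_split_coords by blast
  let ?g = "\<lambda>z. x + cscale z v"
  have hc: "holo_curve (cscale \<i>) S ?g (\<lambda>_. v)" for S
    using holo_curve_affine[OF bounded_linear_cscale] by (subst cscale_Re_Im)
  define S where "S = ?g -` N"
  have "continuous_on UNIV ?g" unfolding cscale_def by (intro continuous_intros continuous_on_Pair) (simp_all add: vector_scalar_mult_def continuous_intros)
  then have S: "open S" unfolding S_def using N by (simp add: open_vimage)
  have "0 \<in> S" using x by (simp add: S_def cscale_def zero_prod_def[symmetric] vec_eq_iff prod_eq_iff)
  then obtain r0 where r0: "r0 > 0" "cball 0 r0 \<subseteq> S" using S open_contains_cball by blast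
  note lc = levi_compose[OF S N f hc _ bounded_linear_cscale cscale_J]
  have "2 * 0 / pi \<le> laplace (\<lambda>z. \<phi> (?g z)) 0"
  proof (rule laplace_lower_bound[OF S lc(1) \<open>0 \<in> S\<close> r0(1)])
    fix r assume r: "0 < r" "r < r0"
    \<comment> \<open>\<open>psh_on\<close> speaks of unit discs, so the radius r is absorbed into
      the direction vector.\<close>
    have "y + \<zeta> *s (of_real r *s w) \<in> split_coords -` N" if "cmod \<zeta> \<le> 1" for \<zeta>
    proof -
      have "\<zeta> * of_real r \<in> cball 0 r0" using that r by (simp add: norm_mult) (smt (verit) mult_left_le_one_le norm_ge_zero)
      then have "?g (\<zeta> * of_real r) \<in> N" using r0 by (auto simp: S_def)
      moreover have "split_coords (y + \<zeta> *s (of_real r *s w)) = ?g (\<zeta> * of_real r)"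
        using y w linear_add[OF bounded_linear.linear[OF bounded_linear_split_coords], of y "\<zeta> *s (of_real r *s w)"]
        by (simp add: split_coords_cmult cscale_def vec_eq_iff prod_eq_iff mult.assoc)
      ultimately show ?thesis by simp
    qed
    then have "(\<phi> \<circ> split_coords) y \<le> integral {0..2*pi} (\<lambda>\<theta>. (\<phi> \<circ> split_coords) (y + cis \<theta> *s (of_real r *s w))) / (2*pi)"
      using psh unfolding psh_prod_on_def psh_on_def by blast
    moreover have "split_coords (y + cis \<theta> *s (of_real r *s w)) = ?g (0 + of_real r * cis \<theta>)" for \<theta>
      using y w linear_add[OF bounded_linear.linear[OF bounded_linear_split_coords], of y "cis \<theta> *s (of_real r *s w)"]
      by (simp add: split_coords_cmult cscale_def vec_eq_iff prod_eq_iff mult.assoc mult.left_commute)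
    moreover have "?g 0 = x" by (simp add: cscale_def vec_eq_iff prod_eq_iff)
    ultimately show "2 * pi * \<phi> (?g 0) + 0 * r^2 \<le> integral {0..2*pi} (\<lambda>\<theta>. \<phi> (?g (0 + of_real r * cis \<theta>)))"
      using y by (simp add: field_simps)
  qed (auto simp: S_def)
  moreover have "?g 0 = x" by (simp add: cscale_def vec_eq_iff prod_eq_iff)
  ultimately show ?thesis using lc(2)[OF _ \<open>0 \<in> S\<close>] by (simp add: S_def)
qed

section \<open>A Prekopa--Leindler inequality for geometric means\<close>

lemma (in prob_space) integrable_ln_bounded:
  assumes X: "X \<in> borel_measurable M" and a: "0 < (a::real)" "\<And>x. x \<in> space M \<Longrightarrow> a \<le> X x \<and> X x \<le> b"
  shows "integrable M (\<lambda>x. ln (X x))"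
proof (rule integrable_const_bound[where B="max \<bar>ln a\<bar> \<bar>ln b\<bar>"])
  show "AE x in M. norm (ln (X x)) \<le> max \<bar>ln a\<bar> \<bar>ln b\<bar>"
  proof (rule AE_I2)
    fix x assume "x \<in> space M"
    with a have "a \<le> X x" "X x \<le> b" "0 < a" by auto
    then have "ln a \<le> ln (X x)" "ln (X x) \<le> ln b" by auto
    then show "norm (ln (X x)) \<le> max \<bar>ln a\<bar> \<bar>ln b\<bar>" by auto
  qed
qed (use X in measurable)

text \<open>With \<open>S t\<close> the essential supremum of \<open>f t\<close>, the sets \<open>{y. l * S t < f t y}\<close> are intervals. A convex
  combination of their endpoints is an admissible selection \<open>y\<close>, so the superlevel set of \<open>f0\<close> at
  \<open>l\<close> times the geometric mean of \<open>S\<close> has at least the mean of their lengths; then integrate over \<open>l\<close>.\<close>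
lemma mean_prekopa_1D:
  fixes M :: "'t measure" and f :: "'t \<Rightarrow> real \<Rightarrow> real" and f0 :: "real \<Rightarrow> ennreal"
  assumes M: "prob_space M"
   and mf: "(\<lambda>p. f (fst p) (snd p)) \<in> borel_measurable (M \<Otimes>\<^sub>M borel)"
   and f0m[measurable]: "f0 \<in> borel_measurable borel"
   and bnd: "\<And>t y. 0 \<le> f t y" "\<And>t y. f t y \<le> C"
   and supp: "\<And>t y. f t y \<noteq> 0 \<Longrightarrow> \<bar>y\<bar> \<le> R"
   and conv: "\<And>t a. t \<in> space M \<Longrightarrow> 0 \<le> a \<Longrightarrow> convex {y. a < f t y}"
   and e: "0 < e" "\<And>t. t \<in> space M \<Longrightarrow> e \<le> (LINT y|lborel. f t y)"
   and H: "\<And>y e'. y \<in> borel_measurable M \<Longrightarrow> 0 < e' \<Longrightarrow> (\<And>t. t \<in> space M \<Longrightarrow> e' \<le> f t (y t))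
      \<Longrightarrow> ennreal (exp (LINT t|M. ln (f t (y t)))) \<le> f0 (LINT t|M. y t)"
  shows "ennreal (exp (LINT t|M. ln (LINT y|lborel. f t y))) \<le> (\<integral>\<^sup>+y. f0 y \<partial>lborel)"
proof -
  interpret M: prob_space M by fact
  interpret P: pair_sigma_finite lborel M ..
  have mf'[measurable (raw)]: "(\<lambda>x. f (g x) (h x)) \<in> borel_measurable N"
    if "g \<in> measurable N M" "h \<in> borel_measurable N" for g h and N :: "'z measure"
    using measurable_compose[OF measurable_Pair[OF that] mf] by simp
  have mft[measurable]: "f t \<in> borel_measurable borel" if "t \<in> space M" for t
    using mf'[of "\<lambda>_. t" borel "\<lambda>x. x"] that by simp
  define F where "F t = (LINT y|lborel. f t y)" for t
  have Fm[measurable]: "F \<in> borel_measurable M" unfolding F_def by measurable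
  obtain t0 where t0: "t0 \<in> space M" using M.not_empty by blast
  have R: "0 < R"
  proof (rule ccontr)
    assume "\<not> 0 < R"
    then have "f t0 y = 0" if "y \<noteq> 0" for y using supp[of t0 y] that by force
    then have "AE y in lborel. f t0 y = 0"
      using AE_lborel_singleton[of "0::real"] by (auto elim!: eventually_mono)
    then have "F t0 = 0" unfolding F_def by (rule integral_eq_zero_AE)
    then show False using e t0 F_def by fastforce
  qed
  have intf: "integrable lborel (f t)" if "t \<in> space M" for t
  proof (rule integrableI_bounded_set[where A="{-R..R}" and B=C])
    show "AE x in lborel. x \<in> {- R..R} \<longrightarrow> norm (f t x) \<le> C" using bnd by auto
    show "AE x in lborel. x \<notin> {- R..R} \<longrightarrow> f t x = 0" using supp[of t] by (intro AE_I2) force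
  qed (use that in \<open>auto simp: emeasure_lborel_Icc_eq\<close>)
  \<comment> \<open>The length of a superlevel set, written as an integral so that its measurability
    in t and a follows from that of parameter integrals.\<close>
  define em where "em t a = (\<integral>\<^sup>+y. (if a < f t y then 1 else 0) \<partial>lborel)" for t a
  have emeq: "em t a = emeasure lborel {y. a < f t y}" if "t \<in> space M" for t a
  proof -
    have "em t a = (\<integral>\<^sup>+y. indicator {y. a < f t y} y \<partial>lborel)"
      unfolding em_def by (intro nn_integral_cong) auto
    also have "\<dots> = emeasure lborel {y. a < f t y}"
      using that by (intro nn_integral_indicator) measurable
    finally show ?thesis .
  qed
  have emm[measurable (raw)]: "(\<lambda>x. em (g x) (h x)) \<in> borel_measurable N" 
    if [measurable]: "g \<in> measurable N M" "h \<in> borel_measurable N" for g h and N :: "'z measure"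
    unfolding em_def by measurable
  \<comment> \<open>Levels exceeded on a set of positive length. Their supremum is the essential
    supremum, and its measurability in t reduces to rational levels.\<close>
  define Q where "Q t = {a. 0 \<le> a \<and> 0 < em t a}" for t
  define S where "S t = Sup (Q t)" for t
  have anti: "em t b \<le> em t a" if "a \<le> b" for t a b
    unfolding em_def using that by (intro nn_integral_mono) auto
  have bddA: "{y. a < f t y} \<subseteq> {-R..R}" if "0 \<le> a" for t a
  proof
    fix y assume "y \<in> {y. a < f t y}"
    then show "y \<in> {-R..R}" using supp[of t y] that by auto
  qed
  have Q0: "0 \<in> Q t" if t: "t \<in> space M" for t
  proof (rule ccontr)
    assume "0 \<notin> Q t"
    then have "em t 0 = 0" by (auto simp: Q_def)
    then have "AE y in lborel. (if 0 < f t y then 1 else 0) = (0::ennreal)"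
      unfolding em_def using t by (subst (asm) nn_integral_0_iff_AE) auto
    then have "AE y in lborel. f t y = 0"
      using bnd(1)[of t] by (auto elim!: eventually_mono split: if_splits simp: not_less dest: antisym)
    then have "F t = 0" unfolding F_def by (rule integral_eq_zero_AE)
    then show False using e t F_def by fastforce
  qed
  have QC: "a \<le> C" if "a \<in> Q t" for a t
  proof (rule ccontr)
    assume "\<not> a \<le> C"
    then have "\<And>y. \<not> a < f t y" using bnd(2)[of t] by (meson less_trans not_le order.strict_trans1)
    then have "em t a = 0" unfolding em_def by simp
    then show False using that by (auto simp: Q_def)
  qed
  have bddQ: "bdd_above (Q t)" for t by (rule bdd_aboveI[of _ C]) (rule QC)
  have S_le: "S t \<le> C" if "t \<in> space M" for t
    unfolding S_def using Q0[OF that] QC by (intro cSup_least) auto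
  have Q_lt: "q \<in> Q t" if t: "t \<in> space M" and "0 \<le> q" "q < S t" for q t
  proof -
    obtain a where "a \<in> Q t" "q < a" using less_cSup_iff[of "Q t" q] Q0[OF t] bddQ[of t] \<open>q < S t\<close> unfolding S_def by blast
    then show ?thesis using that anti[of q a t] by (auto simp: Q_def order.strict_trans2)
  qed
  have S_ub: "q \<le> S t" if "q \<in> Q t" for q t
    unfolding S_def using cSup_upper[OF that bddQ] .
  have emS: "em t (S t) = 0" if t: "t \<in> space M" for t
  proof (rule ccontr)
    assume *: "em t (S t) \<noteq> 0"
    have "{y. S t < f t y} = (\<Union>n. {y. S t + 1 / Suc n < f t y})"
    proof safe
      fix y assume "S t < f t y"
      then obtain n where "1 / Suc n < f t y - S t"
        using reals_Archimedean[of "f t y - S t"] by (auto simp: divide_inverse)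
      then show "y \<in> (\<Union>n. {y. S t + 1 / Suc n < f t y})" by (auto intro!: exI[of _ n])
    next
      fix y n assume "S t + 1 / real (Suc n) < f t y"
      moreover have "0 < 1 / real (Suc n)" by simp
      ultimately show "S t < f t y" by linarith
    qed
    moreover have "emeasure lborel (\<Union>n. {y. S t + 1 / Suc n < f t y}) = 0"
    proof (rule emeasure_UN_eq_0)
      fix n
      have "S t + 1 / Suc n \<notin> Q t" using S_ub[of "S t + 1 / Suc n" t] by auto
      moreover have "0 \<le> S t" using S_ub[OF Q0[OF t]] .
      ultimately show "emeasure lborel {y. S t + 1 / real (Suc n) < f t y} = 0"
        using emeq[OF t, of "S t + 1 / Suc n"] by (auto simp: Q_def)
    qed (use t in auto)
    ultimately show False using * emeq[OF t] by simp
  qed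
  have AE_S: "AE y in lborel. f t y \<le> S t" if t: "t \<in> space M" for t
  proof -
    have "AE y in lborel. (if S t < f t y then 1 else 0) = (0::ennreal)"
      using emS[OF t] t unfolding em_def by (subst (asm) nn_integral_0_iff_AE) auto
    then show ?thesis by (auto elim!: eventually_mono split: if_splits)
  qed
  \<comment> \<open>A mass of at least e is carried by an interval of length 2 R on which
    \<open>f t\<close> is at most \<open>S t\<close> almost everywhere.\<close>
  have S_lb: "e / (2*R) \<le> S t" if t: "t \<in> space M" for t
  proof -
    have "e \<le> F t" using e t F_def by auto
    also have "F t \<le> (LINT y|lborel. S t * indicator {-R..R} y)" unfolding F_def
    proof (rule integral_mono_AE)
      show "AE y in lborel. f t y \<le> S t * indicator {- R..R} y"
      proof (use AE_S[OF t] in eventually_elim)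
        fix y assume "f t y \<le> S t"
        then show "f t y \<le> S t * indicator {- R..R} y"
          using supp[of t y] by (cases "f t y = 0") (auto simp: indicator_def)
      qed
    qed (use intf[OF t] in \<open>auto intro!: integrable_mult_right integrable_real_indicator simp: emeasure_lborel_Icc_eq\<close>)
    also have "\<dots> = S t * (2*R)" using R by simp
    finally show ?thesis using R by (simp add: field_simps)
  qed
  have S_pos: "0 < S t" if t: "t \<in> space M" for t
    using S_lb[OF t] e R by (meson divide_pos_pos less_le_trans mult_pos_pos zero_less_numeral)
  have Sm[measurable]: "S \<in> borel_measurable M"
  proof (subst borel_measurable_iff_greater, rule allI)
    fix a
    have "{w \<in> space M. a < S w} = (\<Union>q\<in>{q\<in>\<rat>. a < q \<and> 0 \<le> q}. {w \<in> space M. 0 < em w q})"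
    proof safe
      fix t assume t: "t \<in> space M" "a < S t"
      then have "max a 0 < S t" using S_pos by auto
      then obtain q where "q \<in> \<rat>" "max a 0 < q" "q < S t" using Rats_dense_in_real by blast
      then show "t \<in> (\<Union>q\<in>{q\<in>\<rat>. a < q \<and> 0 \<le> q}. {w \<in> space M. 0 < em w q})"
        using Q_lt[OF t(1), of q] t by (auto simp: Q_def intro!: bexI[of _ q])
    next
      fix t q assume "t \<in> space M" "a < q" "0 \<le> q" "0 < em t q"
      then show "a < S t" using S_ub[of q t] by (auto simp: Q_def)
    qed
    also have "\<dots> \<in> sets M"
      by (intro sets.countable_UN'') (auto intro: countable_subset[OF _ countable_rat])
    finally show "{w \<in> space M. a < S w} \<in> sets M" .
  qed
  have lnS: "integrable M (\<lambda>t. ln (S t))"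
    by (rule M.integrable_ln_bounded[of _ "e/(2*R)" C]) (use S_le S_lb e R in auto)
  define Sb where "Sb = exp (LINT t|M. ln (S t))"
  have Sb: "Sb > 0" by (simp add: Sb_def)
  \<comment> \<open>One-dimensional Brunn-Minkowski at a common relative level l: the mean of the
    lengths of the intervals bounds the length of a superlevel set of \<open>f0\<close> from
    below.\<close>
  have level: "ennreal Sb * (\<integral>\<^sup>+t. em t (l * S t) \<partial>M) \<le> ennreal Sb * emeasure lborel {p. ennreal (l * Sb) \<le> f0 p}"
    if l: "0 < l" "l < 1" for l
  proof -
    define A where "A t = {y. l * S t < f t y}" for t
    define lo where "lo t = Inf (A t)" for t
    define hi where "hi t = Sup (A t)" for t
    have lS: "0 < l * S t" "l * S t < S t" if "t \<in> space M" for t using l S_pos[OF that] by auto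
    have A_pos: "0 < emeasure lborel (A t)" if t: "t \<in> space M" for t
      using Q_lt[OF t, of "l * S t"] lS[OF t] emeq[OF t] by (auto simp: Q_def A_def)
    have A_sub: "A t \<subseteq> {-R..R}" if t: "t \<in> space M" for t
      using bddA lS[OF t] by (simp add: A_def)
    have A_ne: "A t \<noteq> {}" if t: "t \<in> space M" for t using A_pos[OF t] by auto
    have A_bdd: "bdd_above (A t)" "bdd_below (A t)" if t: "t \<in> space M" for t
      using A_sub[OF t] by (auto intro: bdd_above_mono bdd_below_mono)
    have A_cl: "A t \<subseteq> {lo t..hi t}" if t: "t \<in> space M" for t
      using A_bdd[OF t] by (auto simp: lo_def hi_def intro: cInf_lower cSup_upper)
    have A_op: "{lo t<..<hi t} \<subseteq> A t" if t: "t \<in> space M" for t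
    proof
      fix y assume y: "y \<in> {lo t<..<hi t}"
      obtain p where p: "p \<in> A t" "p < y" using y cInf_less_iff[OF A_ne[OF t] A_bdd(2)[OF t]] by (auto simp: lo_def)
      obtain q where q: "q \<in> A t" "y < q" using y less_cSup_iff[OF A_ne[OF t] A_bdd(1)[OF t]] by (auto simp: hi_def)
      have "convex (A t)" unfolding A_def using conv t lS[OF t] by auto
      then have "is_interval (A t)" by (simp add: is_interval_convex_1)
      then show "y \<in> A t" using p q by (meson less_imp_le mem_is_interval_1_I)
    qed
    have em_le: "em t (l * S t) \<le> ennreal (hi t - lo t)" if t: "t \<in> space M" for t
    proof -
      have "lo t \<le> hi t" using A_ne[OF t] A_cl[OF t] by fastforce
      have "em t (l * S t) = emeasure lborel (A t)" using emeq[OF t] by (simp add: A_def)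
      also have "\<dots> \<le> emeasure lborel {lo t..hi t}" by (intro emeasure_mono A_cl[OF t]) simp
      also have "\<dots> = ennreal (hi t - lo t)" using \<open>lo t \<le> hi t\<close> by simp
      finally show ?thesis .
    qed
    have lohi: "lo t < hi t" if t: "t \<in> space M" for t
    proof (rule ccontr)
      assume "\<not> lo t < hi t"
      then have "em t (l * S t) \<le> 0" using em_le[OF t] by (simp add: ennreal_neg)
      then show False using A_pos[OF t] emeq[OF t] by (simp add: A_def)
    qed
    have lohiR: "- R \<le> lo t" "hi t \<le> R" if t: "t \<in> space M" for t
      using A_sub[OF t] A_ne[OF t] by (auto simp: lo_def hi_def intro!: cInf_greatest cSup_least)
    have lom[measurable]: "lo \<in> borel_measurable M"
    proof (subst borel_measurable_iff_less, rule allI)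
      fix a
      have "{w \<in> space M. lo w < a} = (\<Union>q\<in>{q\<in>\<rat>. q < a}. {w \<in> space M. l * S w < f w q})"
      proof safe
        fix t assume t: "t \<in> space M" "lo t < a"
        then have "lo t < min a (hi t)" using lohi by auto
        then obtain q where q: "q \<in> \<rat>" "lo t < q" "q < min a (hi t)" using Rats_dense_in_real by blast
        then have "q \<in> A t" using A_op[OF t(1)] by auto
        then show "t \<in> (\<Union>q\<in>{q\<in>\<rat>. q < a}. {w \<in> space M. l * S w < f w q})"
          using q t by (auto simp: A_def intro!: bexI[of _ q])
      next
        fix t q assume t: "t \<in> space M" "q < a" "l * S t < f t q"
        then have "q \<in> A t" by (simp add: A_def)
        then show "lo t < a" using A_cl[OF t(1)] t by auto
      qed
      also have "\<dots> \<in> sets M"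
        by (intro sets.countable_UN'') (auto intro: countable_subset[OF _ countable_rat])
      finally show "{w \<in> space M. lo w < a} \<in> sets M" .
    qed
    have him[measurable]: "hi \<in> borel_measurable M"
    proof (subst borel_measurable_iff_greater, rule allI)
      fix a
      have "{w \<in> space M. a < hi w} = (\<Union>q\<in>{q\<in>\<rat>. a < q}. {w \<in> space M. l * S w < f w q})"
      proof safe
        fix t assume t: "t \<in> space M" "a < hi t"
        then have "max a (lo t) < hi t" using lohi by auto
        then obtain q where q: "q \<in> \<rat>" "max a (lo t) < q" "q < hi t" using Rats_dense_in_real by blast
        then have "q \<in> A t" using A_op[OF t(1)] by auto
        then show "t \<in> (\<Union>q\<in>{q\<in>\<rat>. a < q}. {w \<in> space M. l * S w < f w q})"
          using q t by (auto simp: A_def intro!: bexI[of _ q])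
      next
        fix t q assume t: "t \<in> space M" "a < q" "l * S t < f t q"
        then have "q \<in> A t" by (simp add: A_def)
        then show "a < hi t" using A_cl[OF t(1)] t by auto
      qed
      also have "\<dots> \<in> sets M"
        by (intro sets.countable_UN'') (auto intro: countable_subset[OF _ countable_rat])
      finally show "{w \<in> space M. a < hi w} \<in> sets M" .
    qed
    have ilo: "integrable M lo" and ihi: "integrable M hi"
      using lohiR lohi by (auto intro!: M.integrable_const_bound[where B=R] AE_I2 simp: abs_le_iff, (smt (verit))+)
    define LO where "LO = (LINT t|M. lo t)"
    define HI where "HI = (LINT t|M. hi t)"
    have f0ge: "ennreal (l * Sb) \<le> f0 p" if p: "LO < p" "p < HI" for p
    proof -
      \<comment> \<open>p divides [LO, HI] in the ratio k. Using this one ratio in every interval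
        from \<open>lo t\<close> to \<open>hi t\<close> gives a measurable selection whose mean is
        p.\<close>
      define k where "k = (p - LO) / (HI - LO)"
      have k: "0 < k" "k < 1" using p by (auto simp: k_def field_simps)
      define y where "y t = (1 - k) * lo t + k * hi t" for t
      have ym[measurable]: "y \<in> borel_measurable M" unfolding y_def by measurable
      have yA: "y t \<in> A t" if t: "t \<in> space M" for t
      proof -
        have "lo t < y t" "y t < hi t" 
          using k lohi[OF t] mult_strict_left_mono[OF lohi[OF t] k(1)]
            mult_strict_left_mono[OF lohi[OF t], of "1-k"] by (auto simp: y_def algebra_simps)
        then show ?thesis using A_op[OF t] by auto
      qed
      have ge: "l * (e / (2*R)) \<le> f t (y t)" if t: "t \<in> space M" for t
        using yA[OF t] S_lb[OF t] l mult_left_mono[OF S_lb[OF t], of l] by (auto simp: A_def)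
      have le0: "0 < l * (e / (2*R))" using l e R by auto
      have ifl: "integrable M (\<lambda>t. ln (f t (y t)))"
        by (rule M.integrable_ln_bounded[OF _ le0, of _ C]) (use ge bnd(2) in auto)
      have "ennreal (l * Sb) = ennreal (exp (LINT t|M. ln l + ln (S t)))"
        using l lnS by (simp add: Sb_def exp_add M.prob_space)
      also have "\<dots> \<le> ennreal (exp (LINT t|M. ln (f t (y t))))"
      proof (intro ennreal_leI, subst exp_le_cancel_iff, rule integral_mono)
        fix t assume t: "t \<in> space M"
        have "ln (l * S t) \<le> ln (f t (y t))" using yA[OF t] lS[OF t] by (auto simp: A_def)
        then show "ln l + ln (S t) \<le> ln (f t (y t))" using l S_pos[OF t] by (simp add: ln_mult)
      qed (use lnS ifl in auto)
      also have "\<dots> \<le> f0 (LINT t|M. y t)"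
        by (rule H[OF ym le0 ge])
      also have "(LINT t|M. y t) = (1 - k) * LO + k * HI"
        unfolding y_def LO_def HI_def using ilo ihi by simp
      also have "\<dots> = LO + k * (HI - LO)" by (simp add: algebra_simps)
      also have "\<dots> = p" using p by (simp add: k_def)
      finally show ?thesis .
    qed
    have LOHI: "LO \<le> HI" unfolding LO_def HI_def using ilo ihi lohi by (intro integral_mono) (auto intro: less_imp_le)
    have "(\<integral>\<^sup>+t. em t (l * S t) \<partial>M) \<le> (\<integral>\<^sup>+t. ennreal (hi t - lo t) \<partial>M)"
      by (intro nn_integral_mono em_le)
    also have "\<dots> = ennreal (LINT t|M. hi t - lo t)"
      using ilo ihi lohi by (intro nn_integral_eq_integral) (auto intro!: AE_I2 less_imp_le)
    also have "\<dots> = ennreal (HI - LO)" using ilo ihi by (simp add: HI_def LO_def)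
    also have "\<dots> = emeasure lborel {LO<..<HI}" using LOHI by simp
    also have "\<dots> \<le> emeasure lborel {p. ennreal (l * Sb) \<le> f0 p}"
      by (intro emeasure_mono) (use f0ge in auto)
    finally show ?thesis by (rule mult_left_mono) simp
  qed
  have Fpos: "0 < F t" "e \<le> F t" if "t \<in> space M" for t using e that F_def by (auto intro: less_le_trans)
  \<comment> \<open>Layer-cake formula for f / S. Dividing by the essential supremum makes (0, 1)
    the range of levels for every t.\<close>
  have FS: "ennreal (F t / S t) \<le> (\<integral>\<^sup>+l. (if 0 < l \<and> l < 1 then em t (l * S t) else 0) \<partial>lborel)" if t: "t \<in> space M" for t
  proof -
    have [measurable]: "f t \<in> borel_measurable borel" by (rule mft[OF t])
    have "ennreal (F t / S t) = (\<integral>\<^sup>+y. ennreal (f t y / S t) \<partial>lborel)"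
      using intf[OF t] bnd(1) S_pos[OF t] unfolding F_def
      by (subst nn_integral_eq_integral) (auto simp: less_imp_le)
    also have "\<dots> \<le> (\<integral>\<^sup>+y. (\<integral>\<^sup>+l. (if 0 < l \<and> l < 1 \<and> l * S t < f t y then 1 else 0) \<partial>lborel) \<partial>lborel)"
    proof (rule nn_integral_mono_AE, use AE_S[OF t] in eventually_elim)
      fix y assume y: "f t y \<le> S t"
      have "ennreal (f t y / S t) = emeasure lborel {0<..<f t y / S t}"
        using bnd(1) S_pos[OF t] by (simp add: less_imp_le)
      also have "\<dots> = (\<integral>\<^sup>+l. indicator {0<..<f t y / S t} l \<partial>lborel)" by simp
      also have "\<dots> \<le> (\<integral>\<^sup>+l. (if 0 < l \<and> l < 1 \<and> l * S t < f t y then 1 else 0) \<partial>lborel)"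
      proof (rule nn_integral_mono)
        fix l :: real
        have "l < 1 \<and> l * S t < f t y" if "l < f t y / S t"
          using that y S_pos[OF t] by (auto simp: field_simps) (smt (verit) mult_le_cancel_right1)
        then show "indicator {0<..<f t y / S t} l \<le> (if 0 < l \<and> l < 1 \<and> l * S t < f t y then 1 else (0::ennreal))"
          by (auto split: split_indicator)
      qed
      finally show "ennreal (f t y / S t) \<le> (\<integral>\<^sup>+l. (if 0 < l \<and> l < 1 \<and> l * S t < f t y then 1 else 0) \<partial>lborel)" .
    qed
    also have "\<dots> = (\<integral>\<^sup>+l. (\<integral>\<^sup>+y. (if 0 < l \<and> l < 1 \<and> l * S t < f t y then 1 else 0) \<partial>lborel) \<partial>lborel)"
      by (rule lborel_pair.Fubini') measurable
    also have "\<dots> = (\<integral>\<^sup>+l. (if 0 < l \<and> l < 1 then em t (l * S t) else 0) \<partial>lborel)"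
      by (intro nn_integral_cong) (auto simp: em_def)
    finally show ?thesis .
  qed
  have SC: "S t \<le> C" "0 < C" if "t \<in> space M" for t using S_le[OF that] S_pos[OF that] by auto
  have FC: "F t \<le> 2 * R * C" if t: "t \<in> space M" for t
  proof -
    have "F t \<le> (LINT y|lborel. C * indicator {-R..R} y)" unfolding F_def
    proof (rule integral_mono)
      show "f t y \<le> C * indicator {- R..R} y" for y
        using bnd(2)[of t y] supp[of t y] SC(2)[OF t] by (cases "f t y = 0") (auto simp: indicator_def)
    qed (use intf[OF t] in \<open>auto intro!: integrable_mult_right integrable_real_indicator simp: emeasure_lborel_Icc_eq\<close>)
    also have "\<dots> = 2 * R * C" using R by simp
    finally show ?thesis .
  qed
  have lnF: "integrable M (\<lambda>t. ln (F t))"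
    by (rule M.integrable_ln_bounded[of _ e "2*R*C"]) (use FC Fpos e in auto)
  have lnFS: "ln (F t / S t) = ln (F t) - ln (S t)" if "t \<in> space M" for t
    using Fpos(1)[OF that] S_pos[OF that] by (simp add: ln_div)
  \<comment> \<open>The geometric mean \<open>Sb\<close> of \<open>S\<close> is split off before
    Jensen's inequality, so that only the normalized masses F / S pass to the arithmetic mean. That
    mean is linear in the interval lengths, which is what \<open>level\<close> controls.\<close>
  have "exp (LINT t|M. ln (F t)) = Sb * exp (LINT t|M. ln (F t / S t))"
  proof -
    have "(LINT t|M. ln (F t / S t)) = (LINT t|M. ln (F t) - ln (S t))"
      by (intro Bochner_Integration.integral_cong) (use lnFS in auto)
    then show ?thesis using lnF lnS by (simp add: Sb_def exp_diff)
  qed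
  moreover have iFS: "integrable M (\<lambda>t. F t / S t)"
  proof (rule M.integrable_const_bound[where B="2*R*C / (e/(2*R))"])
    show "AE t in M. norm (F t / S t) \<le> 2 * R * C / (e / (2 * R))"
    proof (rule AE_I2)
      fix t assume t: "t \<in> space M"
      show "norm (F t / S t) \<le> 2 * R * C / (e / (2 * R))"
        using Fpos[OF t] S_pos[OF t] FC[OF t] S_lb[OF t] e R SC[OF t] by (auto simp del: divide_divide_eq_right intro!: frac_le)
    qed
  qed measurable
  moreover have "exp (LINT t|M. ln (F t / S t)) \<le> (LINT t|M. exp (ln (F t / S t)))"
  proof (rule M.jensens_inequality[where I=UNIV])
    have "integrable M (\<lambda>t. ln (F t) - ln (S t))" using lnF lnS by auto
    then show "integrable M (\<lambda>t. ln (F t / S t))"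
      by (rule Bochner_Integration.integrable_cong[THEN iffD1, rotated -1]) (use lnFS in auto)
    show "integrable M (\<lambda>t. exp (ln (F t / S t)))"
      by (rule Bochner_Integration.integrable_cong[THEN iffD1, rotated -1, OF iFS]) (use Fpos S_pos in auto)
    show "convex_on UNIV (exp :: real \<Rightarrow> real)" by (rule exp_convex)
  qed auto
  moreover have "(LINT t|M. exp (ln (F t / S t))) = (LINT t|M. F t / S t)"
    by (intro Bochner_Integration.integral_cong) (use Fpos S_pos in auto)
  ultimately have "exp (LINT t|M. ln (F t)) \<le> Sb * (LINT t|M. F t / S t)" using Sb by simp
  then have "ennreal (exp (LINT t|M. ln (F t))) \<le> ennreal (Sb * (LINT t|M. F t / S t))" by (rule ennreal_leI)
  also have "\<dots> = ennreal Sb * (\<integral>\<^sup>+t. ennreal (F t / S t) \<partial>M)"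
    using Sb iFS Fpos S_pos by (subst nn_integral_eq_integral)
      (auto simp: ennreal_mult less_imp_le intro!: AE_I2 integral_nonneg_AE)
  also have "\<dots> \<le> ennreal Sb * (\<integral>\<^sup>+t. (\<integral>\<^sup>+l. (if 0 < l \<and> l < 1 then em t (l * S t) else 0) \<partial>lborel) \<partial>M)"
    by (intro mult_left_mono nn_integral_mono FS) auto
  also have "\<dots> = ennreal Sb * (\<integral>\<^sup>+l. (\<integral>\<^sup>+t. (if 0 < l \<and> l < 1 then em t (l * S t) else 0) \<partial>M) \<partial>lborel)"
    by (subst P.Fubini') (auto simp: split_beta')
  also have "\<dots> = (\<integral>\<^sup>+l. ennreal Sb * (\<integral>\<^sup>+t. (if 0 < l \<and> l < 1 then em t (l * S t) else 0) \<partial>M) \<partial>lborel)"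
    by (rule nn_integral_cmult[symmetric]) measurable
  also have "\<dots> \<le> (\<integral>\<^sup>+l. (\<integral>\<^sup>+p. (if 0 < l \<and> l < 1 \<and> ennreal (l * Sb) \<le> f0 p then ennreal Sb else 0) \<partial>lborel) \<partial>lborel)"
  proof (rule nn_integral_mono)
    fix l :: real
    show "ennreal Sb * (\<integral>\<^sup>+t. (if 0 < l \<and> l < 1 then em t (l * S t) else 0) \<partial>M) \<le>
       (\<integral>\<^sup>+p. (if 0 < l \<and> l < 1 \<and> ennreal (l * Sb) \<le> f0 p then ennreal Sb else 0) \<partial>lborel)"
    proof (cases "0 < l \<and> l < 1")
      case True
      have "(\<integral>\<^sup>+p. (if ennreal (l * Sb) \<le> f0 p then ennreal Sb else 0) \<partial>lborel)
         = (\<integral>\<^sup>+p. ennreal Sb * indicator {p. ennreal (l * Sb) \<le> f0 p} p \<partial>lborel)"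
        by (intro nn_integral_cong) auto
      also have "\<dots> = ennreal Sb * emeasure lborel {p. ennreal (l * Sb) \<le> f0 p}"
        by (subst nn_integral_cmult_indicator) auto
      finally show ?thesis using True level[of l] by simp
    next
      case False
      then have "(\<lambda>t. if 0 < l \<and> l < 1 then em t (l * S t) else 0) = (\<lambda>_. 0)" by auto
      then show ?thesis by simp
    qed
  qed
  also have "\<dots> = (\<integral>\<^sup>+p. (\<integral>\<^sup>+l. (if 0 < l \<and> l < 1 \<and> ennreal (l * Sb) \<le> f0 p then ennreal Sb else 0) \<partial>lborel) \<partial>lborel)"
    by (rule lborel_pair.Fubini') measurable
  \<comment> \<open>Layer cake backwards: for fixed p with finite value, the admissible l fill at
    most the interval from 0 to f0 p / Sb.\<close>
  also have "\<dots> \<le> (\<integral>\<^sup>+p. f0 p \<partial>lborel)"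
  proof (rule nn_integral_mono)
    fix p
    show "(\<integral>\<^sup>+l. (if 0 < l \<and> l < 1 \<and> ennreal (l * Sb) \<le> f0 p then ennreal Sb else 0) \<partial>lborel) \<le> f0 p"
    proof (cases "f0 p")
      case (real v)
      have "(\<integral>\<^sup>+l. (if 0 < l \<and> l < 1 \<and> ennreal (l * Sb) \<le> f0 p then ennreal Sb else 0) \<partial>lborel)
        \<le> (\<integral>\<^sup>+l. ennreal Sb * indicator {0..v/Sb} l \<partial>lborel)"
        using real Sb by (intro nn_integral_mono) (auto split: split_indicator simp: field_simps)
      also have "\<dots> = ennreal Sb * ennreal (v / Sb)" 
        using real Sb by (subst nn_integral_cmult_indicator) auto
      also have "\<dots> = ennreal v" using Sb by (subst ennreal_mult'[symmetric]) auto
      finally show ?thesis using real by simp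
    qed auto
  qed
  finally show ?thesis by (simp add: F_def)
qed

section \<open>From one variable to several\<close>

definition vec_upd :: "'a^'m \<Rightarrow> 'm \<Rightarrow> 'a \<Rightarrow> 'a^'m" where
  "vec_upd x i y = (\<chi> j. if j = i then y else x $ j)"

lemma vec_upd_nth [simp]: "vec_upd x i y $ j = (if j = i then y else x $ j)"
  by (simp add: vec_upd_def)

lemma vec_upd_eq: "vec_upd x i y = x + (y - x $ i) *\<^sub>R axis i (1::real)"
  by (simp add: vec_eq_iff axis_def)

lemma measurable_vec_upd [measurable (raw)]:
  fixes g :: "'z \<Rightarrow> real^'m"
  assumes "g \<in> borel_measurable N" "h \<in> borel_measurable N"
  shows "(\<lambda>z. vec_upd (g z) i (h z)) \<in> borel_measurable N"
proof -
  have "(\<lambda>p::(real^'m) \<times> real. vec_upd (fst p) i (snd p)) \<in> borel_measurable borel"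
    unfolding vec_upd_eq by (intro borel_measurable_continuous_onI continuous_intros)
  then have m: "(\<lambda>p::(real^'m) \<times> real. vec_upd (fst p) i (snd p)) \<in> borel_measurable (borel \<Otimes>\<^sub>M borel)"
    by (simp add: borel_prod)
  show ?thesis using measurable_compose[OF measurable_Pair[OF assms] m] by simp
qed

lemma vec_upd_lincomb: "vec_upd (a *\<^sub>R x + b *\<^sub>R y) i (a * u + b * v) = a *\<^sub>R vec_upd x i u + b *\<^sub>R vec_upd y i v"
  for x y :: "real^'m"
  by (simp add: vec_eq_iff)

text \<open>An iterated integral rather than one over a product measure, because the induction
  removes one coordinate at a time. The head of the list is the innermost integration; coordinates
  outside the list keep their value in \<open>x\<close>.\<close>

primrec iter_int :: "'m list \<Rightarrow> (real^'m \<Rightarrow> ennreal) \<Rightarrow> real^'m \<Rightarrow> ennreal" where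
  "iter_int [] g x = g x"
| "iter_int (i # is) g x = iter_int is (\<lambda>x. \<integral>\<^sup>+y. g (vec_upd x i y) \<partial>lborel) x"

text \<open>Only pairs of points with positive values are compared, since the real \<open>ln\<close>
  at 0 does not model minus infinity.\<close>

definition log_concave :: "('a::real_vector \<Rightarrow> real) \<Rightarrow> bool" where
  "log_concave g \<longleftrightarrow> (\<forall>x y l. 0 < l \<longrightarrow> l < 1 \<longrightarrow> 0 < g x \<longrightarrow> 0 < g y \<longrightarrow>
     exp ((1-l) * ln (g x) + l * ln (g y)) \<le> g ((1-l) *\<^sub>R x + l *\<^sub>R y))"

lemma log_concave_superlevel:
  assumes "log_concave g" "0 \<le> a" shows "convex {y. a < g y}"
proof (rule convexI)
  fix x y and u v :: real
  assume *: "x \<in> {y. a < g y}" "y \<in> {y. a < g y}" "0 \<le> u" "0 \<le> v" "u + v = 1"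
  show "u *\<^sub>R x + v *\<^sub>R y \<in> {y. a < g y}"
  proof (cases "u = 0 \<or> v = 0")
    case True
    then show ?thesis using * by auto
  next
    case False
    then have v: "0 < v" "v < 1" "u = 1 - v" using * by auto
    define m where "m = min (g x) (g y)"
    have m: "a < m" "0 < m" using * assms(2) by (auto simp: m_def)
    have "(1-v) * ln m + v * ln m \<le> (1-v) * ln (g x) + v * ln (g y)"
      using m v by (intro add_mono mult_left_mono) (auto simp: m_def)
    then have "ln m \<le> (1-v) * ln (g x) + v * ln (g y)" by (simp add: algebra_simps)
    then have "m \<le> exp ((1-v) * ln (g x) + v * ln (g y))" using m by (metis exp_le_cancel_iff exp_ln)
    also have "\<dots> \<le> g ((1-v) *\<^sub>R x + v *\<^sub>R y)"
      using assms(1) v * assms(2) unfolding log_concave_def by auto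
    finally show ?thesis using m v by simp
  qed
qed

text \<open>The hypothesis of the Prekopa-Leindler inequality for a continuum of functions.
  Selections are bounded, so that their mean is meaningful, and have values at least e > 0 under
  \<open>f\<close>, which bounds the logarithm from below.\<close>

definition mean_dominated :: "'t measure \<Rightarrow> ('t \<Rightarrow> 'a::euclidean_space \<Rightarrow> real) \<Rightarrow> ('a \<Rightarrow> ennreal) \<Rightarrow> bool" where
  "mean_dominated M f f0 \<longleftrightarrow> (\<forall>x e. x \<in> borel_measurable M \<longrightarrow> bounded (x ` space M) \<longrightarrow> 0 < e \<longrightarrow> (\<forall>t\<in>space M. e \<le> f t (x t)) \<longrightarrow>
     ennreal (exp (LINT t|M. ln (f t (x t)))) \<le> f0 (LINT t|M. x t))"

text \<open>Integrating out one coordinate preserves all hypotheses: the marginals are again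
  log-concave, bounded and boundedly supported, and again satisfy \<open>mean_dominated\<close>. The
  last two structural facts, log-concavity and domination, are both instances of
  \<open>mean_prekopa_1D\<close>.\<close>

lemma mean_prekopa_iterated:
  fixes M :: "'t measure" and f :: "'t \<Rightarrow> real^'m::finite \<Rightarrow> real" and f0 :: "real^'m \<Rightarrow> ennreal"
  assumes M: "prob_space M" and dist: "distinct is" and R: "0 \<le> R" and e: "0 < e"
   and mf: "(\<lambda>p. f (fst p) (snd p)) \<in> borel_measurable (M \<Otimes>\<^sub>M borel)"
   and f0m: "f0 \<in> borel_measurable borel"
   and bnd: "\<And>t x. 0 \<le> f t x" "\<And>t x. f t x \<le> C"
   and supp: "\<And>t x i. i \<in> set is \<Longrightarrow> f t x \<noteq> 0 \<Longrightarrow> \<bar>x $ i\<bar> \<le> R"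
   and lc: "\<And>t. t \<in> space M \<Longrightarrow> log_concave (f t)"
   and H: "mean_dominated M f f0"
   and ge: "\<And>t. t \<in> space M \<Longrightarrow> ennreal e \<le> iter_int is (\<lambda>x. ennreal (f t x)) 0"
  shows "ennreal (exp (LINT t|M. ln (enn2real (iter_int is (\<lambda>x. ennreal (f t x)) 0)))) \<le> iter_int is f0 0"
  using dist mf f0m bnd supp lc H ge
proof (induction "is" arbitrary: f f0 C)
  case Nil
  have "e \<le> f t 0" if "t \<in> space M" for t using Nil.prems(9)[OF that] Nil.prems(4) by (simp add: ennreal_le_iff2) (smt (verit) e)
  then show ?case using Nil.prems(8) e Nil.prems(4) unfolding mean_dominated_def
    by (auto dest!: spec[of _ "\<lambda>_. 0::real^'m"] simp: enn2real_ennreal bounded_def)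
next
  case (Cons i "is")
  interpret M: prob_space M by fact
  note bnd = Cons.prems(4,5) and supp = Cons.prems(6) and H = Cons.prems(8)
  have mf'[measurable (raw)]: "(\<lambda>x. f (g x) (h x)) \<in> borel_measurable N"
    if "g \<in> measurable N M" "h \<in> borel_measurable N" for g h and N :: "'z measure"
    using measurable_compose[OF measurable_Pair[OF that] Cons.prems(2)] by simp
  note [measurable] = Cons.prems(3)
  \<comment> \<open>The value 0 outside \<open>space M\<close> keeps the bounds valid for every t,
    as the induction hypothesis demands.\<close>
  define F where "F t x = (if t \<in> space M then LINT y|lborel. f t (vec_upd x i y) else 0)" for t x
  define F0 where "F0 x = (\<integral>\<^sup>+y. f0 (vec_upd x i y) \<partial>lborel)" for x
  have C: "0 \<le> C" using bnd order_trans by blast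
  have supp_i: "f t (vec_upd x i y) \<noteq> 0 \<Longrightarrow> \<bar>y\<bar> \<le> R" for t x y using supp[of i t "vec_upd x i y"] by auto
  have mfs[measurable]: "(\<lambda>y. f t (vec_upd x i y)) \<in> borel_measurable borel" if "t \<in> space M" for t x
    using that by measurable
  have intf: "integrable lborel (\<lambda>y. f t (vec_upd x i y))" if "t \<in> space M" for t x
  proof (rule integrableI_bounded_set[where A="{-R..R}" and B=C])
    show "AE y in lborel. y \<in> {- R..R} \<longrightarrow> norm (f t (vec_upd x i y)) \<le> C" using bnd by auto
    show "AE y in lborel. y \<notin> {- R..R} \<longrightarrow> f t (vec_upd x i y) = 0" using supp_i[of t x] by (intro AE_I2) force
  qed (use that in \<open>auto simp: emeasure_lborel_Icc_eq\<close>)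
  have Fnn: "ennreal (F t x) = (\<integral>\<^sup>+y. ennreal (f t (vec_upd x i y)) \<partial>lborel)" if "t \<in> space M" for t x
    unfolding F_def using that intf[OF that] bnd by (subst nn_integral_eq_integral) auto
  have mF: "(\<lambda>p. F (fst p) (snd p)) \<in> borel_measurable (M \<Otimes>\<^sub>M borel)"
  proof -
    have "(\<lambda>p. LINT y|lborel. f (fst p) (vec_upd (snd p) i y)) \<in> borel_measurable (M \<Otimes>\<^sub>M borel)" by measurable
    then show ?thesis
      by (rule measurable_cong[THEN iffD1, rotated]) (auto simp: F_def space_pair_measure)
  qed
  have mF0: "F0 \<in> borel_measurable borel" unfolding F0_def by measurable
  have F0': "0 \<le> F t x" for t x using bnd by (auto simp: F_def intro!: integral_nonneg_AE)
  have FC: "F t x \<le> C * (2*R)" for t x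
  proof (cases "t \<in> space M")
    case t: True
    have "F t x = (LINT y|lborel. f t (vec_upd x i y))" using t by (simp add: F_def)
    also have "\<dots> \<le> (LINT y|lborel. C * indicator {-R..R} y)"
    proof (rule integral_mono)
      show "f t (vec_upd x i y) \<le> C * indicator {- R..R} y" for y
        using bnd(2)[of t "vec_upd x i y"] supp_i[of t x y] C by (cases "f t (vec_upd x i y) = 0") (auto simp: indicator_def)
    qed (use intf[OF t] in \<open>auto intro!: integrable_mult_right integrable_real_indicator simp: emeasure_lborel_Icc_eq\<close>)
    also have "\<dots> = C * (2*R)" using R by simp
    finally show ?thesis .
  next
    case False then show ?thesis using C R by (simp add: F_def)
  qed
  have Fsupp: "\<bar>x $ j\<bar> \<le> R" if j: "j \<in> set is" and F: "F t x \<noteq> 0" for t x j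
  proof -
    have "\<exists>y. f t (vec_upd x i y) \<noteq> 0"
    proof (rule ccontr)
      assume "\<not> ?thesis"
      then have "F t x = 0" by (simp add: F_def)
      then show False using F by simp
    qed
    then obtain y where "f t (vec_upd x i y) \<noteq> 0" by blast
    then have "\<bar>vec_upd x i y $ j\<bar> \<le> R" by (intro supp[of j t]) (use j in auto)
    then show ?thesis using j Cons.prems(1) by (auto split: if_splits)
  qed
  have Flc: "log_concave (F t)" if t: "t \<in> space M" for t
    unfolding log_concave_def
  proof safe
    fix x y and l :: real assume l: "0 < l" "l < 1" and pos: "0 < F t x" "0 < F t y"
    \<comment> \<open>Log-concavity of a marginal is the inequality for a two-point mean: the
      Bernoulli measure puts weight 1 - l on x (\<open>False\<close>) and l on y
      (\<open>True\<close>).\<close>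
    define B where "B = measure_pmf (bernoulli_pmf l)"
    interpret B: prob_space B unfolding B_def by (rule measure_pmf.prob_space_axioms)
    have setsB: "sets B = UNIV" "space B = UNIV" by (auto simp: B_def)
    have intB: "(LINT b|B. g b) = (1-l) * g False + l * g True" for g :: "bool \<Rightarrow> real"
      unfolding B_def using l by (subst integral_bernoulli_pmf) auto
    define g where "g b u = f t (vec_upd (if b then y else x) i u)" for b u
    have "ennreal (exp (LINT b|B. ln (LINT u|lborel. g b u)))
        \<le> (\<integral>\<^sup>+u. ennreal (f t (vec_upd ((1-l) *\<^sub>R x + l *\<^sub>R y) i u)) \<partial>lborel)"
    proof (rule mean_prekopa_1D[where C=C and R=R and e="min (F t x) (F t y)" and f=g])
      have "(\<lambda>p. if fst p then f t (vec_upd y i (snd p)) else f t (vec_upd x i (snd p))) \<in> borel_measurable (B \<Otimes>\<^sub>M borel)"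
        using t unfolding B_def by measurable
      then show "(\<lambda>p. g (fst p) (snd p)) \<in> borel_measurable (B \<Otimes>\<^sub>M borel)"
        unfolding g_def by (simp add: if_distrib if_distribR cong: if_cong)
      show "(\<lambda>u. ennreal (f t (vec_upd ((1 - l) *\<^sub>R x + l *\<^sub>R y) i u))) \<in> borel_measurable borel"
        using t by measurable
      show "convex {u. a < g b u}" if a: "0 \<le> a" for a b
      proof (rule convexI)
        fix u v r s :: real assume *: "u \<in> {u. a < g b u}" "v \<in> {u. a < g b u}" "0 \<le> r" "0 \<le> s" "r + s = 1"
        let ?z = "if b then y else x"
        have "convex {z. a < f t z}" using log_concave_superlevel[OF Cons.prems(7)[OF t] a] .
        then have "r *\<^sub>R vec_upd ?z i u + s *\<^sub>R vec_upd ?z i v \<in> {z. a < f t z}"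
          using * unfolding g_def by (intro convexD) auto
        moreover have "r *\<^sub>R vec_upd ?z i u + s *\<^sub>R vec_upd ?z i v = vec_upd (r *\<^sub>R ?z + s *\<^sub>R ?z) i (r * u + s * v)"
          by (rule vec_upd_lincomb[symmetric])
        moreover have "r *\<^sub>R ?z + s *\<^sub>R ?z = ?z" using *(5) by (simp only: scaleR_left_distrib[symmetric] scaleR_one)
        ultimately show "r *\<^sub>R u + s *\<^sub>R v \<in> {u. a < g b u}" by (simp add: g_def)
      qed
      show "min (F t x) (F t y) \<le> (LINT u|lborel. g b u)" for b using t by (cases b) (auto simp: F_def g_def)
      fix w :: "bool \<Rightarrow> real" and e' :: real assume w: "0 < e'" "\<And>b. b \<in> space B \<Longrightarrow> e' \<le> g b (w b)"
      have w': "0 < g False (w False)" "0 < g True (w True)" using w setsB by (auto intro: less_le_trans)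
      have "exp (LINT b|B. ln (g b (w b))) = exp ((1-l) * ln (g False (w False)) + l * ln (g True (w True)))"
        by (simp add: intB)
      also have "\<dots> \<le> f t ((1-l) *\<^sub>R vec_upd x i (w False) + l *\<^sub>R vec_upd y i (w True))"
        using Cons.prems(7)[OF t] l w' unfolding log_concave_def g_def by auto
      also have "\<dots> = f t (vec_upd ((1-l) *\<^sub>R x + l *\<^sub>R y) i (LINT b|B. w b))"
        by (simp add: vec_upd_lincomb intB)
      finally show "ennreal (exp (LINT b|B. ln (g b (w b)))) \<le> ennreal (f t (vec_upd ((1-l) *\<^sub>R x + l *\<^sub>R y) i (LINT b|B. w b)))"
        by (rule ennreal_leI)
    qed (use bnd supp_i pos B.prob_space_axioms in \<open>auto simp: g_def split: if_splits\<close>)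
    then have "ennreal (exp (LINT b|B. ln (LINT u|lborel. g b u))) \<le> ennreal (F t ((1-l) *\<^sub>R x + l *\<^sub>R y))"
      using Fnn[OF t] by simp
    moreover have "(LINT b|B. ln (LINT u|lborel. g b u)) = (1-l) * ln (F t x) + l * ln (F t y)"
      using t by (simp add: intB g_def F_def)
    ultimately show "exp ((1 - l) * ln (F t x) + l * ln (F t y)) \<le> F t ((1 - l) *\<^sub>R x + l *\<^sub>R y)"
      using F0' by (simp add: ennreal_le_iff)
  qed
  \<comment> \<open>Along a selection x the one-dimensional inequality is applied in coordinate i.
    Its own hypothesis, for a selection w, is \<open>H\<close> for the combined selection
    \<open>vec_upd (x t) i (w t)\<close>, whose mean is the update of the two means.\<close>
  have FH: "mean_dominated M F F0" unfolding mean_dominated_def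
  proof (intro allI impI)
    fix x :: "'t \<Rightarrow> real^'m" and e' :: real
    assume x[measurable]: "x \<in> borel_measurable M" and xb: "bounded (x ` space M)" and e': "0 < e'" "\<forall>t\<in>space M. e' \<le> F t (x t)"
    obtain Bx where Bx: "\<And>t. t \<in> space M \<Longrightarrow> norm (x t) \<le> Bx" using xb by (auto simp: bounded_iff)
    have ix: "integrable M x" by (rule M.integrable_const_bound[where B=Bx]) (use Bx in auto)
    define g where "g t u = f t (vec_upd (x t) i u)" for t u
    define g' where "g' t u = (if t \<in> space M then g t u else 0)" for t u
    have "ennreal (exp (LINT t|M. ln (LINT u|lborel. g' t u))) \<le> (\<integral>\<^sup>+u. f0 (vec_upd (LINT t|M. x t) i u) \<partial>lborel)"
    proof (rule mean_prekopa_1D[where C=C and R=R and e=e' and f=g'])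
      have "(\<lambda>p. g (fst p) (snd p)) \<in> borel_measurable (M \<Otimes>\<^sub>M borel)"
        unfolding g_def by measurable
      then show "(\<lambda>p. g' (fst p) (snd p)) \<in> borel_measurable (M \<Otimes>\<^sub>M borel)"
        by (rule measurable_cong[THEN iffD1, rotated]) (auto simp: g'_def space_pair_measure)
      show "convex {u. a < g' t u}" if t: "t \<in> space M" and a: "0 \<le> a" for a t
      proof (rule convexI)
        fix u v r s :: real assume *: "u \<in> {u. a < g' t u}" "v \<in> {u. a < g' t u}" "0 \<le> r" "0 \<le> s" "r + s = 1"
        let ?z = "x t"
        have "convex {z. a < f t z}" using log_concave_superlevel[OF Cons.prems(7)[OF t] a] .
        then have "r *\<^sub>R vec_upd ?z i u + s *\<^sub>R vec_upd ?z i v \<in> {z. a < f t z}"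
          using * t unfolding g_def g'_def by (intro convexD) auto
        moreover have "r *\<^sub>R vec_upd ?z i u + s *\<^sub>R vec_upd ?z i v = vec_upd (r *\<^sub>R ?z + s *\<^sub>R ?z) i (r * u + s * v)"
          by (rule vec_upd_lincomb[symmetric])
        moreover have "r *\<^sub>R ?z + s *\<^sub>R ?z = ?z" using *(5) by (simp only: scaleR_left_distrib[symmetric] scaleR_one)
        ultimately show "r *\<^sub>R u + s *\<^sub>R v \<in> {u. a < g' t u}" using t by (simp add: g_def g'_def)
      qed
      show "e' \<le> (LINT u|lborel. g' t u)" if "t \<in> space M" for t using e' that by (auto simp: F_def g_def g'_def)
      fix w :: "'t \<Rightarrow> real" and e'' :: real
      assume w[measurable]: "w \<in> borel_measurable M" and w2: "0 < e''" "\<And>t. t \<in> space M \<Longrightarrow> e'' \<le> g' t (w t)"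
      have wR: "\<bar>w t\<bar> \<le> R" if t: "t \<in> space M" for t
        using w2(2)[OF t] w2(1) supp_i[of t "x t" "w t"] t by (auto simp: g_def g'_def)
      have iw: "integrable M w" by (rule M.integrable_const_bound[where B=R]) (use wR in auto)
      have e1: "vec_upd (x t) i (w t) = x t + (w t - x t $ i) *\<^sub>R axis i 1" for t by (rule vec_upd_eq)
      have bl: "bounded_linear (\<lambda>z::real^'m. z $ i)" by (rule bounded_linear_vec_nth)
      have xi: "integrable M (\<lambda>t. x t $ i)" using integrable_bounded_linear[OF bl ix] .
      have "(LINT t|M. vec_upd (x t) i (w t)) = (LINT t|M. x t) + (LINT t|M. w t - x t $ i) *\<^sub>R axis i 1"
        unfolding e1 using ix iw xi by (subst Bochner_Integration.integral_add) auto
      also have "(LINT t|M. w t - x t $ i) = (LINT t|M. w t) - (LINT t|M. x t) $ i"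
        using iw xi integral_bounded_linear[OF bl ix] by simp
      finally have avg: "(LINT t|M. vec_upd (x t) i (w t)) = vec_upd (LINT t|M. x t) i (LINT t|M. w t)"
        by (simp add: vec_upd_eq)
      have "bounded ((\<lambda>t. vec_upd (x t) i (w t)) ` space M)"
      proof (rule boundedI[where B="Bx + (R + Bx) * norm (axis i 1 :: real^'m)"], safe)
        fix t assume t: "t \<in> space M"
        have "\<bar>x t $ i\<bar> \<le> Bx" using Bx[OF t] component_le_norm_cart[of "x t" i] by linarith
        then have "\<bar>w t - x t $ i\<bar> \<le> R + Bx" using wR[OF t] by linarith
        then show "norm (vec_upd (x t) i (w t)) \<le> Bx + (R + Bx) * norm (axis i 1 :: real^'m)"
          unfolding e1 using Bx[OF t]
          by (intro order_trans[OF norm_triangle_ineq] add_mono) (auto intro!: mult_right_mono)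
      qed
      moreover have "(\<lambda>t. vec_upd (x t) i (w t)) \<in> borel_measurable M" by measurable
      ultimately have "ennreal (exp (LINT t|M. ln (f t (vec_upd (x t) i (w t))))) \<le> f0 (LINT t|M. vec_upd (x t) i (w t))"
        using H w2 unfolding mean_dominated_def by (auto simp: g_def g'_def)
      moreover have "(LINT t|M. ln (f t (vec_upd (x t) i (w t)))) = (LINT t|M. ln (g' t (w t)))"
        by (intro Bochner_Integration.integral_cong) (auto simp: g_def g'_def)
      ultimately show "ennreal (exp (LINT t|M. ln (g' t (w t)))) \<le> f0 (vec_upd (LINT t|M. x t) i (LINT t|M. w t))"
        by (simp add: avg)
    qed (use bnd supp_i e' M C in \<open>auto simp: g_def g'_def split: if_splits\<close>)
    moreover have "(LINT t|M. ln (LINT u|lborel. g' t u)) = (LINT t|M. ln (F t (x t)))"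
      by (intro Bochner_Integration.integral_cong) (auto simp: g_def g'_def F_def)
    ultimately show "ennreal (exp (LINT t|M. ln (F t (x t)))) \<le> F0 (LINT t|M. x t)"
      by (simp add: F0_def)
  qed
  have eq: "iter_int (i # is) (\<lambda>x. ennreal (f t x)) 0 = iter_int is (\<lambda>x. ennreal (F t x)) 0" if "t \<in> space M" for t
    using Fnn[OF that] by simp
  have "ennreal (exp (LINT t|M. ln (enn2real (iter_int is (\<lambda>x. ennreal (F t x)) 0)))) \<le> iter_int is F0 0"
    by (rule Cons.IH[OF _ mF mF0 F0' FC Fsupp Flc FH]) (use Cons.prems(1) Cons.prems(9) eq in auto)
  moreover have "(LINT t|M. ln (enn2real (iter_int is (\<lambda>x. ennreal (F t x)) 0)))
     = (LINT t|M. ln (enn2real (iter_int (i # is) (\<lambda>x. ennreal (f t x)) 0)))"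
    by (intro Bochner_Integration.integral_cong) (use eq in auto)
  ultimately show ?case by (simp add: F0_def[abs_def])
qed

section \<open>Regularity of the fiber integral\<close>

text \<open>Strict plurisubharmonicity on \<open>W\<close> is recorded as positivity of the Levi
  form, the shape in which it is used. Connectedness of the fibers is what keeps nearby fibers from
  acquiring remote parts, see \<open>local_structure\<close>.\<close>

locale spc_family =
  fixes U :: "(complex^'n::finite) set" and \<Omega> :: "((complex^'n) \<times> (complex^'m::finite)) set"
    and \<rho> :: "(complex^'n) \<times> (complex^'m) \<Rightarrow> real" and N W :: "((complex^'n) \<times> (complex^'m)) set"
  assumes U: "open U"
    and \<Omega>: "open \<Omega>" "\<Omega> \<subseteq> U \<times> UNIV" "fst ` \<Omega> = U"
    and bdd: "\<And>t. t \<in> U \<Longrightarrow> bounded (fiber \<Omega> t)"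
    and N: "open N" "N \<subseteq> U \<times> UNIV"
    and \<rho>: "Ck_on 2 \<rho> N" and \<Omega>_eq: "\<Omega> = {x \<in> N. \<rho> x < 0}"
    and regular: "\<And>t z. t \<in> U \<Longrightarrow> z \<in> frontier (fiber \<Omega> t) \<Longrightarrow> frechet_derivative (\<lambda>w. \<rho> (t, w)) (at z) \<noteq> (\<lambda>_. 0)"
    and W: "open W" "closure \<Omega> \<inter> (U \<times> UNIV) \<subseteq> W" "W \<subseteq> N"
    and levi_pos: "\<And>x v. x \<in> W \<Longrightarrow> v \<noteq> 0 \<Longrightarrow> 0 < levi (cscale \<i>) \<rho> x v"
    and fiber_connected: "\<And>t. t \<in> U \<Longrightarrow> connected (fiber \<Omega> t)"
begin

section \<open>Geometry of the fibers near a given parameter\<close>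

lemma open_fiber: "open S \<Longrightarrow> open (fiber S t)"
  unfolding fiber_def using open_vimage[of S "\<lambda>z. (t, z)"] by (simp add: vimage_def continuous_intros)

lemma fiber_ne: "t \<in> U \<Longrightarrow> fiber \<Omega> t \<noteq> {}"
  using \<Omega>(3) by (force simp: fiber_def)

lemma closure_fiber: "t \<in> U \<Longrightarrow> z \<in> closure (fiber \<Omega> t) \<Longrightarrow> (t, z) \<in> closure \<Omega> \<inter> (U \<times> UNIV)"
proof -
  assume t: "t \<in> U" and z: "z \<in> closure (fiber \<Omega> t)"
  have "z \<in> closure ((\<lambda>z. (t, z)) -` \<Omega>)" using z by (simp add: fiber_def vimage_def)
  moreover have "closed ((\<lambda>z. (t, z)) -` closure \<Omega>)"
    by (intro closed_vimage continuous_intros) auto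
  then have "closure ((\<lambda>z. (t, z)) -` \<Omega>) \<subseteq> (\<lambda>z. (t, z)) -` closure \<Omega>"
    by (intro closure_minimal) (use closure_subset in auto)
  ultimately show ?thesis using t by auto
qed

lemma \<rho>_le_0: "x \<in> closure \<Omega> \<inter> (U \<times> UNIV) \<Longrightarrow> x \<in> N \<and> \<rho> x \<le> 0"
proof -
  assume x: "x \<in> closure \<Omega> \<inter> (U \<times> UNIV)"
  then have xN: "x \<in> N" using W by blast
  obtain f where f: "\<And>n. f n \<in> \<Omega>" "f \<longlonglongrightarrow> x" using x closure_sequential[of x \<Omega>] by blast
  have "isCont \<rho> x" using Ck_on_imp_continuous_on[OF \<rho>] N xN by (simp add: continuous_on_eq_continuous_at)
  then have "(\<lambda>n. \<rho> (f n)) \<longlonglongrightarrow> \<rho> x" using f(2) by (rule isCont_tendsto_compose)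
  moreover have "\<rho> (f n) \<le> 0" for n using f(1)[of n] \<Omega>_eq by auto
  ultimately have "\<rho> x \<le> 0" by (intro LIMSEQ_le_const2) auto
  then show ?thesis using xN by simp
qed

lemma \<rho>_derivative: "p \<in> N \<Longrightarrow> (\<rho> has_derivative frechet_derivative \<rho> (at p)) (at p)"
  by (rule Ck2_derivative[OF \<rho>])

lemma frontier_direction:
  assumes t: "t \<in> U" and z: "z \<in> frontier (fiber \<Omega> t)"
  obtains v where "(t, z) \<in> N" "\<rho> (t, z) = 0" "frechet_derivative \<rho> (at (t, z)) (0, v) > 0"
proof -
  have zc: "z \<in> closure (fiber \<Omega> t)" "z \<notin> fiber \<Omega> t"
    using z open_fiber[OF \<Omega>(1), of t] by (auto simp: frontier_def interior_open)
  have xN: "(t, z) \<in> N" and "\<rho> (t, z) \<le> 0" using \<rho>_le_0[OF closure_fiber[OF t zc(1)]] by auto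
  moreover have "\<not> \<rho> (t, z) < 0" using zc(2) xN \<Omega>_eq by (auto simp: fiber_def)
  ultimately have r0: "\<rho> (t, z) = 0" by simp
  let ?D = "\<lambda>v. frechet_derivative \<rho> (at (t, z)) (0, v)"
  have "((\<lambda>w. (t, w)) has_derivative (\<lambda>v. (0, v))) (at z)" by (auto intro!: derivative_eq_intros)
  from has_derivative_compose[OF this \<rho>_derivative[OF xN]]
  have d: "((\<lambda>w. \<rho> (t, w)) has_derivative ?D) (at z)" .
  from frechet_derivative_at[OF d] regular[OF t z] obtain v where v: "?D v \<noteq> 0" by metis
  have "?D (- v) = - ?D v" using linear_neg[OF has_derivative_linear[OF d]] .
  then have "?D v > 0 \<or> ?D (- v) > 0" using v by linarith
  then show thesis using that[OF xN r0] by blast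
qed

text \<open>Moving from w against a direction of increase strictly lowers \<open>\<rho>\<close>, so
  w - s v lies in the fiber for small s > 0 and w is a limit of such points. Hence no stray points
  with \<open>\<rho> \<le> 0\<close> occur outside the closed fiber near its frontier.\<close>

lemma frontier_local:
  assumes t: "t \<in> U" and z: "z \<in> frontier (fiber \<Omega> t)"
  shows "\<exists>e>0. \<forall>w\<in>ball z e. (t, w) \<in> N \<and> (\<rho> (t, w) \<le> 0 \<longrightarrow> w \<in> closure (fiber \<Omega> t))"
proof -
  obtain v where v: "(t, z) \<in> N" "\<rho> (t, z) = 0" "frechet_derivative \<rho> (at (t, z)) (0, v) > 0"
    by (rule frontier_direction[OF t z])
  define P where "P = (\<lambda>w. (t, w)) -` (N \<inter> (\<lambda>p. frechet_derivative \<rho> (at p) (0, v)) -` {0<..})"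
  have "open (N \<inter> (\<lambda>p. frechet_derivative \<rho> (at p) (0, v)) -` {0<..})"
    using Ck2_D1_cont[OF \<rho>] N(1) by (simp add: continuous_open_preimage)
  then have "open P" unfolding P_def by (intro open_vimage continuous_intros)
  moreover have "z \<in> P" using v by (simp add: P_def)
  ultimately obtain e where e: "0 < e" "ball z e \<subseteq> P" using open_contains_ball by blast
  have "w \<in> closure (fiber \<Omega> t)" if w: "w \<in> ball z e" and r: "\<rho> (t, w) \<le> 0" for w
  proof -
    have "continuous (at (0::real)) (\<lambda>s. w - s *\<^sub>R v)" by (intro continuous_intros)
    have tend: "((\<lambda>s. w - s *\<^sub>R v) \<longlongrightarrow> w - 0 *\<^sub>R v) (at_right 0)" by (intro tendsto_intros)
    have "open ((\<lambda>s. w - s *\<^sub>R v) -` ball z e)" by (intro open_vimage continuous_intros) auto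
    moreover have "0 \<in> (\<lambda>s. w - s *\<^sub>R v) -` ball z e" using w by simp
    ultimately obtain d where d: "0 < d" "cball 0 d \<subseteq> (\<lambda>s. w - s *\<^sub>R v) -` ball z e" using open_contains_cball by blast
    have inP: "w - s *\<^sub>R v \<in> P" if "0 \<le> s" "s \<le> d" for s
    proof -
      have "s \<in> cball 0 d" using that by auto
      then show ?thesis using d e by blast
    qed
    have inf: "w - s *\<^sub>R v \<in> fiber \<Omega> t" if s: "0 < s" "s \<le> d" for s
    proof -
      have "\<rho> (t, w - 0 *\<^sub>R v) > \<rho> (t, w - s *\<^sub>R v)"
      proof (rule DERIV_neg_imp_decreasing[OF s(1)])
        fix x assume x: "0 \<le> x" "x \<le> s"
        then have xN: "(t, w - x *\<^sub>R v) \<in> N" "frechet_derivative \<rho> (at (t, w - x *\<^sub>R v)) (0, v) > 0"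
          using inP[of x] s by (auto simp: P_def)
        have "((\<lambda>s. (t, w - s *\<^sub>R v)) has_derivative (\<lambda>h. (0, - (h *\<^sub>R v)))) (at x)" by (auto intro!: derivative_eq_intros)
        from has_derivative_compose[OF this \<rho>_derivative[OF xN(1)]]
        have 1: "((\<lambda>s. \<rho> (t, w - s *\<^sub>R v)) has_derivative (\<lambda>h. frechet_derivative \<rho> (at (t, w - x *\<^sub>R v)) (0, - (h *\<^sub>R v)))) (at x)" .
        have 2: "frechet_derivative \<rho> (at (t, w - x *\<^sub>R v)) (0, - (h *\<^sub>R v)) = - frechet_derivative \<rho> (at (t, w - x *\<^sub>R v)) (0, v) * h" for h
        proof -
          have "frechet_derivative \<rho> (at (t, w - x *\<^sub>R v)) (0, - (h *\<^sub>R v)) = frechet_derivative \<rho> (at (t, w - x *\<^sub>R v)) ((- h) *\<^sub>R (0, v))" by simp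
          also have "\<dots> = (- h) *\<^sub>R frechet_derivative \<rho> (at (t, w - x *\<^sub>R v)) (0, v)"
            by (rule linear_scale[OF has_derivative_linear[OF \<rho>_derivative[OF xN(1)]]])
          finally show ?thesis by simp
        qed
        have "((\<lambda>s. \<rho> (t, w - s *\<^sub>R v)) has_real_derivative - frechet_derivative \<rho> (at (t, w - x *\<^sub>R v)) (0, v)) (at x)"
          unfolding has_field_derivative_def by (rule has_derivative_eq_rhs[OF 1]) (rule ext, rule 2)
        then show "\<exists>y. ((\<lambda>s. \<rho> (t, w - s *\<^sub>R v)) has_real_derivative y) (at x) \<and> y < 0"
          using xN(2) by (intro exI[of _ "- frechet_derivative \<rho> (at (t, w - x *\<^sub>R v)) (0, v)"]) simp
      qed
      then have "\<rho> (t, w - s *\<^sub>R v) < 0" using r by simp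
      moreover have "(t, w - s *\<^sub>R v) \<in> N" using inP[of s] s by (auto simp: P_def)
      ultimately show ?thesis using \<Omega>_eq by (auto simp: fiber_def)
    qed
    have "\<forall>\<^sub>F s in at_right 0. w - s *\<^sub>R v \<in> closure (fiber \<Omega> t)"
      using eventually_at_right_field[of "\<lambda>s. w - s *\<^sub>R v \<in> closure (fiber \<Omega> t)" 0] inf d closure_subset
      by (metis less_imp_le subsetD)
    from Lim_in_closed_set[OF closed_closure this _ tend] show ?thesis by simp
  qed
  then show ?thesis using e by (intro exI[of _ e]) (auto simp: P_def)
qed

text \<open>\<open>K\<close> is a closed neighbourhood of the closed fiber over t0. On its outer
  layer, at distance exactly eta, \<open>\<rho>\<close> is positive, and this persists for nearby t
  by compactness. A connected fiber over such t meets the central fiber and cannot cross that layer,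
  so it stays in \<open>K\<close>.\<close>

lemma local_structure:
  assumes t0: "t0 \<in> U" and G: "open G" "closure \<Omega> \<inter> (U \<times> UNIV) \<subseteq> G"
  shows "\<exists>r K. 0 < r \<and> cball t0 r \<subseteq> U \<and> compact K \<and> cball t0 r \<times> K \<subseteq> G \<inter> W \<and>
    (\<forall>t\<in>cball t0 r. fiber \<Omega> t \<subseteq> K) \<and> (\<forall>z\<in>K. \<exists>V d. integral_chart \<Omega> t0 z V d) \<and>
    closure (fiber \<Omega> t0) \<subseteq> interior K"
proof -
  define A where "A = closure (fiber \<Omega> t0)"
  have A: "compact A" "A \<noteq> {}" "closed A" using bdd[OF t0] fiber_ne[OF t0] by (auto simp: A_def compact_closure)
  \<comment> \<open>The points over t0 that are either in the closed fiber or have positive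
    \<open>\<rho>\<close>; a neighbourhood of \<open>A\<close> consists of such points by
    \<open>frontier_local\<close>.\<close>
  define B where "B = {w. (t0, w) \<in> G \<inter> W \<and> (w \<notin> A \<longrightarrow> \<rho> (t0, w) > 0)}"
  have "\<exists>e>0. ball z e \<subseteq> B" if z: "z \<in> A" for z
  proof -
    have "(t0, z) \<in> G \<inter> W" using closure_fiber[OF t0] z G W by (auto simp: A_def)
    moreover have "open (fiber (G \<inter> W) t0)" using G W by (intro open_fiber open_Int)
    ultimately obtain e1 where e1: "e1 > 0" "ball z e1 \<subseteq> fiber (G \<inter> W) t0"
      using open_contains_ball by (metis fiber_def mem_Collect_eq)
    show ?thesis
    proof (cases "z \<in> fiber \<Omega> t0")
      case True
      then obtain e2 where e2: "e2 > 0" "ball z e2 \<subseteq> fiber \<Omega> t0" using open_fiber[OF \<Omega>(1)] open_contains_ball by blast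
      have "ball z (min e1 e2) \<subseteq> B"
      proof
        fix w assume w: "w \<in> ball z (min e1 e2)"
        have "w \<in> fiber (G \<inter> W) t0" using w e1 by auto
        moreover have "w \<in> A" using w e2 closure_subset[of "fiber \<Omega> t0"] by (auto simp: A_def)
        ultimately show "w \<in> B" by (simp add: B_def fiber_def)
      qed
      then show ?thesis using e1 e2 by (intro exI[of _ "min e1 e2"]) auto
    next
      case False
      then have "z \<in> frontier (fiber \<Omega> t0)" using z open_fiber[OF \<Omega>(1)] by (simp add: A_def frontier_def interior_open)
      from frontier_local[OF t0 this] obtain e2 where e2: "e2 > 0" "\<And>w. w \<in> ball z e2 \<Longrightarrow> \<rho> (t0, w) \<le> 0 \<longrightarrow> w \<in> A" by (auto simp: A_def)
      have "ball z (min e1 e2) \<subseteq> B"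
      proof
        fix w assume w: "w \<in> ball z (min e1 e2)"
        have "w \<in> fiber (G \<inter> W) t0" using w e1 by auto
        moreover have "w \<in> A \<or> \<rho> (t0, w) > 0" using w e2(2)[of w] by auto
        ultimately show "w \<in> B" by (auto simp add: B_def fiber_def)
      qed
      then show ?thesis using e1 e2 by (intro exI[of _ "min e1 e2"]) auto
    qed
  qed
  then obtain e where e: "\<And>z. z \<in> A \<Longrightarrow> 0 < e z" "\<And>z. z \<in> A \<Longrightarrow> ball z (e z) \<subseteq> B" by metis
  have "open (\<Union>z\<in>A. ball z (e z))" "A \<subseteq> (\<Union>z\<in>A. ball z (e z))" using e by auto
  from compact_subset_open_imp_ball_epsilon_subset[OF A(1) this]
  obtain \<epsilon> where \<epsilon>: "\<epsilon> > 0" "(\<Union>x\<in>A. ball x \<epsilon>) \<subseteq> (\<Union>z\<in>A. ball z (e z))" by blast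
  define \<eta> where "\<eta> = \<epsilon> / 2"
  have \<eta>: "0 < \<eta>" using \<epsilon> by (simp add: \<eta>_def)
  define K where "K = {z. infdist z A \<le> \<eta>}"
  have KB: "K \<subseteq> B"
  proof
    fix z assume "z \<in> K"
    then have "infdist z A < \<epsilon>" using \<epsilon> by (auto simp: K_def \<eta>_def)
    moreover obtain a where "a \<in> A" "infdist z A = dist z a" using infdist_attains_inf[OF A(3,2)] by blast
    ultimately have "z \<in> (\<Union>x\<in>A. ball x \<epsilon>)" by (auto simp: dist_commute)
    then show "z \<in> B" using \<epsilon>(2) e(2) by blast
  qed
  have cinf: "continuous_on S (\<lambda>z. infdist z A)" for S by (intro continuous_on_infdist continuous_on_id)
  have clK: "closed K" "closed {z. infdist z A = \<eta>}"
    unfolding K_def using cinf[of UNIV] by (auto intro!: closed_Collect_le closed_Collect_eq continuous_intros)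
  have K: "compact K"
  proof -
    obtain M where M: "\<And>a. a \<in> A \<Longrightarrow> norm a \<le> M" using compact_imp_bounded[OF A(1)] by (auto simp: bounded_iff)
    have "norm z \<le> M + \<eta>" if "z \<in> K" for z
    proof -
      obtain a where a: "a \<in> A" "infdist z A = dist z a" using infdist_attains_inf[OF A(3,2)] by blast
      then have "dist z a \<le> \<eta>" using that by (simp add: K_def)
      then show ?thesis using M[OF a(1)] norm_triangle_sub[of z a] by (simp add: dist_norm)
    qed
    then have "bounded K" by (auto simp: bounded_iff)
    then show ?thesis using clK by (simp add: compact_eq_bounded_closed)
  qed
  \<comment> \<open>The layer that fibers over nearby parameters cannot cross.\<close>
  define S where "S = {z. infdist z A = \<eta>}"
  have S: "compact S" using compact_Int_closed[OF K clK(2)] by (simp add: S_def K_def Int_def conj_commute cong: conj_cong)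
  have "{t0} \<times> K \<subseteq> G \<inter> W" using KB by (auto simp: B_def)
  from Elementary_Topology.tube_lemma[OF K _ this] G W obtain V1 where V1: "t0 \<in> V1" "open V1" "V1 \<times> K \<subseteq> G \<inter> W" by blast
  have oP: "open (N \<inter> \<rho> -` {0<..})" using Ck_on_imp_continuous_on[OF \<rho>] N(1) by (simp add: continuous_open_preimage)
  have "{t0} \<times> S \<subseteq> N \<inter> \<rho> -` {0<..}"
  proof
    fix x assume "x \<in> {t0} \<times> S"
    then obtain z where z: "x = (t0, z)" "infdist z A = \<eta>" by (auto simp: S_def)
    then have "z \<in> B" using KB by (auto simp: K_def)
    moreover have "z \<notin> A" using z \<eta> by auto
    ultimately show "x \<in> N \<inter> \<rho> -` {0<..}" using z W by (auto simp: B_def)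
  qed
  from Elementary_Topology.tube_lemma[OF S oP this] obtain V2 where V2: "t0 \<in> V2" "open V2" "V2 \<times> S \<subseteq> N \<inter> \<rho> -` {0<..}" by blast
  \<comment> \<open>An anchor: by openness of \<open>\<Omega>\<close> the point p belongs to all
    nearby fibers, and it lies in \<open>A\<close>, on the inner side of \<open>S\<close>.\<close>
  obtain p where p: "(t0, p) \<in> \<Omega>" using fiber_ne[OF t0] by (auto simp: fiber_def)
  from open_prod_elim[OF \<Omega>(1) p] obtain V3 B3 where V3: "open V3" "open B3" "(t0, p) \<in> V3 \<times> B3" "V3 \<times> B3 \<subseteq> \<Omega>" .
  have "open (V1 \<inter> V2 \<inter> V3 \<inter> U)" "t0 \<in> V1 \<inter> V2 \<inter> V3 \<inter> U" using V1 V2 V3 U t0 by auto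
  then obtain r where r: "0 < r" "cball t0 r \<subseteq> V1 \<inter> V2 \<inter> V3 \<inter> U" using open_contains_cball by blast
  show ?thesis
  proof (rule exI[of _ r], rule exI[of _ K], intro conjI ballI)
    show "cball t0 r \<times> K \<subseteq> G \<inter> W" using r V1 by blast
    fix t assume t: "t \<in> cball t0 r"
    show "fiber \<Omega> t \<subseteq> K"
    proof (rule ccontr)
      assume "\<not> ?thesis"
      then obtain q where "q \<in> fiber \<Omega> t" "q \<notin> K" by blast
      then have q: "q \<in> fiber \<Omega> t" "\<eta> < infdist q A" by (auto simp: K_def)
      have pt: "p \<in> fiber \<Omega> t" using t r V3 by (auto simp: fiber_def)
      have "p \<in> A" using p closure_subset[of "fiber \<Omega> t0"] by (auto simp: A_def fiber_def)
      then have "infdist p A \<le> \<eta>" using \<eta> by simp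
      moreover have "connected ((\<lambda>z. infdist z A) ` fiber \<Omega> t)"
        using fiber_connected[of t] t r by (intro connected_continuous_image cinf) auto
      ultimately have "\<eta> \<in> (\<lambda>z. infdist z A) ` fiber \<Omega> t"
        using pt q by (meson connectedD_interval imageI less_imp_le)
      then obtain s where s: "s \<in> fiber \<Omega> t" "infdist s A = \<eta>" by auto
      have "t \<in> V2" using t r by blast
      then have "(t, s) \<in> N \<inter> \<rho> -` {0<..}" using V2(3) s by (auto simp: S_def)
      then show False using s \<Omega>_eq by (auto simp: fiber_def)
    qed
  next
    fix z assume z: "z \<in> K"
    have zB: "z \<in> B" using z KB by blast
    show "\<exists>V d. integral_chart \<Omega> t0 z V d"
    proof (cases "z \<in> A")
      case False
      then have "(t0, z) \<in> N \<inter> \<rho> -` {0<..}" using zB W by (auto simp: B_def)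
      then show ?thesis by (rule integral_chart_exterior[OF oP]) (use \<Omega>_eq in auto)
    next
      case True
      show ?thesis
      proof (cases "z \<in> fiber \<Omega> t0")
        case True
        then show ?thesis by (intro integral_chart_interior[OF \<Omega>(1)]) (simp add: fiber_def)
      next
        case False
        then have "z \<in> frontier (fiber \<Omega> t0)" using True open_fiber[OF \<Omega>(1)] by (simp add: A_def frontier_def interior_open)
        from frontier_direction[OF t0 this] obtain v where v: "(t0, z) \<in> N" "\<rho> (t0, z) = 0" "frechet_derivative \<rho> (at (t0, z)) (0, v) > 0" .
        show ?thesis by (rule integral_chart_boundary[OF N(1) \<rho> v \<Omega>(1)]) (use \<Omega>_eq in auto)
      qed
    qed
  next
    have "open {z. infdist z A < \<eta>}" using cinf[of UNIV] by (auto intro!: open_Collect_less continuous_intros)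
    then show "closure (fiber \<Omega> t0) \<subseteq> interior K"
      by (intro order_trans[OF _ interior_maximal[of "{z. infdist z A < \<eta>}"]]) (use \<eta> in \<open>auto simp: K_def A_def\<close>)
  qed (use r K in auto)
qed

end

section \<open>The fiber integral of the monomial weight\<close>

definition mono_weight :: "('a \<times> (complex^'m::finite) \<Rightarrow> real) \<Rightarrow> ('m \<Rightarrow> nat) \<Rightarrow> 'a \<times> (complex^'m) \<Rightarrow> real" where
  "mono_weight \<phi> k x = (cmod (\<Prod>j\<in>UNIV. snd x $ j ^ k j))\<^sup>2 * exp (- \<phi> x)"

lemma monomial_integral_eq: "monomial_integral \<Omega> \<phi> k t = (LINT z|lborel. indicator \<Omega> (t, z) * mono_weight \<phi> k (t, z))"
  unfolding monomial_integral_def set_lebesgue_integral_def mono_weight_def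
  by (intro Bochner_Integration.integral_cong) (auto simp: fiber_def indicator_def)

lemma Ck_on_mono_weight:
  fixes \<phi> :: "'a::euclidean_space \<times> (complex^'m::finite) \<Rightarrow> real"
  assumes S: "open S" and \<phi>: "Ck_on 2 \<phi> S"
  shows "Ck_on 2 (mono_weight \<phi> k) S"
proof -
  have bl: "bounded_linear (\<lambda>x::'a \<times> (complex^'m). snd x $ j)" for j
    by (rule bounded_linear_compose[OF bounded_linear_vec_nth bounded_linear_snd])
  have "Ck_on 2 (\<lambda>x::'a \<times> (complex^'m). (\<Prod>j\<in>UNIV. (Re (snd x $ j) ^ 2 + Im (snd x $ j) ^ 2) ^ k j) * exp (- \<phi> x)) S"
    by (intro Ck_on_mult Ck_on_prod Ck_on_power Ck_on_add S Ck_on_compose[OF S open_UNIV Ck_on_exp Ck_on_minus[OF S \<phi>]]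
        Ck_on_linear[OF S] bounded_linear_compose[OF bounded_linear_Re bl] bounded_linear_compose[OF bounded_linear_Im bl]) auto
  moreover have "mono_weight \<phi> k x = (\<Prod>j\<in>UNIV. (Re (snd x $ j) ^ 2 + Im (snd x $ j) ^ 2) ^ k j) * exp (- \<phi> x)" for x
    by (simp add: mono_weight_def prod_norm[symmetric] norm_power prod_power_distrib power_mult[symmetric] mult.commute[of _ 2] power_mult cmod_power2)
  then have "mono_weight \<phi> k = (\<lambda>x. (\<Prod>j\<in>UNIV. (Re (snd x $ j) ^ 2 + Im (snd x $ j) ^ 2) ^ k j) * exp (- \<phi> x))" by (rule ext)
  ultimately show ?thesis by (simp only:)
qed

text \<open>Coordinate hyperplanes are null sets, which permits the passage to logarithms of the
  moduli in all integrals.\<close>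

lemma AE_vec_nonzero: "AE z in lborel. \<forall>j. (z :: complex^'m::finite) $ j \<noteq> 0"
proof -
  have "AE z in lborel. (z :: complex^'m) $ j \<noteq> 0" for j :: 'm
  proof -
    have "negligible {z::complex^'m. axis j 1 \<bullet> z = 0}" by (rule negligible_hyperplane) simp
    moreover have "closed {z::complex^'m. axis j 1 \<bullet> z = 0}" by (rule closed_hyperplane)
    ultimately have "{z::complex^'m. axis j 1 \<bullet> z = 0} \<in> null_sets lborel"
      by (auto simp: negligible_iff_null_sets null_sets_def)
    then show ?thesis
      by (rule AE_I') (auto simp: inner_axis')
  qed
  then have "\<forall>j\<in>UNIV. AE z in lborel. (z :: complex^'m) $ j \<noteq> 0" by blast
  then have "AE z in lborel. \<forall>j\<in>UNIV. (z :: complex^'m) $ j \<noteq> 0" by (subst AE_finite_all) auto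
  then show ?thesis by simp
qed

context spc_family
begin

text \<open>Regularity combines \<open>local_structure\<close>, which supplies a compact set of
  charts, with \<open>smooth_integral_cover\<close>. Positivity holds because the weight is nonzero
  almost everywhere and a nonempty open fiber is not a null set.\<close>

lemma Ck_on_monomial_integral:
  assumes NF: "open F" "closure \<Omega> \<inter> (U \<times> UNIV) \<subseteq> F" "Ck_on 2 \<phi> F"
  shows "Ck_on 2 (monomial_integral \<Omega> \<phi> k) U"
    and "\<And>t. t \<in> U \<Longrightarrow> integrable lborel (\<lambda>z. indicator \<Omega> (t, z) * mono_weight \<phi> k (t, z))"
    and "\<And>t. t \<in> U \<Longrightarrow> 0 < monomial_integral \<Omega> \<phi> k t"
proof -
  have *: "\<exists>V. open V \<and> t0 \<in> V \<and> smooth_integral V (\<lambda>x. indicator \<Omega> x * mono_weight \<phi> k x)" if t0: "t0 \<in> U" for t0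
  proof -
    obtain r K where rK: "0 < r" "cball t0 r \<subseteq> U" "compact K" "cball t0 r \<times> K \<subseteq> F \<inter> W"
      "\<forall>t\<in>cball t0 r. fiber \<Omega> t \<subseteq> K" "\<forall>z\<in>K. \<exists>V d. integral_chart \<Omega> t0 z V d"
      using local_structure[OF t0 NF(1,2)] by blast
    have "\<exists>V. open V \<and> t0 \<in> V \<and> V \<subseteq> ball t0 r \<and> smooth_integral V (\<lambda>x. indicator \<Omega> x * mono_weight \<phi> k x)"
    proof (rule smooth_integral_cover[OF rK(3)])
      show "ball t0 r \<times> K \<subseteq> F" using rK(4) by auto
      show "z \<in> K" if "t \<in> ball t0 r" "(t, z) \<in> \<Omega>" for t z using rK(5) that by (force simp: fiber_def)
    qed (use rK NF Ck_on_mono_weight in auto)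
    then show ?thesis by blast
  qed
  show "Ck_on 2 (monomial_integral \<Omega> \<phi> k) U"
  proof (rule Ck_on_local)
    fix t0 assume "t0 \<in> U"
    from *[OF this] show "\<exists>T. open T \<and> t0 \<in> T \<and> Ck_on 2 (monomial_integral \<Omega> \<phi> k) T"
      unfolding smooth_integral_def monomial_integral_eq[symmetric] by blast
  qed
  fix t assume t: "t \<in> U"
  show int: "integrable lborel (\<lambda>z. indicator \<Omega> (t, z) * mono_weight \<phi> k (t, z))"
    using *[OF t] unfolding smooth_integral_def by blast
  have nn: "0 \<le> indicator \<Omega> (t, z) * mono_weight \<phi> k (t, z)" for z by (simp add: mono_weight_def)
  have "monomial_integral \<Omega> \<phi> k t \<noteq> 0"
  proof
    assume "monomial_integral \<Omega> \<phi> k t = 0"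
    then have "AE z in lborel. indicator \<Omega> (t, z) * mono_weight \<phi> k (t, z) = 0"
      unfolding monomial_integral_eq using integral_nonneg_eq_0_iff_AE[OF int] nn by simp
    with AE_vec_nonzero have "AE z in lborel. z \<notin> fiber \<Omega> t"
      by eventually_elim (auto simp: mono_weight_def fiber_def)
    then have "fiber \<Omega> t \<in> null_sets lborel"
      using open_fiber[OF \<Omega>(1)] by (auto simp: AE_iff_null_sets)
    then have "negligible (fiber \<Omega> t)" unfolding negligible_iff_null_sets by (rule null_sets_completionI)
    then show False using open_not_negligible[OF open_fiber[OF \<Omega>(1)] fiber_ne[OF t]] by simp
  qed
  moreover have "0 \<le> monomial_integral \<Omega> \<phi> k t" unfolding monomial_integral_eq using nn by (intro integral_nonneg_AE) auto
  ultimately show "0 < monomial_integral \<Omega> \<phi> k t" by simp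
qed

end

section \<open>Reinhardt fibers in logarithmic coordinates\<close>

lemma bounded_linear_axis: "bounded_linear (axis i :: 'a::euclidean_space \<Rightarrow> 'a^'n::finite)"
proof -
  have "linear (axis i :: 'a \<Rightarrow> 'a^'n)" by (rule linearI) (simp_all add: vec_eq_iff axis_def)
  then show ?thesis by (rule linear_conv_bounded_linear[THEN iffD1])
qed

lemma vec_sum_axis: "(\<chi> j. g j) = (\<Sum>j\<in>UNIV. axis j (g j))" for g :: "'n::finite \<Rightarrow> 'a::euclidean_space"
  by (simp add: vec_eq_iff axis_def if_distrib cong: if_cong)

lemma has_derivative_vec_lambda:
  fixes f :: "'n::finite \<Rightarrow> 'z::real_normed_vector \<Rightarrow> 'a::euclidean_space"
  assumes "\<And>j. (f j has_derivative f' j) F"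
  shows "((\<lambda>x. \<chi> j. f j x) has_derivative (\<lambda>h. \<chi> j. f' j h)) F"
  unfolding vec_sum_axis
  by (intro has_derivative_sum bounded_linear.has_derivative[OF bounded_linear_axis] assms)

lemma LIMSEQ_in_closure:
  fixes l :: "'a::first_countable_topology"
  assumes "f \<longlonglongrightarrow> l" "\<And>n. f n \<in> S"
  shows "l \<in> closure S"
  using assms closure_sequential[of l S] by metis

definition cexp :: "complex^'m \<Rightarrow> complex^'m" where "cexp h = (\<chi> j. exp (h $ j))"
text \<open>The representative with positive coordinates of the torus orbit whose logarithmic moduli
  are x.\<close>

definition rexp :: "real^'m \<Rightarrow> complex^'m" where "rexp x = (\<chi> j. of_real (exp (x $ j)))"
definition vec_Re :: "complex^'m \<Rightarrow> real^'m" where "vec_Re h = (\<chi> j. Re (h $ j))"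
definition vec_of_real :: "real^'m \<Rightarrow> complex^'m" where "vec_of_real x = (\<chi> j. of_real (x $ j))"

lemma cexp_eq_torus_act: "cexp h = torus_act (\<lambda>j. Im (h $ j)) (rexp (vec_Re h))"
  by (simp add: cexp_def torus_act_def rexp_def vec_Re_def vec_eq_iff exp_eq_polar mult.commute)

lemma torus_act_add: "torus_act \<theta> (torus_act \<theta>' z) = torus_act (\<lambda>j. \<theta> j + \<theta>' j) z"
  by (simp add: torus_act_def vec_eq_iff flip: cis_mult)

lemma torus_act_0 [simp]: "torus_act (\<lambda>_. 0) z = z"
  by (simp add: torus_act_def vec_eq_iff)

lemma vec_Re_of_real [simp]: "vec_Re (vec_of_real x) = x"
  by (simp add: vec_Re_def vec_of_real_def)

lemma continuous_on_cexp [continuous_intros]: "continuous_on S f \<Longrightarrow> continuous_on S (\<lambda>x. cexp (f x :: complex^'m::finite))"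
  unfolding cexp_def by (intro continuous_intros)

lemma continuous_on_rexp [continuous_intros]: "continuous_on S f \<Longrightarrow> continuous_on S (\<lambda>x. rexp (f x :: real^'m::finite))"
  unfolding rexp_def by (intro continuous_intros)

text \<open>The source of all holomorphic discs used here: an affine base curve and a fiber part exp
  h with h holomorphic in each coordinate. The second derivative of h provides the acceleration
  asked for by \<open>holo_curve\<close>.\<close>

lemma holo_curve_cexp:
  fixes h h' h'' :: "complex \<Rightarrow> complex^'m::finite" and w :: "complex^'n::finite"
  assumes h: "\<And>j \<tau>. ((\<lambda>\<tau>. h \<tau> $ j) has_field_derivative h' \<tau> $ j) (at \<tau>)"
    and h': "\<And>j \<tau>. ((\<lambda>\<tau>. h' \<tau> $ j) has_field_derivative h'' \<tau> $ j) (at \<tau>)"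
    and h'': "continuous_on UNIV h''"
  shows "holo_curve (cscale \<i>) S (\<lambda>\<tau>. (t + \<tau> *s w, cexp (h \<tau>))) (\<lambda>\<tau>. (w, \<chi> j. h' \<tau> $ j * exp (h \<tau> $ j)))"
  unfolding holo_curve_def cscale_Re_Im[symmetric]
proof (intro conjI ballI exI[of _ "\<lambda>\<tau>. (0, \<chi> j. (h'' \<tau> $ j + (h' \<tau> $ j)^2) * exp (h \<tau> $ j))"])
  fix z
  have 1: "((\<lambda>\<tau>. t + \<tau> *s w) has_derivative (\<lambda>k. k *s w)) (at z)"
  proof -
    have "((\<lambda>\<tau>. t $ j + \<tau> * w $ j) has_derivative (\<lambda>k. k * w $ j)) (at z)" for j
      by (auto intro!: derivative_eq_intros)
    from has_derivative_vec_lambda[OF this] show ?thesis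
      by (simp add: vector_scalar_mult_def plus_vec_def)
  qed
  have e: "((\<lambda>\<tau>. exp (h \<tau> $ j)) has_field_derivative h' z $ j * exp (h z $ j)) (at z)" for j
    by (rule derivative_eq_intros h refl)+ simp
  have 2: "((\<lambda>\<tau>. cexp (h \<tau>)) has_derivative (\<lambda>k. k *s (\<chi> j. h' z $ j * exp (h z $ j)))) (at z)"
  proof -
    have "((\<lambda>\<tau>. exp (h \<tau> $ j)) has_derivative (\<lambda>k. k * (h' z $ j * exp (h z $ j)))) (at z)" for j
      using e[of j] unfolding has_field_derivative_def by (simp add: mult_commute_abs)
    from has_derivative_vec_lambda[OF this] show ?thesis
      by (simp add: vector_scalar_mult_def cexp_def)
  qed
  show "((\<lambda>\<tau>. (t + \<tau> *s w, cexp (h \<tau>))) has_derivative (\<lambda>k. cscale k (w, \<chi> j. h' z $ j * exp (h z $ j)))) (at z)"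
    using has_derivative_Pair[OF 1 2] by (simp add: cscale_def)
  have 3: "((\<lambda>\<tau>. \<chi> j. h' \<tau> $ j * exp (h \<tau> $ j)) has_derivative (\<lambda>k. k *s (\<chi> j. (h'' z $ j + (h' z $ j)^2) * exp (h z $ j)))) (at z)"
  proof -
    have "((\<lambda>\<tau>. h' \<tau> $ j * exp (h \<tau> $ j)) has_field_derivative (h'' z $ j + (h' z $ j)^2) * exp (h z $ j)) (at z)" for j
      using DERIV_mult[OF h' e, of j] by (simp add: algebra_simps power2_eq_square)
    then have "((\<lambda>\<tau>. h' \<tau> $ j * exp (h \<tau> $ j)) has_derivative (\<lambda>k. k * ((h'' z $ j + (h' z $ j)^2) * exp (h z $ j)))) (at z)" for j
      unfolding has_field_derivative_def by (simp add: mult_commute_abs)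
    from has_derivative_vec_lambda[OF this] show ?thesis
      by (simp add: vector_scalar_mult_def)
  qed
  show "((\<lambda>\<tau>. (w, \<chi> j. h' \<tau> $ j * exp (h \<tau> $ j))) has_derivative (\<lambda>k. cscale k (0, \<chi> j. (h'' z $ j + (h' z $ j)^2) * exp (h z $ j)))) (at z)"
    using has_derivative_Pair[OF has_derivative_const[of w] 3] by (simp add: cscale_def)
next
  have ch: "continuous_on S (\<lambda>\<tau>. h \<tau> $ j)" "continuous_on S (\<lambda>\<tau>. h' \<tau> $ j)" for j
    by (intro continuous_at_imp_continuous_on ballI DERIV_isCont[OF h] DERIV_isCont[OF h'])+
  show "continuous_on S (\<lambda>\<tau>. (0, \<chi> j. (h'' \<tau> $ j + (h' \<tau> $ j)^2) * exp (h \<tau> $ j)))"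
    by (intro continuous_intros ch continuous_on_subset[OF h'']) auto
qed

text \<open>The angles in \<open>torus_act\<close> range over a noncompact space. Vectors of unit
  complex numbers, acting by \<open>vmult\<close>, describe the same rotations with a compact
  parameter, so that maxima over rotations are attained.\<close>

definition torus_set :: "(complex^'m) set" where "torus_set = {u. \<forall>j. cmod (u $ j) = 1}"
definition vmult :: "complex^'m \<Rightarrow> complex^'m \<Rightarrow> complex^'m" where "vmult u z = (\<chi> j. u $ j * z $ j)"

lemma compact_torus_set: "compact (torus_set :: (complex^'m::finite) set)"
proof -
  have eq: "torus_set = (\<Inter>j. {u::complex^'m. cmod (u $ j) = 1})" by (auto simp: torus_set_def)
  have "closed (torus_set :: (complex^'m) set)"
    unfolding eq by (intro closed_INT ballI closed_Collect_eq continuous_intros)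
  moreover have "norm u \<le> real CARD('m)" if "u \<in> torus_set" for u :: "complex^'m"
  proof -
    have "norm u \<le> (\<Sum>j\<in>UNIV. cmod (u $ j))" unfolding norm_vec_def by (rule L2_set_le_sum) simp
    also have "\<dots> = real CARD('m)" using that by (simp add: torus_set_def)
    finally show ?thesis .
  qed
  then have "bounded (torus_set :: (complex^'m) set)" by (auto simp: bounded_iff)
  ultimately show ?thesis by (simp add: compact_eq_bounded_closed)
qed

lemma vmult_torus: "u \<in> torus_set \<Longrightarrow> \<exists>\<theta>. \<forall>z. vmult u z = torus_act \<theta> z"
proof -
  assume "u \<in> torus_set"
  then have "\<forall>j. \<exists>\<theta>. u $ j = cis \<theta>" unfolding torus_set_def using cis_Arg_unique
    by (metis (mono_tags, lifting) cis_Arg mem_Collect_eq norm_zero sgn_eq div_by_1 of_real_1 zero_neq_one)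
  then obtain \<theta> where "\<And>j. u $ j = cis (\<theta> j)" by metis
  then show ?thesis by (intro exI[of _ \<theta>]) (simp add: vmult_def torus_act_def vec_eq_iff)
qed

lemma torus_act_vmult: "torus_act \<theta> z = vmult (\<chi> j. cis (\<theta> j)) z" "(\<chi> j. cis (\<theta> j)) \<in> torus_set"
  by (simp_all add: torus_act_def vmult_def torus_set_def)

lemma continuous_on_vmult [continuous_intros]:
  "continuous_on S f \<Longrightarrow> continuous_on S g \<Longrightarrow> continuous_on S (\<lambda>x. vmult (f x) (g x :: complex^'m::finite))"
  unfolding vmult_def by (intro continuous_intros)

section \<open>Maximum principle for the defining function and convexity in logarithmic
  coordinates\<close>

locale reinhardt_family = spc_family U \<Omega> \<rho> N W
  for U :: "(complex^'n::finite) set" and \<Omega> :: "((complex^'n) \<times> (complex^'m::finite)) set"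
    and \<rho> :: "(complex^'n) \<times> (complex^'m) \<Rightarrow> real" and N W :: "((complex^'n) \<times> (complex^'m)) set" +
  assumes torus: "(t, z) \<in> \<Omega> \<Longrightarrow> (t, torus_act \<theta> z) \<in> \<Omega>"
begin

lemma torus_iff: "(t, torus_act \<theta> z) \<in> \<Omega> \<longleftrightarrow> (t, z) \<in> \<Omega>"
proof
  assume "(t, torus_act \<theta> z) \<in> \<Omega>"
  from torus[OF this, of "\<lambda>j. - \<theta> j"] show "(t, z) \<in> \<Omega>" by (simp add: torus_act_add)
qed (rule torus)

lemma torus_closure: "(t, z) \<in> closure \<Omega> \<Longrightarrow> (t, torus_act \<theta> z) \<in> closure \<Omega>"
proof -
  assume "(t, z) \<in> closure \<Omega>"
  then obtain f where f: "\<And>n. f n \<in> \<Omega>" "f \<longlonglongrightarrow> (t, z)" using closure_sequential[of "(t, z)" \<Omega>] by blast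
  have "(\<lambda>n. (fst (f n), torus_act \<theta> (snd (f n)))) \<longlonglongrightarrow> (fst (t, z), torus_act \<theta> (snd (t, z)))"
    unfolding torus_act_def by (intro tendsto_intros f(2))
  moreover have "(fst (f n), torus_act \<theta> (snd (f n))) \<in> \<Omega>" for n using torus[of "fst (f n)" "snd (f n)"] f(1)[of n] by simp
  ultimately have "(fst (t, z), torus_act \<theta> (snd (t, z))) \<in> closure \<Omega>" by (rule LIMSEQ_in_closure)
  then show ?thesis by simp
qed

definition logdom :: "complex^'n \<Rightarrow> (real^'m) set" where "logdom t = {x. (t, rexp x) \<in> \<Omega>}"

lemma cexp_in_\<Omega>: "(t, cexp h) \<in> \<Omega> \<longleftrightarrow> vec_Re h \<in> logdom t"
  by (simp add: cexp_eq_torus_act torus_iff logdom_def)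

lemma open_logdom: "open (logdom t)"
proof -
  have "open ((\<lambda>x. (t, rexp x)) -` \<Omega>)" by (intro open_vimage \<Omega>(1) continuous_intros)
  then show ?thesis by (simp add: logdom_def vimage_def)
qed

text \<open>The maximum principle as a contradiction: along a holomorphic curve in \<open>W\<close>,
  at a parameter with nonzero velocity the Laplacian of \<open>\<rho>\<close> is positive, which
  excludes a maximum.\<close>

lemma laplace_curve_pos:
  assumes hc: "holo_curve (cscale \<i>) S \<gamma> p" and S: "open S" "\<And>z. z \<in> S \<Longrightarrow> \<gamma> z \<in> W" and a: "a \<in> S" and p: "p a \<noteq> 0"
    and m: "\<And>z. z \<in> S \<Longrightarrow> \<rho> (\<gamma> z) \<le> \<rho> (\<gamma> a)"
  shows False
proof -
  have \<rho>W: "Ck_on 2 \<rho> W" using \<rho> W(3) by (rule Ck_on_subset)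
  note lc = levi_compose[OF S(1) W(1) \<rho>W hc S(2) bounded_linear_cscale cscale_J]
  have "laplace (\<lambda>z. \<rho> (\<gamma> z)) a \<le> 0" by (rule laplace_local_max[OF S(1) lc(1) a m])
  moreover have "laplace (\<lambda>z. \<rho> (\<gamma> z)) a = levi (cscale \<i>) \<rho> (\<gamma> a) (p a)" by (rule lc(2)[OF _ a])
  ultimately show False using levi_pos[OF S(2)[OF a] p] by simp
qed

text \<open>\<open>\<rho>\<close> is maximized over the segment and over all rotations together. A
  maximum at an interior point of the segment would be a maximum along a holomorphic curve, since
  complexifying the segment parameter only adds rotations.\<close>

lemma segment_max_principle:
  assumes t: "t \<in> U" and W: "\<And>s \<theta>. 0 \<le> s \<Longrightarrow> s \<le> 1 \<Longrightarrow> (t, torus_act \<theta> (rexp (x + s *\<^sub>R (y - x)))) \<in> W"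
    and b: "\<And>\<theta>. \<rho> (t, torus_act \<theta> (rexp x)) \<le> b" "\<And>\<theta>. \<rho> (t, torus_act \<theta> (rexp y)) \<le> b"
    and s: "0 \<le> s" "s \<le> 1"
  shows "\<rho> (t, torus_act \<theta> (rexp (x + s *\<^sub>R (y - x)))) \<le> b"
proof (rule ccontr)
  assume bad: "\<not> ?thesis"
  \<comment> \<open>Segment parameter times torus: a compact set on which the maximum is
    attained.\<close>
  define C where "C = {0..1::real} \<times> (torus_set :: (complex^'m) set)"
  define F where "F p = \<rho> (t, vmult (snd p) (rexp (x + fst p *\<^sub>R (y - x))))" for p
  have C: "compact C" unfolding C_def by (intro compact_Times compact_torus_set) simp
  have inW: "(t, vmult u (rexp (x + s *\<^sub>R (y - x)))) \<in> W" if "(s, u) \<in> C" for s u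
    using vmult_torus[of u] that W[of s] by (auto simp: C_def)
  have "continuous_on C F" unfolding F_def
    by (rule continuous_on_compose2[OF Ck_on_imp_continuous_on[OF \<rho>]])
      (use inW spc_family.W(3)[OF spc_family_axioms] in \<open>auto intro!: continuous_intros\<close>)
  moreover have "(s, \<chi> j. cis (\<theta> j)) \<in> C" using s torus_act_vmult(2) by (simp add: C_def)
  ultimately obtain p where p: "p \<in> C" "\<And>q. q \<in> C \<Longrightarrow> F q \<le> F p"
    using continuous_attains_sup[OF C] by blast
  obtain s1 u1 where p1: "p = (s1, u1)" by (cases p)
  obtain \<theta>1 where \<theta>1: "\<And>z. vmult u1 z = torus_act \<theta>1 z" using vmult_torus[of u1] p(1) p1 by (auto simp: C_def)
  have Fp: "F p = \<rho> (t, torus_act \<theta>1 (rexp (x + s1 *\<^sub>R (y - x))))" by (simp add: F_def p1 \<theta>1)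
  have max: "\<rho> (t, torus_act \<alpha> (rexp (x + r *\<^sub>R (y - x)))) \<le> F p" if "0 \<le> r" "r \<le> 1" for r \<alpha>
    using p(2)[of "(r, \<chi> j. cis (\<alpha> j))"] that by (auto simp: C_def F_def torus_act_vmult)
  have "b < F p" using bad max[OF s, of \<theta>] by linarith
  then have s1: "0 < s1" "s1 < 1"
    using b(1)[of \<theta>1] b(2)[of \<theta>1] p(1) Fp p1 by (auto simp: C_def less_le)
  have xy: "x \<noteq> y" using \<open>b < F p\<close> b(1)[of \<theta>1] Fp by auto
  define d where "d = (\<chi> j. complex_of_real ((y - x) $ j))"
  \<comment> \<open>The real part of zeta moves along the segment and its imaginary part rotates the
    coordinates. Every point of the curve over the strip \<open>S\<close> thus competes in the
    maximum over \<open>C\<close>.\<close>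
  define h where "h \<zeta> = (\<chi> j. of_real ((x + s1 *\<^sub>R (y - x)) $ j) + \<i> * of_real (\<theta>1 j) + \<zeta> * d $ j)" for \<zeta>
  have hc: "holo_curve (cscale \<i>) S (\<lambda>\<zeta>. (t + \<zeta> *s (0::complex^'n), cexp (h \<zeta>))) (\<lambda>\<zeta>. (0, \<chi> j. d $ j * exp (h \<zeta> $ j)))" for S
    by (rule holo_curve_cexp[where h''="\<lambda>_. 0"]) (auto simp: h_def intro!: derivative_eq_intros)
  define \<gamma> where "\<gamma> \<zeta> = (t + \<zeta> *s (0::complex^'n), cexp (h \<zeta>))" for \<zeta>
  have \<gamma>: "\<gamma> \<zeta> = (t, torus_act (\<lambda>j. \<theta>1 j + Im \<zeta> * (y - x) $ j) (rexp (x + (s1 + Re \<zeta>) *\<^sub>R (y - x))))" for \<zeta>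
    unfolding \<gamma>_def cexp_eq_torus_act by (simp add: h_def d_def vec_Re_def vec_eq_iff rexp_def torus_act_def algebra_simps)
  define S where "S = {\<zeta>. - s1 < Re \<zeta>} \<inter> {\<zeta>. Re \<zeta> < 1 - s1}"
  have S: "open S" unfolding S_def by (intro open_Int open_halfspace_Re_gt open_halfspace_Re_lt)
  have p0: "(0, \<chi> j. d $ j * exp (h 0 $ j)) \<noteq> (0 :: (complex^'n) \<times> (complex^'m))"
  proof -
    obtain j where "x $ j \<noteq> y $ j" using xy unfolding vec_eq_iff by blast
    then have "(y - x) $ j \<noteq> 0" by simp
    then have "(\<chi> j. d $ j * exp (h 0 $ j)) $ j \<noteq> 0" by (simp add: d_def)
    then show ?thesis by (auto simp: zero_prod_def vec_eq_iff)
  qed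
  show False
  proof (rule laplace_curve_pos[OF hc[of S, folded \<gamma>_def] S _ _ p0])
    show "\<gamma> z \<in> W" if "z \<in> S" for z unfolding \<gamma> using that by (intro W) (auto simp: S_def)
    show "\<rho> (\<gamma> z) \<le> \<rho> (\<gamma> 0)" if "z \<in> S" for z
    proof -
      have "\<rho> (\<gamma> z) \<le> F p" unfolding \<gamma> using that by (intro max) (auto simp: S_def)
      also have "F p = \<rho> (\<gamma> 0)" unfolding \<gamma> Fp by simp
      finally show ?thesis .
    qed
  qed (use s1 in \<open>auto simp: S_def\<close>)
qed

text \<open>Compactness of the torus turns negativity on an orbit into a uniform negative bound,
  which survives limits.\<close>

lemma torus_sup:
  assumes "x \<in> logdom t"
  obtains b where "b < 0" "\<And>\<theta>. \<rho> (t, torus_act \<theta> (rexp x)) \<le> b"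
proof -
  have inO: "(t, vmult u (rexp x)) \<in> \<Omega>" if "u \<in> torus_set" for u
    using vmult_torus[OF that] assms torus_iff by (auto simp: logdom_def)
  have "continuous_on torus_set (\<lambda>u. \<rho> (t, vmult u (rexp x)))"
    by (rule continuous_on_compose2[OF Ck_on_imp_continuous_on[OF \<rho>]])
      (use inO \<Omega>_eq in \<open>auto intro!: continuous_intros\<close>)
  from continuous_attains_sup[OF compact_torus_set _ this] torus_act_vmult(2)
  obtain u where u: "u \<in> torus_set" "\<And>u'. u' \<in> torus_set \<Longrightarrow> \<rho> (t, vmult u' (rexp x)) \<le> \<rho> (t, vmult u (rexp x))" by blast
  show thesis
  proof (rule that[of "\<rho> (t, vmult u (rexp x))"])
    show "\<rho> (t, vmult u (rexp x)) < 0" using inO[OF u(1)] \<Omega>_eq by auto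
    show "\<rho> (t, torus_act \<theta> (rexp x)) \<le> \<rho> (t, vmult u (rexp x))" for \<theta>
      using u(2) torus_act_vmult by metis
  qed
qed

text \<open>A fiber may meet the coordinate hyperplanes, which logarithmic coordinates omit, so
  connectedness does not transfer by an image argument. Instead a separation of the logarithmic
  domain is lifted to one of the fiber, testing a point p by the boxes \<open>X p d\<close> of
  nearby moduli; these remain nonempty and connected even if p has zero coordinates.\<close>

lemma connected_logdom:
  assumes t: "t \<in> U"
  shows "connected (logdom t)"
proof (rule ccontr)
  assume "\<not> connected (logdom t)"
  then obtain A B where AB: "open A" "open B" "logdom t \<subseteq> A \<union> B" "A \<inter> B \<inter> logdom t = {}" "A \<inter> logdom t \<noteq> {}" "B \<inter> logdom t \<noteq> {}"
    unfolding connected_def by blast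
  \<comment> \<open>A convex box of logarithmic coordinates: at a zero coordinate of p it is a
    half-line reaching to minus infinity.\<close>
  define X where "X p d = {x::real^'m. \<forall>j. \<bar>exp (x $ j) - cmod (p $ j)\<bar> < d}" for p :: "complex^'m" and d
  have Xmono: "X p d \<subseteq> X p d'" if "d \<le> d'" for p d d' using that by (auto simp: X_def intro: less_le_trans)
  have Xne: "X p d \<noteq> {}" if d: "0 < d" for p d
  proof -
    have "\<exists>y. \<bar>exp y - cmod (p $ j)\<bar> < d" for j
    proof (cases "p $ j = 0")
      case True
      then show ?thesis using d by (intro exI[of _ "ln (d/2)"]) auto
    next
      case False
      then show ?thesis using d by (intro exI[of _ "ln (cmod (p $ j))"]) auto
    qed
    then obtain f where "\<And>j. \<bar>exp (f j) - cmod (p $ j)\<bar> < d" by metis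
    then have "(\<chi> j. f j) \<in> X p d" by (simp add: X_def)
    then show ?thesis by blast
  qed
  have Xconv: "convex (X p d)" for p d
  proof -
    have "convex {x::real^'m. \<bar>exp (x $ j) - cmod (p $ j)\<bar> < d}" for j
    proof -
      have "is_interval {y::real. \<bar>exp y - cmod (p $ j)\<bar> < d}"
        unfolding is_interval_1 by (auto simp: abs_less_iff) (smt (verit) exp_le_cancel_iff)+
      then have "convex {y::real. \<bar>exp y - cmod (p $ j)\<bar> < d}" by (simp add: is_interval_convex_1)
      from convex_linear_vimage[OF _ this, of "\<lambda>x::real^'m. x $ j"] 
      show ?thesis by (simp add: vimage_def bounded_linear.linear[OF bounded_linear_vec_nth])
    qed
    moreover have "X p d = (\<Inter>j. {x::real^'m. \<bar>exp (x $ j) - cmod (p $ j)\<bar> < d})" by (auto simp: X_def)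
    ultimately show ?thesis by (simp add: convex_INT)
  qed
  have Xsub: "\<exists>d>0. X p d \<subseteq> logdom t" if p: "p \<in> fiber \<Omega> t" for p
  proof -
    obtain e where e: "0 < e" "ball p e \<subseteq> fiber \<Omega> t" using p open_fiber[OF \<Omega>(1)] open_contains_ball by blast
    define d where "d = e / (real CARD('m) + 1)"
    have d: "0 < d" "real CARD('m) * d < e" using e by (auto simp: d_def field_simps)
    have "X p d \<subseteq> logdom t"
    proof
      fix x assume x: "x \<in> X p d"
      define \<theta> where "\<theta> j = (if p $ j = 0 then 0 else Arg (p $ j))" for j
      define z where "z = torus_act \<theta> (rexp x)"
      have "cmod (z $ j - p $ j) < d" for j
      proof -
        have "p $ j = cis (\<theta> j) * of_real (cmod (p $ j))"
          by (cases "p $ j = 0") (auto simp: \<theta>_def cis_Arg sgn_eq)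
        then have "z $ j - p $ j = cis (\<theta> j) * of_real (exp (x $ j) - cmod (p $ j))"
          by (simp add: z_def torus_act_def rexp_def algebra_simps)
        then have "cmod (z $ j - p $ j) = \<bar>exp (x $ j) - cmod (p $ j)\<bar>" by (simp only: norm_mult norm_cis norm_of_real) simp
        then show ?thesis using x by (simp add: X_def)
      qed
      then have "norm (z - p) \<le> (\<Sum>j\<in>(UNIV::'m set). d)"
        unfolding norm_vec_def by (intro order_trans[OF L2_set_le_sum] sum_mono) (auto intro: less_imp_le)
      then have "z \<in> ball p e" using d by (simp add: dist_norm norm_minus_commute)
      then have "(t, z) \<in> \<Omega>" using e by (auto simp: fiber_def)
      then show "x \<in> logdom t" by (simp add: z_def torus_iff logdom_def)
    qed
    then show ?thesis using d by blast
  qed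
  have Xcont: "X q (d/2) \<subseteq> X p d" if q: "q \<in> ball p (d/2)" for p q d
  proof
    fix x assume x: "x \<in> X q (d/2)"
    have "\<bar>exp (x $ j) - cmod (p $ j)\<bar> < d" for j
    proof -
      have "cmod (p $ j - q $ j) < d/2" using q Finite_Cartesian_Product.norm_nth_le[of "p - q" j] by (simp add: dist_norm)
      moreover have "\<bar>cmod (q $ j) - cmod (p $ j)\<bar> \<le> cmod (p $ j - q $ j)" using norm_triangle_ineq3[of "q $ j" "p $ j"] by (simp add: norm_minus_commute)
      moreover have "\<bar>exp (x $ j) - cmod (q $ j)\<bar> < d/2" using x by (simp add: X_def)
      ultimately show ?thesis by linarith
    qed
    then show "x \<in> X p d" by (simp add: X_def)
  qed
  \<comment> \<open>The fiber points all of whose nearby positive moduli belong to \<open>E\<close>;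
    boxes being connected, each point belongs to \<open>T A\<close> or \<open>T B\<close>.\<close>
  define T where "T E = {p \<in> fiber \<Omega> t. \<exists>d>0. X p d \<subseteq> E \<inter> logdom t}" for E
  have oT: "open (T E)" for E
    unfolding open_contains_ball
  proof
    fix p assume p: "p \<in> T E"
    then obtain d where d: "d > 0" "X p d \<subseteq> E \<inter> logdom t" by (auto simp: T_def)
    obtain e where e: "0 < e" "ball p e \<subseteq> fiber \<Omega> t" using p open_fiber[OF \<Omega>(1)] open_contains_ball unfolding T_def by blast
    have "ball p (min e (d/2)) \<subseteq> T E"
    proof
      fix q assume "q \<in> ball p (min e (d/2))"
      then have "q \<in> ball p e" "q \<in> ball p (d/2)" by auto
      then show "q \<in> T E" using e d Xcont[of q p d] by (auto simp: T_def intro!: exI[of _ "d/2"])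
    qed
    then show "\<exists>e>0. ball p e \<subseteq> T E" using e d by (intro exI[of _ "min e (d/2)"]) auto
  qed
  have cover: "fiber \<Omega> t \<subseteq> T A \<union> T B"
  proof
    fix p assume p: "p \<in> fiber \<Omega> t"
    obtain d where d: "0 < d" "X p d \<subseteq> logdom t" using Xsub[OF p] by blast
    have "connected (X p d)" by (rule convex_connected[OF Xconv])
    then have "A \<inter> X p d = {} \<or> B \<inter> X p d = {}"
      by (rule connectedD[OF _ AB(1,2)]) (use d AB in auto)
    then have "X p d \<subseteq> A \<or> X p d \<subseteq> B" using d AB(3) by blast
    then show "p \<in> T A \<union> T B" using p d by (auto simp: T_def)
  qed
  have disj: "T A \<inter> T B \<inter> fiber \<Omega> t = {}"
  proof (rule ccontr)
    assume "T A \<inter> T B \<inter> fiber \<Omega> t \<noteq> {}"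
    then obtain p d d' where *: "0 < d" "X p d \<subseteq> A \<inter> logdom t" "0 < d'" "X p d' \<subseteq> B \<inter> logdom t" by (auto simp: T_def)
    obtain x where x: "x \<in> X p (min d d')" using Xne[of "min d d'" p] * by auto
    then have "x \<in> X p d" "x \<in> X p d'" using Xmono by (meson min.cobounded1 min.cobounded2 subsetD)+
    then show False using * AB(4) by blast
  qed
  have ne: "T E \<inter> fiber \<Omega> t \<noteq> {}" if E: "open E" "E \<inter> logdom t \<noteq> {}" and o: "E = A \<or> E = B" for E
  proof -
    obtain x where x: "x \<in> E" "x \<in> logdom t" using E by blast
    have p: "rexp x \<in> fiber \<Omega> t" using x by (simp add: logdom_def fiber_def)
    have xX: "x \<in> X (rexp x) d" if "0 < d" for d using that by (simp add: X_def rexp_def)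
    have "rexp x \<in> T A \<union> T B" using cover p by blast
    then obtain E' d where E': "E' = A \<or> E' = B" "rexp x \<in> T E'" "0 < d" "X (rexp x) d \<subseteq> E' \<inter> logdom t" by (auto simp: T_def)
    then have "x \<in> E'" using xX by blast
    then have "E' = E" using x AB(4) E'(1) o by blast
    then show ?thesis using E'(2) p by blast
  qed
  from connectedD[OF fiber_connected[OF t] oT[of A] oT[of B] disj cover] ne[OF AB(1,5)] ne[OF AB(2,6)] show False by auto
qed

text \<open>For fixed x the endpoints y whose whole segment from x lies in the domain form a clopen
  subset: open by the tube lemma, closed because \<open>segment_max_principle\<close> bounds
  \<open>\<rho>\<close> on a limiting segment by its negative maximum over the orbits of the
  endpoints. Connectedness then gives every y.\<close>

lemma convex_logdom:
  assumes t: "t \<in> U"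
  shows "convex (logdom t)"
proof -
  have seg: "x + s *\<^sub>R (y - x) \<in> logdom t" if x: "x \<in> logdom t" and y: "y \<in> logdom t" and s: "0 \<le> s" "s \<le> 1" for x y s
  proof -
    define S where "S = {y \<in> logdom t. \<forall>s\<in>{0..1}. x + s *\<^sub>R (y - x) \<in> logdom t}"
    have "openin (top_of_set (logdom t)) S"
    proof (rule openin_open_eq[OF open_logdom, THEN iffD2], intro conjI)
      show "open S"
        unfolding open_contains_ball
      proof
        fix y assume y: "y \<in> S"
        have o: "open ((\<lambda>p. x + snd p *\<^sub>R (fst p - x)) -` logdom t)" by (intro open_vimage open_logdom continuous_intros)
        have "{y} \<times> {0..1} \<subseteq> (\<lambda>p. x + snd p *\<^sub>R (fst p - x)) -` logdom t" using y by (auto simp: S_def)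
        from Elementary_Topology.tube_lemma[OF _ o this] obtain Y where Y: "y \<in> Y" "open Y" "Y \<times> {0..1} \<subseteq> (\<lambda>p. x + snd p *\<^sub>R (fst p - x)) -` logdom t" by auto
        have "Y \<inter> logdom t \<subseteq> S" using Y(3) by (auto simp: S_def)
        moreover have "open (Y \<inter> logdom t)" "y \<in> Y \<inter> logdom t" using Y y open_logdom by (auto simp: S_def)
        ultimately show "\<exists>e>0. ball y e \<subseteq> S" by (meson open_contains_ball subset_trans)
      qed
    qed (auto simp: S_def)
    moreover have "closedin (top_of_set (logdom t)) S"
      unfolding closedin_limpt
    proof (intro conjI allI impI)
      fix y assume "y islimpt S \<and> y \<in> logdom t"
      then have yl: "y islimpt S" and yD: "y \<in> logdom t" by auto
      have "y \<in> closure S" using yl by (simp add: closure_def)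
      then obtain f where f: "\<And>n. f n \<in> S" "f \<longlonglongrightarrow> y" using closure_sequential[of y S] by blast
      have cl: "(t, torus_act \<theta> (rexp (x + s *\<^sub>R (y - x)))) \<in> closure \<Omega> \<inter> (U \<times> UNIV)" if s: "0 \<le> s" "s \<le> 1" for s \<theta>
      proof -
        have 1: "(\<lambda>n. (t, rexp (x + s *\<^sub>R (f n - x)))) \<longlonglongrightarrow> (t, rexp (x + s *\<^sub>R (y - x)))"
          unfolding rexp_def by (intro tendsto_intros f(2))
        have "(t, rexp (x + s *\<^sub>R (y - x))) \<in> closure \<Omega>"
          by (rule LIMSEQ_in_closure[OF 1]) (use f(1) s in \<open>auto simp: S_def logdom_def\<close>)
        then show ?thesis using torus_closure t by auto
      qed
      obtain b1 where b1: "b1 < 0" "\<And>\<theta>. \<rho> (t, torus_act \<theta> (rexp x)) \<le> b1" using torus_sup[OF x] by blast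
      obtain b2 where b2: "b2 < 0" "\<And>\<theta>. \<rho> (t, torus_act \<theta> (rexp y)) \<le> b2" using torus_sup[OF yD] by blast
      have "x + s *\<^sub>R (y - x) \<in> logdom t" if s: "s \<in> {0..1}" for s
      proof -
        have "\<rho> (t, torus_act (\<lambda>_. 0) (rexp (x + s *\<^sub>R (y - x)))) \<le> max b1 b2"
        proof (rule segment_max_principle[OF t])
          show "(t, torus_act \<theta> (rexp (x + s *\<^sub>R (y - x)))) \<in> W" if "0 \<le> s" "s \<le> 1" for s \<theta> using cl[OF that] W(2) by blast
          show "\<rho> (t, torus_act \<theta> (rexp x)) \<le> max b1 b2" for \<theta> using b1(2)[of \<theta>] by simp
          show "\<rho> (t, torus_act \<theta> (rexp y)) \<le> max b1 b2" for \<theta> using b2(2)[of \<theta>] by simp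
        qed (use s in auto)
        moreover have "(t, rexp (x + s *\<^sub>R (y - x))) \<in> N" using cl[of s "\<lambda>_. 0"] s W by auto
        ultimately have "(t, rexp (x + s *\<^sub>R (y - x))) \<in> \<Omega>" using b1(1) b2(1) by (subst \<Omega>_eq) auto
        then show ?thesis by (simp add: logdom_def)
      qed
      then show "y \<in> S" using yD by (simp add: S_def)
    qed (auto simp: S_def)
    moreover have "x \<in> S" using x by (simp add: S_def)
    ultimately have "S = logdom t" using connected_logdom[OF t] unfolding connected_clopen by blast
    then have "y \<in> S" using y by simp
    then show ?thesis using s by (auto simp: S_def)
  qed
  show ?thesis
  proof (rule convexI)
    fix x y and u v :: real assume *: "x \<in> logdom t" "y \<in> logdom t" "0 \<le> u" "0 \<le> v" "u + v = 1"
    then have "u = 1 - v" by simp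
    then have "u *\<^sub>R x + v *\<^sub>R y = x + v *\<^sub>R (y - x)" by (simp only:) (simp add: algebra_simps)
    then show "u *\<^sub>R x + v *\<^sub>R y \<in> logdom t" using seg[of x y v] * by simp
  qed
qed

text \<open>\<open>segment_max_principle\<close> again, now on segments already known to lie in the
  domain. It makes the slices of the compact exhaustion in \<open>circle_volume\<close>
  convex.\<close>

lemma convex_sublevel:
  assumes t: "t \<in> U"
  shows "convex {x \<in> logdom t. \<forall>\<theta>. \<rho> (t, torus_act \<theta> (rexp x)) \<le> b}"
proof (rule convexI)
  fix x y and u v :: real
  assume *: "x \<in> {x \<in> logdom t. \<forall>\<theta>. \<rho> (t, torus_act \<theta> (rexp x)) \<le> b}" "y \<in> {x \<in> logdom t. \<forall>\<theta>. \<rho> (t, torus_act \<theta> (rexp x)) \<le> b}"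
    "0 \<le> u" "0 \<le> v" "u + v = 1"
  have "u = 1 - v" using *(5) by simp
  then have eq: "u *\<^sub>R x + v *\<^sub>R y = x + v *\<^sub>R (y - x)" by (simp only:) (simp add: algebra_simps)
  have D: "x + s *\<^sub>R (y - x) \<in> logdom t" if "0 \<le> s" "s \<le> 1" for s
    using convexD[OF convex_logdom[OF t], of x y "1-s" s] * that by (simp add: algebra_simps)
  have "\<rho> (t, torus_act \<theta> (rexp (x + v *\<^sub>R (y - x)))) \<le> b" for \<theta>
  proof (rule segment_max_principle[OF t])
    show "(t, torus_act \<theta> (rexp (x + s *\<^sub>R (y - x)))) \<in> W" if "0 \<le> s" "s \<le> 1" for s \<theta>
    proof -
      have "(t, torus_act \<theta> (rexp (x + s *\<^sub>R (y - x)))) \<in> \<Omega>" using D[OF that] by (simp add: torus_iff logdom_def)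
      then show ?thesis using W(2) \<Omega>(2) closure_subset by blast
    qed
  qed (use * in auto)
  then show "u *\<^sub>R x + v *\<^sub>R y \<in> {x \<in> logdom t. \<forall>\<theta>. \<rho> (t, torus_act \<theta> (rexp x)) \<le> b}"
    unfolding eq using D[of v] * by auto
qed

text \<open>A continuity argument in a parameter s that contracts h to the constant c. The set of
  good s contains 0 and is open by compactness of the disc. It is closed because convexity keeps the
  boundary of the disc inside, so a limiting disc could touch the boundary of
  \<open>\<Omega>\<close> only at an interior parameter, where \<open>\<rho>\<close> along it would
  have a maximum with velocity component w nonzero.\<close>

lemma holomorphic_disc_in_\<Omega>:
  fixes h h' h'' :: "complex \<Rightarrow> complex^'m" and w :: "complex^'n"
  assumes h: "\<And>j \<tau>. ((\<lambda>\<tau>. h \<tau> $ j) has_field_derivative h' \<tau> $ j) (at \<tau>)"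
    and h': "\<And>j \<tau>. ((\<lambda>\<tau>. h' \<tau> $ j) has_field_derivative h'' \<tau> $ j) (at \<tau>)"
    and h'': "continuous_on UNIV h''" and w: "w \<noteq> 0"
    and tU: "\<And>\<tau>. cmod \<tau> \<le> r \<Longrightarrow> t0 + \<tau> *s w \<in> U"
    and c: "\<And>\<tau>. cmod \<tau> \<le> r \<Longrightarrow> c \<in> logdom (t0 + \<tau> *s w)"
    and bd: "\<And>\<tau>. cmod \<tau> = r \<Longrightarrow> vec_Re (h \<tau>) \<in> logdom (t0 + \<tau> *s w)"
    and \<tau>: "cmod \<tau> \<le> r"
  shows "(t0 + \<tau> *s w, cexp (h \<tau>)) \<in> \<Omega>"
proof -
  \<comment> \<open>The real part of \<open>H s\<close> is a convex combination of c and that of h,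
    while each \<open>H s\<close> stays holomorphic.\<close>
  define H where "H s \<tau> = vec_of_real c + of_real s *s (h \<tau> - vec_of_real c)" for s and \<tau> :: complex
  define \<Gamma> where "\<Gamma> p = (t0 + snd p *s w, cexp (H (fst p) (snd p)))" for p :: "real \<times> complex"
  have chj: "continuous_on S (\<lambda>\<tau>. h \<tau> $ j)" for S j
    by (intro continuous_at_imp_continuous_on ballI DERIV_isCont[OF h])
  have ch: "continuous_on UNIV (\<lambda>\<tau>. \<chi> j. h \<tau> $ j)" by (intro continuous_intros chj)
  then have ch: "continuous_on UNIV h" by simp
  have c\<Gamma>: "continuous_on S \<Gamma>" for S
    unfolding \<Gamma>_def H_def vector_scalar_mult_def vec_of_real_def
    by (intro continuous_intros continuous_on_compose2[OF ch]) auto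
  define S where "S = {s\<in>{0..1}. \<forall>\<tau>\<in>cball 0 r. \<Gamma> (s, \<tau>) \<in> \<Omega>}"
  have o: "openin (top_of_set {0..1}) S"
  proof -
    have "\<exists>X. open X \<and> s \<in> X \<and> X \<inter> {0..1} \<subseteq> S" if s: "s \<in> S" for s
    proof -
      have o: "open (\<Gamma> -` \<Omega>)" using c\<Gamma> \<Omega>(1) by (intro open_vimage) auto
      have "{s} \<times> cball 0 r \<subseteq> \<Gamma> -` \<Omega>" using s by (auto simp: S_def)
      from Elementary_Topology.tube_lemma[OF compact_cball o this] obtain X where "s \<in> X" "open X" "X \<times> cball 0 r \<subseteq> \<Gamma> -` \<Omega>" by blast
      then show ?thesis by (intro exI[of _ X]) (auto simp: S_def)
    qed
    then show ?thesis unfolding openin_subopen[of _ S] openin_open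
      by (metis (no_types, lifting) Int_commute Int_iff S_def mem_Collect_eq)
  qed
  have bd': "\<Gamma> (s, \<tau>) \<in> \<Omega>" if s: "s \<in> {0..1}" and \<tau>: "cmod \<tau> = r" for s \<tau>
  proof -
    have "vec_Re (H s \<tau>) = (1 - s) *\<^sub>R c + s *\<^sub>R vec_Re (h \<tau>)"
      by (simp add: H_def vec_Re_def vec_of_real_def vec_eq_iff algebra_simps)
    also have "\<dots> \<in> logdom (t0 + \<tau> *s w)"
      by (rule convexD[OF convex_logdom[OF tU] c bd]) (use s \<tau> in auto)
    finally show ?thesis by (simp add: \<Gamma>_def cexp_in_\<Omega>)
  qed
  have cl: "closedin (top_of_set {0..1}) S"
    unfolding closedin_limpt
  proof (intro conjI allI impI)
    fix s assume "s islimpt S \<and> s \<in> {0..1}"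
    then have sl: "s islimpt S" and s: "s \<in> {0..1}" by auto
      have "s \<in> closure S" using sl by (simp add: closure_def)
      then obtain f where f: "\<And>n. f n \<in> S" "f \<longlonglongrightarrow> s" using closure_sequential[of s S] by blast
    have clo: "\<Gamma> (s, \<tau>) \<in> closure \<Omega> \<inter> (U \<times> UNIV)" if \<tau>: "cmod \<tau> \<le> r" for \<tau>
    proof -
      have 1: "(\<lambda>n. (f n, \<tau>)) \<longlonglongrightarrow> (s, \<tau>)" by (intro tendsto_intros f(2))
      have 2: "isCont \<Gamma> (s, \<tau>)" using c\<Gamma>[of UNIV] by (simp add: continuous_on_eq_continuous_at)
      have "\<Gamma> (s, \<tau>) \<in> closure \<Omega>"
        by (rule LIMSEQ_in_closure[OF isCont_tendsto_compose[OF 2 1]]) (use f(1) \<tau> in \<open>auto simp: S_def\<close>)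
      then show ?thesis using tU[OF \<tau>] by (simp add: \<Gamma>_def)
    qed
    have "\<Gamma> (s, \<tau>) \<in> \<Omega>" if \<tau>: "cmod \<tau> \<le> r" for \<tau>
    proof (rule ccontr)
      assume bad: "\<Gamma> (s, \<tau>) \<notin> \<Omega>"
      then have \<tau>r: "cmod \<tau> < r" using bd'[OF s, of \<tau>] \<tau> by (cases "cmod \<tau> = r") auto
      have "\<rho> (\<Gamma> (s, \<tau>)) = 0" using \<rho>_le_0[OF clo[OF \<tau>]] bad \<Omega>_eq by (auto simp: less_le)
      have hc: "holo_curve (cscale \<i>) (ball 0 r) (\<lambda>\<tau>. (t0 + \<tau> *s w, cexp (H s \<tau>))) (\<lambda>\<tau>. (w, \<chi> j. (of_real s *s h' \<tau>) $ j * exp (H s \<tau> $ j)))"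
      proof (rule holo_curve_cexp[where h''="\<lambda>\<tau>. of_real s *s h'' \<tau>"])
        show "((\<lambda>\<tau>. H s \<tau> $ j) has_field_derivative (of_real s *s h' \<tau>) $ j) (at \<tau>)" for j \<tau>
          unfolding H_def by (auto intro!: derivative_eq_intros h)
        show "((\<lambda>\<tau>. (of_real s *s h' \<tau>) $ j) has_field_derivative (of_real s *s h'' \<tau>) $ j) (at \<tau>)" for j \<tau>
          by (auto intro!: derivative_eq_intros h')
        show "continuous_on UNIV (\<lambda>\<tau>. of_real s *s h'' \<tau>)" unfolding vector_scalar_mult_def by (intro continuous_intros h'')
      qed
      show False
      proof (rule laplace_curve_pos[OF hc open_ball, of \<tau>])
        show "(t0 + z *s w, cexp (H s z)) \<in> W" if "z \<in> ball 0 r" for z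
          using clo[of z] that W(2) by (auto simp: \<Gamma>_def)
        show "\<rho> (t0 + z *s w, cexp (H s z)) \<le> \<rho> (t0 + \<tau> *s w, cexp (H s \<tau>))" if "z \<in> ball 0 r" for z
          using \<rho>_le_0[OF clo[of z]] that \<open>\<rho> (\<Gamma> (s, \<tau>)) = 0\<close> by (auto simp: \<Gamma>_def)
        show "(w, \<chi> j. (of_real s *s h' \<tau>) $ j * exp (H s \<tau> $ j)) \<noteq> 0" using w by (simp add: zero_prod_def)
      qed (use \<tau>r in auto)
    qed
    then show "s \<in> S" using s by (auto simp: S_def)
  qed (auto simp: S_def)
  have "0 \<in> S"
  proof -
    have "H 0 \<tau> = vec_of_real c" for \<tau> by (simp add: H_def vec_eq_iff)
    then show ?thesis using c by (auto simp: S_def \<Gamma>_def cexp_in_\<Omega>)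
  qed
  moreover have "connected {0..1::real}" by (rule connected_Icc)
  ultimately have "S = {0..1}" using o cl unfolding connected_clopen by blast
  then have "1 \<in> S" by simp
  then have "\<Gamma> (1, \<tau>) \<in> \<Omega>" using \<tau> by (auto simp: S_def)
  moreover have "H 1 \<tau> = h \<tau>" by (simp add: H_def vec_eq_iff)
  ultimately show ?thesis by (simp add: \<Gamma>_def)
qed

end

section \<open>Holomorphic discs with prescribed boundary values\<close>

definition circle_measure :: "real measure" where
  "circle_measure = density lborel (\<lambda>\<theta>. ennreal (indicator {0..2*pi} \<theta> / (2*pi)))"

lemma sets_circle_measure [simp, measurable_cong]: "sets circle_measure = sets borel"
  and space_circle_measure [simp]: "space circle_measure = UNIV"
  by (simp_all add: circle_measure_def)

lemma prob_space_circle_measure: "prob_space circle_measure"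
proof (rule prob_spaceI)
  have "emeasure circle_measure (space circle_measure) = (\<integral>\<^sup>+\<theta>. ennreal (1/(2*pi)) * indicator {0..2*pi} \<theta> \<partial>lborel)"
    unfolding circle_measure_def by (subst emeasure_density) (auto intro!: nn_integral_cong simp: indicator_def)
  also have "\<dots> = ennreal (1/(2*pi)) * ennreal (2*pi)" by (subst nn_integral_cmult_indicator) auto
  also have "\<dots> = 1" by (subst ennreal_mult[symmetric]) auto
  finally show "emeasure circle_measure (space circle_measure) = 1" .
qed

interpretation circle: prob_space circle_measure by (rule prob_space_circle_measure)

lemma LINT_circle_continuous:
  fixes f :: "real \<Rightarrow> real"
  assumes "continuous_on {0..2*pi} f" "f \<in> borel_measurable borel"
  shows "(LINT \<theta>|circle_measure. f \<theta>) = integral {0..2*pi} f / (2*pi)"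
proof -
  have "(LINT \<theta>|circle_measure. f \<theta>) = (LINT \<theta>|lborel. (indicator {0..2*pi} \<theta> / (2*pi)) *\<^sub>R f \<theta>)"
    unfolding circle_measure_def by (rule integral_density) (use assms(2) in auto)
  also have "\<dots> = (LINT \<theta>|lborel. indicator {0..2*pi} \<theta> *\<^sub>R f \<theta>) / (2*pi)" by simp
  also have "(LINT \<theta>|lborel. indicator {0..2*pi} \<theta> *\<^sub>R f \<theta>) = integral {0..2*pi} f"
  proof -
    have "set_integrable lborel {0..2*pi} f"
      unfolding set_integrable_def by (intro borel_integrable_compact assms(1)) auto
    from set_borel_integral_eq_integral(2)[OF this] show ?thesis unfolding set_lebesgue_integral_def .
  qed
  finally show ?thesis .
qed

lemma AE_circle: "AE \<theta> in lborel. P \<theta> \<Longrightarrow> AE \<theta> in circle_measure. P \<theta>"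
  unfolding circle_measure_def by (subst AE_density) (auto elim!: eventually_mono)

lemma AE_circle_interval: "AE \<theta> in circle_measure. \<theta> \<in> {0<..<2*pi}"
proof -
  have "AE \<theta> in lborel. \<theta> \<noteq> (0::real)" "AE \<theta> in lborel. \<theta> \<noteq> 2*pi" by (rule AE_lborel_singleton)+
  then have "AE \<theta> in lborel. 0 < ennreal (indicator {0..2*pi} \<theta> / (2*pi)) \<longrightarrow> \<theta> \<in> {0<..<2*pi}"
    by eventually_elim (auto simp: indicator_def split: if_splits)
  then show ?thesis unfolding circle_measure_def by (subst AE_density) auto
qed

section \<open>Continuous loops as limits of real parts of polynomials\<close>

lemma has_integral_cis_power:
  assumes "0 < k" shows "((\<lambda>\<theta>. cis \<theta> ^ k) has_integral 0) {0..2*pi}"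
proof -
  have "((\<lambda>\<theta>. cis (real k * \<theta>)) has_integral (cis (real k * (2*pi)) / (\<i> * real k) - cis (real k * 0) / (\<i> * real k))) {0..2*pi}"
  proof (rule fundamental_theorem_of_calculus)
    fix \<theta>
    have "((\<lambda>\<theta>. cis (real k * \<theta>) / (\<i> * real k)) has_derivative (\<lambda>h. h *\<^sub>R cis (real k * \<theta>))) (at \<theta> within {0..2*pi})"
    proof -
      have "((\<lambda>\<theta>. cis (real k * \<theta>)) has_derivative (\<lambda>h. (real k * h) *\<^sub>R (\<i> * cis (real k * \<theta>)))) (at \<theta> within {0..2*pi})"
        by (rule has_derivative_cis) (auto intro!: derivative_eq_intros)
      from has_derivative_mult_left[OF this, of "inverse (\<i> * real k)"]
      show ?thesis unfolding divide_inverse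
        by (rule has_derivative_eq_rhs) (use assms in \<open>simp add: fun_eq_iff scaleR_conv_of_real field_simps\<close>)
    qed
    then show "((\<lambda>\<theta>. cis (real k * \<theta>) / (\<i> * real k)) has_vector_derivative cis (real k * \<theta>)) (at \<theta> within {0..2*pi})"
      by (simp add: has_vector_derivative_def)
  qed simp
  moreover have "cis (real k * (2*pi)) = 1"
    using Complex.DeMoivre[of "2*pi" k] by simp
  ultimately show ?thesis by (simp add: Complex.DeMoivre)
qed

lemma circle_mean_poly: "(LINT \<theta>|circle_measure. Re (poly P (of_real r * cis \<theta>))) = Re (poly P 0)"
proof -
  have "((\<lambda>\<theta>. \<Sum>i\<le>degree P. (coeff P i * of_real r ^ i) * cis \<theta> ^ i) has_integral (\<Sum>i\<le>degree P. (coeff P i * of_real r ^ i) * (if i = 0 then 2*pi else 0))) {0..2*pi}"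
  proof (intro has_integral_sum has_integral_mult_right)
    fix i
    show "((\<lambda>\<theta>. cis \<theta> ^ i) has_integral complex_of_real (if i = 0 then 2*pi else 0)) {0..2*pi}"
      using has_integral_cis_power[of i] has_integral_const_real[of "1::complex" 0 "2*pi"]
      by (cases "i = 0") (auto simp: scaleR_conv_of_real)
  qed simp
  moreover have "(\<Sum>i\<le>degree P. (coeff P i * of_real r ^ i) * (if i = 0 then 2*pi else 0)) = poly P 0 * (2*pi)"
  proof -
    have "(\<Sum>i\<le>degree P. (coeff P i * of_real r ^ i) * (if i = 0 then 2*pi else 0)) = (\<Sum>i\<le>degree P. if i = 0 then coeff P 0 * (2*pi) else 0)"
      by (rule sum.cong) auto
    then show ?thesis by (simp add: poly_0_coeff_0)
  qed
  moreover have "(\<Sum>i\<le>degree P. (coeff P i * of_real r ^ i) * cis \<theta> ^ i) = poly P (of_real r * cis \<theta>)" for \<theta>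
    by (simp add: poly_altdef power_mult_distrib mult.assoc)
  ultimately have "((\<lambda>\<theta>. poly P (of_real r * cis \<theta>)) has_integral poly P 0 * (2*pi)) {0..2*pi}" by simp
  from has_integral_linear[OF this bounded_linear_Re]
  have "((\<lambda>\<theta>. Re (poly P (of_real r * cis \<theta>))) has_integral Re (poly P 0) * (2*pi)) {0..2*pi}" by (simp add: comp_def)
  then have "integral {0..2*pi} (\<lambda>\<theta>. Re (poly P (of_real r * cis \<theta>))) = Re (poly P 0) * (2*pi)" by (rule integral_unique)
  moreover have c: "continuous_on S (\<lambda>\<theta>. Re (poly P (of_real r * cis \<theta>)))" for S by (intro continuous_intros)
  ultimately show ?thesis by (subst LINT_circle_continuous[OF c borel_measurable_continuous_onI[OF c]]) simp
qed

text \<open>On the unit circle the conjugate of u is its inverse, so the product is a trigonometric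
  polynomial; taking conjugates of the negative frequencies does not change real parts. The
  induction multiplies out the constant terms and uses u cnj u = 1 on the rest.\<close>

lemma Re_poly_cnj_poly:
  "\<exists>s. \<forall>u. cmod u = 1 \<longrightarrow> Re (poly p u * cnj (poly q u)) = Re (poly s u)"
proof (induction p arbitrary: q rule: pCons_induct)
  case 0
  show ?case by (intro exI[of _ 0]) simp
next
  case (pCons a p)
  obtain b q' where q: "q = pCons b q'" by (cases q)
  obtain s where s: "\<And>u. cmod u = 1 \<Longrightarrow> Re (poly p u * cnj (poly q' u)) = Re (poly s u)" using pCons.IH by metis
  show ?case
  proof (intro exI[of _ "[:a * cnj b:] + smult (cnj b) (pCons 0 p) + smult (cnj a) (pCons 0 q') + s"] allI impI)
    fix u :: complex assume u: "cmod u = 1"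
    have uu: "u * cnj u = 1" using u by (simp add: complex_norm_square[symmetric])
    have "poly (pCons a p) u * cnj (poly q u) = a * cnj b + cnj b * (u * poly p u) + cnj (cnj a * (u * poly q' u)) + (u * cnj u) * (poly p u * cnj (poly q' u))"
      by (simp add: q algebra_simps)
    also have "\<dots> = a * cnj b + cnj b * (u * poly p u) + cnj (cnj a * (u * poly q' u)) + poly p u * cnj (poly q' u)"
      by (simp only: uu mult_1)
    finally have e: "poly (pCons a p) u * cnj (poly q u) = a * cnj b + cnj b * (u * poly p u) + cnj (cnj a * (u * poly q' u)) + poly p u * cnj (poly q' u)" .
    have f: "poly ([:a * cnj b:] + smult (cnj b) (pCons 0 p) + smult (cnj a) (pCons 0 q') + s) u = a * cnj b + cnj b * (u * poly p u) + cnj a * (u * poly q' u) + poly s u" by (simp add: algebra_simps)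
    have "Re (A + B + cnj C + D) = Re (A + B + C + E)" if "Re D = Re E" for A B C D E using that by simp
    from this[OF s[OF u]]
    show "Re (poly (pCons a p) u * cnj (poly q u)) = Re (poly ([:a * cnj b:] + smult (cnj b) (pCons 0 p) + smult (cnj a) (pCons 0 q') + s) u)"
      unfolding e f .
  qed
qed

text \<open>Products are the interesting case: Re a Re b is half of Re (a b) + Re (a cnj b), and
  \<open>Re_poly_cnj_poly\<close> makes the second term a real part of a polynomial as well. The
  Dirichlet problem for such data is solved by an entire function.\<close>

lemma real_polynomial_on_circle:
  assumes "real_polynomial_function (g :: complex \<Rightarrow> real)"
  shows "\<exists>P. \<forall>u. cmod u = 1 \<longrightarrow> g u = Re (poly P u)"
  using assms
proof (induction rule: real_polynomial_function.induct)
  case (linear f)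
  have "f u = Re (poly [:0, of_real (f 1) - \<i> * of_real (f \<i>):] u)" for u
  proof -
    note L = bounded_linear.linear[OF linear]
    have "f (Re u *\<^sub>R 1 + Im u *\<^sub>R \<i>) = Re u * f 1 + Im u * f \<i>"
      unfolding linear_add[OF L] linear_scale[OF L] by simp
    moreover have "Re u *\<^sub>R 1 + Im u *\<^sub>R \<i> = u" by (simp add: complex_eq_iff)
    ultimately have "f u = Re u * f 1 + Im u * f \<i>" by (simp only:)
    then show ?thesis by simp
  qed
  then show ?case by blast
next
  case (const c)
  show ?case by (intro exI[of _ "[:of_real c:]"]) simp
next
  case (add f g)
  then obtain P Q where "\<And>u. cmod u = 1 \<Longrightarrow> f u = Re (poly P u)" "\<And>u. cmod u = 1 \<Longrightarrow> g u = Re (poly Q u)" by blast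
  then show ?case by (intro exI[of _ "P + Q"]) simp
next
  case (mult f g)
  then obtain P Q where PQ: "\<And>u. cmod u = 1 \<Longrightarrow> f u = Re (poly P u)" "\<And>u. cmod u = 1 \<Longrightarrow> g u = Re (poly Q u)" by blast
  obtain s where s: "\<And>u. cmod u = 1 \<Longrightarrow> Re (poly P u * cnj (poly Q u)) = Re (poly s u)" using Re_poly_cnj_poly by metis
  have "f u * g u = Re (poly (smult (1/2) (P * Q + s)) u)" if u: "cmod u = 1" for u
  proof -
    have "f u * g u = (Re (poly P u * poly Q u) + Re (poly P u * cnj (poly Q u))) / 2" unfolding PQ[OF u] by simp
    also have "\<dots> = (Re (poly P u * poly Q u) + Re (poly s u)) / 2" unfolding s[OF u] ..
    also have "\<dots> = Re ((1/2) * (poly P u * poly Q u + poly s u))" by simp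
    finally show ?thesis by (simp only: poly_smult poly_add poly_mult)
  qed
  then show ?case by blast
qed

text \<open>Stone-Weierstrass in each coordinate, followed by the replacement of real polynomials by
  real parts of complex ones. The 1 added to the number of coordinates makes the final estimate
  strict.\<close>

lemma circle_poly_approx:
  fixes Y :: "complex \<Rightarrow> real^'m::finite"
  assumes Y: "continuous_on (sphere 0 1) Y" and e: "0 < e"
  shows "\<exists>P. \<forall>u. cmod u = 1 \<longrightarrow> norm (Y u - (\<chi> j. Re (poly (P j) u))) < e"
proof -
  define d where "d = e / (real CARD('m) + 1)"
  have d: "0 < d" "real CARD('m) * d < e" using e by (auto simp: d_def field_simps)
  have "\<exists>P. \<forall>u. cmod u = 1 \<longrightarrow> \<bar>Y u $ j - Re (poly P u)\<bar> < d" for j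
  proof -
    have "continuous_on (sphere 0 1) (\<lambda>u. Y u $ j)" by (intro continuous_intros Y)
    from Stone_Weierstrass_real_polynomial_function[OF compact_sphere this d(1)]
    obtain g where g: "real_polynomial_function g" "\<And>u. u \<in> sphere 0 1 \<Longrightarrow> \<bar>Y u $ j - g u\<bar> < d" by blast
    then show ?thesis using real_polynomial_on_circle[OF g(1)] by fastforce
  qed
  then obtain P where P: "\<And>j u. cmod u = 1 \<Longrightarrow> \<bar>Y u $ j - Re (poly (P j) u)\<bar> < d" by metis
  have "norm (Y u - (\<chi> j. Re (poly (P j) u))) < e" if "cmod u = 1" for u
  proof -
    have "norm (Y u - (\<chi> j. Re (poly (P j) u))) \<le> (\<Sum>j\<in>(UNIV::'m set). d)"
      using P[OF that] unfolding norm_vec_def by (intro order_trans[OF L2_set_le_sum] sum_mono) (auto intro: less_imp_le)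
    then show ?thesis using d by simp
  qed
  then show ?thesis by blast
qed

text \<open>Continuity across the point where the argument jumps follows from a closedness argument:
  preimages of closed sets are images under \<open>cis\<close> of compact subsets of [0, 2 pi], the
  matching end values making the description correct.\<close>

lemma loop_on_circle:
  fixes y :: "real \<Rightarrow> 'a::t2_space"
  assumes y: "continuous_on {0..2*pi} y" "y 0 = y (2*pi)"
  shows "\<exists>Y. continuous_on (sphere 0 1) Y \<and> (\<forall>\<theta>\<in>{0..2*pi}. Y (cis \<theta>) = y \<theta>)"
proof -
  define Y where "Y u = y (Arg2pi u)" for u
  have cA: "cis (Arg2pi u) = u" "Arg2pi u \<in> {0..2*pi}" if "cmod u = 1" for u
    using Arg2pi_eq[of u] that Arg2pi_ge_0[of u] Arg2pi_lt_2pi[of u] by (auto simp: cis_conv_exp)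
  have Yc: "Y (cis \<theta>) = y \<theta>" if \<theta>: "\<theta> \<in> {0..2*pi}" for \<theta>
  proof (cases "\<theta> = 2*pi")
    case True
    have "Arg2pi 1 = 0" by (rule Arg2pi_unique[of 1]) auto
    then show ?thesis using True y by (simp add: Y_def)
  next
    case False
    then have "Arg2pi (cis \<theta>) = \<theta>" using \<theta> by (intro Arg2pi_unique[of 1]) (auto simp: cis_conv_exp)
    then show ?thesis by (simp add: Y_def)
  qed
  have "continuous_on (sphere 0 1) Y"
    unfolding continuous_on_closed_vimage[OF closed_sphere]
  proof (intro allI impI)
    fix B :: "'a set" assume B: "closed B"
    have eq: "Y -` B \<inter> sphere 0 1 = cis ` (y -` B \<inter> {0..2*pi})"
    proof safe
      fix u assume u: "Y u \<in> B" "u \<in> sphere 0 1"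
      then show "u \<in> cis ` (y -` B \<inter> {0..2*pi})" using cA[of u] by (intro image_eqI[of _ _ "Arg2pi u"]) (auto simp: Y_def)
    next
      fix \<theta> assume "y \<theta> \<in> B" "\<theta> \<in> {0..2*pi}"
      then show "cis \<theta> \<in> Y -` B" using Yc by auto
    qed auto
    have "closed (y -` B \<inter> {0..2*pi})" using y(1) B by (simp add: continuous_on_closed_vimage)
    then have "compact (y -` B \<inter> {0..2*pi})" by (metis compact_Icc compact_Int_closed inf.absorb_iff2 inf_le2 Int_commute)
    then have "compact (cis ` (y -` B \<inter> {0..2*pi}))" by (intro compact_continuous_image continuous_intros)
    then show "closed (Y -` B \<inter> sphere 0 1)" unfolding eq by (rule compact_imp_closed)
  qed
  then show ?thesis using Yc by blast
qed

lemma borel_measurable_imp_AE_limit_continuous: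
  fixes x :: "real \<Rightarrow> 'a::euclidean_space"
  assumes "x \<in> borel_measurable borel"
  obtains g where "\<And>n. continuous_on UNIV (g n)" "AE \<theta> in lborel. (\<lambda>n. g n \<theta>) \<longlonglongrightarrow> x \<theta>"
proof -
  have "x \<in> borel_measurable lebesgue" using assms by (simp add: measurable_completion)
  then have "x measurable_on UNIV" by (intro lebesgue_measurable_imp_measurable_on) auto
  then obtain N g where N: "negligible N" "\<And>n. continuous_on UNIV (g n)" "\<And>\<theta>. \<theta> \<notin> N \<Longrightarrow> (\<lambda>n. g n \<theta>) \<longlonglongrightarrow> x \<theta>"
    unfolding measurable_on_def by auto
  have "N \<in> null_sets lebesgue" using N(1) by (simp add: negligible_iff_null_sets)
  then have "AE \<theta> in lebesgue. (\<lambda>n. g n \<theta>) \<longlonglongrightarrow> x \<theta>" by (rule AE_I') (use N(3) in auto)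
  then have "AE \<theta> in lborel. (\<lambda>n. g n \<theta>) \<longlonglongrightarrow> x \<theta>" by (simp add: AE_completion_iff)
  then show thesis using that N(2) by blast
qed

section \<open>The weight and its means along holomorphic discs\<close>

locale reinhardt_weight = reinhardt_family U \<Omega> \<rho> N W
  for U :: "(complex^'n::finite) set" and \<Omega> :: "((complex^'n) \<times> (complex^'m::finite)) set"
    and \<rho> :: "(complex^'n) \<times> (complex^'m) \<Rightarrow> real" and N W :: "((complex^'n) \<times> (complex^'m)) set" +
  fixes \<phi> :: "(complex^'n) \<times> (complex^'m) \<Rightarrow> real" and F :: "((complex^'n) \<times> (complex^'m)) set"
  assumes F: "open F" "closure \<Omega> \<inter> (U \<times> UNIV) \<subseteq> F" and \<phi>: "Ck_on 2 \<phi> F"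
    and \<phi>_levi: "\<And>x v. x \<in> F \<Longrightarrow> 0 \<le> levi (cscale \<i>) \<phi> x v"
    and \<phi>_torus: "\<And>t z \<theta>. (t, z) \<in> \<Omega> \<Longrightarrow> \<phi> (t, torus_act \<theta> z) = \<phi> (t, z)"
begin

lemma \<Omega>_sub: "\<Omega> \<subseteq> F" "\<Omega> \<subseteq> W" "\<Omega> \<subseteq> N"
  using \<Omega>(2) F(2) W closure_subset[of \<Omega>] by blast+

text \<open>Along zeta |-> exp (x + zeta (y - x)) torus invariance makes \<open>\<phi>\<close>
  depend on the real part of zeta only. The Laplacian, nonnegative by plurisubharmonicity, is
  therefore the second derivative along the segment.\<close>

lemma \<phi>_logconvex:
  assumes t: "t \<in> U" and x: "x \<in> logdom t" "y \<in> logdom t" and s: "0 \<le> s" "s \<le> 1"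
  shows "\<phi> (t, rexp ((1 - s) *\<^sub>R x + s *\<^sub>R y)) \<le> (1 - s) * \<phi> (t, rexp x) + s * \<phi> (t, rexp y)"
proof -
  define d where "d = (\<chi> j. complex_of_real ((y - x) $ j))"
  define h where "h \<zeta> = (\<chi> j. of_real (x $ j) + \<zeta> * d $ j)" for \<zeta>
  define \<gamma> where "\<gamma> \<zeta> = (t + \<zeta> *s (0::complex^'n), cexp (h \<zeta>))" for \<zeta>
  define p where "p \<zeta> = ((0::complex^'n), \<chi> j. d $ j * exp (h \<zeta> $ j))" for \<zeta>
  have hc: "holo_curve (cscale \<i>) S \<gamma> p" for S
    unfolding \<gamma>_def p_def by (rule holo_curve_cexp[where h''="\<lambda>_. 0"]) (auto simp: h_def intro!: derivative_eq_intros)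
  have \<gamma>: "\<gamma> \<zeta> = (t, torus_act (\<lambda>j. Im \<zeta> * (y - x) $ j) (rexp (x + Re \<zeta> *\<^sub>R (y - x))))" for \<zeta>
    unfolding \<gamma>_def cexp_eq_torus_act by (simp add: h_def d_def vec_Re_def vec_eq_iff rexp_def torus_act_def algebra_simps)
  define S where "S = \<gamma> -` \<Omega>"
  have "continuous_on UNIV \<gamma>" using hc[of UNIV] unfolding holo_curve_def
    by (auto intro!: continuous_at_imp_continuous_on has_derivative_continuous)
  then have S: "open S" unfolding S_def using \<Omega>(1) by (simp add: open_vimage)
  have SF: "\<gamma> z \<in> F" if "z \<in> S" for z using that \<Omega>_sub by (auto simp: S_def)
  note lc = levi_compose[OF S F(1) \<phi> hc SF bounded_linear_cscale cscale_J]
  define v where "v z = \<phi> (\<gamma> z)" for z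
  have v2: "Ck_on 2 v S" unfolding v_def by (rule lc(1))
  have vRe: "v z = v (of_real (Re z))" if "z \<in> S" for z
  proof -
    have "(t, rexp (x + Re z *\<^sub>R (y - x))) \<in> \<Omega>" using that by (simp add: S_def \<gamma> torus_iff)
    from \<phi>_torus[OF this, of "\<lambda>j. Im z * (y - x) $ j"] show ?thesis by (simp add: v_def \<gamma>)
  qed
  have Sre: "z \<in> S \<longleftrightarrow> of_real (Re z) \<in> S" for z by (simp add: S_def \<gamma> torus_iff)
  have dI: "frechet_derivative v (at z) \<i> = 0" if z: "z \<in> S" for z
  proof -
    have "((\<lambda>s::real. z + s *\<^sub>R \<i>) has_derivative (\<lambda>h. h *\<^sub>R \<i>)) (at 0)" by (auto intro!: derivative_eq_intros)
    from has_derivative_compose[OF this, of v "frechet_derivative v (at z)"] Ck2_derivative[OF v2 z]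
    have 1: "((\<lambda>s::real. v (z + s *\<^sub>R \<i>)) has_derivative (\<lambda>h. frechet_derivative v (at z) (h *\<^sub>R \<i>))) (at 0)" by simp
    have "z + s *\<^sub>R \<i> \<in> S" for s :: real using Sre[of "z + s *\<^sub>R \<i>"] Sre[of z] z by simp
    then have "v (z + s *\<^sub>R \<i>) = v z" for s :: real using vRe[of "z + s *\<^sub>R \<i>"] vRe[OF z] by simp
    then have "((\<lambda>s::real. v (z + s *\<^sub>R \<i>)) has_derivative (\<lambda>h. 0)) (at 0)" by simp
    from has_derivative_unique[OF 1 this] have "frechet_derivative v (at z) (1 *\<^sub>R \<i>) = 0" by (rule fun_cong)
    then show ?thesis by simp
  qed
  have D2i: "D2 v z \<i> \<i> = 0" if z: "z \<in> S" for z
  proof -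
    have "D2 v z \<i> \<i> = frechet_derivative (\<lambda>_. 0) (at z) \<i>"
      unfolding D2_def by (subst frechet_derivative_cong_open[OF S z dI]) auto
    then show ?thesis by (simp add: frechet_derivative_const)
  qed
  have D2pos: "0 \<le> D2 v z 1 1" if z: "z \<in> S" for z
  proof -
    have "laplace v z = levi (cscale \<i>) \<phi> (\<gamma> z) (p z)" unfolding v_def by (rule lc(2)[OF _ z])
    then show ?thesis using \<phi>_levi[OF SF[OF z], of "p z"] D2i[OF z] by (simp add: levi_def)
  qed
  have inS: "of_real s \<in> S" if "s \<in> {0..1}" for s
  proof -
    have "(1 - s) *\<^sub>R x + s *\<^sub>R y \<in> logdom t" using convexD[OF convex_logdom[OF t] x, of "1 - s" s] that by simp
    then have "(t, rexp (x + s *\<^sub>R (y - x))) \<in> \<Omega>" by (simp add: logdom_def algebra_simps)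
    then show ?thesis by (simp add: S_def \<gamma>)
  qed
  have "convex_on {0..1} (\<lambda>s. v (of_real s))"
  proof (rule f''_ge0_imp_convex)
    fix s :: real assume s: "s \<in> {0..1}"
    have d: "((\<lambda>s. complex_of_real s) has_derivative (\<lambda>h. h *\<^sub>R 1)) (at s)" by (auto intro!: derivative_eq_intros simp: scaleR_conv_of_real)
    have "((\<lambda>s. v (of_real s)) has_derivative (*) (frechet_derivative v (at (of_real s)) 1)) (at s)"
    proof (rule has_derivative_eq_rhs[OF has_derivative_compose[OF d Ck2_derivative[OF v2 inS[OF s]]]], rule ext)
      fix h
      have "frechet_derivative v (at (of_real s)) (h *\<^sub>R 1) = h *\<^sub>R frechet_derivative v (at (of_real s)) 1"
        by (rule linear_scale[OF Ck2_linear[OF v2 inS[OF s]]])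
      then show "frechet_derivative v (at (of_real s)) (h *\<^sub>R 1) = frechet_derivative v (at (of_real s)) 1 * h"
        by (simp only: real_scaleR_def mult.commute)
    qed
    then show "((\<lambda>s. v (of_real s)) has_real_derivative frechet_derivative v (at (of_real s)) 1) (at s)"
      unfolding has_field_derivative_def .
    have "((\<lambda>s. frechet_derivative v (at (of_real s)) 1) has_derivative (*) (D2 v (of_real s) 1 1)) (at s)"
    proof (rule has_derivative_eq_rhs[OF has_derivative_compose[OF d Ck2_derivative2[OF v2 inS[OF s], of 1]]], rule ext)
      fix h
      have "D2 v (of_real s) (h *\<^sub>R 1) 1 = h *\<^sub>R D2 v (of_real s) 1 1"
        by (rule linear_scale[OF Ck2_D2_linear1[OF v2 inS[OF s]]])
      then show "D2 v (of_real s) (h *\<^sub>R 1) 1 = D2 v (of_real s) 1 1 * h"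
        by (simp only: real_scaleR_def mult.commute)
    qed
    then show "((\<lambda>s. frechet_derivative v (at (of_real s)) 1) has_real_derivative D2 v (of_real s) 1 1) (at s)"
      unfolding has_field_derivative_def .
    show "0 \<le> D2 v (of_real s) 1 1" by (rule D2pos[OF inS[OF s]])
  qed simp
  from convex_onD[OF this s, of 0 1] have "v (of_real s) \<le> (1 - s) * v 0 + s * v 1" by simp
  moreover have "x + s *\<^sub>R (y - x) = (1 - s) *\<^sub>R x + s *\<^sub>R y" by (simp add: algebra_simps)
  ultimately show ?thesis by (simp add: v_def \<gamma>)
qed

text \<open>Both estimates are \<open>mean_value_laplace\<close> on the disc: for
  \<open>\<phi>\<close> with Laplacian at least 0, and for \<open>\<rho>\<close> with Laplacian at
  least kappa. As \<open>\<rho>\<close> is nonpositive on the boundary circle, 2 pi rho + pi kappa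
  r^2 / 2 is at most 0 at the centre, which explains the 4.\<close>

lemma polynomial_disc:
  fixes P :: "'m \<Rightarrow> complex poly" and w :: "complex^'n"
  assumes w: "w \<noteq> 0" and r: "0 < r"
    and tU: "\<And>\<tau>. cmod \<tau> \<le> r \<Longrightarrow> t0 + \<tau> *s w \<in> U"
    and c: "\<And>\<tau>. cmod \<tau> \<le> r \<Longrightarrow> c \<in> logdom (t0 + \<tau> *s w)"
    and bd: "\<And>\<tau>. cmod \<tau> = r \<Longrightarrow> (\<chi> j. Re (poly (P j) \<tau>)) \<in> logdom (t0 + \<tau> *s w)"
    and \<kappa>: "\<And>\<tau> z b. cmod \<tau> \<le> r \<Longrightarrow> (t0 + \<tau> *s w, z) \<in> \<Omega> \<Longrightarrow> \<kappa> \<le> levi (cscale \<i>) \<rho> (t0 + \<tau> *s w, z) (w, b)"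
  shows "(\<chi> j. Re (poly (P j) 0)) \<in> logdom t0"
    and "\<rho> (t0, torus_act \<alpha> (rexp (\<chi> j. Re (poly (P j) 0)))) \<le> - \<kappa> * r^2 / 4"
    and "\<phi> (t0, rexp (\<chi> j. Re (poly (P j) 0))) \<le>
      (LINT \<theta>|circle_measure. \<phi> (t0 + (of_real r * cis \<theta>) *s w, rexp (\<chi> j. Re (poly (P j) (of_real r * cis \<theta>)))))"
proof -
  define x0 where "x0 = (\<chi> j. Re (poly (P j) 0))"
  have key: "x0 \<in> logdom t0 \<and> \<rho> (t0, torus_act \<alpha> (rexp x0)) \<le> - \<kappa> * r^2 / 4 \<and>
     2 * pi * \<phi> (t0, rexp x0) \<le> integral {0..2*pi} (\<lambda>\<theta>. \<phi> (t0 + (of_real r * cis \<theta>) *s w, rexp (\<chi> j. Re (poly (P j) (of_real r * cis \<theta>)))))" for \<alpha>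
  proof -
    \<comment> \<open>Imaginary constants are added so that the centre of the disc is the point over
      \<open>x0\<close> rotated by the prescribed angles; real parts are unaffected. Letting the
      angles vary gives the bound on the entire orbit.\<close>
    define Q where "Q j = P j + [:\<i> * of_real (\<alpha> j - Im (poly (P j) 0)):]" for j
    define h h' h'' where "h \<tau> = (\<chi> j. poly (Q j) \<tau>)" "h' \<tau> = (\<chi> j. poly (pderiv (Q j)) \<tau>)" "h'' \<tau> = (\<chi> j. poly (pderiv (pderiv (Q j))) \<tau>)" for \<tau>
    have hd: "((\<lambda>\<tau>. h \<tau> $ j) has_field_derivative h' \<tau> $ j) (at \<tau>)" "((\<lambda>\<tau>. h' \<tau> $ j) has_field_derivative h'' \<tau> $ j) (at \<tau>)" for j \<tau>
      by (auto simp: h_h'_h''_def intro!: derivative_eq_intros)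
    have ch'': "continuous_on UNIV h''" unfolding h_h'_h''_def by (intro continuous_intros)
    have Reh: "vec_Re (h \<tau>) = (\<chi> j. Re (poly (P j) \<tau>))" for \<tau> by (simp add: h_h'_h''_def vec_Re_def vec_eq_iff Q_def)
    define \<gamma> where "\<gamma> \<tau> = (t0 + \<tau> *s w, cexp (h \<tau>))" for \<tau>
    define p where "p \<tau> = (w, \<chi> j. h' \<tau> $ j * exp (h \<tau> $ j))" for \<tau>
    have in\<Omega>: "\<gamma> \<tau> \<in> \<Omega>" if "cmod \<tau> \<le> r" for \<tau> unfolding \<gamma>_def
      by (rule holomorphic_disc_in_\<Omega>[OF hd ch'' w tU c _ that]) (use bd Reh in auto)
    have hc: "holo_curve (cscale \<i>) S \<gamma> p" for S
      unfolding \<gamma>_def p_def by (rule holo_curve_cexp[OF hd ch''])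
    have "continuous_on UNIV \<gamma>" using hc[of UNIV] unfolding holo_curve_def
      by (auto intro!: continuous_at_imp_continuous_on has_derivative_continuous)
    note c\<gamma> = this
    define S where "S = \<gamma> -` \<Omega>"
    have S: "open S" unfolding S_def using \<Omega>(1) c\<gamma> by (simp add: open_vimage)
    have cb: "cball 0 r \<subseteq> S" using in\<Omega> by (auto simp: S_def)
    have SF: "\<gamma> z \<in> F" "\<gamma> z \<in> W" "\<gamma> z \<in> N" if "z \<in> S" for z using that \<Omega>_sub by (auto simp: S_def)
    note l1 = levi_compose[OF S F(1) \<phi> hc SF(1) bounded_linear_cscale cscale_J]
    note l2 = levi_compose[OF S N(1) \<rho> hc SF(3) bounded_linear_cscale cscale_J]
    have \<gamma>0: "\<gamma> 0 = (t0, torus_act \<alpha> (rexp x0))"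
      unfolding \<gamma>_def cexp_eq_torus_act Reh
      by (simp add: x0_def h_h'_h''_def Q_def vec_eq_iff torus_act_def)
    have "(t0, torus_act \<alpha> (rexp x0)) \<in> \<Omega>" using in\<Omega>[of 0] r \<gamma>0 by simp
    then have 1: "x0 \<in> logdom t0" by (simp add: torus_iff logdom_def)
    have rc: "cmod (of_real r * cis \<theta>) = r" for \<theta> using r by (simp add: norm_mult)
    have "2 * pi * \<rho> (\<gamma> 0) + pi * \<kappa> * r^2 / 2 \<le> integral {0..2*pi} (\<lambda>\<theta>. \<rho> (\<gamma> (0 + of_real r * cis \<theta>)))"
    proof (rule mean_value_laplace[OF S l2(1) r cb])
      fix z :: complex assume z: "z \<in> cball 0 r"
      then have "laplace (\<lambda>z. \<rho> (\<gamma> z)) z = levi (cscale \<i>) \<rho> (\<gamma> z) (p z)" using cb by (intro l2(2)) auto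
      also have "\<kappa> \<le> \<dots>" unfolding \<gamma>_def p_def by (rule \<kappa>) (use z in\<Omega>[of z] in \<open>auto simp: \<gamma>_def\<close>)
      finally show "\<kappa> \<le> laplace (\<lambda>z. \<rho> (\<gamma> z)) z" .
    qed
    also have "\<dots> \<le> integral {0..2*pi} (\<lambda>\<theta>. 0)"
    proof (rule integral_le)
      show "(\<lambda>\<theta>. \<rho> (\<gamma> (0 + of_real r * cis \<theta>))) integrable_on {0..2*pi}"
        by (intro integrable_continuous_real continuous_on_compose2[OF Ck_on_imp_continuous_on[OF l2(1)]] continuous_intros)
          (use cb rc in auto)
      fix \<theta>
      have "\<gamma> (of_real r * cis \<theta>) \<in> \<Omega>" using in\<Omega> rc by simp
      then show "\<rho> (\<gamma> (0 + of_real r * cis \<theta>)) \<le> 0" using \<Omega>_eq by auto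
    qed (rule integrable_0)
    finally have "pi * (2 * (\<rho> (\<gamma> 0) + \<kappa> * r^2 / 4)) \<le> 0" by (simp add: algebra_simps)
    then have "\<rho> (\<gamma> 0) + \<kappa> * r^2 / 4 \<le> 0" using pi_gt_zero by (simp only: mult_le_0_iff) auto
    then have 2: "\<rho> (t0, torus_act \<alpha> (rexp x0)) \<le> - \<kappa> * r^2 / 4" using \<gamma>0 by simp
    have "2 * pi * \<phi> (\<gamma> 0) + pi * 0 * r^2 / 2 \<le> integral {0..2*pi} (\<lambda>\<theta>. \<phi> (\<gamma> (0 + of_real r * cis \<theta>)))"
    proof (rule mean_value_laplace[OF S l1(1) r cb])
      fix z :: complex assume z: "z \<in> cball 0 r"
      then have zS: "z \<in> S" using cb by auto
      then have "laplace (\<lambda>z. \<phi> (\<gamma> z)) z = levi (cscale \<i>) \<phi> (\<gamma> z) (p z)" by (intro l1(2))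
      then show "0 \<le> laplace (\<lambda>z. \<phi> (\<gamma> z)) z" using \<phi>_levi[OF SF(1)[OF zS], of "p z"] by (simp only:)
    qed
    moreover have "\<phi> (\<gamma> 0) = \<phi> (t0, rexp x0)" unfolding \<gamma>0 by (rule \<phi>_torus) (use 1 in \<open>simp add: logdom_def\<close>)
    moreover have "\<phi> (\<gamma> (of_real r * cis \<theta>)) = \<phi> (t0 + (of_real r * cis \<theta>) *s w, rexp (\<chi> j. Re (poly (P j) (of_real r * cis \<theta>))))" for \<theta>
      unfolding \<gamma>_def cexp_eq_torus_act Reh by (rule \<phi>_torus) (use bd[OF rc[of \<theta>]] in \<open>simp add: logdom_def\<close>)
    ultimately show ?thesis using 1 2 by simp
  qed
  show "(\<chi> j. Re (poly (P j) 0)) \<in> logdom t0" using key by (simp add: x0_def)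
  show "\<rho> (t0, torus_act \<alpha> (rexp (\<chi> j. Re (poly (P j) 0)))) \<le> - \<kappa> * r^2 / 4" using key by (simp add: x0_def)
  have c: "continuous_on S (\<lambda>\<theta>. \<phi> (t0 + (of_real r * cis \<theta>) *s w, rexp (\<chi> j. Re (poly (P j) (of_real r * cis \<theta>)))))" for S
  proof (rule continuous_on_compose2[OF Ck_on_imp_continuous_on[OF \<phi>]])
    show "continuous_on S (\<lambda>\<theta>. (t0 + (of_real r * cis \<theta>) *s w, rexp (\<chi> j. Re (poly (P j) (of_real r * cis \<theta>)))))"
      unfolding vector_scalar_mult_def by (intro continuous_intros)
    have "(t0 + (of_real r * cis \<theta>) *s w, rexp (\<chi> j. Re (poly (P j) (of_real r * cis \<theta>)))) \<in> \<Omega>" for \<theta>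
      using bd[of "of_real r * cis \<theta>"] r by (simp add: norm_mult logdom_def)
    then show "(\<lambda>\<theta>. (t0 + (of_real r * cis \<theta>) *s w, rexp (\<chi> j. Re (poly (P j) (of_real r * cis \<theta>))))) ` S \<subseteq> F" using \<Omega>_sub by blast
  qed
  show "\<phi> (t0, rexp (\<chi> j. Re (poly (P j) 0))) \<le>
      (LINT \<theta>|circle_measure. \<phi> (t0 + (of_real r * cis \<theta>) *s w, rexp (\<chi> j. Re (poly (P j) (of_real r * cis \<theta>)))))"
    unfolding LINT_circle_continuous[OF c borel_measurable_continuous_onI[OF c]]
    using key by (simp add: x0_def field_simps)
qed

end

lemma compact_thicken:
  fixes K :: "'a::euclidean_space set"
  assumes K: "compact K" "K \<noteq> {}" and D: "open D" "K \<subseteq> D" and C: "closed C"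
  shows "\<exists>\<eta>>0. compact {p \<in> C. infdist p K \<le> \<eta>} \<and> {p. infdist p K \<le> \<eta>} \<subseteq> D"
proof -
  from compact_subset_open_imp_ball_epsilon_subset[OF K(1) D] obtain e where e: "e > 0" "(\<Union>x\<in>K. ball x e) \<subseteq> D" by blast
  have cK: "closed K" using K(1) by (rule compact_imp_closed)
  have ci: "continuous_on UNIV (\<lambda>p. infdist p K)" by (intro continuous_on_infdist continuous_on_id)
  show ?thesis
  proof (intro exI[of _ "e/2"] conjI)
    show "{p. infdist p K \<le> e/2} \<subseteq> D"
    proof
      fix p assume p: "p \<in> {p. infdist p K \<le> e/2}"
      obtain a where a: "a \<in> K" "infdist p K = dist p a" using infdist_attains_inf[OF cK K(2)] by blast
      then have "p \<in> ball a e" using p e(1) by (simp add: dist_commute)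
      then show "p \<in> D" using a e(2) by blast
    qed
    obtain M where M: "\<And>a. a \<in> K \<Longrightarrow> norm a \<le> M" using compact_imp_bounded[OF K(1)] by (auto simp: bounded_iff)
    have "norm p \<le> M + e/2" if "infdist p K \<le> e/2" for p
    proof -
      obtain a where a: "a \<in> K" "infdist p K = dist p a" using infdist_attains_inf[OF cK K(2)] by blast
      then have "dist p a \<le> e/2" using that by simp
      then show ?thesis using M[OF a(1)] norm_triangle_sub[of p a] by (simp add: dist_norm)
    qed
    then have "bounded {p \<in> C. infdist p K \<le> e/2}" by (auto simp: bounded_iff)
    moreover have "closed {p. infdist p K \<le> e/2}" using ci by (intro closed_Collect_le continuous_on_const)
    then have "closed {p \<in> C. infdist p K \<le> e/2}" using closed_Int[OF C, of "{p. infdist p K \<le> e/2}"] by (simp add: Int_def)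
    ultimately show "compact {p \<in> C. infdist p K \<le> e/2}" by (simp add: compact_eq_bounded_closed)
  qed (use e in auto)
qed

context reinhardt_weight
begin

text \<open>Approximation carries \<open>polynomial_disc\<close> over to measurable loops: almost
  everywhere limits of continuous loops, then polynomials, all with graphs in one compact set where
  \<open>\<phi>\<close> is bounded, so that dominated convergence applies to the means.\<close>

lemma measurable_loop:
  fixes w :: "complex^'n" and x :: "real \<Rightarrow> real^'m"
  assumes w: "w \<noteq> 0" and r: "0 < r"
    and tU: "\<And>\<tau>. cmod \<tau> \<le> r \<Longrightarrow> t0 + \<tau> *s w \<in> U"
    and c: "\<And>\<tau>. cmod \<tau> \<le> r \<Longrightarrow> c \<in> logdom (t0 + \<tau> *s w)"
    and \<kappa>0: "0 < \<kappa>" and \<kappa>: "\<And>\<tau> z b. cmod \<tau> \<le> r \<Longrightarrow> (t0 + \<tau> *s w, z) \<in> \<Omega> \<Longrightarrow> \<kappa> \<le> levi (cscale \<i>) \<rho> (t0 + \<tau> *s w, z) (w, b)"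
    and K: "compact K" "\<And>\<tau> x. (\<tau>, x) \<in> K \<Longrightarrow> cmod \<tau> = r \<and> x \<in> logdom (t0 + \<tau> *s w)"
    and x: "x \<in> borel_measurable borel" "\<And>\<theta>. (of_real r * cis \<theta>, x \<theta>) \<in> K"
  defines "a \<equiv> (LINT \<theta>|circle_measure. x \<theta>)"
  shows "a \<in> logdom t0" "\<rho> (t0, torus_act \<alpha> (rexp a)) \<le> - \<kappa> * r^2 / 4"
    "\<phi> (t0, rexp a) \<le> (LINT \<theta>|circle_measure. \<phi> (t0 + (of_real r * cis \<theta>) *s w, rexp (x \<theta>)))"
    "(\<lambda>\<theta>. \<phi> (t0 + (of_real r * cis \<theta>) *s w, rexp (x \<theta>))) \<in> borel_measurable borel"
proof -
  define G where "G p = (t0 + fst p *s w, rexp (snd p))" for p :: "complex \<times> (real^'m)"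
  define D where "D = G -` \<Omega>"
  have cG: "continuous_on S G" for S unfolding G_def vector_scalar_mult_def by (intro continuous_intros)
  have D: "open D" unfolding D_def using \<Omega>(1) cG by (simp add: open_vimage)
  have inD: "(\<tau>, x) \<in> D \<longleftrightarrow> x \<in> logdom (t0 + \<tau> *s w)" for \<tau> x by (simp add: D_def G_def logdom_def)
  have KD: "K \<subseteq> D" using K(2) inD by auto
  have Kne: "K \<noteq> {}" using x(2)[of 0] by auto
  have convD: "(\<tau>, c + s *\<^sub>R (x - c)) \<in> D" if "cmod \<tau> \<le> r" "(\<tau>, x) \<in> D" "0 \<le> s" "s \<le> 1" for \<tau> x s
  proof -
    have "(1 - s) *\<^sub>R c + s *\<^sub>R x \<in> logdom (t0 + \<tau> *s w)"
      by (rule convexD[OF convex_logdom[OF tU] c]) (use that inD in auto)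
    then show ?thesis unfolding inD by (simp add: algebra_simps)
  qed
  define \<Phi> where "\<Phi> p = \<phi> (G p)" for p
  have c\<Phi>: "continuous_on D \<Phi>" unfolding \<Phi>_def
    by (rule continuous_on_compose2[OF Ck_on_imp_continuous_on[OF \<phi>] cG]) (use \<Omega>_sub in \<open>auto simp: D_def\<close>)
  define Sp where "Sp = sphere (0::complex) r \<times> (UNIV :: (real^'m) set)"
  have Sp: "closed Sp" unfolding Sp_def by (intro closed_Times) auto
  obtain \<eta> where \<eta>: "0 < \<eta>" "compact {p \<in> Sp. infdist p K \<le> \<eta>}" "{p. infdist p K \<le> \<eta>} \<subseteq> D"
    using compact_thicken[OF K(1) Kne D KD Sp] by blast
  define P where "P = {p \<in> Sp. infdist p K \<le> \<eta>}"
  \<comment> \<open>The star-shaped hull about c of a neighbourhood of \<open>K\<close>, fiber by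
    fiber, together with c itself over the whole circle. Convexity of the fibers keeps it inside the
    domain, and it contains all modified loops \<open>y n\<close>.\<close>
  define K1 where "K1 = (\<lambda>q. (fst (snd q), c + fst q *\<^sub>R (snd (snd q) - c))) ` ({0..1} \<times> P) \<union> sphere 0 r \<times> {c}"
  have K1c: "compact K1" unfolding K1_def
    by (intro compact_Un compact_continuous_image continuous_intros compact_Times) (use \<eta>(2) in \<open>auto simp: P_def\<close>)
  have K1D: "K1 \<subseteq> D"
  proof
    fix p assume "p \<in> K1"
    then consider (1) s \<tau> y where "s \<in> {0..1}" "(\<tau>, y) \<in> P" "p = (\<tau>, c + s *\<^sub>R (y - c))" | (2) \<tau> where "cmod \<tau> = r" "p = (\<tau>, c)"
      by (auto simp: K1_def)
    then show "p \<in> D"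
    proof cases
      case 1
      then show ?thesis using \<eta>(3) by (auto simp: P_def Sp_def intro!: convD)
    next
      case 2
      then show ?thesis using c inD by auto
    qed
  qed
  have K1ne: "K1 \<noteq> {}" using r by (auto simp: K1_def intro!: exI[of _ "complex_of_real r"])
  obtain \<eta>2 where \<eta>2: "0 < \<eta>2" "compact {p \<in> Sp. infdist p K1 \<le> \<eta>2}" "{p. infdist p K1 \<le> \<eta>2} \<subseteq> D"
    using compact_thicken[OF K1c K1ne D K1D Sp] by blast
  define K2 where "K2 = {p \<in> Sp. infdist p K1 \<le> \<eta>2}"
  have K2: "compact K2" "K2 \<subseteq> D" using \<eta>2 by (auto simp: K2_def)
  have "bounded (\<Phi> ` K2)" by (intro compact_imp_bounded compact_continuous_image continuous_on_subset[OF c\<Phi>] K2)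
  then obtain B where "\<forall>v\<in>\<Phi> ` K2. norm v \<le> B" unfolding bounded_iff by blast
  then have B: "\<And>p. p \<in> K2 \<Longrightarrow> \<bar>\<Phi> p\<bar> \<le> B" by auto
  obtain B2 where B2: "\<And>p. p \<in> K2 \<Longrightarrow> norm p \<le> B2" using compact_imp_bounded[OF K2(1)] unfolding bounded_iff by blast
  have B2': "norm y \<le> B2" if "(\<tau>, y) \<in> K2" for \<tau> y
    by (rule order_trans[OF norm_snd_le B2[OF that]])
  obtain g where g: "\<And>n. continuous_on UNIV (g n)" "AE \<theta> in lborel. (\<lambda>n. g n \<theta>) \<longlonglongrightarrow> x \<theta>"
    using borel_measurable_imp_AE_limit_continuous[OF x(1)] by blast
  \<comment> \<open>Pulls the loop to c at 0 and 2 pi, so that it closes up, and tends to 1 at every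
    angle strictly between.\<close>
  define \<omega> where "\<omega> n \<theta> = max 0 (min 1 (real n * min \<theta> (2*pi - \<theta>)))" for n \<theta>
  \<comment> \<open>Equals 1 on \<open>K\<close> and 0 beyond distance eta: where the approximation
    \<open>g n\<close> has strayed from \<open>K\<close>, the loop is replaced by c, while
    convergence to x is not disturbed.\<close>
  define \<sigma> where "\<sigma> p = max 0 (1 - infdist p K / \<eta>)" for p
  have \<sigma>01: "0 \<le> \<sigma> p" "\<sigma> p \<le> 1" for p using \<eta>(1) infdist_nonneg[of p K] by (auto simp: \<sigma>_def)
  have \<omega>01: "0 \<le> \<omega> n \<theta>" "\<omega> n \<theta> \<le> 1" for n \<theta> by (auto simp: \<omega>_def)
  define y where "y n \<theta> = c + (\<omega> n \<theta> * \<sigma> (of_real r * cis \<theta>, g n \<theta>)) *\<^sub>R (g n \<theta> - c)" for n \<theta>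
  have c\<sigma>: "continuous_on S \<sigma>" for S unfolding \<sigma>_def by (intro continuous_intros continuous_on_infdist) (use \<eta>(1) in auto)
  have cy: "continuous_on S (y n)" for S n unfolding y_def \<omega>_def
    by (intro continuous_intros continuous_on_compose2[OF c\<sigma>[of UNIV]] continuous_on_subset[OF g(1)]) auto
  have yK1: "(of_real r * cis \<theta>, y n \<theta>) \<in> K1" for n \<theta>
  proof (cases "\<sigma> (of_real r * cis \<theta>, g n \<theta>) = 0")
    case True
    then show ?thesis using r by (simp add: y_def K1_def norm_mult)
  next
    case False
    then have "infdist (of_real r * cis \<theta>, g n \<theta>) K \<le> \<eta>" using \<eta>(1) by (auto simp: \<sigma>_def max_def field_simps split: if_splits)
    then have "(of_real r * cis \<theta>, g n \<theta>) \<in> P" using r by (simp add: P_def Sp_def norm_mult)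
    moreover have "\<omega> n \<theta> * \<sigma> (of_real r * cis \<theta>, g n \<theta>) \<in> {0..1}" using \<sigma>01 \<omega>01 by (auto intro!: mult_le_one)
    ultimately show ?thesis unfolding K1_def y_def
      by (intro UnI1 image_eqI[of _ _ "(\<omega> n \<theta> * \<sigma> (of_real r * cis \<theta>, g n \<theta>), (of_real r * cis \<theta>, g n \<theta>))"]) auto
  qed
  have y_lim: "AE \<theta> in circle_measure. (\<lambda>n. y n \<theta>) \<longlonglongrightarrow> x \<theta>"
    using AE_circle[OF g(2)] AE_circle_interval
  proof eventually_elim
    case (elim \<theta>)
    have "isCont \<sigma> (of_real r * cis \<theta>, x \<theta>)" using c\<sigma>[of UNIV] by (simp add: continuous_on_eq_continuous_at)
    moreover have "(\<lambda>n. (of_real r * cis \<theta>, g n \<theta>)) \<longlonglongrightarrow> (of_real r * cis \<theta>, x \<theta>)" by (intro tendsto_intros elim(1))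
    ultimately have 1: "(\<lambda>n. \<sigma> (of_real r * cis \<theta>, g n \<theta>)) \<longlonglongrightarrow> \<sigma> (of_real r * cis \<theta>, x \<theta>)" by (rule isCont_tendsto_compose)
    have 2: "\<sigma> (of_real r * cis \<theta>, x \<theta>) = 1" using x(2)[of \<theta>] by (simp add: \<sigma>_def)
    define m where "m = min \<theta> (2*pi - \<theta>)"
    have m: "0 < m" using elim(2) by (simp add: m_def)
    have "\<forall>\<^sub>F n in sequentially. \<omega> n \<theta> = 1"
    proof -
      obtain n0 :: nat where n0: "1 / m < real n0" using reals_Archimedean2 by blast
      show ?thesis
      proof (rule eventually_sequentiallyI[of n0])
        fix n assume "n0 \<le> n"
        then have "1 / m \<le> real n" using n0 by linarith
        then have "1 \<le> real n * m" using m by (simp add: field_simps)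
        then show "\<omega> n \<theta> = 1" by (simp add: \<omega>_def m_def)
      qed
    qed
    then have 3: "(\<lambda>n. \<omega> n \<theta>) \<longlonglongrightarrow> 1" by (rule tendsto_eventually)
    have "(\<lambda>n. y n \<theta>) \<longlonglongrightarrow> c + (1 * 1) *\<^sub>R (x \<theta> - c)" unfolding y_def by (intro tendsto_intros 3 1[unfolded 2] elim(1))
    then show ?case by simp
  qed
  have y_ends: "y n 0 = y n (2*pi)" for n by (simp add: y_def \<omega>_def)
  \<comment> \<open>The bound \<open>\<eta>2\<close> keeps the polynomial loops in the compact set
    \<open>K2\<close>; the bound 1 / (n + 1) makes them converge to the same limit as
    \<open>y n\<close>.\<close>
  define e where "e n = min \<eta>2 (1 / real (Suc n))" for n
  have e: "0 < e n" for n using \<eta>2(1) by (simp add: e_def)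
  have "\<exists>Pn. \<forall>\<theta>\<in>{0..2*pi}. norm (y n \<theta> - (\<chi> j. Re (poly (Pn j) (of_real r * cis \<theta>)))) < e n" for n
  proof -
    obtain Y where Y: "continuous_on (sphere 0 1) Y" "\<And>\<theta>. \<theta> \<in> {0..2*pi} \<Longrightarrow> Y (cis \<theta>) = y n \<theta>"
      using loop_on_circle[OF cy y_ends] by blast
    obtain Pn where Pn: "\<And>u. cmod u = 1 \<Longrightarrow> norm (Y u - (\<chi> j. Re (poly (Pn j) u))) < e n" using circle_poly_approx[OF Y(1) e] by blast
    \<comment> \<open>The approximation lives on the unit circle; composing with multiplication by 1
      / r turns it into a polynomial in tau on the circle of radius r.\<close>
    have "norm (y n \<theta> - (\<chi> j. Re (poly (pcompose (Pn j) [:0, 1 / of_real r:]) (of_real r * cis \<theta>)))) < e n" if "\<theta> \<in> {0..2*pi}" for \<theta>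
      using Pn[of "cis \<theta>"] Y(2)[OF that] r by (simp add: poly_pcompose)
    then show ?thesis by (intro exI[of _ "\<lambda>j. pcompose (Pn j) [:0, 1 / of_real r:]"]) blast
  qed
  then obtain Pn where Pn: "\<And>n \<theta>. \<theta> \<in> {0..2*pi} \<Longrightarrow> norm (y n \<theta> - (\<chi> j. Re (poly (Pn n j) (of_real r * cis \<theta>)))) < e n" by metis
  define q where "q n \<tau> = (\<chi> j. Re (poly (Pn n j) \<tau>))" for n \<tau>
  have qK2: "(\<tau>, q n \<tau>) \<in> K2" if \<tau>: "cmod \<tau> = r" for n \<tau>
  proof -
    define \<theta> where "\<theta> = Arg2pi \<tau>"
    have \<theta>: "\<theta> \<in> {0..2*pi}" "\<tau> = of_real r * cis \<theta>"
      using Arg2pi_eq[of \<tau>] Arg2pi_ge_0[of \<tau>] Arg2pi_lt_2pi[of \<tau>] \<tau> by (auto simp: \<theta>_def cis_conv_exp)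
    have "infdist (\<tau>, q n \<tau>) K1 \<le> dist (\<tau>, q n \<tau>) (\<tau>, y n \<theta>)" using yK1[of \<theta> n] \<theta>(2) by (intro infdist_le) simp
    also have "\<dots> = norm (y n \<theta> - q n \<tau>)" by (simp add: dist_Pair_Pair dist_norm norm_minus_commute)
    also have "\<dots> \<le> \<eta>2" using Pn[OF \<theta>(1), of n] \<theta>(2) by (simp add: q_def e_def)
    finally show ?thesis using \<tau> by (simp add: K2_def Sp_def)
  qed
  have qlog: "q n \<tau> \<in> logdom (t0 + \<tau> *s w)" if "cmod \<tau> = r" for n \<tau>
    using qK2[OF that, of n] K2(2) inD by blast
  define an where "an n = q n 0" for n
  note pd = polynomial_disc[OF w r tU c qlog[unfolded q_def] \<kappa>, folded q_def, folded an_def]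
  have rc: "cmod (of_real r * cis \<theta>) = r" for \<theta> using r by (simp add: norm_mult)
  have q_lim: "AE \<theta> in circle_measure. (\<lambda>n. q n (of_real r * cis \<theta>)) \<longlonglongrightarrow> x \<theta>"
    using y_lim AE_circle_interval
  proof eventually_elim
    case (elim \<theta>)
    have "(\<lambda>n. y n \<theta> - q n (of_real r * cis \<theta>)) \<longlonglongrightarrow> 0"
    proof (rule Lim_null_comparison[where g="\<lambda>n. 1 / real (Suc n)"])
      have "norm (y n \<theta> - q n (of_real r * cis \<theta>)) \<le> 1 / real (Suc n)" for n
        using Pn[of \<theta> n] elim(2) by (simp add: q_def e_def)
      then show "\<forall>\<^sub>F n in sequentially. norm (y n \<theta> - q n (of_real r * cis \<theta>)) \<le> 1 / real (Suc n)" by simp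
      show "(\<lambda>n. 1 / real (Suc n)) \<longlonglongrightarrow> 0" by (rule lim_1_over_real_power[of 1, simplified, THEN LIMSEQ_Suc]) 
    qed
    from tendsto_diff[OF elim(1) this] show ?case by simp
  qed
  have cq: "continuous_on S (\<lambda>\<theta>. q n (of_real r * cis \<theta>))" for S n unfolding q_def by (intro continuous_intros)
  have mq: "(\<lambda>\<theta>. q n (of_real r * cis \<theta>)) \<in> borel_measurable borel" for n by (rule borel_measurable_continuous_onI[OF cq])
  have xK2: "(of_real r * cis \<theta>, x \<theta>) \<in> K2" for \<theta>
  proof -
    have "(of_real r * cis \<theta>, x \<theta>) \<in> P" using x(2)[of \<theta>] \<eta>(1) rc by (simp add: P_def Sp_def)
    then have "(of_real r * cis \<theta>, x \<theta>) \<in> K1" unfolding K1_def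
      by (intro UnI1 image_eqI[of _ _ "(1, (of_real r * cis \<theta>, x \<theta>))"]) auto
    then show ?thesis using \<eta>2(1) rc by (simp add: K2_def Sp_def)
  qed
  have ix: "integrable circle_measure x"
    by (rule circle.integrable_const_bound[where B=B2]) (use B2'[OF xK2] x(1) in auto)
  have an_lim: "an \<longlonglongrightarrow> a"
  proof (rule vec_tendstoI)
    fix j
    have "(\<lambda>n. LINT \<theta>|circle_measure. q n (of_real r * cis \<theta>) $ j) \<longlonglongrightarrow> (LINT \<theta>|circle_measure. x \<theta> $ j)"
    proof (rule integral_dominated_convergence[where w="\<lambda>_. B2"])
      show "AE \<theta> in circle_measure. (\<lambda>n. q n (of_real r * cis \<theta>) $ j) \<longlonglongrightarrow> x \<theta> $ j"
        using q_lim by (auto elim!: eventually_mono intro: tendsto_vec_nth)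
      show "AE \<theta> in circle_measure. norm (q n (of_real r * cis \<theta>) $ j) \<le> B2" for n
        using B2'[OF qK2[OF rc]] Finite_Cartesian_Product.norm_nth_le order_trans by (intro AE_I2) blast
      have bl: "(\<lambda>z::real^'m. z $ j) \<in> borel_measurable borel" by (intro borel_measurable_continuous_onI continuous_intros)
      show "(\<lambda>\<theta>. x \<theta> $ j) \<in> borel_measurable circle_measure" using measurable_compose[OF x(1) bl] by simp
      show "(\<lambda>\<theta>. q n (of_real r * cis \<theta>) $ j) \<in> borel_measurable circle_measure" for n using measurable_compose[OF mq bl] by simp
    qed simp
    moreover have "(LINT \<theta>|circle_measure. q n (of_real r * cis \<theta>) $ j) = an n $ j" for n
      by (simp add: q_def an_def circle_mean_poly)
    moreover have "(LINT \<theta>|circle_measure. x \<theta> $ j) = a $ j"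
      unfolding a_def by (rule integral_bounded_linear[OF bounded_linear_vec_nth ix])
    ultimately show "(\<lambda>n. an n $ j) \<longlonglongrightarrow> a $ j" by simp
  qed
  have t0U: "t0 \<in> U" using tU[of 0] r by simp
  have ra: "(\<lambda>n. (t0, torus_act \<alpha> (rexp (an n)))) \<longlonglongrightarrow> (t0, torus_act \<alpha> (rexp a))" for \<alpha>
    unfolding torus_act_def rexp_def by (intro tendsto_intros an_lim)
  have acl: "(t0, torus_act \<alpha> (rexp a)) \<in> closure \<Omega> \<inter> (U \<times> UNIV)" for \<alpha>
  proof -
    have "(t0, torus_act \<alpha> (rexp a)) \<in> closure \<Omega>"
      by (rule LIMSEQ_in_closure[OF ra]) (use pd(1) in \<open>auto simp: torus_iff logdom_def\<close>)
    then show ?thesis using t0U by simp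
  qed
  have \<rho>a: "\<rho> (t0, torus_act \<alpha> (rexp a)) \<le> - \<kappa> * r^2 / 4" for \<alpha>
  proof -
    have "(t0, torus_act \<alpha> (rexp a)) \<in> N" using acl W by blast
    then have "isCont \<rho> (t0, torus_act \<alpha> (rexp a))" using Ck_on_imp_continuous_on[OF \<rho>] N(1) by (simp add: continuous_on_eq_continuous_at)
    then have "(\<lambda>n. \<rho> (t0, torus_act \<alpha> (rexp (an n)))) \<longlonglongrightarrow> \<rho> (t0, torus_act \<alpha> (rexp a))" using ra by (rule isCont_tendsto_compose)
    then show ?thesis by (rule LIMSEQ_le_const2) (use pd(2) in blast)
  qed
  show "\<rho> (t0, torus_act \<alpha> (rexp a)) \<le> - \<kappa> * r^2 / 4" by (rule \<rho>a)
  \<comment> \<open>The limit a is so far only known to have its orbit in the closure of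
    \<open>\<Omega>\<close>; the strictly negative bound on \<open>\<rho>\<close> places it in
    \<open>\<Omega>\<close>.\<close>
  have "- \<kappa> * r^2 / 4 < 0" using \<kappa>0 r by simp
  then have "\<rho> (t0, torus_act (\<lambda>_. 0) (rexp a)) < 0" using \<rho>a[of "\<lambda>_. 0"] by linarith
  moreover have "(t0, torus_act (\<lambda>_. 0) (rexp a)) \<in> N" using acl W by blast
  ultimately have "(t0, rexp a) \<in> \<Omega>" by (subst \<Omega>_eq) simp
  then show "a \<in> logdom t0" by (simp add: logdom_def)
  have iD: "(\<lambda>p. indicator D p *\<^sub>R \<Phi> p) \<in> borel_measurable borel"
    by (rule borel_measurable_continuous_on_indicator[OF _ c\<Phi>]) (use D in auto)
  have m1: "(\<lambda>\<theta>. (of_real r * cis \<theta>, x \<theta>)) \<in> borel_measurable borel"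
    by (intro borel_measurable_Pair x(1) borel_measurable_continuous_onI continuous_intros)
  have mx: "(\<lambda>\<theta>. \<Phi> (of_real r * cis \<theta>, x \<theta>)) \<in> borel_measurable borel"
  proof -
    have "(of_real r * cis \<theta>, x \<theta>) \<in> D" for \<theta> using x(2) KD by blast
    then show ?thesis using measurable_compose[OF m1 iD] by simp
  qed
  have \<Phi>x: "\<Phi> (of_real r * cis \<theta>, x) = \<phi> (t0 + (of_real r * cis \<theta>) *s w, rexp x)" for \<theta> x by (simp add: \<Phi>_def G_def)
  show "(\<lambda>\<theta>. \<phi> (t0 + (of_real r * cis \<theta>) *s w, rexp (x \<theta>))) \<in> borel_measurable borel" using mx by (simp add: \<Phi>x)
  have L1: "(\<lambda>n. LINT \<theta>|circle_measure. \<Phi> (of_real r * cis \<theta>, q n (of_real r * cis \<theta>))) \<longlonglongrightarrow> (LINT \<theta>|circle_measure. \<Phi> (of_real r * cis \<theta>, x \<theta>))"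
  proof (rule integral_dominated_convergence[where w="\<lambda>_. B"])
    show "AE \<theta> in circle_measure. (\<lambda>n. \<Phi> (of_real r * cis \<theta>, q n (of_real r * cis \<theta>))) \<longlonglongrightarrow> \<Phi> (of_real r * cis \<theta>, x \<theta>)"
      using q_lim
    proof eventually_elim
      case (elim \<theta>)
      have "(of_real r * cis \<theta>, x \<theta>) \<in> D" using x(2) KD by blast
      then have "isCont \<Phi> (of_real r * cis \<theta>, x \<theta>)" using c\<Phi> D by (simp add: continuous_on_eq_continuous_at)
      moreover have "(\<lambda>n. (of_real r * cis \<theta>, q n (of_real r * cis \<theta>))) \<longlonglongrightarrow> (of_real r * cis \<theta>, x \<theta>)" by (intro tendsto_intros elim)
      ultimately show ?case by (rule isCont_tendsto_compose)
    qed
    show "AE \<theta> in circle_measure. norm (\<Phi> (of_real r * cis \<theta>, q n (of_real r * cis \<theta>))) \<le> B" for n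
      using B[OF qK2[OF rc]] by (intro AE_I2) simp
    have c\<Phi>q: "continuous_on UNIV (\<lambda>\<theta>. \<Phi> (of_real r * cis \<theta>, q n (of_real r * cis \<theta>)))" for n
      by (rule continuous_on_compose2[OF c\<Phi>]) (use qK2[OF rc] K2(2) in \<open>auto intro!: continuous_intros cq\<close>)
    show "(\<lambda>\<theta>. \<Phi> (of_real r * cis \<theta>, q n (of_real r * cis \<theta>))) \<in> borel_measurable circle_measure" for n
      using borel_measurable_continuous_onI[OF c\<Phi>q] by simp
  qed (use mx in simp_all)
  have L2: "(\<lambda>n. \<phi> (t0, rexp (an n))) \<longlonglongrightarrow> \<phi> (t0, rexp a)"
  proof -
    have "(t0, rexp a) \<in> F" using \<open>(t0, rexp a) \<in> \<Omega>\<close> \<Omega>_sub by blast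
    then have "isCont \<phi> (t0, rexp a)" using Ck_on_imp_continuous_on[OF \<phi>] F(1) by (simp add: continuous_on_eq_continuous_at)
    then show ?thesis using ra[of "\<lambda>_. 0"] by (auto intro: isCont_tendsto_compose)
  qed
  have "\<phi> (t0, rexp a) \<le> (LINT \<theta>|circle_measure. \<Phi> (of_real r * cis \<theta>, x \<theta>))"
    by (rule LIMSEQ_le[OF L2 L1]) (use pd(3) in \<open>auto simp: \<Phi>x\<close>)
  then show "\<phi> (t0, rexp a) \<le> (LINT \<theta>|circle_measure. \<phi> (t0 + (of_real r * cis \<theta>) *s w, rexp (x \<theta>)))" by (simp add: \<Phi>x)
qed

end

section \<open>Integration in logarithmic coordinates\<close>

text \<open>The minus sign turns the test rays \<open>{b<..}\<close> into discs about 0 of radius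
  exp (-b), whose areas are finite and known, as the uniqueness criterion for measures requires.
  Differentiating pi exp (-2 b) gives the density.\<close>

lemma distr_neg_ln_cmod:
  "distr (lborel :: complex measure) borel (\<lambda>z. - ln (cmod z)) = density lborel (\<lambda>y. ennreal (2 * pi * exp (- 2 * y)))"
proof (rule measure_eqI_lessThan)
  fix b :: real
  have "AE z in (lborel :: complex measure). z \<noteq> 0" by (rule AE_lborel_singleton)
  have "emeasure (distr (lborel :: complex measure) borel (\<lambda>z. - ln (cmod z))) {b<..} = emeasure lborel {z::complex. b < - ln (cmod z)}"
    by (subst emeasure_distr) (auto simp: vimage_def)
  also have "\<dots> = emeasure lborel (ball (0::complex) (exp (- b)))"
  proof (rule emeasure_eq_AE)
    show "AE z in lborel. z \<in> {z::complex. b < - ln (cmod z)} \<longleftrightarrow> z \<in> ball 0 (exp (- b))"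
      using \<open>AE z in (lborel :: complex measure). z \<noteq> 0\<close>
    proof eventually_elim
      case (elim z)
      have "b < - ln (cmod z) \<longleftrightarrow> ln (cmod z) < - b" by linarith
      also have "\<dots> \<longleftrightarrow> cmod z < exp (- b)" using elim by (metis exp_less_cancel_iff exp_ln zero_less_norm_iff)
      finally show ?case by simp
    qed
  qed measurable
  also have "\<dots> = ennreal (pi * exp (- 2 * b))"
    by (subst emeasure_ball) (auto simp: unit_ball_vol_2 power2_eq_square simp flip: exp_add)
  finally have L: "emeasure (distr (lborel :: complex measure) borel (\<lambda>z. - ln (cmod z))) {b<..} = ennreal (pi * exp (- 2 * b))" .
  have "emeasure (density lborel (\<lambda>y. ennreal (2 * pi * exp (- 2 * y)))) {b<..} = (\<integral>\<^sup>+y. ennreal (2 * pi * exp (- 2 * y)) * indicator {b<..} y \<partial>lborel)"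
    by (subst emeasure_density) auto
  also have "\<dots> = (\<integral>\<^sup>+y. ennreal (2 * pi * exp (- 2 * y)) * indicator {b..} y \<partial>lborel)"
    by (intro nn_integral_cong_AE) (use AE_lborel_singleton[of b] in \<open>auto elim!: eventually_mono simp: indicator_def\<close>)
  also have "\<dots> = ennreal (0 - (- pi * exp (- 2 * b)))"
  proof (rule nn_integral_FTC_atLeast)
    show "((\<lambda>y. - pi * exp (- 2 * y)) has_real_derivative 2 * pi * exp (- 2 * x)) (at x)" for x
      by (auto intro!: derivative_eq_intros)
    show "((\<lambda>y. - pi * exp (- 2 * y)) \<longlongrightarrow> 0) at_top" by real_asymp
  qed auto
  finally have R: "emeasure (density lborel (\<lambda>y. ennreal (2 * pi * exp (- 2 * y)))) {b<..} = ennreal (pi * exp (- 2 * b))" by simp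
  show "emeasure (distr (lborel :: complex measure) borel (\<lambda>z. - ln (cmod z))) {b<..} = emeasure (density lborel (\<lambda>y. ennreal (2 * pi * exp (- 2 * y)))) {b<..}"
    by (simp only: L R)
  show "emeasure (distr (lborel :: complex measure) borel (\<lambda>z. - ln (cmod z))) {b<..} < \<infinity>" by (simp only: L) simp
qed auto

text \<open>Integration in polar coordinates for radial functions with the radius written as exp x:
  the factor r dr becomes exp (2 x) dx.\<close>

lemma nn_integral_complex_log:
  assumes [measurable]: "g \<in> borel_measurable borel"
  shows "(\<integral>\<^sup>+z. g (ln (cmod z)) \<partial>(lborel :: complex measure)) = (\<integral>\<^sup>+x. g x * ennreal (2 * pi * exp (2 * x)) \<partial>lborel)"
proof -
  have "(\<integral>\<^sup>+z. g (ln (cmod z)) \<partial>(lborel :: complex measure)) = (\<integral>\<^sup>+y. g (- y) \<partial>(distr (lborel :: complex measure) borel (\<lambda>z. - ln (cmod z))))"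
    by (subst nn_integral_distr) auto
  also have "\<dots> = (\<integral>\<^sup>+y. ennreal (2 * pi * exp (- 2 * y)) * g (- y) \<partial>lborel)"
    unfolding distr_neg_ln_cmod by (subst nn_integral_density) auto
  also have "\<dots> = ennreal \<bar>- 1\<bar> * (\<integral>\<^sup>+x. ennreal (2 * pi * exp (- 2 * (0 + (- 1) * x))) * g (- (0 + (- 1) * x)) \<partial>lborel)"
    by (rule nn_integral_real_affine) auto
  finally show ?thesis by (simp add: mult.commute)
qed

lemma measurable_vec_lambda:
  fixes g :: "'m::finite \<Rightarrow> 'z \<Rightarrow> 'a::euclidean_space"
  assumes "\<And>j. g j \<in> borel_measurable M"
  shows "(\<lambda>z. \<chi> j. g j z) \<in> borel_measurable M"
  unfolding vec_sum_axis by (intro borel_measurable_sum measurable_compose[OF assms borel_measurable_continuous_onI])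
    (auto intro!: linear_continuous_on bounded_linear_axis)

lemma distr_PiM_lborel_vec:
  "distr (Pi\<^sub>M (UNIV :: 'm::finite set) (\<lambda>_. lborel :: complex measure)) borel (\<lambda>f. \<chi> j. f j) = (lborel :: (complex^'m) measure)"
proof (rule lborel_eqI[symmetric])
  interpret product_sigma_finite "\<lambda>_::'m. lborel :: complex measure" ..
  have m: "(\<lambda>f. \<chi> j. f j) \<in> measurable (Pi\<^sub>M (UNIV :: 'm set) (\<lambda>_. lborel :: complex measure)) borel"
    by (rule measurable_vec_lambda) simp
  fix l u :: "complex^'m" assume lu: "\<And>b. b \<in> Basis \<Longrightarrow> l \<bullet> b \<le> u \<bullet> b"
  have v: "(\<lambda>f. \<chi> j. f j) -` box l u \<inter> space (Pi\<^sub>M (UNIV :: 'm set) (\<lambda>_. lborel :: complex measure)) = (\<Pi>\<^sub>E j\<in>UNIV. box (l $ j) (u $ j))"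
    by (auto simp: space_PiM PiE_UNIV_domain box_def Basis_vec_def inner_axis)
  have lu': "l $ j \<bullet> b \<le> u $ j \<bullet> b" if "b \<in> Basis" for j b
    using lu[of "axis j b"] that by (auto simp: inner_axis Basis_vec_def)
  have "emeasure (distr (Pi\<^sub>M (UNIV :: 'm set) (\<lambda>_. lborel :: complex measure)) borel (\<lambda>f. \<chi> j. f j)) (box l u)
     = (\<Prod>j\<in>UNIV. emeasure lborel (box (l $ j) (u $ j)))"
    by (subst emeasure_distr[OF m]) (auto simp: v emeasure_PiM)
  also have "\<dots> = ennreal (\<Prod>j\<in>UNIV. \<Prod>b\<in>Basis. (u $ j - l $ j) \<bullet> b)"
    by (subst prod_ennreal[symmetric]) (auto simp: emeasure_lborel_box lu' inner_diff_left intro!: prod_nonneg prod.cong)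
  also have "(\<Prod>j\<in>UNIV. \<Prod>b\<in>Basis. (u $ j - l $ j) \<bullet> b) = (\<Prod>b\<in>Basis. (u - l) \<bullet> b)"
  proof -
    have "(\<Prod>b\<in>Basis. (u - l) \<bullet> b) = (\<Prod>b\<in>(\<lambda>(j, b). axis j b) ` (UNIV \<times> Basis). (u - l) \<bullet> b)"
      by (rule prod.cong) (auto simp: Basis_vec_def)
    also have "\<dots> = (\<Prod>p\<in>UNIV \<times> Basis. (u - l) \<bullet> (axis (fst p) (snd p)))"
      by (subst prod.reindex) (auto simp: inj_on_def axis_eq_axis case_prod_unfold)
    also have "\<dots> = (\<Prod>j\<in>UNIV. \<Prod>b\<in>Basis. (u - l) \<bullet> axis j b)"
      by (simp add: prod.cartesian_product case_prod_unfold)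
    finally show ?thesis by (simp add: inner_axis)
  qed
  finally show "emeasure (distr (Pi\<^sub>M (UNIV :: 'm set) (\<lambda>_. lborel :: complex measure)) borel (\<lambda>f. \<chi> j. f j)) (box l u) = ennreal (\<Prod>b\<in>Basis. (u - l) \<bullet> b)" .
qed simp

definition vec_ln :: "complex^'m \<Rightarrow> real^'m" where "vec_ln z = (\<chi> j. ln (cmod (z $ j)))"

lemma measurable_vec_ln [measurable]: "vec_ln \<in> borel_measurable (borel :: (complex^'m::finite) measure)"
  unfolding vec_ln_def
proof (rule measurable_vec_lambda)
  fix j
  have "(\<lambda>z::complex^'m. z $ j) \<in> borel_measurable borel" by (intro borel_measurable_continuous_onI continuous_intros)
  then show "(\<lambda>z::complex^'m. ln (cmod (z $ j))) \<in> borel_measurable borel" by measurable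
qed

text \<open>During the induction only the coordinates in the list are integrated; \<open>x\<close>
  supplies the others.\<close>

lemma nn_integral_vec_ln_aux:
  fixes h :: "real^'m::finite \<Rightarrow> ennreal" and x :: "real^'m"
  assumes "distinct is" "h \<in> borel_measurable borel"
  shows "(\<integral>\<^sup>+f. h (\<chi> j. if j \<in> set is then ln (cmod (f j)) else x $ j) \<partial>Pi\<^sub>M (set is) (\<lambda>_. lborel :: complex measure))
     = iter_int is (\<lambda>x. h x * (\<Prod>j\<in>set is. ennreal (2 * pi * exp (2 * x $ j)))) x"
  using assms
proof (induction "is" arbitrary: h)
  case Nil
  interpret product_sigma_finite "\<lambda>_::'m. lborel :: complex measure" ..
  show ?case by (simp add: PiM_empty nn_integral_count_space_finite)
next
  case (Cons i "is")
  interpret product_sigma_finite "\<lambda>_::'m. lborel :: complex measure" ..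
  note [measurable] = Cons.prems(2)
  have i: "i \<notin> set is" using Cons.prems by simp
  define h' where "h' X = (\<integral>\<^sup>+s. h (vec_upd X i s) * ennreal (2 * pi * exp (2 * s)) \<partial>lborel)" for X
  have h'[measurable]: "h' \<in> borel_measurable borel" unfolding h'_def by measurable
  have mX: "(\<lambda>f. \<chi> j. if j \<in> J then ln (cmod (f j)) else x $ j) \<in> borel_measurable (Pi\<^sub>M J (\<lambda>_. lborel :: complex measure))" for J
  proof (rule measurable_vec_lambda)
    fix j
    show "(\<lambda>f. if j \<in> J then ln (cmod (f j)) else x $ j) \<in> borel_measurable (Pi\<^sub>M J (\<lambda>_. lborel :: complex measure))"
      by (cases "j \<in> J") (auto intro!: borel_measurable_ln borel_measurable_norm)
  qed
  have "(\<integral>\<^sup>+f. h (\<chi> j. if j \<in> set (i # is) then ln (cmod (f j)) else x $ j) \<partial>Pi\<^sub>M (set (i # is)) (\<lambda>_. lborel :: complex measure))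
    = (\<integral>\<^sup>+f. (\<integral>\<^sup>+y. h (\<chi> j. if j \<in> insert i (set is) then ln (cmod ((f(i := y)) j)) else x $ j) \<partial>lborel) \<partial>Pi\<^sub>M (set is) (\<lambda>_. lborel :: complex measure))"
    using i measurable_compose[OF mX Cons.prems(2), of "insert i (set is)"] by (simp add: product_nn_integral_insert)
  also have "\<dots> = (\<integral>\<^sup>+f. h' (\<chi> j. if j \<in> set is then ln (cmod (f j)) else x $ j) \<partial>Pi\<^sub>M (set is) (\<lambda>_. lborel :: complex measure))"
  proof (rule nn_integral_cong)
    fix f :: "'m \<Rightarrow> complex"
    define X where "X = (\<chi> j. if j \<in> set is then ln (cmod (f j)) else x $ j)"
    have "(\<chi> j. if j \<in> insert i (set is) then ln (cmod ((f(i := y)) j)) else x $ j) = vec_upd X i (ln (cmod y))" for y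
      by (auto simp: vec_eq_iff X_def)
    then have "(\<integral>\<^sup>+y. h (\<chi> j. if j \<in> insert i (set is) then ln (cmod ((f(i := y)) j)) else x $ j) \<partial>lborel) = (\<integral>\<^sup>+y. h (vec_upd X i (ln (cmod y))) \<partial>lborel)" by simp
    also have "\<dots> = h' X" unfolding h'_def by (rule nn_integral_complex_log) measurable
    finally show "(\<integral>\<^sup>+y. h (\<chi> j. if j \<in> insert i (set is) then ln (cmod ((f(i := y)) j)) else x $ j) \<partial>lborel) = h' X" .
  qed
  also have "\<dots> = iter_int is (\<lambda>x. h' x * (\<Prod>j\<in>set is. ennreal (2 * pi * exp (2 * x $ j)))) x"
    by (rule Cons.IH) (use Cons.prems in auto)
  also have "(\<lambda>x. h' x * (\<Prod>j\<in>set is. ennreal (2 * pi * exp (2 * x $ j)))) =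
     (\<lambda>x. \<integral>\<^sup>+y. h (vec_upd x i y) * (\<Prod>j\<in>set (i # is). ennreal (2 * pi * exp (2 * vec_upd x i y $ j))) \<partial>lborel)"
  proof (rule ext)
    fix X
    have "(\<Prod>j\<in>set (i # is). ennreal (2 * pi * exp (2 * vec_upd X i y $ j))) = ennreal (2 * pi * exp (2 * y)) * (\<Prod>j\<in>set is. ennreal (2 * pi * exp (2 * X $ j)))" for y
      using i by (auto intro!: arg_cong2[where f="(*)"] prod.cong)
    then have "(\<integral>\<^sup>+y. h (vec_upd X i y) * (\<Prod>j\<in>set (i # is). ennreal (2 * pi * exp (2 * vec_upd X i y $ j))) \<partial>lborel)
       = (\<integral>\<^sup>+y. (h (vec_upd X i y) * ennreal (2 * pi * exp (2 * y))) * (\<Prod>j\<in>set is. ennreal (2 * pi * exp (2 * X $ j))) \<partial>lborel)"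
      by (simp only: mult.assoc)
    also have "\<dots> = h' X * (\<Prod>j\<in>set is. ennreal (2 * pi * exp (2 * X $ j)))" unfolding h'_def
      by (rule nn_integral_multc) measurable
    finally show "h' X * (\<Prod>j\<in>set is. ennreal (2 * pi * exp (2 * X $ j))) = (\<integral>\<^sup>+y. h (vec_upd X i y) * (\<Prod>j\<in>set (i # is). ennreal (2 * pi * exp (2 * vec_upd X i y $ j))) \<partial>lborel)" ..
  qed
  finally show ?case by simp
qed

lemma nn_integral_vec_ln:
  fixes h :: "real^'m::finite \<Rightarrow> ennreal"
  assumes "distinct is" "set is = UNIV" "h \<in> borel_measurable borel"
  shows "(\<integral>\<^sup>+z. h (vec_ln z) \<partial>(lborel :: (complex^'m) measure)) = iter_int is (\<lambda>x. h x * (\<Prod>j\<in>UNIV. ennreal (2 * pi * exp (2 * x $ j)))) x"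
proof -
  have m: "(\<lambda>f. \<chi> j. f j) \<in> measurable (Pi\<^sub>M (UNIV :: 'm set) (\<lambda>_. lborel :: complex measure)) borel"
    by (rule measurable_vec_lambda) simp
  have "(\<integral>\<^sup>+z. h (vec_ln z) \<partial>(lborel :: (complex^'m) measure)) = (\<integral>\<^sup>+f. h (vec_ln (\<chi> j. f j)) \<partial>Pi\<^sub>M UNIV (\<lambda>_. lborel :: complex measure))"
    unfolding distr_PiM_lborel_vec[symmetric] by (rule nn_integral_distr[OF m]) (simp add: measurable_compose[OF measurable_vec_ln assms(3)])
  also have "\<dots> = (\<integral>\<^sup>+f. h (\<chi> j. if j \<in> set is then ln (cmod (f j)) else x $ j) \<partial>Pi\<^sub>M (set is) (\<lambda>_. lborel :: complex measure))"
    by (simp add: vec_ln_def assms(2))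
  also have "\<dots> = iter_int is (\<lambda>x. h x * (\<Prod>j\<in>set is. ennreal (2 * pi * exp (2 * x $ j)))) x"
    by (rule nn_integral_vec_ln_aux[OF assms(1,3)])
  finally show ?thesis by (simp add: assms(2))
qed

text \<open>The logarithm of |z^k|^2 times the Jacobian of logarithmic polar coordinates: 2 (k_j +
  1) x_j collects |z_j|^(2 k_j) and exp (2 x_j), and ln (2 pi) comes from the angle. Being affine,
  it commutes with means.\<close>

definition log_weight :: "('m::finite \<Rightarrow> nat) \<Rightarrow> real^'m \<Rightarrow> real" where
  "log_weight k x = (\<Sum>j\<in>UNIV. ln (2 * pi) + 2 * (real (k j) + 1) * x $ j)"

lemma continuous_on_log_weight [continuous_intros]: "continuous_on S f \<Longrightarrow> continuous_on S (\<lambda>x. log_weight k (f x))"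
  unfolding log_weight_def by (intro continuous_intros)

lemma log_weight_convex_comb: "log_weight k ((1 - s) *\<^sub>R x + s *\<^sub>R y) = (1 - s) * log_weight k x + s * log_weight k y"
  unfolding log_weight_def by (simp add: sum_distrib_left sum.distrib[symmetric]) (rule sum.cong, simp_all add: algebra_simps)

lemma mono_weight_rexp:
  "mono_weight \<phi> k (t, rexp x) * (\<Prod>j\<in>UNIV. 2 * pi * exp (2 * x $ j)) = exp (log_weight k x - \<phi> (t, rexp x))" for x :: "real^'m::finite"
proof -
  have "(cmod (\<Prod>j\<in>UNIV. rexp x $ j ^ k j))\<^sup>2 = (\<Prod>j\<in>UNIV. exp (2 * real (k j) * x $ j))"
    by (simp add: rexp_def prod_norm[symmetric] norm_power prod_power_distrib[symmetric] flip: exp_of_nat_mult power_mult exp_double)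
       (simp add: mult_ac power2_eq_square prod.distrib[symmetric] flip: exp_add)
  moreover have "exp (log_weight k x) = (\<Prod>j\<in>UNIV. exp (2 * real (k j) * x $ j) * (2 * pi * exp (2 * x $ j)))"
    unfolding log_weight_def by (subst exp_sum) (auto intro!: prod.cong simp: exp_add algebra_simps)
  ultimately show ?thesis by (simp add: mono_weight_def exp_diff exp_minus prod.distrib field_simps)
qed

section \<open>The inequality on circles, in logarithmic coordinates and for fiber integrals\<close>

context reinhardt_weight
begin

text \<open>Restriction to a compact set on which everything is continuous yields joint Borel
  measurability.\<close>

lemma measurable_circle_weight:
  assumes K: "compact K" "\<And>\<tau> x. (\<tau>, x) \<in> K \<Longrightarrow> x \<in> logdom (t0 + \<tau> *s w)"
  shows "(\<lambda>p. indicator K (of_real r * cis (fst p), snd p) * exp (log_weight k (snd p) - \<phi> (t0 + (of_real r * cis (fst p)) *s w, rexp (snd p))))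
    \<in> borel_measurable (circle_measure \<Otimes>\<^sub>M borel)"
proof -
  define g where "g p = exp (log_weight k (snd p) - \<phi> (t0 + fst p *s w, rexp (snd p)))" for p :: "complex \<times> (real^'m)"
  have cg: "continuous_on K g" unfolding g_def vector_scalar_mult_def
    by (intro continuous_intros continuous_on_compose2[OF Ck_on_imp_continuous_on[OF \<phi>]])
      (use K(2) \<Omega>_sub in \<open>auto simp: logdom_def vector_scalar_mult_def\<close>)
  have gm: "(\<lambda>p. indicator K p *\<^sub>R g p) \<in> borel_measurable borel"
    by (rule borel_measurable_continuous_on_indicator[OF _ cg]) (intro borel_closed compact_imp_closed K(1))
  have cism: "(\<lambda>\<theta>. of_real r * cis \<theta>) \<in> borel_measurable borel" by (intro borel_measurable_continuous_onI continuous_intros)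
  have "(\<lambda>p. (of_real r * cis (fst p), snd p)) \<in> borel_measurable (circle_measure \<Otimes>\<^sub>M (borel :: (real^'m) measure))"
  proof (rule borel_measurable_Pair)
    have "fst \<in> measurable (circle_measure \<Otimes>\<^sub>M (borel :: (real^'m) measure)) borel" by measurable
    from measurable_compose[OF this cism] show "(\<lambda>p. of_real r * cis (fst p)) \<in> borel_measurable (circle_measure \<Otimes>\<^sub>M (borel :: (real^'m) measure))" .
  qed measurable
  from measurable_compose[OF this gm] show ?thesis by (simp add: g_def)
qed

text \<open>The intersection over all rotations is uncountable, but its complement in the domain is
  a union of open sets.\<close>

lemma sublevel_borel: "{x \<in> logdom t. \<forall>\<alpha>. \<rho> (t, torus_act \<alpha> (rexp x)) \<le> b} \<in> sets borel"
proof -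
  have o: "open {x \<in> logdom t. b < \<rho> (t, torus_act \<alpha> (rexp x))}" for \<alpha>
  proof -
    have im: "(\<lambda>x. (t, torus_act \<alpha> (rexp x))) ` logdom t \<subseteq> N" using \<Omega>_sub(3) by (auto simp: logdom_def torus_iff)
    have "continuous_on (logdom t) (\<lambda>x. (t, torus_act \<alpha> (rexp x)))"
      unfolding torus_act_def rexp_def by (auto intro!: continuous_intros)
    from continuous_on_compose2[OF Ck_on_imp_continuous_on[OF \<rho>] this im]
    have "continuous_on (logdom t) (\<lambda>x. \<rho> (t, torus_act \<alpha> (rexp x)))" .
    from continuous_open_preimage[OF this open_logdom, of "{b<..}"] show ?thesis by (simp add: Int_def vimage_def)
  qed
  have "{x \<in> logdom t. \<forall>\<alpha>. \<rho> (t, torus_act \<alpha> (rexp x)) \<le> b} = logdom t - (\<Union>\<alpha>. {x \<in> logdom t. b < \<rho> (t, torus_act \<alpha> (rexp x))})"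
    by (auto simp: not_less[symmetric])
  also have "\<dots> \<in> sets borel" by (intro sets.Diff borel_open open_logdom open_UN ballI o)
  finally show ?thesis .
qed

text \<open>The hypotheses of \<open>mean_prekopa_iterated\<close> are met: log-concavity by
  convexity of the slices of \<open>K\<close> and \<open>\<phi>_logconvex\<close>, and domination by
  \<open>measurable_loop\<close>, the affine part of the exponent passing exactly to the mean. The
  gain in \<open>\<rho>\<close> is recorded in the set on which \<open>f0\<close> lives.\<close>

lemma circle_prekopa:
  fixes w :: "complex^'n" and k :: "'m \<Rightarrow> nat"
  assumes w: "w \<noteq> 0" and r: "0 < r"
    and tU: "\<And>\<tau>. cmod \<tau> \<le> r \<Longrightarrow> t0 + \<tau> *s w \<in> U"
    and c: "\<And>\<tau>. cmod \<tau> \<le> r \<Longrightarrow> c \<in> logdom (t0 + \<tau> *s w)"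
    and \<kappa>0: "0 < \<kappa>" and \<kappa>: "\<And>\<tau> z b. cmod \<tau> \<le> r \<Longrightarrow> (t0 + \<tau> *s w, z) \<in> \<Omega> \<Longrightarrow> \<kappa> \<le> levi (cscale \<i>) \<rho> (t0 + \<tau> *s w, z) (w, b)"
    and K: "compact K" "\<And>\<tau> x. (\<tau>, x) \<in> K \<Longrightarrow> cmod \<tau> = r \<and> x \<in> logdom (t0 + \<tau> *s w)"
    and Kconv: "\<And>\<tau>. convex {x. (\<tau>, x) \<in> K}"
    and e: "0 < e" and "is": "distinct is"
  defines "f \<equiv> \<lambda>\<theta> x. indicator K (of_real r * cis \<theta>, x) * exp (log_weight k x - \<phi> (t0 + (of_real r * cis \<theta>) *s w, rexp x))"
    and "f0 \<equiv> \<lambda>x. indicator {x \<in> logdom t0. \<forall>\<alpha>. \<rho> (t0, torus_act \<alpha> (rexp x)) \<le> - \<kappa> * r^2 / 4} x * exp (log_weight k x - \<phi> (t0, rexp x))"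
  assumes ge: "\<And>\<theta>. ennreal e \<le> iter_int is (\<lambda>x. ennreal (f \<theta> x)) 0"
  shows "ennreal (exp (LINT \<theta>|circle_measure. ln (enn2real (iter_int is (\<lambda>x. ennreal (f \<theta> x)) 0)))) \<le> iter_int is (\<lambda>x. ennreal (f0 x)) 0"
proof -
  define g where "g p = exp (log_weight k (snd p) - \<phi> (t0 + fst p *s w, rexp (snd p)))" for p :: "complex \<times> (real^'m)"
  have cg: "continuous_on K g" unfolding g_def vector_scalar_mult_def
    by (intro continuous_intros continuous_on_compose2[OF Ck_on_imp_continuous_on[OF \<phi>]])
      (use K(2) \<Omega>_sub in \<open>auto simp: logdom_def vector_scalar_mult_def\<close>)
  have "bounded (g ` K)" by (intro compact_imp_bounded compact_continuous_image cg K)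
  then obtain B where "\<forall>v\<in>g ` K. norm v \<le> B" unfolding bounded_iff by blast
  then have B: "\<And>p. p \<in> K \<Longrightarrow> g p \<le> B" by (auto simp: g_def)
  obtain R where R: "\<And>p. p \<in> K \<Longrightarrow> norm p \<le> R" using compact_imp_bounded[OF K(1)] unfolding bounded_iff by blast
  have fg: "f \<theta> x = indicator K (of_real r * cis \<theta>, x) *\<^sub>R g (of_real r * cis \<theta>, x)" for \<theta> x by (simp add: f_def g_def)
  have f0m: "f0 \<in> borel_measurable borel"
  proof -
    have "continuous_on {x \<in> logdom t0. \<forall>\<alpha>. \<rho> (t0, torus_act \<alpha> (rexp x)) \<le> - \<kappa> * r^2 / 4} (\<lambda>x. exp (log_weight k x - \<phi> (t0, rexp x)))"
      by (intro continuous_intros continuous_on_compose2[OF Ck_on_imp_continuous_on[OF \<phi>]])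
        (use \<Omega>_sub in \<open>auto simp: logdom_def\<close>)
    from borel_measurable_continuous_on_indicator[OF sublevel_borel this] show ?thesis by (simp add: f0_def)
  qed
  show ?thesis
  proof (rule mean_prekopa_iterated[where R="max 0 R" and e=e and C="max 0 B"])
    show "prob_space circle_measure" by (rule prob_space_circle_measure)
    show "(\<lambda>p. f (fst p) (snd p)) \<in> borel_measurable (circle_measure \<Otimes>\<^sub>M borel)"
      unfolding f_def by (rule measurable_circle_weight) (use K in auto)
    show "(\<lambda>x. ennreal (f0 x)) \<in> borel_measurable borel" using f0m by simp
    show "f \<theta> x \<le> max 0 B" for \<theta> x using B[of "(of_real r * cis \<theta>, x)"] by (auto simp: fg indicator_def)
    show "\<bar>x $ i\<bar> \<le> max 0 R" if "f \<theta> x \<noteq> 0" for \<theta> x i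
    proof -
      have "(of_real r * cis \<theta>, x) \<in> K" using that by (auto simp: fg indicator_def split: if_splits)
      from R[OF this] have "norm x \<le> R" by (rule order_trans[OF norm_snd_le])
      then show ?thesis using component_le_norm_cart[of x i] by simp
    qed
    show "log_concave (f \<theta>)" for \<theta>
      unfolding log_concave_def
    proof (intro allI impI)
      fix x y and s :: real assume s: "0 < s" "s < 1" and pos: "0 < f \<theta> x" "0 < f \<theta> y"
      let ?\<tau> = "of_real r * cis \<theta>"
      have xK: "(?\<tau>, x) \<in> K" "(?\<tau>, y) \<in> K" using pos by (auto simp: f_def indicator_def zero_less_mult_iff)
      have zK: "(?\<tau>, (1 - s) *\<^sub>R x + s *\<^sub>R y) \<in> K"
        using convexD[OF Kconv[of ?\<tau>], of x y "1 - s" s] xK s by simp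
      have xl: "x \<in> logdom (t0 + ?\<tau> *s w)" "y \<in> logdom (t0 + ?\<tau> *s w)" "t0 + ?\<tau> *s w \<in> U"
        using K(2)[OF xK(1)] K(2)[OF xK(2)] tU[of ?\<tau>] by auto
      have "(1-s) * ln (f \<theta> x) + s * ln (f \<theta> y) = log_weight k ((1 - s) *\<^sub>R x + s *\<^sub>R y) - ((1-s) * \<phi> (t0 + ?\<tau> *s w, rexp x) + s * \<phi> (t0 + ?\<tau> *s w, rexp y))"
        using xK unfolding f_def log_weight_convex_comb by (simp add: algebra_simps)
      also have "\<dots> \<le> log_weight k ((1 - s) *\<^sub>R x + s *\<^sub>R y) - \<phi> (t0 + ?\<tau> *s w, rexp ((1 - s) *\<^sub>R x + s *\<^sub>R y))"
        using \<phi>_logconvex[OF xl(3,1,2), of s] s by simp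
      finally show "exp ((1-s) * ln (f \<theta> x) + s * ln (f \<theta> y)) \<le> f \<theta> ((1 - s) *\<^sub>R x + s *\<^sub>R y)"
        using zK by (simp add: f_def)
    qed
    show "mean_dominated circle_measure f (\<lambda>x. ennreal (f0 x))"
      unfolding mean_dominated_def
    proof (intro allI impI)
      fix x :: "real \<Rightarrow> real^'m" and e :: real
      assume x: "x \<in> borel_measurable circle_measure" "bounded (x ` space circle_measure)" and e: "0 < e" "\<forall>\<theta>\<in>space circle_measure. e \<le> f \<theta> (x \<theta>)"
      have x': "x \<in> borel_measurable borel" using x(1) by simp
      have xK: "(of_real r * cis \<theta>, x \<theta>) \<in> K" for \<theta>
      proof -
        have "0 < f \<theta> (x \<theta>)" using e by (auto intro: less_le_trans)
        then show ?thesis by (auto simp: f_def indicator_def zero_less_mult_iff)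
      qed
      define a where "a = (LINT \<theta>|circle_measure. x \<theta>)"
      note ml = measurable_loop[OF w r tU c \<kappa>0 \<kappa> K x' xK, folded a_def]
      have B2: "norm (x \<theta>) \<le> R" for \<theta> using R[OF xK[of \<theta>]] by (rule order_trans[OF norm_snd_le])
      have ix: "integrable circle_measure x"
        by (rule circle.integrable_const_bound[where B=R]) (use B2 x(1) in auto)
      have ixj: "integrable circle_measure (\<lambda>\<theta>. x \<theta> $ j)" for j by (rule integrable_bounded_linear[OF bounded_linear_vec_nth ix])
      have lw: "(LINT \<theta>|circle_measure. log_weight k (x \<theta>)) = log_weight k a" "integrable circle_measure (\<lambda>\<theta>. log_weight k (x \<theta>))"
      proof -
        have aj: "(LINT \<theta>|circle_measure. x \<theta> $ j) = a $ j" for j unfolding a_def by (rule integral_bounded_linear[OF bounded_linear_vec_nth ix])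
        show "integrable circle_measure (\<lambda>\<theta>. log_weight k (x \<theta>))" unfolding log_weight_def by (intro Bochner_Integration.integrable_sum Bochner_Integration.integrable_add integrable_mult_right ixj) simp
        show "(LINT \<theta>|circle_measure. log_weight k (x \<theta>)) = log_weight k a"
          unfolding log_weight_def using ixj by (subst Bochner_Integration.integral_sum) (auto simp: aj circle.prob_space[simplified])
      qed
      have i\<phi>: "integrable circle_measure (\<lambda>\<theta>. \<phi> (t0 + (of_real r * cis \<theta>) *s w, rexp (x \<theta>)))"
      proof -
        have "continuous_on K (\<lambda>p. \<phi> (t0 + fst p *s w, rexp (snd p)))" unfolding vector_scalar_mult_def
          by (intro continuous_intros continuous_on_compose2[OF Ck_on_imp_continuous_on[OF \<phi>]])
            (use K(2) \<Omega>_sub in \<open>auto simp: logdom_def vector_scalar_mult_def\<close>)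
        then have "bounded ((\<lambda>p. \<phi> (t0 + fst p *s w, rexp (snd p))) ` K)" by (intro compact_imp_bounded compact_continuous_image K)
        then obtain B3 where "\<forall>v\<in>(\<lambda>p. \<phi> (t0 + fst p *s w, rexp (snd p))) ` K. norm v \<le> B3" unfolding bounded_iff by blast
        then have "\<And>\<theta>. norm (\<phi> (t0 + (of_real r * cis \<theta>) *s w, rexp (x \<theta>))) \<le> B3" using xK by fastforce
        then show ?thesis using ml(4) by (intro circle.integrable_const_bound[where B=B3]) auto
      qed
      have "(LINT \<theta>|circle_measure. ln (f \<theta> (x \<theta>))) = (LINT \<theta>|circle_measure. log_weight k (x \<theta>) - \<phi> (t0 + (of_real r * cis \<theta>) *s w, rexp (x \<theta>)))"
        using xK by (intro Bochner_Integration.integral_cong) (auto simp: f_def)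
      also have "\<dots> = log_weight k a - (LINT \<theta>|circle_measure. \<phi> (t0 + (of_real r * cis \<theta>) *s w, rexp (x \<theta>)))"
        using lw i\<phi> by simp
      also have "\<dots> \<le> log_weight k a - \<phi> (t0, rexp a)" using ml(3) by simp
      finally have "exp (LINT \<theta>|circle_measure. ln (f \<theta> (x \<theta>))) \<le> f0 a" using ml(1,2) by (simp add: f0_def)
      then show "ennreal (exp (LINT \<theta>|circle_measure. ln (f \<theta> (x \<theta>)))) \<le> ennreal (f0 (LINT \<theta>|circle_measure. x \<theta>))"
        unfolding a_def[symmetric] by (rule ennreal_leI)
    qed
  qed (use ge e "is" in \<open>auto simp: f_def\<close>)
qed

end

lemma measurable_iter_int:
  fixes h :: "'t \<Rightarrow> real^'m::finite \<Rightarrow> ennreal"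
  assumes "(\<lambda>p. h (fst p) (snd p)) \<in> borel_measurable (M \<Otimes>\<^sub>M borel)"
  shows "(\<lambda>p. iter_int is (h (fst p)) (snd p)) \<in> borel_measurable (M \<Otimes>\<^sub>M borel)"
  using assms
proof (induction "is" arbitrary: h)
  case (Cons i "is")
  note [measurable] = Cons.prems
  have "(\<lambda>q. (fst (fst q), vec_upd (snd (fst q)) i (snd q) :: real^'m)) \<in> measurable ((M \<Otimes>\<^sub>M borel) \<Otimes>\<^sub>M lborel) (M \<Otimes>\<^sub>M borel)"
    by measurable
  from measurable_compose[OF this Cons.prems]
  have "(\<lambda>q. h (fst (fst q)) (vec_upd (snd (fst q)) i (snd q))) \<in> borel_measurable ((M \<Otimes>\<^sub>M borel) \<Otimes>\<^sub>M lborel)" by simp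
  then have "(\<lambda>p. \<integral>\<^sup>+y. h (fst p) (vec_upd (snd p) i y) \<partial>lborel) \<in> borel_measurable (M \<Otimes>\<^sub>M borel)"
    by (intro lborel.borel_measurable_nn_integral) (simp add: case_prod_unfold)
  from Cons.IH[of "\<lambda>t x. \<integral>\<^sup>+y. h t (vec_upd x i y) \<partial>lborel", OF this] show ?case by simp
qed simp

lemma vec_polar:
  assumes "\<forall>j. (z :: complex^'m) $ j \<noteq> 0"
  shows "\<exists>\<alpha>. z = torus_act \<alpha> (rexp (vec_ln z))"
proof
  have "cis (Arg (z $ j)) * of_real (exp (ln (cmod (z $ j)))) = z $ j" for j
    using assms rcis_cmod_Arg[of "z $ j"] by (simp add: rcis_def mult.commute)
  then show "z = torus_act (\<lambda>j. Arg (z $ j)) (rexp (vec_ln z))"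
    by (simp add: torus_act_def rexp_def vec_ln_def vec_eq_iff)
qed

lemma vec_ln_rexp [simp]: "vec_ln (rexp x) = x"
  by (simp add: vec_ln_def rexp_def vec_eq_iff)

lemma rexp_nz: "rexp x $ j \<noteq> 0"
  by (simp add: rexp_def)

lemma emeasure_vec_ln_ball:
  assumes "0 < d"
  shows "0 < emeasure lborel {z :: complex^'m::finite. vec_ln z \<in> cball c d}"
proof -
  have "isCont (vec_ln :: complex^'m \<Rightarrow> _) (rexp c)"
    unfolding vec_ln_def isCont_def by (intro tendsto_intros) (simp_all add: rexp_nz)
  then obtain e where e: "0 < e" "\<And>z. dist z (rexp c) < e \<Longrightarrow> dist (vec_ln z) (vec_ln (rexp c)) < d"
    using assms unfolding continuous_at_eps_delta by blast
  have "ball (rexp c) e \<subseteq> {z. vec_ln z \<in> cball c d}"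
    using e(2) by (auto simp: dist_commute less_imp_le)
  then have "emeasure lborel (ball (rexp c) e) \<le> emeasure lborel {z :: complex^'m. vec_ln z \<in> cball c d}"
    by (intro emeasure_mono) (auto intro!: measurable_sets_borel[OF measurable_vec_ln, unfolded vimage_def])
  moreover have "0 < emeasure lborel (ball (rexp c :: complex^'m) e)" using e(1) by (simp add: emeasure_ball unit_ball_vol_pos)
  ultimately show ?thesis by (rule less_le_trans[rotated])
qed

context reinhardt_weight
begin

lemma mono_weight_torus:
  assumes "(t, y) \<in> \<Omega>"
  shows "mono_weight \<phi> k (t, torus_act \<alpha> y) = mono_weight \<phi> k (t, y)"
proof -
  have "cmod (\<Prod>j\<in>UNIV. torus_act \<alpha> y $ j ^ k j) = cmod (\<Prod>j\<in>UNIV. y $ j ^ k j)"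
    by (simp add: torus_act_def prod_norm[symmetric] norm_mult norm_power)
  then show ?thesis using \<phi>_torus[OF assms] by (simp add: mono_weight_def)
qed

lemma vec_ln_logdom:
  assumes "\<forall>j. z $ j \<noteq> 0"
  shows "vec_ln z \<in> logdom t \<longleftrightarrow> (t, z) \<in> \<Omega>"
  using vec_polar[OF assms] torus_iff unfolding logdom_def by (metis mem_Collect_eq)

lemma mono_weight_vec_ln:
  assumes "\<forall>j. z $ j \<noteq> 0" "(t, z) \<in> \<Omega>"
  shows "mono_weight \<phi> k (t, rexp (vec_ln z)) = mono_weight \<phi> k (t, z)"
proof -
  obtain \<alpha> where \<alpha>: "z = torus_act \<alpha> (rexp (vec_ln z))" using vec_polar[OF assms(1)] by blast
  have "(t, rexp (vec_ln z)) \<in> \<Omega>" using vec_ln_logdom[OF assms(1)] assms(2) by (simp add: logdom_def)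
  from mono_weight_torus[OF this, of k \<alpha>] \<alpha> show ?thesis by simp
qed

text \<open>Invariance under the torus identifies the value at z with that at
  \<open>rexp (vec_ln z)\<close> whenever all coordinates are nonzero, which is almost everywhere;
  the change of variables then absorbs the Jacobian in \<open>log_weight\<close>.\<close>

lemma iter_int_log_weight:
  assumes A: "A \<in> sets borel" "A \<subseteq> logdom t" and "is": "distinct is" "set is = UNIV"
  shows "iter_int is (\<lambda>x. ennreal (indicator A x * exp (log_weight k x - \<phi> (t, rexp x)))) x0
    = (\<integral>\<^sup>+z. ennreal (indicator A (vec_ln z) * (indicator \<Omega> (t, z) * mono_weight \<phi> k (t, z))) \<partial>lborel)"
proof -
  define h where "h x = ennreal (indicator A x * mono_weight \<phi> k (t, rexp x))" for x
  have "continuous_on A (\<lambda>x. mono_weight \<phi> k (t, rexp x))"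
    by (rule continuous_on_compose2[OF Ck_on_imp_continuous_on[OF Ck_on_mono_weight[OF F(1) \<phi>]]])
      (use A(2) \<Omega>_sub in \<open>auto simp: logdom_def intro!: continuous_intros\<close>)
  from borel_measurable_continuous_on_indicator[OF A(1) this]
  have h: "h \<in> borel_measurable borel" unfolding h_def by simp
  have hh: "ennreal (indicator A x * exp (log_weight k x - \<phi> (t, rexp x))) = h x * (\<Prod>j\<in>UNIV. ennreal (2 * pi * exp (2 * x $ j)))" for x
    by (simp add: h_def prod_ennreal ennreal_mult'[symmetric] mono_weight_rexp[symmetric] prod_nonneg mono_weight_def mult.assoc flip: ennreal_mult)
  have "iter_int is (\<lambda>x. ennreal (indicator A x * exp (log_weight k x - \<phi> (t, rexp x)))) x0 = (\<integral>\<^sup>+z. h (vec_ln z) \<partial>lborel)"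
    unfolding hh by (rule nn_integral_vec_ln[OF "is" h, symmetric])
  also have "\<dots> = (\<integral>\<^sup>+z. ennreal (indicator A (vec_ln z) * (indicator \<Omega> (t, z) * mono_weight \<phi> k (t, z))) \<partial>lborel)"
  proof (rule nn_integral_cong_AE)
    show "AE z in lborel. h (vec_ln z) = ennreal (indicator A (vec_ln z) * (indicator \<Omega> (t, z) * mono_weight \<phi> k (t, z)))"
      using AE_vec_nonzero
    proof eventually_elim
      case (elim z)
      then show ?case using A(2) vec_ln_logdom[OF elim, of t] mono_weight_vec_ln[OF elim, of t k]
        by (cases "vec_ln z \<in> A") (auto simp: h_def)
    qed
  qed
  finally show ?thesis .
qed

text \<open>Uniform room around the common point c over the whole circle, by compactness. It gives
  the truncated integrals a positive lower bound that depends neither on the angle nor on the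
  truncation.\<close>

lemma circle_lower_bound:
  fixes w :: "complex^'n" and k :: "'m \<Rightarrow> nat"
  assumes r: "0 < r" and c: "\<And>\<tau>. cmod \<tau> \<le> r \<Longrightarrow> c \<in> logdom (t0 + \<tau> *s w)"
  obtains d \<eta> \<mu> where "0 < d" "0 < \<eta>" "0 < \<mu>"
    "\<And>\<tau> x. cmod \<tau> = r \<Longrightarrow> x \<in> cball c d \<Longrightarrow> x \<in> logdom (t0 + \<tau> *s w)"
    "\<And>\<tau> x \<alpha>. cmod \<tau> = r \<Longrightarrow> x \<in> cball c d \<Longrightarrow> \<rho> (t0 + \<tau> *s w, torus_act \<alpha> (rexp x)) \<le> - \<eta>"
    "\<And>\<tau> x. cmod \<tau> = r \<Longrightarrow> x \<in> cball c d \<Longrightarrow> \<mu> \<le> mono_weight \<phi> k (t0 + \<tau> *s w, rexp x)"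
proof -
  define Op where "Op = {p :: (real^'m) \<times> complex. (t0 + snd p *s w, rexp (fst p)) \<in> \<Omega>}"
  have cO: "continuous_on S (\<lambda>p :: (real^'m) \<times> complex. (t0 + snd p *s w, rexp (fst p)))" for S
    unfolding vector_scalar_mult_def by (intro continuous_intros)
  have "open Op" unfolding Op_def using open_vimage[OF \<Omega>(1) cO] by (simp add: vimage_def)
  moreover have "{c} \<times> sphere (0::complex) r \<subseteq> Op" using c by (auto simp: Op_def logdom_def)
  ultimately obtain X where X: "c \<in> X" "open X" "X \<times> sphere (0::complex) r \<subseteq> Op"
    using Elementary_Topology.tube_lemma[OF compact_sphere] by metis
  obtain d where d: "0 < d" "cball c d \<subseteq> X" using X(1,2) open_contains_cball by blast
  have lg: "x \<in> logdom (t0 + \<tau> *s w)" if "cmod \<tau> = r" "x \<in> cball c d" for \<tau> x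
  proof -
    have "(x, \<tau>) \<in> X \<times> sphere 0 r" using that d(2) by auto
    then have "(x, \<tau>) \<in> Op" using X(3) by blast
    then show ?thesis by (simp add: Op_def logdom_def)
  qed
  define Q where "Q = cball c d \<times> sphere (0::complex) r"
  have Q: "compact Q" unfolding Q_def by (intro compact_Times compact_cball compact_sphere)
  have Qne: "(c, of_real r) \<in> Q" using d r by (simp add: Q_def)
  have u1: "(1 :: complex^'m) \<in> torus_set" by (simp add: torus_set_def)
  have in\<Omega>: "(t0 + snd p *s w, vmult u (rexp (fst p))) \<in> \<Omega>" if "p \<in> Q" "u \<in> torus_set" for p and u :: "complex^'m"
  proof -
    have "fst p \<in> logdom (t0 + snd p *s w)" using lg that(1) by (auto simp: Q_def)
    then show ?thesis using vmult_torus[OF that(2)] torus_iff by (auto simp: logdom_def)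
  qed
  have QT: "compact (Q \<times> (torus_set :: (complex^'m) set))" by (intro compact_Times Q compact_torus_set)
  have "continuous_on (Q \<times> torus_set) (\<lambda>q. (t0 + snd (fst q) *s w, vmult (snd q) (rexp (fst (fst q)))))"
    unfolding vector_scalar_mult_def by (intro continuous_intros)
  moreover have "(\<lambda>q. (t0 + snd (fst q) *s w, vmult (snd q) (rexp (fst (fst q))))) ` (Q \<times> torus_set) \<subseteq> N"
    using in\<Omega> \<Omega>_sub(3) by fastforce
  ultimately have "continuous_on (Q \<times> torus_set) (\<lambda>q. \<rho> (t0 + snd (fst q) *s w, vmult (snd q) (rexp (fst (fst q)))))"
    by (rule continuous_on_compose2[OF Ck_on_imp_continuous_on[OF \<rho>]])
  from continuous_attains_sup[OF QT _ this] Qne u1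
  obtain q where q: "q \<in> Q \<times> torus_set" "\<And>q'. q' \<in> Q \<times> torus_set \<Longrightarrow>
    \<rho> (t0 + snd (fst q') *s w, vmult (snd q') (rexp (fst (fst q')))) \<le> \<rho> (t0 + snd (fst q) *s w, vmult (snd q) (rexp (fst (fst q))))" by blast
  define \<eta> where "\<eta> = - \<rho> (t0 + snd (fst q) *s w, vmult (snd q) (rexp (fst (fst q))))"
  have "(t0 + snd (fst q) *s w, vmult (snd q) (rexp (fst (fst q)))) \<in> \<Omega>" using q(1) in\<Omega> by (cases q) auto
  then have \<eta>: "0 < \<eta>" by (subst (asm) \<Omega>_eq) (simp add: \<eta>_def)
  have \<rho>\<eta>: "\<rho> (t0 + \<tau> *s w, torus_act \<alpha> (rexp x)) \<le> - \<eta>" if "cmod \<tau> = r" "x \<in> cball c d" for \<tau> x \<alpha>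
    using q(2)[of "((x, \<tau>), \<chi> j. cis (\<alpha> j))"] that torus_act_vmult[of \<alpha>] by (auto simp: \<eta>_def Q_def)
  have "(\<lambda>p. (t0 + snd p *s w, rexp (fst p))) ` Q \<subseteq> F"
    using lg \<Omega>_sub(1) by (auto simp: logdom_def Q_def)
  from continuous_on_compose2[OF Ck_on_imp_continuous_on[OF Ck_on_mono_weight[OF F(1) \<phi>]] cO this]
  have "continuous_on Q (\<lambda>p. mono_weight \<phi> k (t0 + snd p *s w, rexp (fst p)))" .
  from continuous_attains_inf[OF Q _ this] Qne
  obtain p where p: "p \<in> Q" "\<And>p'. p' \<in> Q \<Longrightarrow> mono_weight \<phi> k (t0 + snd p *s w, rexp (fst p)) \<le> mono_weight \<phi> k (t0 + snd p' *s w, rexp (fst p'))" by blast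
  have "0 < mono_weight \<phi> k (t0 + snd p *s w, rexp (fst p))" by (simp add: mono_weight_def rexp_nz)
  moreover have "mono_weight \<phi> k (t0 + snd p *s w, rexp (fst p)) \<le> mono_weight \<phi> k (t0 + \<tau> *s w, rexp x)" if "cmod \<tau> = r" "x \<in> cball c d" for \<tau> x
    using p(2)[of "(x, \<tau>)"] that by (simp add: Q_def)
  ultimately show thesis using d(1) \<eta> lg \<rho>\<eta> that by blast
qed

text \<open>\<open>circle_prekopa\<close> is applied to the compact sets \<open>K n\<close>
  exhausting the domains over the circle; the right-hand side does not depend on n, and on the left
  dominated convergence removes the truncation.\<close>

lemma circle_volume:
  fixes w :: "complex^'n" and k :: "'m \<Rightarrow> nat"
  assumes w: "w \<noteq> 0" and r: "0 < r"
    and tU: "\<And>\<tau>. cmod \<tau> \<le> r \<Longrightarrow> t0 + \<tau> *s w \<in> U"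
    and c: "\<And>\<tau>. cmod \<tau> \<le> r \<Longrightarrow> c \<in> logdom (t0 + \<tau> *s w)"
    and \<kappa>0: "0 < \<kappa>" and \<kappa>: "\<And>\<tau> z b. cmod \<tau> \<le> r \<Longrightarrow> (t0 + \<tau> *s w, z) \<in> \<Omega> \<Longrightarrow> \<kappa> \<le> levi (cscale \<i>) \<rho> (t0 + \<tau> *s w, z) (w, b)"
  shows "ennreal (exp (LINT \<theta>|circle_measure. ln (monomial_integral \<Omega> \<phi> k (t0 + (of_real r * cis \<theta>) *s w))))
    \<le> (\<integral>\<^sup>+z. ennreal (indicator {z. (t0, z) \<in> \<Omega> \<and> \<rho> (t0, z) \<le> - \<kappa> * r^2 / 4} z * mono_weight \<phi> k (t0, z)) \<partial>lborel)" (is "_ \<le> ?R")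
proof -
  define T where "T \<theta> = t0 + (of_real r * cis \<theta>) *s w" for \<theta>
  note GC = Ck_on_monomial_integral[where k=k, OF F \<phi>]
  let ?G = "monomial_integral \<Omega> \<phi> k"
  define H where "H \<theta> z = indicator \<Omega> (T \<theta>, z) * mono_weight \<phi> k (T \<theta>, z)" for \<theta> z
  have TU: "T \<theta> \<in> U" for \<theta> using tU[of "of_real r * cis \<theta>"] r by (simp add: T_def norm_mult)
  have H0: "0 \<le> H \<theta> z" for \<theta> z by (simp add: H_def mono_weight_def)
  have Hi: "integrable lborel (H \<theta>)" for \<theta> unfolding H_def by (rule GC(2)[OF TU])
  have HG: "(\<integral>\<^sup>+z. ennreal (H \<theta> z) \<partial>lborel) = ennreal (?G (T \<theta>))" for \<theta>
    using nn_integral_eq_integral[OF Hi] H0 by (simp add: monomial_integral_eq H_def[abs_def])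
  \<comment> \<open>A strict gap for \<open>\<rho>\<close> on whole orbits makes the set closed
    although the domain is open: a limit point lies in the closure of \<open>\<Omega>\<close> and
    still has negative \<open>\<rho>\<close>. The 1 added to n keeps the gap strict at n = 0, where
    division by 0 would yield 0.\<close>
  define K where "K n = {(\<tau>, x). cmod \<tau> = r \<and> norm x \<le> real n \<and> (x \<in> logdom (t0 + \<tau> *s w) \<and>
    (\<forall>\<alpha>. \<rho> (t0 + \<tau> *s w, torus_act \<alpha> (rexp x)) \<le> - 1 / (real n + 1)))}" for n
  have K2: "cmod \<tau> = r \<and> x \<in> logdom (t0 + \<tau> *s w)" if "(\<tau>, x) \<in> K n" for \<tau> x n
    using that by (simp add: K_def)
  have Kc: "compact (K n)" for n
  proof (rule compact_eq_bounded_closed[THEN iffD2], intro conjI)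
    have "K n \<subseteq> cball 0 r \<times> cball 0 (real n)" by (auto simp: K_def)
    then show "bounded (K n)" by (rule bounded_subset[rotated]) (intro bounded_Times bounded_cball)
    show "closed (K n)"
    unfolding closed_sequential_limits
    proof (intro allI impI)
      fix s l assume s: "(\<forall>i. s i \<in> K n) \<and> s \<longlonglongrightarrow> l"
      obtain \<tau> x where l: "l = (\<tau>, x)" by (cases l)
      have sK: "s i \<in> K n" for i using s by simp
      have s1: "(\<lambda>i. fst (s i)) \<longlonglongrightarrow> \<tau>" and s2: "(\<lambda>i. snd (s i)) \<longlonglongrightarrow> x"
        using s tendsto_fst[of s l] tendsto_snd[of s l] by (auto simp: l)
      have \<tau>: "cmod \<tau> = r"
        using LIMSEQ_unique[OF tendsto_norm[OF s1], of r] sK by (auto simp: K_def case_prod_unfold)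
      have x: "norm x \<le> real n"
        by (rule LIMSEQ_le_const2[OF tendsto_norm[OF s2]]) (use sK in \<open>auto simp: K_def case_prod_unfold\<close>)
      have lim: "(\<lambda>i. (t0 + fst (s i) *s w, torus_act \<alpha> (rexp (snd (s i))))) \<longlonglongrightarrow> (t0 + \<tau> *s w, torus_act \<alpha> (rexp x))" for \<alpha>
        unfolding vector_scalar_mult_def torus_act_def rexp_def by (intro tendsto_intros s1 s2)
      have "(t0 + fst (s i) *s w, torus_act \<alpha> (rexp (snd (s i)))) \<in> \<Omega>" for i \<alpha>
        using sK[of i] by (auto simp: K_def case_prod_unfold torus_iff logdom_def)
      from LIMSEQ_in_closure[OF lim this] have "(t0 + \<tau> *s w, torus_act \<alpha> (rexp x)) \<in> closure \<Omega>" for \<alpha> .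
      then have inN: "(t0 + \<tau> *s w, torus_act \<alpha> (rexp x)) \<in> N" for \<alpha> using tU[of \<tau>] \<tau> W by auto
      have \<rho>l: "\<rho> (t0 + \<tau> *s w, torus_act \<alpha> (rexp x)) \<le> - 1 / (real n + 1)" for \<alpha>
      proof -
        have "isCont \<rho> (t0 + \<tau> *s w, torus_act \<alpha> (rexp x))"
          using Ck_on_imp_continuous_on[OF \<rho>] N(1) inN by (simp add: continuous_on_eq_continuous_at)
        from isCont_tendsto_compose[OF this lim] show ?thesis
          by (rule LIMSEQ_le_const2) (use sK in \<open>auto simp: K_def case_prod_unfold\<close>)
      qed
      have "- 1 / (real n + 1) < 0" by simp
      then have "\<rho> (t0 + \<tau> *s w, rexp x) < 0" using le_less_trans[OF \<rho>l[of "\<lambda>_. 0"]] by simp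
      then have "x \<in> logdom (t0 + \<tau> *s w)" unfolding logdom_def using inN[of "\<lambda>_. 0"] by (subst \<Omega>_eq) simp
      then show "l \<in> K n" using \<tau> x \<rho>l by (simp add: l K_def)
    qed
  qed
  have Kconv: "convex {x. (\<tau>, x) \<in> K n}" for \<tau> n
  proof (cases "cmod \<tau> = r")
    case True
    then have "{x. (\<tau>, x) \<in> K n} = cball 0 (real n) \<inter> {x \<in> logdom (t0 + \<tau> *s w). \<forall>\<alpha>. \<rho> (t0 + \<tau> *s w, torus_act \<alpha> (rexp x)) \<le> - 1 / (real n + 1)}"
      by (auto simp: K_def)
    moreover have "t0 + \<tau> *s w \<in> U" using tU True by simp
    ultimately show ?thesis by (simp add: convex_Int convex_sublevel)
  qed (simp add: K_def)
  obtain "is" :: "'m list" where "is": "distinct is" "set is = UNIV" using finite_distinct_list[of "UNIV :: 'm set"] by auto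
  define A where "A n \<theta> = {x. (of_real r * cis \<theta>, x) \<in> K n}" for n \<theta>
  have Ab: "A n \<theta> \<in> sets borel" for n \<theta>
  proof -
    have "closed (A n \<theta>)" unfolding A_def using closed_vimage[OF compact_imp_closed[OF Kc], of "\<lambda>x. (of_real r * cis \<theta>, x)" n]
      by (simp add: vimage_def continuous_intros)
    then show ?thesis by simp
  qed
  have Al: "A n \<theta> \<subseteq> logdom (T \<theta>)" for n \<theta> using K2 by (auto simp: A_def T_def)
  define I where "I n \<theta> = iter_int is (\<lambda>x. ennreal (indicator (K n) (of_real r * cis \<theta>, x) * exp (log_weight k x - \<phi> (T \<theta>, rexp x)))) 0" for n \<theta>
  have IA: "I n \<theta> = (\<integral>\<^sup>+z. ennreal (indicator (A n \<theta>) (vec_ln z) * H \<theta> z) \<partial>lborel)" for n \<theta>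
  proof -
    have "indicator (K n) (of_real r * cis \<theta>, x) = (indicator (A n \<theta>) x :: real)" for x by (simp add: A_def indicator_def)
    then show ?thesis unfolding I_def H_def using iter_int_log_weight[OF Ab Al "is"] by simp
  qed
  have mI: "(\<lambda>z. ennreal (indicator (A n \<theta>) (vec_ln z) * H \<theta> z)) \<in> borel_measurable lborel" for n \<theta>
  proof -
    have "(\<lambda>z. indicator (A n \<theta>) (vec_ln z) :: real) \<in> borel_measurable borel"
      by (rule measurable_compose[OF measurable_vec_ln]) (use Ab in simp)
    moreover have "H \<theta> \<in> borel_measurable borel" using borel_measurable_integrable[OF Hi] by simp
    ultimately show ?thesis by simp
  qed
  have I_le: "I n \<theta> \<le> ennreal (?G (T \<theta>))" for n \<theta>
    unfolding IA HG[symmetric] by (intro nn_integral_mono ennreal_leI) (use H0 in \<open>auto simp: indicator_def\<close>)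
  have I_lim: "(\<lambda>n. I n \<theta>) \<longlonglongrightarrow> ennreal (?G (T \<theta>))" for \<theta>
    unfolding IA HG[symmetric]
  proof (rule nn_integral_dominated_convergence[where w="\<lambda>z. ennreal (H \<theta> z)"])
    show "AE z in lborel. ennreal (indicator (A n \<theta>) (vec_ln z) * H \<theta> z) \<le> ennreal (H \<theta> z)" for n
      by (intro AE_I2 ennreal_leI) (use H0 in \<open>auto simp: indicator_def\<close>)
    show "(\<integral>\<^sup>+z. ennreal (H \<theta> z) \<partial>lborel) < \<infinity>" by (simp add: HG)
    show "AE z in lborel. (\<lambda>n. ennreal (indicator (A n \<theta>) (vec_ln z) * H \<theta> z)) \<longlonglongrightarrow> ennreal (H \<theta> z)"
      using AE_vec_nonzero
    proof eventually_elim
      case (elim z)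
      show ?case
      proof (cases "(T \<theta>, z) \<in> \<Omega>")
        case True
        then have xl: "vec_ln z \<in> logdom (T \<theta>)" using vec_ln_logdom[OF elim] by simp
        obtain b where b: "b < 0" "\<And>\<alpha>. \<rho> (T \<theta>, torus_act \<alpha> (rexp (vec_ln z))) \<le> b" by (rule torus_sup[OF xl]) blast
        obtain n0 where n0: "max (norm (vec_ln z)) (1 / - b) \<le> real n0" using real_arch_simple by blast
        have "vec_ln z \<in> A n \<theta>" if n: "n0 \<le> n" for n
        proof -
          have "norm (vec_ln z) \<le> real n" using n0 n by simp
          moreover have "b \<le> - 1 / (real n + 1)"
          proof -
            have "1 / - b \<le> real n + 1" using n0 n by simp
            then have "1 / (real n + 1) \<le> - b" using b(1) by (simp add: field_simps)
            then show ?thesis by simp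
          qed
          then have "\<rho> (T \<theta>, torus_act \<alpha> (rexp (vec_ln z))) \<le> - 1 / (real n + 1)" for \<alpha> using b(2)[of \<alpha>] by linarith
          ultimately show ?thesis using xl r by (simp add: A_def K_def T_def norm_mult)
        qed
        then have "eventually (\<lambda>n. ennreal (indicator (A n \<theta>) (vec_ln z) * H \<theta> z) = ennreal (H \<theta> z)) sequentially"
          by (intro eventually_sequentiallyI[of n0]) simp
        then show ?thesis by (rule tendsto_eventually)
      qed (simp add: H_def)
    qed
  qed (use mI Hi in simp_all)
  obtain d \<eta> \<mu> where d: "0 < d" "0 < \<eta>" "0 < \<mu>"
    "\<And>\<tau> x. cmod \<tau> = r \<Longrightarrow> x \<in> cball c d \<Longrightarrow> x \<in> logdom (t0 + \<tau> *s w)"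
    "\<And>\<tau> x \<alpha>. cmod \<tau> = r \<Longrightarrow> x \<in> cball c d \<Longrightarrow> \<rho> (t0 + \<tau> *s w, torus_act \<alpha> (rexp x)) \<le> - \<eta>"
    "\<And>\<tau> x. cmod \<tau> = r \<Longrightarrow> x \<in> cball c d \<Longrightarrow> \<mu> \<le> mono_weight \<phi> k (t0 + \<tau> *s w, rexp x)"
    using circle_lower_bound[OF r c, of k] by blast
  define V where "V = emeasure lborel {z :: complex^'m. vec_ln z \<in> cball c d}"
  have V: "0 < V" unfolding V_def by (rule emeasure_vec_ln_ball[OF d(1)])
  \<comment> \<open>A positive real below mu V; the minimum with 1 makes it finite at once.\<close>
  define e where "e = enn2real (min 1 (ennreal \<mu> * V))"
  have eV: "ennreal e \<le> ennreal \<mu> * V" "0 < e"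
  proof -
    have fin: "min 1 (ennreal \<mu> * V) < top" by (simp add: min_less_iff_disj)
    then show "ennreal e \<le> ennreal \<mu> * V" by (simp add: e_def)
    show "0 < e" unfolding e_def using fin V d(3) by (simp add: enn2real_positive_iff ennreal_zero_less_mult_iff)
  qed
  obtain n0 where n0: "max (norm c + d) (1 / \<eta>) \<le> real n0" using real_arch_simple by blast
  have I_ge: "ennreal e \<le> I n \<theta>" if n: "n0 \<le> n" for n \<theta>
  proof -
    have cA: "cball c d \<subseteq> A n \<theta>"
    proof
      fix x assume x: "x \<in> cball c d"
      have rc: "cmod (of_real r * cis \<theta>) = r" using r by (simp add: norm_mult)
      have "norm x \<le> norm c + d" using x norm_triangle_ineq2[of x c] by (simp add: dist_norm norm_minus_commute)
      then have "norm x \<le> real n" using n0 n by simp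
      moreover have "- \<eta> \<le> - 1 / (real n + 1)"
      proof -
        have "1 / \<eta> \<le> real n + 1" using n0 n by simp
        then have "1 / (real n + 1) \<le> \<eta>" using d(2) by (simp add: field_simps)
        then show ?thesis by simp
      qed
      then have "\<rho> (t0 + (of_real r * cis \<theta>) *s w, torus_act \<alpha> (rexp x)) \<le> - 1 / (real n + 1)" for \<alpha>
        using d(5)[OF rc x, of \<alpha>] by linarith
      ultimately show "x \<in> A n \<theta>" using d(4)[OF rc x] rc by (simp add: A_def K_def)
    qed
    have "ennreal e \<le> (\<integral>\<^sup>+z. ennreal \<mu> * indicator {z. vec_ln z \<in> cball c d} z \<partial>(lborel :: (complex^'m) measure))"
      using eV(1) unfolding V_def by (subst nn_integral_cmult_indicator) (auto intro!: measurable_sets_borel[OF measurable_vec_ln, unfolded vimage_def])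
    also have "\<dots> \<le> I n \<theta>" unfolding IA
    proof (rule nn_integral_mono_AE)
      show "AE z in lborel. ennreal \<mu> * indicator {z. vec_ln z \<in> cball c d} z \<le> ennreal (indicator (A n \<theta>) (vec_ln z) * H \<theta> z)"
        using AE_vec_nonzero
      proof eventually_elim
        case (elim z)
        show ?case
        proof (cases "vec_ln z \<in> cball c d")
          case True
          then have *: "vec_ln z \<in> A n \<theta>" "vec_ln z \<in> logdom (T \<theta>)" using cA Al[of n \<theta>] by auto
          then have "(T \<theta>, z) \<in> \<Omega>" using vec_ln_logdom[OF elim] by simp
          moreover from mono_weight_vec_ln[OF elim this, of k] have "\<mu> \<le> mono_weight \<phi> k (T \<theta>, z)"
            using d(6)[of "of_real r * cis \<theta>" "vec_ln z"] True r by (simp add: T_def norm_mult)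
          ultimately show ?thesis using True * by (simp add: H_def ennreal_leI)
        qed simp
      qed
    qed
    finally show ?thesis .
  qed
  have step: "ennreal (exp (LINT \<theta>|circle_measure. ln (enn2real (I n \<theta>)))) \<le> ?R" if n: "n0 \<le> n" for n
  proof -
    have "ennreal (exp (LINT \<theta>|circle_measure. ln (enn2real (I n \<theta>)))) \<le> 
      iter_int is (\<lambda>x. ennreal (indicator {x \<in> logdom t0. \<forall>\<alpha>. \<rho> (t0, torus_act \<alpha> (rexp x)) \<le> - \<kappa> * r^2 / 4} x * exp (log_weight k x - \<phi> (t0, rexp x)))) 0"
      unfolding I_def T_def
    proof (rule circle_prekopa[OF w r tU c \<kappa>0 \<kappa> Kc K2 Kconv eV(2) "is"(1)])
      show "ennreal e \<le> iter_int is (\<lambda>x. ennreal (indicat_real (K n) (of_real r * cis \<theta>, x) * exp (log_weight k x - \<phi> (t0 + (of_real r * cis \<theta>) *s w, rexp x)))) 0" for \<theta>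
        using I_ge[OF n, of \<theta>] by (simp add: I_def T_def)
    qed
    also have "\<dots> = (\<integral>\<^sup>+z. ennreal (indicator {x \<in> logdom t0. \<forall>\<alpha>. \<rho> (t0, torus_act \<alpha> (rexp x)) \<le> - \<kappa> * r^2 / 4} (vec_ln z) * (indicator \<Omega> (t0, z) * mono_weight \<phi> k (t0, z))) \<partial>lborel)"
      by (rule iter_int_log_weight[OF sublevel_borel _ "is"]) auto
    also have "\<dots> \<le> ?R"
    proof (rule nn_integral_mono_AE)
      show "AE z in lborel. ennreal (indicator {x \<in> logdom t0. \<forall>\<alpha>. \<rho> (t0, torus_act \<alpha> (rexp x)) \<le> - \<kappa> * r^2 / 4} (vec_ln z) * (indicator \<Omega> (t0, z) * mono_weight \<phi> k (t0, z)))
        \<le> ennreal (indicator {z. (t0, z) \<in> \<Omega> \<and> \<rho> (t0, z) \<le> - \<kappa> * r^2 / 4} z * mono_weight \<phi> k (t0, z))"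
        using AE_vec_nonzero
      proof eventually_elim
        case (elim z)
        obtain \<alpha> where \<alpha>: "z = torus_act \<alpha> (rexp (vec_ln z))" using vec_polar[OF elim] by blast
        have "0 \<le> mono_weight \<phi> k (t0, z)" by (simp add: mono_weight_def)
        moreover have "\<rho> (t0, z) \<le> - \<kappa> * r^2 / 4" if "\<forall>\<alpha>. \<rho> (t0, torus_act \<alpha> (rexp (vec_ln z))) \<le> - \<kappa> * r^2 / 4"
          using that[rule_format, of \<alpha>] \<alpha>[symmetric] by simp
        ultimately show ?case by (intro ennreal_leI) (auto simp: indicator_def)
      qed
    qed
    finally show ?thesis .
  qed
  have cT: "continuous_on S T" for S unfolding T_def vector_scalar_mult_def by (intro continuous_intros)
  have cG: "continuous_on S (\<lambda>\<theta>. ?G (T \<theta>))" for S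
    by (rule continuous_on_compose2[OF Ck_on_imp_continuous_on[OF GC(1)] cT]) (use TU in auto)
  obtain B where B: "\<And>\<theta>. ?G (T \<theta>) \<le> B"
  proof -
    have "continuous_on (sphere 0 r) (\<lambda>\<tau>. t0 + \<tau> *s w)" unfolding vector_scalar_mult_def by (intro continuous_intros)
    then have "continuous_on (sphere 0 r) (\<lambda>\<tau>. ?G (t0 + \<tau> *s w))"
      by (rule continuous_on_compose2[OF Ck_on_imp_continuous_on[OF GC(1)]]) (use tU in auto)
    then have "bounded ((\<lambda>\<tau>. ?G (t0 + \<tau> *s w)) ` sphere 0 r)" by (intro compact_imp_bounded compact_continuous_image compact_sphere)
    then obtain B where B: "\<forall>v\<in>(\<lambda>\<tau>. ?G (t0 + \<tau> *s w)) ` sphere 0 r. norm v \<le> B" unfolding bounded_iff by blast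
    have "?G (T \<theta>) \<le> B" for \<theta>
    proof -
      have "of_real r * cis \<theta> \<in> sphere 0 r" using r by (simp add: norm_mult)
      then have "norm (?G (T \<theta>)) \<le> B" using B unfolding T_def by blast
      then show ?thesis by simp
    qed
    then show thesis by (rule that)
  qed
  have en: "e \<le> enn2real (I n \<theta>) \<and> enn2real (I n \<theta>) \<le> B" if "n0 \<le> n" for n \<theta>
  proof -
    have "I n \<theta> < top" using I_le[of n \<theta>] by (rule le_less_trans) simp
    then have I: "I n \<theta> = ennreal (enn2real (I n \<theta>))" by simp
    have "e \<le> enn2real (I n \<theta>)" using I_ge[OF that, of \<theta>] by (subst (asm) I) simp
    moreover have "enn2real (I n \<theta>) \<le> ?G (T \<theta>)" using I_le[of n \<theta>] GC(3)[OF TU[of \<theta>]] by (subst (asm) I) simp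
    ultimately show ?thesis using B[of \<theta>] by linarith
  qed
  \<comment> \<open>The index is shifted by \<open>n0\<close> because the lower bound e, which
    dominates the logarithms from below, holds from there on.\<close>
  have "(\<lambda>n. LINT \<theta>|circle_measure. ln (enn2real (I (n + n0) \<theta>))) \<longlonglongrightarrow> (LINT \<theta>|circle_measure. ln (?G (T \<theta>)))"
  proof (rule integral_dominated_convergence[where w="\<lambda>_. max \<bar>ln e\<bar> \<bar>ln B\<bar>"])
    show "(\<lambda>\<theta>. ln (?G (T \<theta>))) \<in> borel_measurable circle_measure"
      using borel_measurable_continuous_onI[OF cG] by simp
    show "(\<lambda>\<theta>. ln (enn2real (I (n + n0) \<theta>))) \<in> borel_measurable circle_measure" for n
    proof -
      have "(\<lambda>p. ennreal (indicat_real (K (n + n0)) (of_real r * cis (fst p), snd p) * exp (log_weight k (snd p) - \<phi> (T (fst p), rexp (snd p))))) \<in> borel_measurable (circle_measure \<Otimes>\<^sub>M borel)"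
        unfolding T_def by (rule measurable_compose[OF measurable_circle_weight[OF Kc] measurable_ennreal]) (use K2 in auto)
      from measurable_iter_int[where h="\<lambda>\<theta> x. ennreal (indicat_real (K (n + n0)) (of_real r * cis \<theta>, x) * exp (log_weight k x - \<phi> (T \<theta>, rexp x)))", OF this, of "is"]
      have m: "(\<lambda>p. iter_int is (\<lambda>x. ennreal (indicat_real (K (n + n0)) (of_real r * cis (fst p), x) * exp (log_weight k x - \<phi> (T (fst p), rexp x)))) (snd p)) \<in> borel_measurable (circle_measure \<Otimes>\<^sub>M borel)" .
      have "(\<lambda>\<theta>::real. (\<theta>, 0::real^'m)) \<in> measurable circle_measure (circle_measure \<Otimes>\<^sub>M borel)" by measurable
      from measurable_compose[OF this m] have "(\<lambda>\<theta>. I (n + n0) \<theta>) \<in> borel_measurable circle_measure"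
        unfolding I_def by simp
      then show ?thesis by measurable
    qed
    show "AE \<theta> in circle_measure. (\<lambda>n. ln (enn2real (I (n + n0) \<theta>))) \<longlonglongrightarrow> ln (?G (T \<theta>))"
    proof (rule AE_I2)
      fix \<theta>
      have "(\<lambda>n. enn2real (I (n + n0) \<theta>)) \<longlonglongrightarrow> enn2real (ennreal (?G (T \<theta>)))"
        using LIMSEQ_ignore_initial_segment[OF I_lim[of \<theta>], of n0] by (intro tendsto_enn2real) simp_all
      then show "(\<lambda>n. ln (enn2real (I (n + n0) \<theta>))) \<longlonglongrightarrow> ln (?G (T \<theta>))"
        using GC(3)[OF TU[of \<theta>]] by (intro tendsto_ln) simp_all
    qed
    show "AE \<theta> in circle_measure. norm (ln (enn2real (I (n + n0) \<theta>))) \<le> max \<bar>ln e\<bar> \<bar>ln B\<bar>" for n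
    proof (rule AE_I2)
      fix \<theta>
      have "ln e \<le> ln (enn2real (I (n + n0) \<theta>))" "ln (enn2real (I (n + n0) \<theta>)) \<le> ln B"
        using en[of "n + n0" \<theta>] eV(2) by auto
      then show "norm (ln (enn2real (I (n + n0) \<theta>))) \<le> max \<bar>ln e\<bar> \<bar>ln B\<bar>" by auto
    qed
  qed simp
  then have "(\<lambda>n. ennreal (exp (LINT \<theta>|circle_measure. ln (enn2real (I (n + n0) \<theta>))))) \<longlonglongrightarrow> ennreal (exp (LINT \<theta>|circle_measure. ln (?G (T \<theta>))))"
    by (intro tendsto_ennrealI tendsto_exp)
  then have "ennreal (exp (LINT \<theta>|circle_measure. ln (?G (T \<theta>)))) \<le> ?R"
    by (rule LIMSEQ_le_const2) (use step in auto)
  then show ?thesis by (simp add: T_def)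
qed

end

section \<open>The shell estimate and strict plurisubharmonicity\<close>

lemma LINT_lborel_scaleR:
  fixes g :: "'a::euclidean_space \<Rightarrow> real"
  assumes c: "0 < c" and g [measurable]: "g \<in> borel_measurable borel"
  shows "(LINT x|lborel. g (c *\<^sub>R x)) = (LINT x|lborel. g x) / c ^ DIM('a)"
    and "integrable lborel g \<Longrightarrow> integrable lborel (\<lambda>x. g (c *\<^sub>R x))"
proof -
  have eq: "lborel = density (distr lborel borel (\<lambda>x::'a. c *\<^sub>R x)) (\<lambda>_. ennreal (c ^ DIM('a)))"
    using lborel_affine[of c "0::'a"] c by simp
  have "(LINT x|lborel. g x) = (LINT x|density (distr lborel borel (\<lambda>x::'a. c *\<^sub>R x)) (\<lambda>_. ennreal (c ^ DIM('a))). g x)"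
    using eq by simp
  also have "\<dots> = (LINT x|lborel. c ^ DIM('a) * g (c *\<^sub>R x))"
    using c by (simp add: integral_density integral_distr)
  finally show "(LINT x|lborel. g (c *\<^sub>R x)) = (LINT x|lborel. g x) / c ^ DIM('a)"
    using c by simp
  assume "integrable lborel g"
  then have "integrable (density (distr lborel borel (\<lambda>x::'a. c *\<^sub>R x)) (\<lambda>_. ennreal (c ^ DIM('a)))) g" using eq by simp
  then have "integrable lborel (\<lambda>x. c ^ DIM('a) * g (c *\<^sub>R x))"
    using c by (simp add: integrable_density integrable_distr_eq)
  then show "integrable lborel (\<lambda>x. g (c *\<^sub>R x))" using c by simp
qed

lemma Ck2_derivative_bound:
  fixes f :: "'a::euclidean_space \<Rightarrow> real"
  assumes f: "Ck_on 2 f S" and C: "compact C" "C \<subseteq> S"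
  obtains L where "0 < L" "\<And>x v. x \<in> C \<Longrightarrow> \<bar>frechet_derivative f (at x) v\<bar> \<le> L * norm v"
proof -
  have "continuous_on C (\<lambda>x. \<Sum>b\<in>Basis. \<bar>frechet_derivative f (at x) b\<bar>)"
    by (intro continuous_intros continuous_on_subset[OF Ck2_D1_cont[OF f] C(2)])
  then have "bounded ((\<lambda>x. \<Sum>b\<in>Basis. \<bar>frechet_derivative f (at x) b\<bar>) ` C)"
    by (intro compact_imp_bounded compact_continuous_image C(1))
  then obtain B where B: "\<forall>v\<in>(\<lambda>x. \<Sum>b\<in>Basis. \<bar>frechet_derivative f (at x) b\<bar>) ` C. norm v \<le> B" unfolding bounded_iff by blast
  have "\<bar>frechet_derivative f (at x) v\<bar> \<le> max 1 B * norm v" if x: "x \<in> C" for x v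
  proof -
    have lin: "linear (frechet_derivative f (at x))" using Ck2_linear[OF f] x C(2) by blast
    have "frechet_derivative f (at x) v = (\<Sum>b\<in>Basis. (v \<bullet> b) * frechet_derivative f (at x) b)"
      using linear_sum[OF lin, of "\<lambda>b. (v \<bullet> b) *\<^sub>R b" Basis] by (simp add: euclidean_representation linear_scale[OF lin])
    also have "\<bar>\<dots>\<bar> \<le> (\<Sum>b\<in>Basis. \<bar>(v \<bullet> b) * frechet_derivative f (at x) b\<bar>)" by (rule sum_abs)
    also have "\<dots> \<le> (\<Sum>b\<in>Basis. norm v * \<bar>frechet_derivative f (at x) b\<bar>)"
      by (intro sum_mono) (simp add: abs_mult Basis_le_norm mult_right_mono)
    also have "\<dots> = norm v * (\<Sum>b\<in>Basis. \<bar>frechet_derivative f (at x) b\<bar>)" by (simp add: sum_distrib_left)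
    also have "\<dots> \<le> norm v * max 1 B"
    proof (rule mult_left_mono)
      have "norm (\<Sum>b\<in>Basis. \<bar>frechet_derivative f (at x) b\<bar>) \<le> B" using B x by blast
      then show "(\<Sum>b\<in>Basis. \<bar>frechet_derivative f (at x) b\<bar>) \<le> max 1 B" by simp
    qed simp
    finally show ?thesis by (simp add: mult.commute)
  qed
  then show thesis using that[of "max 1 B"] by simp
qed

lemma levi_scaleR:
  assumes S: "open S" and f: "Ck_on 2 f S" and x: "x \<in> S" and J: "linear J"
  shows "levi J f x (c *\<^sub>R v) = c^2 * levi J f x v"
proof -
  have "D2 f x (c *\<^sub>R u) (c *\<^sub>R u) = c^2 * D2 f x u u" for u
    using linear_scale[OF Ck2_D2_linear1[OF f x]] linear_scale[OF Ck2_D2_linear2[OF S f x]]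
    by (simp add: power2_eq_square)
  then show ?thesis by (simp add: levi_def linear_scale[OF J] algebra_simps)
qed

context reinhardt_weight
begin

text \<open>If \<open>\<rho> \<le> - s\<close> at z, the dilate by l = 1 + delta is still in the
  fiber, with delta proportional to s. Hence the removed part has at least the weighted volume of
  the fiber minus that of its preimage under the dilation, which by homogeneity is a fixed fraction
  of delta.\<close>

lemma shell_integral:
  fixes k :: "'m \<Rightarrow> nat"
  assumes t0: "t0 \<in> U"
  obtains c1 s0 where "0 < c1" "0 < s0"
    "\<And>s. 0 < s \<Longrightarrow> s < s0 \<Longrightarrow>
      (\<integral>\<^sup>+z. ennreal (indicator {z. (t0, z) \<in> \<Omega> \<and> \<rho> (t0, z) \<le> - s} z * mono_weight \<phi> k (t0, z)) \<partial>lborel)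
        \<le> ennreal (monomial_integral \<Omega> \<phi> k t0 - c1 * s)"
proof -
  define D where "D = fiber \<Omega> t0"
  obtain r K where K: "0 < r" "compact K" "cball t0 r \<times> K \<subseteq> F \<inter> W" "closure D \<subseteq> interior K"
    using local_structure[OF t0 F] unfolding D_def by blast
  have DK: "D \<subseteq> K" using K(4) closure_subset interior_subset by blast
  have tK: "(t0, z) \<in> F" "(t0, z) \<in> N" if "z \<in> K" for z
  proof -
    have "(t0, z) \<in> cball t0 r \<times> K" using K(1) that by simp
    then show "(t0, z) \<in> F" "(t0, z) \<in> N" using K(3) W(3) by blast+
  qed
  have "compact (closure D)" using bdd[OF t0] by (simp add: D_def compact_closure)
  from compact_subset_open_imp_cball_epsilon_subset[OF this open_interior K(4)]
  obtain d where d: "0 < d" "(\<Union>x\<in>closure D. cball x d) \<subseteq> interior K" by blast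
  have dK: "cball z d \<subseteq> K" if "z \<in> D" for z
    using d(2) that closure_subset[of D] interior_subset[of K] by blast
  obtain M0 where M0: "\<And>z. z \<in> D \<Longrightarrow> norm z \<le> M0" using bdd[OF t0] unfolding D_def bounded_iff by blast
  define M where "M = max 1 M0"
  have M: "1 \<le> M" "\<And>z. z \<in> D \<Longrightarrow> norm z \<le> M" using M0 by (force simp: M_def)+
  have "compact ({t0} \<times> K)" by (intro compact_Times compact_sing K(2)) 
  moreover have "{t0} \<times> K \<subseteq> N" using tK by auto
  ultimately obtain L where L: "0 < L" "\<And>x v. x \<in> {t0} \<times> K \<Longrightarrow> \<bar>frechet_derivative \<rho> (at x) v\<bar> \<le> L * norm v"
    using Ck2_derivative_bound[OF \<rho>, of "{t0} \<times> K"] by metis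
  \<comment> \<open>If the dilate has left the fiber, \<open>\<rho>\<close> has risen to at least 0
    along a segment of length at most delta M, and L bounds its slope there.\<close>
  have key: "- \<rho> (t0, z) \<le> L * (\<delta> * M)" if z: "z \<in> D" and \<delta>: "0 < \<delta>" "\<delta> * M \<le> d" and out: "(1 + \<delta>) *\<^sub>R z \<notin> D" for z \<delta>
  proof -
    define y where "y s = z + (s * \<delta>) *\<^sub>R z" for s :: real
    have yK: "y s \<in> K" if "0 \<le> s" "s \<le> 1" for s
    proof -
      have "s * (\<delta> * norm z) \<le> 1 * (\<delta> * M)" using that \<delta> M(2)[OF z] by (intro mult_mono mult_left_mono) auto
      moreover have "dist z (y s) = s * (\<delta> * norm z)" using \<delta>(1) that by (simp add: y_def dist_norm abs_mult mult.assoc)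
      ultimately have "dist z (y s) \<le> d" using \<delta>(2) by linarith
      then show ?thesis using dK[OF z] by auto
    qed
    have der: "((\<lambda>s. \<rho> (t0, y s)) has_real_derivative frechet_derivative \<rho> (at (t0, y s)) (0, \<delta> *\<^sub>R z)) (at s)" if "0 \<le> s" "s \<le> 1" for s
    proof -
      have inN: "(t0, y s) \<in> N" using tK(2) yK that by blast
      have "((\<lambda>s. (t0, y s)) has_derivative (\<lambda>h. (0, (h * \<delta>) *\<^sub>R z))) (at s)"
        unfolding y_def by (auto intro!: derivative_eq_intros)
      from has_derivative_compose[OF this Ck2_derivative[OF \<rho> inN]]
      have "((\<lambda>s. \<rho> (t0, y s)) has_derivative (\<lambda>h. frechet_derivative \<rho> (at (t0, y s)) (0, (h * \<delta>) *\<^sub>R z))) (at s)" .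
      moreover have "frechet_derivative \<rho> (at (t0, y s)) (0, (h * \<delta>) *\<^sub>R z) = frechet_derivative \<rho> (at (t0, y s)) (0, \<delta> *\<^sub>R z) * h" for h
        using linear_scale[OF Ck2_linear[OF \<rho> inN], of h "(0, \<delta> *\<^sub>R z)"] by (simp add: mult.commute)
      ultimately show ?thesis unfolding has_field_derivative_def by simp
    qed
    obtain \<xi> where \<xi>: "0 < \<xi>" "\<xi> < 1" "\<rho> (t0, y 1) - \<rho> (t0, y 0) = (1 - 0) * frechet_derivative \<rho> (at (t0, y \<xi>)) (0, \<delta> *\<^sub>R z)"
      using MVT2[OF zero_less_one der] by blast
    have "y 1 = (1 + \<delta>) *\<^sub>R z" by (simp add: y_def algebra_simps)
    then have "(t0, y 1) \<notin> \<Omega>" using out by (simp add: D_def fiber_def)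
    moreover have "(t0, y 1) \<in> N" using tK(2) yK[of 1] by simp
    ultimately have "0 \<le> \<rho> (t0, y 1)" by (subst (asm) \<Omega>_eq) simp
    moreover have "\<rho> (t0, y 0) = \<rho> (t0, z)" by (simp add: y_def)
    moreover have "\<bar>frechet_derivative \<rho> (at (t0, y \<xi>)) (0, \<delta> *\<^sub>R z)\<bar> \<le> L * (\<delta> * norm z)"
      using L(2)[of "(t0, y \<xi>)" "(0, \<delta> *\<^sub>R z)"] yK[of \<xi>] \<xi> \<delta> by (simp add: norm_Pair)
    moreover have "L * (\<delta> * norm z) \<le> L * (\<delta> * M)"
      using L(1) \<delta> M(2)[OF z] by (intro mult_left_mono) auto
    moreover have "\<rho> (t0, y 1) - \<rho> (t0, y 0) = frechet_derivative \<rho> (at (t0, y \<xi>)) (0, \<delta> *\<^sub>R z)" using \<xi>(3) by simp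
    ultimately show ?thesis by linarith
  qed
  have Kne: "K \<noteq> {}" using DK fiber_ne[OF t0] by (auto simp: D_def)
  have "continuous_on K (\<lambda>z. exp (- \<phi> (t0, z)))"
    by (intro continuous_intros continuous_on_compose2[OF Ck_on_imp_continuous_on[OF \<phi>]]) (use tK in auto)
  from continuous_attains_inf[OF K(2) Kne this] obtain z0 where z0: "\<And>z. z \<in> K \<Longrightarrow> exp (- \<phi> (t0, z0)) \<le> exp (- \<phi> (t0, z))" by blast
  define m where "m = exp (- \<phi> (t0, z0))"
  have m: "0 < m" "\<And>z. z \<in> D \<Longrightarrow> m \<le> exp (- \<phi> (t0, z))" using z0 DK by (auto simp: m_def)
  note G1 = Ck_on_monomial_integral[where k=k, OF F \<phi>]
  note G0 = Ck_on_monomial_integral[where k=k and \<phi>="\<lambda>_. 0", OF F Ck_on_const[OF F(1)]]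
  define u where "u z = indicator \<Omega> (t0, z) * mono_weight (\<lambda>_. 0) k (t0, z)" for z
  define W1 where "W1 z = indicator \<Omega> (t0, z) * mono_weight \<phi> k (t0, z)" for z
  define V where "V = (LINT z|lborel. u z)"
  have V: "0 < V" using G0(3)[OF t0] by (simp add: V_def u_def monomial_integral_eq)
  have ui: "integrable lborel u" unfolding u_def using G0(2)[OF t0] .
  have W1i: "integrable lborel W1" "(LINT z|lborel. W1 z) = monomial_integral \<Omega> \<phi> k t0"
    unfolding W1_def using G1(2)[OF t0] by (simp_all add: monomial_integral_eq)
  define p where "p = 2 * (\<Sum>j\<in>UNIV. k j)"
  have mw: "mono_weight (\<lambda>_. 0) k (t0, l *\<^sub>R z) = l ^ p * mono_weight (\<lambda>_. 0) k (t0, z)" if "0 < l" for l z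
    using that by (simp add: mono_weight_def p_def prod_norm[symmetric] norm_power power_mult_distrib prod.distrib power_sum[symmetric] power_mult mult.commute[of 2])
  have bound: "(\<integral>\<^sup>+z. ennreal (indicator {z. (t0, z) \<in> \<Omega> \<and> \<rho> (t0, z) \<le> - s} z * mono_weight \<phi> k (t0, z)) \<partial>lborel)
        \<le> ennreal (monomial_integral \<Omega> \<phi> k t0 - m * V / (4 * L * M) * s)" if s: "0 < s" "s < min (2 * L * d) (2 * L * M)" for s
  proof -
    \<comment> \<open>Chosen so that dilation raises \<open>\<rho>\<close> by at most s / 2, less
      than the depth s. The two bounds on s ensure delta M at most d and delta at most 1.\<close>
    define \<delta> where "\<delta> = s / (2 * L * M)"
    have \<delta>: "0 < \<delta>" "\<delta> * M \<le> d" "\<delta> \<le> 1" "L * (\<delta> * M) = s / 2"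
      using s L(1) M(1) by (auto simp: \<delta>_def field_simps)
    define l where "l = 1 + \<delta>"
    have l: "1 < l" using \<delta>(1) by (simp add: l_def)
    \<comment> \<open>An integrable majorant of the integral over the deeper part. By homogeneity of
      degree p, \<open>u (l *\<^sub>R z) / l ^ p\<close> is the unweighted monomial at z restricted
      to points whose dilate is in the fiber. For deep points the bracket vanishes; elsewhere in the
      fiber at most m times the monomial is subtracted, which W1 dominates. The fiber need not be
      star-shaped, as outside it R can only be positive or 0.\<close>
    define R where "R z = W1 z - m * (u z - u (l *\<^sub>R z) / l ^ p)" for z
    have le: "indicator {z. (t0, z) \<in> \<Omega> \<and> \<rho> (t0, z) \<le> - s} z * mono_weight \<phi> k (t0, z) \<le> R z" "0 \<le> R z" for z
    proof -
      have a: "u (l *\<^sub>R z) / l ^ p = indicator \<Omega> (t0, l *\<^sub>R z) * mono_weight (\<lambda>_. 0) k (t0, z)"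
        using l by (simp add: u_def mw)
      have b: "mono_weight \<phi> k (t0, z) = mono_weight (\<lambda>_. 0) k (t0, z) * exp (- \<phi> (t0, z))" "0 \<le> mono_weight (\<lambda>_. 0) k (t0, z)"
        by (simp_all add: mono_weight_def)
      have R: "R z = indicator \<Omega> (t0, z) * mono_weight (\<lambda>_. 0) k (t0, z) * exp (- \<phi> (t0, z))
          - m * (indicator \<Omega> (t0, z) * mono_weight (\<lambda>_. 0) k (t0, z) - indicator \<Omega> (t0, l *\<^sub>R z) * mono_weight (\<lambda>_. 0) k (t0, z))"
        unfolding R_def a unfolding W1_def b(1) u_def by simp
      have c: "m * mono_weight (\<lambda>_. 0) k (t0, z) \<le> mono_weight (\<lambda>_. 0) k (t0, z) * exp (- \<phi> (t0, z))" if "(t0, z) \<in> \<Omega>"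
        using mult_right_mono[OF m(2)[of z] b(2)] that by (simp add: D_def fiber_def mult.commute[of _ "exp _"])
      have mb: "0 \<le> m * mono_weight (\<lambda>_. 0) k (t0, z)" using m(1) b(2) by simp
      show "0 \<le> R z" using c b(2) m(1) mb by (auto simp: R indicator_def)
      show "indicator {z. (t0, z) \<in> \<Omega> \<and> \<rho> (t0, z) \<le> - s} z * mono_weight \<phi> k (t0, z) \<le> R z"
      proof (cases "(t0, z) \<in> \<Omega> \<and> \<rho> (t0, z) \<le> - s")
        case True
        have "l *\<^sub>R z \<in> D"
        proof (rule ccontr)
          assume "l *\<^sub>R z \<notin> D"
          then have "- \<rho> (t0, z) \<le> L * (\<delta> * M)" using key[of z \<delta>] \<delta> True by (simp add: l_def D_def fiber_def)
          then show False using \<delta>(4) True s by linarith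
        qed
        then show ?thesis using True by (simp add: R b(1) D_def fiber_def)
      qed (use \<open>0 \<le> R z\<close> in simp)
    qed
    have um: "u \<in> borel_measurable borel" using borel_measurable_integrable[OF ui] by simp
    have uli: "integrable lborel (\<lambda>z. u (l *\<^sub>R z))" by (rule LINT_lborel_scaleR(2)[OF _ um ui]) (use l in simp)
    have Ri: "integrable lborel R" unfolding R_def by (intro Bochner_Integration.integrable_diff integrable_mult_right integrable_divide ui W1i uli)
    have "(LINT z|lborel. R z) = monomial_integral \<Omega> \<phi> k t0 - m * (V - V / l ^ DIM(complex^'m) / l ^ p)"
      unfolding R_def using LINT_lborel_scaleR(1)[OF _ um, of l] l ui W1i uli by (simp add: V_def)
    also have "\<dots> = monomial_integral \<Omega> \<phi> k t0 - m * V * (1 - 1 / l ^ (DIM(complex^'m) + p))"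
      by (simp add: power_add algebra_simps)
    also have "\<dots> \<le> monomial_integral \<Omega> \<phi> k t0 - m * V * (\<delta> / 2)"
    proof -
      \<comment> \<open>The exponent is at least 1 because the dimension is, so the fraction kept is
        at most 1 / l, and 1 / (1 + delta) is at most 1 - delta / 2 for delta at most 1.\<close>
      have "l ^ 1 \<le> l ^ (DIM(complex^'m) + p)" using l DIM_positive[where 'a="complex^'m"] by (intro power_increasing) linarith+
      then have "1 / l ^ (DIM(complex^'m) + p) \<le> 1 / l" using l by (intro divide_left_mono) auto
      also have "1 / l \<le> 1 - \<delta> / 2"
      proof -
        have "\<delta> * \<delta> \<le> \<delta>" using \<delta> by (simp add: mult_left_le)
        then have "1 \<le> (1 - \<delta> / 2) * l" by (simp add: l_def algebra_simps)
        then show ?thesis using l by (simp add: pos_divide_le_eq)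
      qed
      finally have "\<delta> / 2 \<le> 1 - 1 / l ^ (DIM(complex^'m) + p)" by linarith
      then show ?thesis using m(1) V by (intro diff_left_mono mult_left_mono) auto
    qed
    also have "m * V * (\<delta> / 2) = m * V / (4 * L * M) * s" by (simp add: \<delta>_def)
    finally have RG: "(LINT z|lborel. R z) \<le> monomial_integral \<Omega> \<phi> k t0 - m * V / (4 * L * M) * s" .
    have "(\<integral>\<^sup>+z. ennreal (indicator {z. (t0, z) \<in> \<Omega> \<and> \<rho> (t0, z) \<le> - s} z * mono_weight \<phi> k (t0, z)) \<partial>lborel) \<le> (\<integral>\<^sup>+z. ennreal (R z) \<partial>lborel)"
      by (intro nn_integral_mono ennreal_leI le(1))
    also have "\<dots> = ennreal (LINT z|lborel. R z)" by (rule nn_integral_eq_integral[OF Ri]) (use le(2) in simp)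
    also have "\<dots> \<le> ennreal (monomial_integral \<Omega> \<phi> k t0 - m * V / (4 * L * M) * s)" by (rule ennreal_leI[OF RG])
    finally show ?thesis .
  qed
  show thesis
    by (rule that[of "m * V / (4 * L * M)" "min (2 * L * d) (2 * L * M)", OF _ _ bound]) (use m(1) V L(1) M(1) d(1) in auto)
qed

text \<open>\<open>circle_volume\<close> bounds the exponential of the mean of ln G by the integral
  over the part where \<open>\<rho> \<le> - \<kappa> * r^2 / 4\<close>, and
  \<open>shell_integral\<close> says that this is below G(t0) by a multiple of r^2; taking
  logarithms gives the excess.\<close>

lemma ln_integral_submean:
  fixes w :: "complex^'n" and k :: "'m \<Rightarrow> nat"
  assumes t0: "t0 \<in> U" and w: "w \<noteq> 0"
  obtains \<epsilon> r0 where "0 < \<epsilon>" "0 < r0"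
    "\<And>r. 0 < r \<Longrightarrow> r < r0 \<Longrightarrow> 2 * pi * (- ln (monomial_integral \<Omega> \<phi> k t0)) + \<epsilon> * r^2
      \<le> integral {0..2*pi} (\<lambda>\<theta>. - ln (monomial_integral \<Omega> \<phi> k (t0 + (of_real r * cis \<theta>) *s w)))"
proof -
  let ?G = "monomial_integral \<Omega> \<phi> k"
  note GC = Ck_on_monomial_integral[where k=k, OF F \<phi>]
  obtain r1 K where K: "0 < r1" "cball t0 r1 \<subseteq> U" "compact K" "cball t0 r1 \<times> K \<subseteq> F \<inter> W" "\<And>t. t \<in> cball t0 r1 \<Longrightarrow> fiber \<Omega> t \<subseteq> K"
    using local_structure[OF t0 F] by blast
  have "\<exists>z. z \<in> fiber \<Omega> t0 \<and> (\<forall>j. z $ j \<noteq> 0)"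
  proof (rule ccontr)
    assume n: "\<not> ?thesis"
    obtain z e where e: "0 < e" "ball z e \<subseteq> fiber \<Omega> t0"
      using open_fiber[OF \<Omega>(1)] fiber_ne[OF t0] open_contains_ball by blast
    have "AE x in lborel. x \<notin> ball z e" using AE_vec_nonzero by (rule eventually_mono) (use n e(2) in blast)
    then have "emeasure lborel (ball z e) = 0" by (subst (asm) AE_iff_measurable[OF _ refl]) (auto simp: ball_def)
    then show False using e(1) by (simp add: emeasure_ball unit_ball_vol_pos[THEN less_imp_neq, symmetric])
  qed
  then obtain z where z: "(t0, z) \<in> \<Omega>" "\<forall>j. z $ j \<noteq> 0" by (auto simp: fiber_def)
  \<comment> \<open>Logarithmic coordinates of a fiber point without zero coordinates. By openness
    of \<open>\<Omega>\<close> it serves as common centre for all parameters near t0 on the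
    line.\<close>
  define c where "c = vec_ln z"
  have c0: "c \<in> logdom t0" unfolding c_def using vec_ln_logdom[OF z(2)] z(1) by simp
  have co: "continuous_on S (\<lambda>\<tau>. t0 + \<tau> *s w)" for S unfolding vector_scalar_mult_def by (intro continuous_intros)
  have "open ((\<lambda>\<tau>. t0 + \<tau> *s w) -` ball t0 r1)" by (rule open_vimage[OF open_ball co])
  moreover have "open ((\<lambda>\<tau>. (t0 + \<tau> *s w, rexp c)) -` \<Omega>)" by (rule open_vimage[OF \<Omega>(1) continuous_on_Pair[OF co continuous_on_const]])
  ultimately have "open ((\<lambda>\<tau>. t0 + \<tau> *s w) -` ball t0 r1 \<inter> (\<lambda>\<tau>. (t0 + \<tau> *s w, rexp c)) -` \<Omega>)" by (rule open_Int)
  moreover have "0 \<in> (\<lambda>\<tau>. t0 + \<tau> *s w) -` ball t0 r1 \<inter> (\<lambda>\<tau>. (t0 + \<tau> *s w, rexp c)) -` \<Omega>"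
    using c0 K(1) by (simp add: logdom_def)
  ultimately obtain r2 where r2: "0 < r2" "cball 0 r2 \<subseteq> (\<lambda>\<tau>. t0 + \<tau> *s w) -` ball t0 r1 \<inter> (\<lambda>\<tau>. (t0 + \<tau> *s w, rexp c)) -` \<Omega>"
    using open_contains_cball by blast
  have near: "t0 + \<tau> *s w \<in> cball t0 r1" "t0 + \<tau> *s w \<in> U" "c \<in> logdom (t0 + \<tau> *s w)" if "cmod \<tau> \<le> r2" for \<tau>
  proof -
    have "\<tau> \<in> cball 0 r2" using that by simp
    then have "t0 + \<tau> *s w \<in> ball t0 r1" "(t0 + \<tau> *s w, rexp c) \<in> \<Omega>" using r2(2) by blast+
    then show "t0 + \<tau> *s w \<in> cball t0 r1" "t0 + \<tau> *s w \<in> U" "c \<in> logdom (t0 + \<tau> *s w)" using K(2) by (auto simp: logdom_def)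
  qed
  \<comment> \<open>Compact set of base points and unit directions, on which the Levi form has a
    positive minimum. Since |(w, b)| is at least |w|, quadratic scaling yields a bound
    \<open>\<kappa>\<close> independent of the fiber component b of the velocity.\<close>
  define Q where "Q = (cball t0 r1 \<times> K) \<times> sphere (0 :: (complex^'n) \<times> (complex^'m)) 1"
  have Q: "compact Q" unfolding Q_def by (intro compact_Times compact_cball compact_sphere K(3))
  have Qne: "Q \<noteq> {}"
  proof -
    have "z \<in> K" using K(1) K(5)[of t0] z(1) by (auto simp: fiber_def)
    then have "((t0, z), (w /\<^sub>R norm w, 0)) \<in> Q" using w K(1) by (simp add: Q_def norm_Pair)
    then show ?thesis by blast
  qed
  have QN: "fst q \<in> N" if "q \<in> Q" for q
  proof -
    have "fst q \<in> cball t0 r1 \<times> K" using that unfolding Q_def by (rule mem_Times_iff[THEN iffD1, THEN conjunct1])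
    then have "fst q \<in> W" by (rule K(4)[THEN subsetD, THEN IntD2])
    then show ?thesis by (rule W(3)[THEN subsetD])
  qed
  have "continuous_on Q (\<lambda>q. levi (cscale \<i>) \<rho> (fst q) (snd q))"
    by (rule continuous_on_levi[OF N(1) \<rho> continuous_on_fst[OF continuous_on_id] continuous_on_snd[OF continuous_on_id] bounded_linear_cscale QN])
  from continuous_attains_inf[OF Q Qne this] obtain q where q: "q \<in> Q" "\<And>q'. q' \<in> Q \<Longrightarrow> levi (cscale \<i>) \<rho> (fst q) (snd q) \<le> levi (cscale \<i>) \<rho> (fst q') (snd q')" by blast
  define \<kappa>1 where "\<kappa>1 = levi (cscale \<i>) \<rho> (fst q) (snd q)"
  have \<kappa>1: "0 < \<kappa>1" unfolding \<kappa>1_def by (rule levi_pos) (use q(1) K(4) in \<open>auto simp: Q_def\<close>)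
  define \<kappa> where "\<kappa> = \<kappa>1 * (norm w)^2"
  have \<kappa>0: "0 < \<kappa>" using \<kappa>1 w by (simp add: \<kappa>_def)
  have \<kappa>: "\<kappa> \<le> levi (cscale \<i>) \<rho> (t0 + \<tau> *s w, z) (w, b)" if "cmod \<tau> \<le> r2" "(t0 + \<tau> *s w, z) \<in> \<Omega>" for \<tau> z b
  proof -
    define v where "v = (w, b)"
    have nw: "norm w \<le> norm v" by (simp add: v_def norm_Pair real_le_rsqrt)
    have v: "norm v \<noteq> 0" using w by (simp add: v_def zero_prod_def)
    have "z \<in> K" using K(5)[OF near(1)[OF that(1)]] that(2) by (auto simp: fiber_def)
    then have "((t0 + \<tau> *s w, z), v /\<^sub>R norm v) \<in> Q" using near(1)[OF that(1)] v by (simp add: Q_def)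
    from q(2)[OF this] have "\<kappa>1 \<le> levi (cscale \<i>) \<rho> (t0 + \<tau> *s w, z) (v /\<^sub>R norm v)" by (simp add: \<kappa>1_def)
    moreover have "levi (cscale \<i>) \<rho> (t0 + \<tau> *s w, z) (norm v *\<^sub>R (v /\<^sub>R norm v)) = (norm v)^2 * levi (cscale \<i>) \<rho> (t0 + \<tau> *s w, z) (v /\<^sub>R norm v)"
      by (rule levi_scaleR[OF N(1) \<rho> _ bounded_linear.linear[OF bounded_linear_cscale]]) (use that(2) \<Omega>_sub in blast)
    ultimately have "(norm v)^2 * \<kappa>1 \<le> levi (cscale \<i>) \<rho> (t0 + \<tau> *s w, z) v" using v by (simp add: mult_left_mono)
    moreover have "\<kappa> \<le> (norm v)^2 * \<kappa>1" unfolding \<kappa>_def using nw \<kappa>1 by (simp add: mult.commute power_mono mult_left_mono)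
    ultimately show ?thesis by (simp add: v_def)
  qed
  obtain c1 s0 where c1: "0 < c1" "0 < s0" "\<And>s. 0 < s \<Longrightarrow> s < s0 \<Longrightarrow>
      (\<integral>\<^sup>+z. ennreal (indicator {z. (t0, z) \<in> \<Omega> \<and> \<rho> (t0, z) \<le> - s} z * mono_weight \<phi> k (t0, z)) \<partial>lborel) \<le> ennreal (?G t0 - c1 * s)"
    using shell_integral[OF t0, of k] by blast
  \<comment> \<open>The square root makes s = kappa r^2 / 4 smaller than s0, the range of
    \<open>shell_integral\<close>.\<close>
  define r0 where "r0 = min r2 (sqrt (4 * s0 / \<kappa>))"
  \<comment> \<open>From 2 pi c1 s / G(t0) with s = kappa r^2 / 4.\<close>
  define \<epsilon> where "\<epsilon> = pi * c1 * \<kappa> / (2 * ?G t0)"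
  have G0: "0 < ?G t0" by (rule GC(3)[OF t0])
  show thesis
  proof (rule that)
    show "0 < \<epsilon>" using c1 \<kappa>0 G0 by (simp add: \<epsilon>_def)
    show "0 < r0" using r2(1) c1 \<kappa>0 by (simp add: r0_def)
    fix r assume r: "0 < r" "r < r0"
    have rr: "r \<le> r2" using r by (simp add: r0_def)
    define s where "s = \<kappa> * r^2 / 4"
    have s0: "0 < s" using \<kappa>0 r by (simp add: s_def)
    have "r^2 < (sqrt (4 * s0 / \<kappa>))^2" using r by (intro power_strict_mono) (auto simp: r0_def)
    then have "r^2 < 4 * s0 / \<kappa>" using c1(2) \<kappa>0 by simp
    then have s1: "s < s0" using \<kappa>0 by (simp add: s_def field_simps)
    define X where "X = (LINT \<theta>|circle_measure. ln (?G (t0 + (of_real r * cis \<theta>) *s w)))"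
    have "ennreal (exp X) \<le> (\<integral>\<^sup>+z. ennreal (indicator {z. (t0, z) \<in> \<Omega> \<and> \<rho> (t0, z) \<le> - \<kappa> * r^2 / 4} z * mono_weight \<phi> k (t0, z)) \<partial>lborel)"
      unfolding X_def
      by (rule circle_volume[where c=c, OF w r(1) _ _ \<kappa>0]) (use near \<kappa> rr in auto)
    also have "\<dots> \<le> ennreal (?G t0 - c1 * s)" using c1(3)[OF s0 s1] by (simp add: s_def)
    finally have eX: "exp X \<le> ?G t0 - c1 * s" by (simp add: ennreal_le_iff2)
    then have y: "0 < ?G t0 - c1 * s" using exp_gt_zero[of X] by linarith
    have "X \<le> ln (?G t0 - c1 * s)" using eX y by (simp add: ln_ge_iff)
    also have "\<dots> = ln (?G t0) + ln ((?G t0 - c1 * s) / ?G t0)" using y G0 by (simp add: ln_div)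
    \<comment> \<open>The inequality ln y at most y - 1 makes the relative loss of mass an additive
      loss for the logarithm.\<close>
    also have "\<dots> \<le> ln (?G t0) + ((?G t0 - c1 * s) / ?G t0 - 1)"
      using ln_le_minus_one[of "(?G t0 - c1 * s) / ?G t0"] y G0 by simp
    also have "\<dots> = ln (?G t0) - c1 * s / ?G t0" using G0 by (simp add: field_simps)
    finally have X: "X \<le> ln (?G t0) - c1 * s / ?G t0" .
    have cln: "continuous_on S (\<lambda>\<theta>. ln (?G (t0 + (of_real r * cis \<theta>) *s w)))" for S
    proof -
      have TU: "t0 + (of_real r * cis \<theta>) *s w \<in> U" for \<theta>
        by (rule near(2)) (use r rr in \<open>simp add: norm_mult\<close>)
      have "continuous_on S (\<lambda>\<theta>. t0 + (of_real r * cis \<theta>) *s w)" unfolding vector_scalar_mult_def by (intro continuous_intros)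
      then have "continuous_on S (\<lambda>\<theta>. ?G (t0 + (of_real r * cis \<theta>) *s w))"
        by (rule continuous_on_compose2[OF Ck_on_imp_continuous_on[OF GC(1)]]) (use TU in auto)
      then show ?thesis by (rule continuous_on_ln) (use GC(3)[OF TU] in \<open>auto simp: less_imp_neq[symmetric]\<close>)
    qed
    have "X = integral {0..2*pi} (\<lambda>\<theta>. ln (?G (t0 + (of_real r * cis \<theta>) *s w))) / (2 * pi)"
      unfolding X_def by (rule LINT_circle_continuous[OF cln borel_measurable_continuous_onI[OF cln]])
    then have "integral {0..2*pi} (\<lambda>\<theta>. - ln (?G (t0 + (of_real r * cis \<theta>) *s w))) = - (2 * pi * X)"
      by simp
    moreover have "2 * pi * X \<le> 2 * pi * (ln (?G t0) - c1 * s / ?G t0)" using X by (intro mult_left_mono) auto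
    moreover have "2 * pi * (ln (?G t0) - c1 * s / ?G t0) = 2 * pi * ln (?G t0) - \<epsilon> * r^2"
      using G0 by (simp add: \<epsilon>_def s_def field_simps)
    ultimately show "2 * pi * (- ln (?G t0)) + \<epsilon> * r^2 \<le> integral {0..2*pi} (\<lambda>\<theta>. - ln (?G (t0 + (of_real r * cis \<theta>) *s w)))"
      by simp
  qed
qed

text \<open>On each complex line the quadratic excess of circle means is converted by
  \<open>laplace_lower_bound\<close> into a positive Laplacian, which equals the Levi form in that
  direction; positivity in all directions is positive definiteness of the complex Hessian.\<close>

lemma strictly_psh_ln_monomial_integral: "strictly_psh_on (\<lambda>t. - ln (monomial_integral \<Omega> \<phi> k t)) U"
proof -
  let ?\<psi> = "\<lambda>t. - ln (monomial_integral \<Omega> \<phi> k t)"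
  note GC = Ck_on_monomial_integral[where k=k, OF F \<phi>]
  have \<psi>: "Ck_on 2 ?\<psi> U"
    by (intro Ck_on_minus[OF U] Ck_on_compose[OF U _ Ck_on_ln GC(1)]) (use GC(3) in auto)
  have "0 < levi vecJ ?\<psi> t0 w" if t0: "t0 \<in> U" and w: "w \<noteq> 0" for t0 w
  proof -
    obtain \<epsilon> r0 where e: "0 < \<epsilon>" "0 < r0"
      "\<And>r. 0 < r \<Longrightarrow> r < r0 \<Longrightarrow> 2 * pi * ?\<psi> t0 + \<epsilon> * r^2 \<le> integral {0..2*pi} (\<lambda>\<theta>. ?\<psi> (t0 + (of_real r * cis \<theta>) *s w))"
      using ln_integral_submean[OF t0 w, of k] by blast
    define \<gamma> where "\<gamma> \<tau> = t0 + (Re \<tau> *\<^sub>R w + Im \<tau> *\<^sub>R vecJ w)" for \<tau>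
    have \<gamma>: "\<gamma> \<tau> = t0 + \<tau> *s w" for \<tau> by (simp add: \<gamma>_def vec_cmult_Re_Im[of \<tau>])
    define S where "S = \<gamma> -` U"
    have S: "open S" unfolding S_def by (rule open_vimage[OF U]) (unfold \<gamma>_def, intro continuous_intros)
    have hc: "holo_curve vecJ S \<gamma> (\<lambda>_. w)" unfolding \<gamma>_def[abs_def] by (rule holo_curve_affine[OF bounded_linear_vec_cmult])
    have S0: "0 \<in> S" using t0 by (simp add: S_def \<gamma>_def)
    have SU: "\<And>z. z \<in> S \<Longrightarrow> \<gamma> z \<in> U" by (simp add: S_def)
    have lc: "Ck_on 2 (\<lambda>\<tau>. ?\<psi> (\<gamma> \<tau>)) S" "laplace (\<lambda>\<tau>. ?\<psi> (\<gamma> \<tau>)) 0 = levi vecJ ?\<psi> (\<gamma> 0) w"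
      by (rule levi_compose[OF S U \<psi> hc _ bounded_linear_vec_cmult vecJ_vecJ]; use SU S0 in blast)+
    have "2 * \<epsilon> / pi \<le> laplace (\<lambda>\<tau>. ?\<psi> (\<gamma> \<tau>)) 0"
      by (rule laplace_lower_bound[OF S lc(1) S0 e(2)]) (use e(3) in \<open>simp_all add: \<gamma>\<close>)
    also have "\<dots> = levi vecJ ?\<psi> t0 w" using lc(2) by (simp add: \<gamma>)
    finally show ?thesis using e(1) by (smt (verit) divide_pos_pos pi_gt_zero)
  qed
  then show ?thesis unfolding strictly_psh_on_def
    using U \<psi> positive_definite_iff_levi[OF U \<psi>] by blast
qed

end

theorem theorem1p3:
  fixes U :: "(complex^'n::finite) set"
    and \<Omega> :: "((complex^'n) \<times> (complex^'m::finite)) set"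
    and \<phi> :: "(complex^'n) \<times> (complex^'m) \<Rightarrow> real"
    and N :: "((complex^'n) \<times> (complex^'m)) set"
    and k :: "'m \<Rightarrow> nat"
  assumes "is_domain U"
    and "strictly_pseudoconvex_bounded_family U \<Omega>"
    and "closure_nbhd U \<Omega> N" and "Ck_on 2 \<phi> N" and "psh_prod_on \<phi> N"
    and "\<And>t. t \<in> U \<Longrightarrow> reinhardt_domain (fiber \<Omega> t)"
    and "torus_invariant_on \<phi> N"
  defines "\<psi> \<equiv> \<lambda>t. - ln (monomial_integral \<Omega> \<phi> k t)"
  shows "(\<forall>t\<in>U. exp (- \<psi> t) = monomial_integral \<Omega> \<phi> k t) \<and> strictly_psh_on \<psi> U"
proof -
  obtain N' \<rho> W where fam: "is_domain \<Omega>" "\<Omega> \<subseteq> U \<times> UNIV" "fst ` \<Omega> = U" "\<forall>t\<in>U. bounded (fiber \<Omega> t)"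
    and \<rho>: "closure_nbhd U \<Omega> N'" "Ck_on 2 \<rho> N'" "\<Omega> = {x \<in> N'. \<rho> x < 0}"
      "\<forall>t\<in>U. \<forall>z\<in>frontier (fiber \<Omega> t). frechet_derivative (\<lambda>w. \<rho> (t, w)) (at z) \<noteq> (\<lambda>_. 0)"
    and W: "closure_nbhd U \<Omega> W" "W \<subseteq> N'" "strictly_psh_prod_on \<rho> W"
    using assms(2) unfolding strictly_pseudoconvex_bounded_family_def bounded_domain_family_def defining_function_def by blast
  have N': "open N'" "N' \<subseteq> U \<times> UNIV" using \<rho>(1) by (auto simp: closure_nbhd_def)
  have N: "open N" "closure \<Omega> \<inter> (U \<times> UNIV) \<subseteq> N" using assms(3) by (auto simp: closure_nbhd_def)
  have \<Omega>N: "\<Omega> \<subseteq> N" using N(2) fam(2) closure_subset[of \<Omega>] by blast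
  have torus: "(t, torus_act \<theta> z) \<in> \<Omega>" if "(t, z) \<in> \<Omega>" for t z \<theta>
    using that assms(6)[of t] fam(2) by (auto simp: reinhardt_domain_def fiber_def)
  interpret reinhardt_weight U \<Omega> \<rho> N' W \<phi> N
  proof
    show "open U" using assms(1) by (simp add: is_domain_def)
    show "open \<Omega>" using fam(1) by (simp add: is_domain_def)
    show "\<And>t. t \<in> U \<Longrightarrow> connected (fiber \<Omega> t)" using assms(6) by (simp add: reinhardt_domain_def is_domain_def)
    show "open W" "closure \<Omega> \<inter> (U \<times> UNIV) \<subseteq> W" using W(1) by (auto simp: closure_nbhd_def)
    show "\<And>x v. x \<in> W \<Longrightarrow> v \<noteq> 0 \<Longrightarrow> 0 < levi (cscale \<i>) \<rho> x v"
      by (rule strictly_psh_prod_levi[OF N'(1) \<rho>(2) W(3,2)])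
    show "\<And>x v. x \<in> N \<Longrightarrow> 0 \<le> levi (cscale \<i>) \<phi> x v"
      by (rule psh_prod_levi[OF N(1) assms(4,5)])
    \<comment> \<open>\<open>N\<close> need not be invariant, but \<open>\<Omega>\<close> is and
      lies in \<open>N\<close>, so both points are in the set where invariance of
      \<open>\<phi>\<close> is assumed.\<close>
    show "\<phi> (t, torus_act \<theta> z) = \<phi> (t, z)" if "(t, z) \<in> \<Omega>" for t z \<theta>
      using assms(7) that torus[OF that, of \<theta>] \<Omega>N unfolding torus_invariant_on_def by blast
  qed (use fam \<rho> W N N' assms(4) torus in auto)
  have "exp (- \<psi> t) = monomial_integral \<Omega> \<phi> k t" if "t \<in> U" for t
    using Ck_on_monomial_integral(3)[where k=k, OF F \<phi> that] by (simp add: \<psi>_def)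
  then show ?thesis using strictly_psh_ln_monomial_integral[of k] by (simp add: \<psi>_def)
qed

end
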